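(* Let $0<s<1$, $n\ge 1$, let $\Omega\subset\mathbb{R}^n$ be a bounded open set and $T\in(0,\infty)$. Let $Q_1,Q_2\in L^\infty((-T,T)\times\Omega)$ be two (real-valued) bounded potentials, each satisfying the eigenvalue condition (stated in the context). Let $\mathcal U_1,\mathcal U_2\subset\mathbb{R}^n\setminus\overline\Omega$ be arbitrary nonempty open sets, and let $\Lambda_{Q_j}$ be the Dirichlet-to-Neumann map associated with $(\mathcal L^s+Q_j)u=0$ in $\Omega_T$, $j=1,2$. If $$\Lambda_{Q_1}f|_{(-T,T)\times\mathcal U_2}=\Lambda_{Q_2}f|_{(-T,T)\times\mathcal U_2}\quad\text{for all } f\in C_c^\infty((-T,T)\times\mathcal U_1),$$ then $Q_1=Q_2$ (a.e.) in $\Omega_T$.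
   Context: Points of $\mathbb{R}^{n+1}$ are written $(t,x)$ with $t\in\mathbb{R}$, $x\in\mathbb{R}^n$. The Fourier transform is $\widehat u(\rho,\xi)=\int_{\mathbb{R}^{n+1}}e^{-i(t\rho+x\cdot\xi)}u(t,x)\,dt\,dx$. The operator $\mathcal L^s=(\partial_t-\Delta_x)^s$ and its adjoint $\mathcal L^s_*$ are defined by $\widehat{\mathcal L^su}(\rho,\xi)=(i\rho+|\xi|^2)^s\widehat u(\rho,\xi)$ and $\widehat{\mathcal L^s_*u}(\rho,\xi)=(-i\rho+|\xi|^2)^s\widehat u(\rho,\xi)$ (principal branch); $\mathcal L^{s/2},\mathcal L^{s/2}_*$ are defined analogously. $\mathcal H^s(\mathbb{R}^{n+1})$ is the space of $u\in L^2(\mathbb{R}^{n+1})$ with $\|u\|^2_{\mathcal H^s}=\int(1+|i\rho+|\xi|^2|)^s|\widehat u|^2\,d\rho\,d\xi<\infty$. For closed $E\subset\mathbb{R}^{n+1}$, $\mathcal H^s_E=\{u\in\mathcal H^s(\mathbb{R}^{n+1}):\operatorname{supp}u\subset E\}$. Notation: $\Omega_T=(-T,T)\times\Omega$, $\Omega_e=\mathbb{R}^n\setminus\overline\Omega$, $(\Omega_e)_T=(-T,T)\times\Omega_e$, and $(f,g)_O=\int_O f\overline g\,dx\,dt$. For $Q\in L^\infty(\Omega_T)$ and $u,w\in\mathcal H^s(\mathbb{R}^{n+1})$ set $B_Q(u,w)=(\mathcal L^{s/2}u,\mathcal L^{s/2}_*w)_{\mathbb{R}^{n+1}}+(Qu,w)_{\Omega_T}$.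 A function $u\in\mathcal H^s(\mathbb{R}^{n+1})$ solves $(\mathcal L^s+Q)u=0$ in $\Omega_T$ if $B_Q(u,w)=0$ for all $w\in\mathcal H^s_{\overline{\Omega_T}}$. Eigenvalue condition for $Q$: if $u\in\mathcal H^s(\mathbb{R}^{n+1})$ solves $(\mathcal L^s+Q)u=0$ in $\Omega_T$ with $u=0$ in $(\Omega_e)_T$ and $u=0$ in $(-\infty,-T]\times\mathbb{R}^n$, then $u\equiv0$ in $(-\infty,T)\times\mathbb{R}^n$. Dirichlet-to-Neumann map: under the eigenvalue condition, for $f\in C_c^\infty((\Omega_e)_T)$ there is a unique $u_f\in\mathcal H^s(\mathbb{R}^{n+1})$ with $u_f-f\in\mathcal H^s_{\overline{\Omega_T}}$ solving $(\mathcal L^s+Q)u_f=0$ in $\Omega_T$ (so $u_f=f$ in $(\Omega_e)_T$ and $u_f=0$ for $t\le -T$), and $\langle\Lambda_Qf,g\rangle=B_Q(u_f,g)$; equivalently $\Lambda_Qf=\mathcal L^su_f|_{(\Omega_e)_T}$. The equality $\Lambda_{Q_1}f|_{(-T,T)\times\mathcal U_2}=\Lambda_{Q_2}f|_{(-T,T)\times\mathcal U_2}$ means $\langle\Lambda_{Q_1}f,g\rangle=\langle\Lambda_{Q_2}f,g\rangle$ for all $g\in C_c^\infty((-T,T)\times\mathcal U_2)$. *)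

theory Defs
  imports "HOL-Analysis.Analysis"
begin

text \<open>
  Points \<open>(t, x)\<close> of \<open>\<real>\<^sup>n\<^sup>+\<^sup>1\<close> are pairs in \<open>real \<times> real^'n\<close>, with \<open>n = CARD('n)\<close>. Elements of
  \<open>L\<^sup>2(\<real>\<^sup>n\<^sup>+\<^sup>1)\<close> are represented by measurable functions; operators between \<open>L\<^sup>2\<close> spaces pick some
  representative of the image class, and everything built from them depends only on classes
  modulo equality almost everywhere.
\<close>

type_synonym 'n spacetime = "real \<times> (real, 'n) vec"

definition L2_norm_sq :: "('n::finite spacetime \<Rightarrow> complex) \<Rightarrow> ennreal" where
  "L2_norm_sq u = (\<integral>\<^sup>+ z. ennreal ((norm (u z))\<^sup>2) \<partial>lebesgue)"

definition L2 :: "('n::finite spacetime \<Rightarrow> complex) set" where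
  "L2 = {u \<in> borel_measurable lebesgue. L2_norm_sq u < \<infinity>}"

definition L2_inner ::
  "'n::finite spacetime set \<Rightarrow> ('n spacetime \<Rightarrow> complex) \<Rightarrow> ('n spacetime \<Rightarrow> complex) \<Rightarrow> complex" where
  "L2_inner A f g = set_lebesgue_integral lebesgue A (\<lambda>z. f z * cnj (g z))"


subsection \<open>Fourier transform\<close>

definition fourier_integral :: "('n::finite spacetime \<Rightarrow> complex) \<Rightarrow> 'n spacetime \<Rightarrow> complex" where
  "fourier_integral u = (\<lambda>(\<rho>, \<xi>).
     integral\<^sup>L lebesgue (\<lambda>(t, x). exp (- (\<i> * complex_of_real (t * \<rho> + x \<bullet> \<xi>))) * u (t, x)))"

text \<open>
  The integral converges absolutely only on \<open>L\<^sup>1\<close>. On \<open>L\<^sup>2\<close> the transform is the Plancherel extension,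
  i.e. the \<open>L\<^sup>2\<close>-limit of the Fourier integrals of the truncations of \<open>u\<close> to balls.
\<close>

definition is_fourier :: "('n::finite spacetime \<Rightarrow> complex) \<Rightarrow> ('n spacetime \<Rightarrow> complex) \<Rightarrow> bool" where
  "is_fourier u v \<longleftrightarrow> u \<in> L2 \<and> v \<in> L2 \<and>
     ((\<lambda>R::real. L2_norm_sq
         (\<lambda>\<zeta>. fourier_integral (\<lambda>z. indicator (cball 0 R) z * u z) \<zeta> - v \<zeta>)) \<longlongrightarrow> 0) at_top"

definition fourier :: "('n::finite spacetime \<Rightarrow> complex) \<Rightarrow> 'n spacetime \<Rightarrow> complex" where
  "fourier u = (SOME v. is_fourier u v)"


subsection \<open>Fractional powers of the heat operator and the parabolic Sobolev spaces\<close>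

definition heat_symbol :: "'n::finite spacetime \<Rightarrow> complex" where
  "heat_symbol = (\<lambda>(\<rho>, \<xi>). \<i> * complex_of_real \<rho> + complex_of_real ((norm \<xi>)\<^sup>2))"

definition heat_symbol_adj :: "'n::finite spacetime \<Rightarrow> complex" where
  "heat_symbol_adj = (\<lambda>(\<rho>, \<xi>). - (\<i> * complex_of_real \<rho>) + complex_of_real ((norm \<xi>)\<^sup>2))"

text \<open>
  \<open>heat_pow a u\<close> is \<open>(\<partial>\<^sub>t - \<Delta>\<^sub>x)\<^sup>a u\<close> whenever this is an \<open>L\<^sup>2\<close> function (in particular for
  \<open>u \<in> Hs s\<close> and \<open>a = s / 2\<close>); \<open>powr\<close> on the complex numbers is the principal branch.
\<close>

definition heat_pow :: "real \<Rightarrow> ('n::finite spacetime \<Rightarrow> complex) \<Rightarrow> 'n spacetime \<Rightarrow> complex" where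
  "heat_pow a u = (SOME v. v \<in> L2 \<and>
     (AE \<zeta> in lebesgue. fourier v \<zeta> = heat_symbol \<zeta> powr complex_of_real a * fourier u \<zeta>))"

definition heat_pow_adj :: "real \<Rightarrow> ('n::finite spacetime \<Rightarrow> complex) \<Rightarrow> 'n spacetime \<Rightarrow> complex" where
  "heat_pow_adj a u = (SOME v. v \<in> L2 \<and>
     (AE \<zeta> in lebesgue. fourier v \<zeta> = heat_symbol_adj \<zeta> powr complex_of_real a * fourier u \<zeta>))"

definition Hs :: "real \<Rightarrow> ('n::finite spacetime \<Rightarrow> complex) set" where
  "Hs s = {u \<in> L2.
     (\<integral>\<^sup>+ \<zeta>. ennreal ((1 + norm (heat_symbol \<zeta>)) powr s * (norm (fourier u \<zeta>))\<^sup>2) \<partial>lebesgue) < \<infinity>}"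

text \<open>The support of an \<open>L\<^sup>2\<close> class (equivalently, its support as a distribution).\<close>

definition ess_supp :: "('n::finite spacetime \<Rightarrow> complex) \<Rightarrow> 'n spacetime set" where
  "ess_supp u = - \<Union>{V. open V \<and> (AE z in lebesgue. z \<in> V \<longrightarrow> u z = 0)}"

definition Hs_supp :: "real \<Rightarrow> 'n::finite spacetime set \<Rightarrow> ('n spacetime \<Rightarrow> complex) set" where
  "Hs_supp s E = {u \<in> Hs s. ess_supp u \<subseteq> E}"


subsection \<open>Smooth compactly supported functions\<close>

text \<open>\<open>Ck k f\<close>: \<open>f\<close> is \<open>k\<close> times continuously differentiable on the whole space.\<close>

fun Ck :: "nat \<Rightarrow> ('a::euclidean_space \<Rightarrow> complex) \<Rightarrow> bool" where
  "Ck 0 f \<longleftrightarrow> continuous_on UNIV f"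
| "Ck (Suc k) f \<longleftrightarrow>
     (\<forall>z. f differentiable (at z)) \<and> (\<forall>h. Ck k (\<lambda>z. frechet_derivative f (at z) h))"

definition Cc_infty :: "'a::euclidean_space set \<Rightarrow> ('a \<Rightarrow> complex) set" where
  "Cc_infty A = {f. (\<forall>k. Ck k f) \<and> compact (closure {z. f z \<noteq> 0}) \<and> closure {z. f z \<noteq> 0} \<subseteq> A}"


subsection \<open>The exterior value problem\<close>

definition cyl :: "real \<Rightarrow> (real ^ 'n::finite) set \<Rightarrow> 'n spacetime set" where
  "cyl T A = {-T<..<T} \<times> A"

definition exterior :: "(real ^ 'n::finite) set \<Rightarrow> (real ^ 'n) set" where
  "exterior \<Omega> = - closure \<Omega>"

definition Linfty_real :: "'n::finite spacetime set \<Rightarrow> ('n spacetime \<Rightarrow> real) set" where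
  "Linfty_real A = {Q \<in> borel_measurable (lebesgue_on A). \<exists>C. AE z in lebesgue_on A. \<bar>Q z\<bar> \<le> C}"

definition form_B ::
  "real \<Rightarrow> real \<Rightarrow> (real ^ 'n::finite) set \<Rightarrow> ('n spacetime \<Rightarrow> real)
    \<Rightarrow> ('n spacetime \<Rightarrow> complex) \<Rightarrow> ('n spacetime \<Rightarrow> complex) \<Rightarrow> complex" where
  "form_B s T \<Omega> Q u w = L2_inner UNIV (heat_pow (s / 2) u) (heat_pow_adj (s / 2) w)
     + L2_inner (cyl T \<Omega>) (\<lambda>z. complex_of_real (Q z) * u z) w"

definition solves ::
  "real \<Rightarrow> real \<Rightarrow> (real ^ 'n::finite) set \<Rightarrow> ('n spacetime \<Rightarrow> real) \<Rightarrow> ('n spacetime \<Rightarrow> complex) \<Rightarrow> bool" where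
  "solves s T \<Omega> Q u \<longleftrightarrow> u \<in> Hs s \<and> (\<forall>w \<in> Hs_supp s (closure (cyl T \<Omega>)). form_B s T \<Omega> Q u w = 0)"

definition eigenvalue_condition ::
  "real \<Rightarrow> real \<Rightarrow> (real ^ 'n::finite) set \<Rightarrow> ('n spacetime \<Rightarrow> real) \<Rightarrow> bool" where
  "eigenvalue_condition s T \<Omega> Q \<longleftrightarrow>
     (\<forall>u. solves s T \<Omega> Q u
        \<and> (AE z in lebesgue. z \<in> cyl T (exterior \<Omega>) \<longrightarrow> u z = 0)
        \<and> (AE z in lebesgue. z \<in> {..-T} \<times> UNIV \<longrightarrow> u z = 0)
      \<longrightarrow> (AE z in lebesgue. z \<in> {..<T} \<times> UNIV \<longrightarrow> u z = 0))"

text \<open>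
  Under the eigenvalue condition the solution with exterior datum \<open>f\<close> exists and is unique up to
  null sets; \<open>DN_map s T \<Omega> Q f g\<close> is the pairing \<open>\<langle>\<Lambda>\<^sub>Q f, g\<rangle>\<close>.
\<close>

definition exterior_solution ::
  "real \<Rightarrow> real \<Rightarrow> (real ^ 'n::finite) set \<Rightarrow> ('n spacetime \<Rightarrow> real)
    \<Rightarrow> ('n spacetime \<Rightarrow> complex) \<Rightarrow> 'n spacetime \<Rightarrow> complex" where
  "exterior_solution s T \<Omega> Q f =
     (SOME u. solves s T \<Omega> Q u \<and> (\<lambda>z. u z - f z) \<in> Hs_supp s (closure (cyl T \<Omega>)))"

definition DN_map ::
  "real \<Rightarrow> real \<Rightarrow> (real ^ 'n::finite) set \<Rightarrow> ('n spacetime \<Rightarrow> real)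
    \<Rightarrow> ('n spacetime \<Rightarrow> complex) \<Rightarrow> ('n spacetime \<Rightarrow> complex) \<Rightarrow> complex" where
  "DN_map s T \<Omega> Q f g = form_B s T \<Omega> Q (exterior_solution s T \<Omega> Q f) g"

end

theory Submission imports Defs "HOL-Probability.Probability" begin

text \<open>
  The form \<open>B\<close> is not coercive, but multiplying one argument by a weight that decays fast in time makes it
  so (causality of the heat semigroup), and hence both the exterior value problem and its adjoint are
  solvable for every bounded potential. Equality of the Dirichlet-to-Neumann maps then gives
  \<open>\<integral> (Q1 - Q2) u1 * cnj u2 = 0\<close> over the cylinder for all solutions \<open>u1\<close> and adjoint solutions \<open>u2\<close> with smooth exterior
  data in \<open>U1\<close> and \<open>U2\<close>.

  Such solutions restrict to a dense subset of \<open>L\<^sup>2\<close> of the cylinder (Runge approximation): otherwise, solving the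
  dual problem with a source orthogonal to all of them yields \<open>v \<noteq> 0\<close> supported in the closed cylinder for which the
  nonlocal operator vanishes in the exterior cylinder. Away from the support of \<open>v\<close> that operator is convolution with
  the kernel \<open>\<tau> powr (- 1 - s - n / 2) * exp (- (norm y)\<^sup>2 / (4 * \<tau>))\<close>. Differentiating in \<open>t\<close> and \<open>x\<close>
  multiplies the kernel by arbitrary polynomials in \<open>1 / \<tau>\<close> and \<open>y\<close>, so that by the Weierstrass theorem in time and
  in space \<open>v = 0\<close>. Density applied in \<open>u1\<close> and then in \<open>u2\<close> gives \<open>Q1 = Q2\<close>.
\<close>



section \<open>Square integrable functions\<close>

text \<open>What makes the kernel argument close: \<open>kap m c \<tau>\<close> with
  \<open>c = |y|^2 / 4\<close> is a multiple of the heat kernel only for \<open>m = n / 2\<close>;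
  in general the heat operator maps it to \<open>n / 2 - m\<close> times the kernel with exponent
  \<open>m + 1\<close>. The fractional power produces \<open>m = 1 + s + n / 2\<close>, so vanishing
  of a potential on an open cylinder propagates to all exponents \<open>m + j\<close>. The series of
  \<open>exp (- d / \<tau>)\<close> in these powers stays dominated only while \<open>d\<close> is
  small against the separation of the supports, which forces steps of size \<open>c0 / 2\<close>.

  Solvability has its own obstacle: Garding's inequality bounds the form below only up to an L2
  term, and a bounded potential may have either sign. A time weight on one argument gives an L2
  bound with an arbitrarily large constant, because the semigroup formula compares a function only
  with its values at earlier times. The weight must map H^s to itself, which limits its choice.
  Adding the two estimates gives inf-sup bounds on both sides.\<close>

definition sqint :: "'a measure => ('a => complex) => bool" where
 "sqint M u \<longleftrightarrow> u \<in> borel_measurable M \<and> integrable M (\<lambda>x. (cmod (u x))\<^sup>2)"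

text \<open>The norm is kept squared: limits and Plancherel then need no roots, at the price of the
  factor 2 in the triangle inequality.\<close>

definition sqnorm :: "'a measure => ('a => complex) => real" where
 "sqnorm M u = (LINT x|M. (cmod (u x))\<^sup>2)"

definition inprod :: "'a measure => ('a => complex) => ('a => complex) => complex" where
 "inprod M u w = (LINT x|M. u x * cnj (w x))"

lemma sqintI: "u \<in> borel_measurable M ==> integrable M (\<lambda>x. (cmod (u x))\<^sup>2) ==> sqint M u"
 by (simp add: sqint_def)

lemma sqint_measurable: "sqint M u ==> u \<in> borel_measurable M"
 by (simp add: sqint_def)

lemma sqint_integrable: "sqint M u ==> integrable M (\<lambda>x. (cmod (u x))\<^sup>2)"
 by (simp add: sqint_def)

lemma sqnorm_nonneg: "0 \<le> sqnorm M u"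
 by (simp add: sqnorm_def)

lemma borel_measurable_cnj [measurable (raw)]:
 "f \<in> borel_measurable M ==> (\<lambda>x. cnj (f x)) \<in> borel_measurable M"
 by (rule measurable_compose[OF _ borel_measurable_continuous_onI[OF continuous_on_cnj[OF continuous_on_id]]])

lemma norm_add_sq_le: "(cmod (a + b))\<^sup>2 \<le> 2 * (cmod a)\<^sup>2 + 2 * (cmod b)\<^sup>2"
proof -
 have "(cmod (a + b))\<^sup>2 \<le> (cmod a + cmod b)\<^sup>2"
  by (intro power_mono norm_triangle_ineq) auto
 also have "\<dots> \<le> 2 * (cmod a)\<^sup>2 + 2 * (cmod b)\<^sup>2"
  using sum_squares_bound[of "cmod a" "cmod b"] by (simp add: power2_sum)
 finally show ?thesis .
qed

lemma sqint_add: assumes "sqint M u" "sqint M w" shows "sqint M (\<lambda>x. u x + w x)"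
proof (rule sqintI)
 note [measurable] = assms[THEN sqint_measurable]
 show "(\<lambda>x. u x + w x) \<in> borel_measurable M" by simp
 have i: "integrable M (\<lambda>x. 2 * (cmod (u x))\<^sup>2 + 2 * (cmod (w x))\<^sup>2)"
  by (simp add: assms[THEN sqint_integrable])
 show "integrable M (\<lambda>x. (cmod (u x + w x))\<^sup>2)"
  by (rule Bochner_Integration.integrable_bound[OF i]) (auto simp: norm_add_sq_le)
qed

lemma sqint_cmult: assumes "sqint M u" shows "sqint M (\<lambda>x. c * u x)"
 using assms by (auto simp: sqint_def norm_mult power_mult_distrib)

lemma sqint_uminus: assumes "sqint M u" shows "sqint M (\<lambda>x. - u x)"
 using assms by (auto simp: sqint_def)

lemma sqint_cnj: assumes "sqint M u" shows "sqint M (\<lambda>x. cnj (u x))"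
 using assms by (auto simp: sqint_def)

lemma sqint_diff: assumes "sqint M u" "sqint M w" shows "sqint M (\<lambda>x. u x - w x)"
 using sqint_add[OF assms(1) sqint_uminus[OF assms(2)]] by simp

lemma sqint_0: "sqint M (\<lambda>x. 0)"
 by (auto simp: sqint_def)

lemma sqint_bound:
 assumes "sqint M u" "w \<in> borel_measurable M" "AE x in M. cmod (w x) \<le> C * cmod (u x)"
 shows "sqint M w"
proof (rule sqintI)
 have i: "integrable M (\<lambda>x. C\<^sup>2 * (cmod (u x))\<^sup>2)"
  by (simp add: assms(1)[THEN sqint_integrable])
 show "integrable M (\<lambda>x. (cmod (w x))\<^sup>2)"
 proof (rule Bochner_Integration.integrable_bound[OF i])
  show "AE x in M. norm ((cmod (w x))\<^sup>2) \<le> norm (C\<^sup>2 * (cmod (u x))\<^sup>2)"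
   using assms(3)
  proof eventually_elim
   case (elim x)
   then have "(cmod (w x))\<^sup>2 \<le> (C * cmod (u x))\<^sup>2" by (intro power_mono) auto
   then show ?case by (simp add: power_mult_distrib abs_mult)
  qed
 qed (use assms in measurable)
qed (use assms in simp)

lemma integrable_norm_mult:
 assumes "sqint M u" "sqint M w" shows "integrable M (\<lambda>x. cmod (u x) * cmod (w x))"
proof (rule Bochner_Integration.integrable_bound)
 have [measurable]: "u \<in> borel_measurable M" "w \<in> borel_measurable M"
  using assms by (auto dest: sqint_measurable)
 show "integrable M (\<lambda>x. (cmod (u x))\<^sup>2 + (cmod (w x))\<^sup>2)"
  by (simp add: assms[THEN sqint_integrable])
 show "(\<lambda>x. cmod (u x) * cmod (w x)) \<in> borel_measurable M" by simp
 show "AE x in M. norm (cmod (u x) * cmod (w x)) \<le> norm ((cmod (u x))\<^sup>2 + (cmod (w x))\<^sup>2)"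
 proof (intro AE_I2)
  fix x
  have "2 * (cmod (u x) * cmod (w x)) \<le> (cmod (u x))\<^sup>2 + (cmod (w x))\<^sup>2" "0 \<le> cmod (u x) * cmod (w x)"
   using sum_squares_bound[of "cmod (u x)" "cmod (w x)"] by (auto simp: mult.assoc)
  then have "cmod (u x) * cmod (w x) \<le> (cmod (u x))\<^sup>2 + (cmod (w x))\<^sup>2" by linarith
  then show "norm (cmod (u x) * cmod (w x)) \<le> norm ((cmod (u x))\<^sup>2 + (cmod (w x))\<^sup>2)"
   by (simp add: abs_mult)
 qed
qed

lemma integrable_mult_sqint:
 assumes "sqint M u" "sqint M w" shows "integrable M (\<lambda>x. u x * w x)"
 by (rule Bochner_Integration.integrable_bound[OF integrable_norm_mult[OF assms]])
  (use assms in \<open>auto dest!: sqint_measurable simp: norm_mult\<close>)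

lemma integrable_mult_cnj:
 assumes "sqint M u" "sqint M w" shows "integrable M (\<lambda>x. u x * cnj (w x))"
 by (intro integrable_mult_sqint sqint_cnj assms)

lemma sqnorm_cmult: "sqnorm M (\<lambda>x. c * u x) = (cmod c)\<^sup>2 * sqnorm M u"
 by (simp add: sqnorm_def norm_mult power_mult_distrib)

lemma sqnorm_commute: "sqnorm M (\<lambda>x. u x - w x) = sqnorm M (\<lambda>x. w x - u x)"
 by (simp add: sqnorm_def norm_minus_commute)

lemma sqnorm_add_le:
 assumes "sqint M u" "sqint M w"
 shows "sqnorm M (\<lambda>x. u x + w x) \<le> 2 * sqnorm M u + 2 * sqnorm M w"
proof -
 have "sqnorm M (\<lambda>x. u x + w x) \<le> (LINT x|M. 2 * (cmod (u x))\<^sup>2 + 2 * (cmod (w x))\<^sup>2)"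
  unfolding sqnorm_def using sqint_integrable[OF sqint_add[OF assms]] assms[THEN sqint_integrable]
  by (intro integral_mono) (auto simp: norm_add_sq_le)
 also have "\<dots> = 2 * sqnorm M u + 2 * sqnorm M w"
  unfolding sqnorm_def by (simp add: assms[THEN sqint_integrable])
 finally show ?thesis .
qed

lemma sqnorm_triangle:
 assumes "sqint M u" "sqint M v" "sqint M w"
 shows "sqnorm M (\<lambda>x. u x - w x) \<le> 2 * sqnorm M (\<lambda>x. u x - v x) + 2 * sqnorm M (\<lambda>x. v x - w x)"
 using sqnorm_add_le[OF sqint_diff[OF assms(1,2)] sqint_diff[OF assms(2,3)]] by simp

text \<open>Cauchy-Schwarz, from the discriminant of the integral of \<open>(|u| - a |w|)^2\<close>
  as a quadratic in \<open>a\<close>. The version with absolute values under the integral serves the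
  Fubini arguments below.\<close>

lemma norm_inprod_le:
 assumes "sqint M u" "sqint M w"
 shows "(LINT x|M. cmod (u x) * cmod (w x))\<^sup>2 \<le> sqnorm M u * sqnorm M w"
  and "(cmod (inprod M u w))\<^sup>2 \<le> sqnorm M u * sqnorm M w"
proof -
 define p where "p = (LINT x|M. cmod (u x) * cmod (w x))"
 have p0: "0 \<le> p" unfolding p_def by simp
 have q: "0 \<le> sqnorm M u - 2 * a * p + a\<^sup>2 * sqnorm M w" for a :: real
 proof -
  have i: "integrable M (\<lambda>x. (cmod (u x))\<^sup>2)" "integrable M (\<lambda>x. (cmod (w x))\<^sup>2)"
   "integrable M (\<lambda>x. cmod (u x) * cmod (w x))"
   by (simp_all add: assms[THEN sqint_integrable] integrable_norm_mult[OF assms])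
  have "0 \<le> (LINT x|M. (cmod (u x) - a * cmod (w x))\<^sup>2)" by simp
  also have "\<dots> = (LINT x|M. (cmod (u x))\<^sup>2 - 2 * a * (cmod (u x) * cmod (w x)) + a\<^sup>2 * (cmod (w x))\<^sup>2)"
   by (rule Bochner_Integration.integral_cong) (auto simp: power2_eq_square algebra_simps)
  also have "\<dots> = sqnorm M u - 2 * a * p + a\<^sup>2 * sqnorm M w"
   unfolding sqnorm_def p_def using i by simp
  finally show ?thesis .
 qed
 have main: "p\<^sup>2 \<le> sqnorm M u * sqnorm M w"
 proof (cases "sqnorm M w = 0")
  case True
  have "p = 0"
  proof (rule ccontr)
   assume "p \<noteq> 0"
   \<comment> \<open>The quadratic is affine here, and at this \<open>a\<close> it equals
     -1.\<close>
   with q[of "(sqnorm M u + 1) / (2 * p)"] True show False by simp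
  qed
  then show ?thesis using True by simp
 next
  case False
  then have w: "sqnorm M w > 0" using sqnorm_nonneg[of M w] by linarith
  have "0 \<le> (sqnorm M u - 2 * (p / sqnorm M w) * p + (p / sqnorm M w)\<^sup>2 * sqnorm M w) * sqnorm M w"
   using q[of "p / sqnorm M w"] w by (intro mult_nonneg_nonneg) auto
  also have "\<dots> = sqnorm M u * sqnorm M w - p\<^sup>2"
   using w by (simp add: field_simps power2_eq_square)
  finally show ?thesis by simp
 qed
 show "(LINT x|M. cmod (u x) * cmod (w x))\<^sup>2 \<le> sqnorm M u * sqnorm M w" using main by (simp add: p_def)
 have "cmod (inprod M u w) \<le> p"
  unfolding inprod_def p_def by (rule order_trans[OF integral_norm_bound]) (simp add: norm_mult)
 then show "(cmod (inprod M u w))\<^sup>2 \<le> sqnorm M u * sqnorm M w"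
  using main by (meson order_trans power_mono norm_ge_zero)
qed

lemma inprod_add_left:
 "sqint M u ==> sqint M v ==> sqint M w ==> inprod M (\<lambda>x. u x + v x) w = inprod M u w + inprod M v w"
 unfolding inprod_def by (simp add: distrib_right integrable_mult_cnj)

lemma inprod_diff_left:
 "sqint M u ==> sqint M v ==> sqint M w ==> inprod M (\<lambda>x. u x - v x) w = inprod M u w - inprod M v w"
 unfolding inprod_def by (simp add: left_diff_distrib integrable_mult_cnj)

lemma inprod_diff_right:
 "sqint M u ==> sqint M v ==> sqint M w ==> inprod M u (\<lambda>x. v x - w x) = inprod M u v - inprod M u w"
 unfolding inprod_def by (simp add: right_diff_distrib integrable_mult_cnj)

lemma inprod_cmult_left: "inprod M (\<lambda>x. c * u x) w = c * inprod M u w"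
 unfolding inprod_def by (simp add: mult.assoc)

lemma inprod_cnj: "cnj (inprod M u w) = inprod M w u"
 unfolding inprod_def by (subst Bochner_Integration.integral_cnj[symmetric]) (simp add: mult.commute)

lemma inprod_self: "inprod M u u = complex_of_real (sqnorm M u)"
 unfolding inprod_def sqnorm_def integral_complex_of_real[symmetric]
 by (simp only: complex_norm_square)

lemma sqnorm_diff_expand:
 assumes "sqint M u" "sqint M w"
 shows "sqnorm M (\<lambda>x. u x - w x) = sqnorm M u - 2 * Re (inprod M u w) + sqnorm M w"
proof -
 have "complex_of_real (sqnorm M (\<lambda>x. u x - w x)) =
   inprod M u u - inprod M u w - (inprod M w u - inprod M w w)"
  unfolding inprod_self[symmetric]
  by (simp add: inprod_diff_left inprod_diff_right assms sqint_diff)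
 also have "inprod M w u = cnj (inprod M u w)" by (simp add: inprod_cnj)
 finally have "Re (complex_of_real (sqnorm M (\<lambda>x. u x - w x))) = Re (inprod M u u - inprod M u w - (cnj (inprod M u w) - inprod M w w))"
  by simp
 then show ?thesis by (simp add: inprod_self)
qed

lemma sqnorm_0_AE:
 assumes "sqint M u" "sqnorm M u = 0" shows "AE x in M. u x = 0"
 using assms integral_nonneg_eq_0_iff_AE[of M "\<lambda>x. (cmod (u x))\<^sup>2"]
 by (auto simp: sqint_def sqnorm_def)

lemma sqint_AE_cong:
 assumes "sqint M u" "AE x in M. u x = w x" "w \<in> borel_measurable M"
 shows "sqint M w"
 by (rule sqint_bound[OF assms(1,3), of 1]) (use assms(2) in \<open>auto elim: eventually_mono\<close>)

lemma sqnorm_AE_cong: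
 assumes "AE x in M. u x = w x" "u \<in> borel_measurable M" "w \<in> borel_measurable M"
 shows "sqnorm M u = sqnorm M w"
 unfolding sqnorm_def using assms by (intro integral_cong_AE) (auto elim: eventually_mono)

lemma nn_integral_sqint:
 "sqint M u ==> (\<integral>\<^sup>+x. ennreal ((cmod (u x))\<^sup>2) \<partial>M) = ennreal (sqnorm M u)"
 unfolding sqnorm_def by (intro nn_integral_eq_integral) (simp_all add: sqint_integrable)

lemma sqint_iff_nn_integral:
 "sqint M u \<longleftrightarrow> u \<in> borel_measurable M \<and> (\<integral>\<^sup>+x. ennreal ((cmod (u x))\<^sup>2) \<partial>M) < \<infinity>"
 unfolding sqint_def integrable_iff_bounded by auto

lemma nn_integral_le_sqnorm:
 assumes "u \<in> borel_measurable M" "(\<integral>\<^sup>+x. ennreal ((cmod (u x))\<^sup>2) \<partial>M) \<le> ennreal c" "0 \<le> c"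
 shows "sqint M u" "sqnorm M u \<le> c"
proof -
 show s: "sqint M u" unfolding sqint_iff_nn_integral
  using assms(1) order.strict_trans1[OF assms(2)] by simp
 show "sqnorm M u \<le> c" using assms(2,3) unfolding nn_integral_sqint[OF s] by simp
qed

lemma sqnorm_tendsto_imp_inprod:
 assumes u: "\<And>k. sqint M (uk k)" "sqint M u" "(\<lambda>k. sqnorm M (\<lambda>x. uk k x - u x)) \<longlonglongrightarrow> 0"
  and w: "\<And>k. sqint M (wk k)" "sqint M w" "(\<lambda>k. sqnorm M (\<lambda>x. wk k x - w x)) \<longlonglongrightarrow> 0"
 shows "(\<lambda>k. inprod M (uk k) (wk k)) \<longlonglongrightarrow> inprod M u w"
proof -
 define A where "A k = sqrt (sqnorm M (\<lambda>x. uk k x - u x))" for k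
 define B where "B k = sqrt (sqnorm M (\<lambda>x. wk k x - w x))" for k
 have A: "A \<longlonglongrightarrow> 0" and B: "B \<longlonglongrightarrow> 0"
  unfolding A_def B_def using tendsto_real_sqrt[OF u(3)] tendsto_real_sqrt[OF w(3)] by simp_all
 have cs: "cmod (inprod M f g) \<le> sqrt (sqnorm M f) * sqrt (sqnorm M g)" if "sqint M f" "sqint M g" for f g
  using norm_inprod_le(2)[OF that] by (metis real_le_rsqrt real_sqrt_mult)
 have b: "norm (inprod M (uk k) (wk k) - inprod M u w) \<le> A k * B k + A k * sqrt (sqnorm M w) + sqrt (sqnorm M u) * B k" for k
 proof -
  have "inprod M (uk k) (wk k) - inprod M u w =
   inprod M (\<lambda>x. uk k x - u x) (\<lambda>x. wk k x - w x) + inprod M (\<lambda>x. uk k x - u x) w + inprod M u (\<lambda>x. wk k x - w x)"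
   using u w by (simp add: inprod_diff_left inprod_diff_right sqint_diff)
  moreover have "cmod (inprod M (\<lambda>x. uk k x - u x) (\<lambda>x. wk k x - w x)) \<le> A k * B k"
   "cmod (inprod M (\<lambda>x. uk k x - u x) w) \<le> A k * sqrt (sqnorm M w)"
   "cmod (inprod M u (\<lambda>x. wk k x - w x)) \<le> sqrt (sqnorm M u) * B k"
   unfolding A_def B_def using u w by (intro cs sqint_diff; simp)+
  ultimately show ?thesis
   by (auto intro!: order_trans[OF norm_triangle_ineq] add_mono)
 qed
 have "(\<lambda>k. A k * B k + A k * sqrt (sqnorm M w) + sqrt (sqnorm M u) * B k) \<longlonglongrightarrow> 0 * 0 + 0 * sqrt (sqnorm M w) + sqrt (sqnorm M u) * 0"
  by (intro tendsto_intros A B)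
 then have "(\<lambda>k. A k * B k + A k * sqrt (sqnorm M w) + sqrt (sqnorm M u) * B k) \<longlonglongrightarrow> 0" by simp
 then have "(\<lambda>k. inprod M (uk k) (wk k) - inprod M u w) \<longlonglongrightarrow> 0"
  by (rule Lim_null_comparison[rotated]) (use b in auto)
 then show ?thesis by (simp add: LIM_zero_iff)
qed

lemma sqnorm_tendsto:
 assumes "\<And>k. sqint M (uk k)" "sqint M u" "(\<lambda>k. sqnorm M (\<lambda>x. uk k x - u x)) \<longlonglongrightarrow> 0"
 shows "(\<lambda>k. sqnorm M (uk k)) \<longlonglongrightarrow> sqnorm M u"
 using tendsto_Re[OF sqnorm_tendsto_imp_inprod[OF assms assms]] by (simp add: inprod_self)

text \<open>Riesz-Fischer. Along a subsequence the increments have squared norm at most 4^-k;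
  weighted by 2^k they still have a finite sum of integrals, so almost everywhere they decay
  geometrically and the subsequence converges. Fatou's lemma carries the Cauchy estimate over to the
  limit.\<close>

lemma sqint_complete:
 assumes u: "\<And>k. sqint M (u k)"
  and C: "\<And>e. e > 0 ==> \<exists>N. \<forall>m\<ge>N. \<forall>n\<ge>N. sqnorm M (\<lambda>x. u m x - u n x) < (e::real)"
 shows "\<exists>v. sqint M v \<and> (\<lambda>k. sqnorm M (\<lambda>x. u k x - v x)) \<longlonglongrightarrow> 0"
proof -
 have [measurable]: "u k \<in> borel_measurable M" for k using u by (rule sqint_measurable)
 have "\<exists>N. \<forall>m\<ge>N. \<forall>n\<ge>N. sqnorm M (\<lambda>x. u m x - u n x) < (1/4)^k" for k :: nat
  by (rule C) simp
 then obtain N where N: "\<And>k m n. m \<ge> N k ==> n \<ge> N k ==> sqnorm M (\<lambda>x. u m x - u n x) < (1/4)^k"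
  by metis
 \<comment> \<open>Adding \<open>k\<close> and all earlier \<open>N i\<close> makes \<open>r\<close>
   monotone, at least \<open>N k\<close> and unbounded.\<close>
 define r where "r k = k + (\<Sum>i\<le>k. N i)" for k
 have rN: "r k \<ge> N k" for k
  unfolding r_def using member_le_sum[of k "{..k}" N] by simp
 have rSuc: "r (Suc k) \<ge> r k" for k unfolding r_def by simp
 have rk: "r k \<ge> k" for k unfolding r_def by simp
 define d where "d k x = u (r (Suc k)) x - u (r k) x" for k x
 have [measurable]: "d k \<in> borel_measurable M" for k unfolding d_def by simp
 have sd: "sqint M (d k)" for k unfolding d_def by (intro sqint_diff u)
 have nd: "sqnorm M (d k) \<le> (1/4)^k" for k
  unfolding d_def by (intro less_imp_le N order_trans[OF rN rSuc] rN)
 have "(\<integral>\<^sup>+x. (\<Sum>k. ennreal (2^k * (cmod (d k x))\<^sup>2)) \<partial>M) = (\<Sum>k. \<integral>\<^sup>+x. ennreal (2^k * (cmod (d k x))\<^sup>2) \<partial>M)"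
  by (rule nn_integral_suminf) simp
 also have "\<dots> \<le> (\<Sum>k. ennreal ((1/2)^k))"
 proof (rule suminf_le)
  fix k
  have "(\<integral>\<^sup>+x. ennreal (2^k * (cmod (d k x))\<^sup>2) \<partial>M) = ennreal (2^k) * ennreal (sqnorm M (d k))"
   by (simp add: ennreal_mult nn_integral_cmult nn_integral_sqint[OF sd])
  also have "\<dots> = ennreal (2^k * sqnorm M (d k))"
   by (simp add: ennreal_mult sqnorm_nonneg)
  also have "\<dots> \<le> ennreal (2^k * (1/4)^k)"
   by (intro ennreal_leI mult_left_mono nd) simp
  also have "(2::real)^k * (1/4)^k = (1/2)^k" by (simp flip: power_mult_distrib)
  finally show "(\<integral>\<^sup>+x. ennreal (2^k * (cmod (d k x))\<^sup>2) \<partial>M) \<le> ennreal ((1/2)^k)" .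
 qed auto
 also have "\<dots> < \<infinity>"
  by (subst suminf_ennreal2) (auto intro!: summable_geometric)
 finally have fin: "AE x in M. (\<Sum>k. ennreal (2^k * (cmod (d k x))\<^sup>2)) \<noteq> \<infinity>"
  by (intro nn_integral_PInf_AE) auto
 have conv: "AE x in M. convergent (\<lambda>k. u (r k) x)"
  using fin
 proof eventually_elim
  case (elim x)
  obtain K where K: "(\<Sum>k. ennreal (2^k * (cmod (d k x))\<^sup>2)) = ennreal K" "K \<ge> 0"
  proof
   show "(\<Sum>k. ennreal (2^k * (cmod (d k x))\<^sup>2)) = ennreal (enn2real (\<Sum>k. ennreal (2^k * (cmod (d k x))\<^sup>2)))"
    using elim by (simp only: ennreal_enn2real_if infinity_ennreal_def if_False)
  qed (rule enn2real_nonneg)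
  have le: "cmod (d k x) \<le> sqrt K * (sqrt (1/2))^k" for k
  proof -
   have "ennreal (2^k * (cmod (d k x))\<^sup>2) \<le> ennreal K"
   proof -
    have "sum (\<lambda>k. ennreal (2^k * (cmod (d k x))\<^sup>2)) {k} \<le> (\<Sum>k. ennreal (2^k * (cmod (d k x))\<^sup>2))"
     by (rule sum_le_suminf) auto
    then show ?thesis unfolding K(1) by (simp only: sum.empty finite.intros sum.insert empty_iff not_False_eq_True add_0_right)
   qed
   then have "2^k * (cmod (d k x))\<^sup>2 \<le> K" using K(2) by simp
   then have "(cmod (d k x))\<^sup>2 \<le> K * (1/2)^k" by (simp add: field_simps)
   then have "cmod (d k x) \<le> sqrt (K * (1/2)^k)" by (rule real_le_rsqrt)
   then show ?thesis by (simp add: real_sqrt_mult real_sqrt_power)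
  qed
  have sq: "sqrt (1/2) < (1::real)" using real_sqrt_less_iff[of "1/2" 1] by simp
  have "summable (\<lambda>k. d k x)"
  proof (rule summable_comparison_test')
   show "summable (\<lambda>k. sqrt K * (sqrt (1/2))^k)"
    by (intro summable_mult summable_geometric) (use sq in simp)
  qed (use le in auto)
  then have "convergent (\<lambda>n. \<Sum>k<n. d k x)" by (simp add: summable_iff_convergent)
  moreover have "(\<Sum>k<n. d k x) = u (r n) x - u (r 0) x" for n
   unfolding d_def by (rule sum_lessThan_telescope)
  ultimately have "convergent (\<lambda>n. (u (r n) x - u (r 0) x) + u (r 0) x)"
   by (intro convergent_add convergent_const) simp
  then show ?case by simp
 qed
 define v where "v x = lim (\<lambda>k. u (r k) x)" for x
 have [measurable]: "v \<in> borel_measurable M" unfolding v_def by (rule borel_measurable_lim_metric) simp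
 \<comment> \<open>Used twice: once with bound 1 to see that \<open>v\<close> is square integrable,
   once with arbitrarily small bounds for the convergence.\<close>
 have bnd: "sqint M (\<lambda>x. u n x - v x) \<and> sqnorm M (\<lambda>x. u n x - v x) \<le> e"
  if n: "\<And>m. m \<ge> n ==> sqnorm M (\<lambda>x. u n x - u m x) \<le> e" and e: "0 \<le> e" for n e
 proof -
  have "(\<integral>\<^sup>+x. ennreal ((cmod (u n x - v x))\<^sup>2) \<partial>M) \<le> (\<integral>\<^sup>+x. liminf (\<lambda>k. ennreal ((cmod (u n x - u (r k) x))\<^sup>2)) \<partial>M)"
  proof (rule nn_integral_mono_AE, use conv in eventually_elim)
   case (elim x)
   then have "(\<lambda>k. u (r k) x) \<longlonglongrightarrow> v x" unfolding v_def by (simp add: convergent_LIMSEQ_iff)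
   then have "(\<lambda>k. ennreal ((cmod (u n x - u (r k) x))\<^sup>2)) \<longlonglongrightarrow> ennreal ((cmod (u n x - v x))\<^sup>2)"
    by (intro tendsto_intros)
   then have "liminf (\<lambda>k. ennreal ((cmod (u n x - u (r k) x))\<^sup>2)) = ennreal ((cmod (u n x - v x))\<^sup>2)"
    by (rule lim_imp_Liminf[rotated]) simp
   then show ?case by simp
  qed
  also have "\<dots> \<le> liminf (\<lambda>k. \<integral>\<^sup>+x. ennreal ((cmod (u n x - u (r k) x))\<^sup>2) \<partial>M)"
   by (rule nn_integral_liminf) simp
  also have "\<dots> \<le> ennreal e"
  proof (rule Liminf_le)
   show "\<forall>\<^sub>F k in sequentially. (\<integral>\<^sup>+x. ennreal ((cmod (u n x - u (r k) x))\<^sup>2) \<partial>M) \<le> ennreal e"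
    using eventually_ge_at_top[of n]
   proof eventually_elim
    case (elim k)
    then have "r k \<ge> n" using rk[of k] by linarith
    then show ?case using n by (simp add: nn_integral_sqint sqint_diff u ennreal_leI)
   qed
  qed simp
  finally show ?thesis using nn_integral_le_sqnorm[OF _ _ e, of "\<lambda>x. u n x - v x"] by simp
 qed
 obtain N1 where N1: "\<And>m n. m \<ge> N1 ==> n \<ge> N1 ==> sqnorm M (\<lambda>x. u m x - u n x) < 1"
  using C[of 1] by auto
 have "sqint M (\<lambda>x. u N1 x - v x)" using bnd[of N1 1] N1[of N1] by (auto intro: less_imp_le)
 from sqint_diff[OF u[of N1] this] have sv: "sqint M v" by simp
 have "(\<lambda>k. sqnorm M (\<lambda>x. u k x - v x)) \<longlonglongrightarrow> 0"
 proof (rule LIMSEQ_I)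
  fix e :: real assume e: "0 < e"
  obtain N2 where N2: "\<And>m n. m \<ge> N2 ==> n \<ge> N2 ==> sqnorm M (\<lambda>x. u m x - u n x) < e/2"
   using C[of "e/2"] e by auto
  have "norm (sqnorm M (\<lambda>x. u n x - v x) - 0) < e" if "n \<ge> N2" for n
  proof -
   have "sqnorm M (\<lambda>x. u n x - u m x) \<le> e/2" if "m \<ge> n" for m
    by (rule less_imp_le, rule N2) (use that \<open>n \<ge> N2\<close> in auto)
   from bnd[OF this] have "sqnorm M (\<lambda>x. u n x - v x) \<le> e/2" using e by simp
   then show ?thesis using e sqnorm_nonneg[of M "\<lambda>x. u n x - v x"] by simp
  qed
  then show "\<exists>no. \<forall>n\<ge>no. norm (sqnorm M (\<lambda>x. u n x - v x) - 0) < e" by blast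
 qed
 with sv show ?thesis by blast
qed

section \<open>The Fourier transform\<close>

lemma lborel_translate:
 fixes f :: "'a::euclidean_space => 'b::{banach, second_countable_topology}"
 assumes [measurable]: "f \<in> borel_measurable borel"
 shows "integrable lborel (\<lambda>x. f (x + c)) \<longleftrightarrow> integrable lborel f"
  and "(LINT x|lborel. f (x + c)) = (LINT x|lborel. f x)"
proof -
 have eq: "f = (\<lambda>x. f x)" by simp
 have "integrable (distr lborel borel ((+) c)) f \<longleftrightarrow> integrable lborel (\<lambda>x. f (c + x))"
  by (rule integrable_distr_eq) auto
 then show "integrable lborel (\<lambda>x. f (x + c)) \<longleftrightarrow> integrable lborel f"
  by (simp add: lborel_distr_plus add.commute)
 have "(LINT x|distr lborel borel ((+) c). f x) = (LINT x|lborel. f (c + x))"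
  by (rule integral_distr) auto
 then show "(LINT x|lborel. f (x + c)) = (LINT x|lborel. f x)"
  by (simp add: lborel_distr_plus add.commute)
qed

lemma lborel_reflect_measure: "distr lborel borel uminus = (lborel :: 'a::euclidean_space measure)"
 using lborel_affine[of "-1" "0::'a"] by (simp add: density_1 one_ennreal_def[symmetric])

lemma lborel_reflect:
 fixes f :: "'a::euclidean_space => 'b::{banach, second_countable_topology}"
 assumes [measurable]: "f \<in> borel_measurable borel"
 shows "integrable lborel (\<lambda>x. f (- x)) \<longleftrightarrow> integrable lborel f"
  and "(LINT x|lborel. f (- x)) = (LINT x|lborel. f x)"
proof -
 have "integrable (distr lborel borel uminus) f \<longleftrightarrow> integrable lborel (\<lambda>x. f (- x))"
  by (rule integrable_distr_eq) auto
 then show "integrable lborel (\<lambda>x. f (- x)) \<longleftrightarrow> integrable lborel f"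
  by (simp add: lborel_reflect_measure)
 have "(LINT x|distr lborel borel uminus. f x) = (LINT x|lborel. f (- x))"
  by (rule integral_distr) auto
 then show "(LINT x|lborel. f (- x)) = (LINT x|lborel. f x)"
  by (simp add: lborel_reflect_measure)
qed

lemma lborel_scale:
 fixes f :: "'a::euclidean_space => complex"
 assumes [measurable]: "f \<in> borel_measurable borel" and "0 < c"
 shows "(LINT x|lborel. f x) = c ^ DIM('a) * (LINT x|lborel. f (c *\<^sub>R x))"
proof -
 have "(LINT x|lborel. f x) = (LINT x|density (distr lborel borel (\<lambda>x. 0 + c *\<^sub>R x)) (\<lambda>_. \<bar>c\<bar>^DIM('a)). f x)"
  using lborel_affine[of c "0::'a"] assms(2) by simp
 also have "\<dots> = (LINT x|distr lborel borel (\<lambda>x. c *\<^sub>R x). (c^DIM('a)) *\<^sub>R f x)"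
  using assms(2) by (subst integral_density) auto
 also have "\<dots> = (LINT x|lborel. (c^DIM('a)) *\<^sub>R f (c *\<^sub>R x))"
  by (rule integral_distr) auto
 finally show ?thesis by (simp add: scaleR_conv_of_real)
qed

text \<open>Allows Gaussians and characters to be integrated one coordinate at a time.\<close>

lemma lborel_prod_Basis:
 fixes f :: "'a::euclidean_space => real => complex"
 assumes int: "\<And>b. b \<in> Basis ==> integrable lborel (f b)"
 shows "integrable lborel (\<lambda>x::'a. \<Prod>b\<in>Basis. f b (x \<bullet> b))"
  and "(LINT x|lborel. (\<Prod>b\<in>Basis. f b (x \<bullet> b))) = (\<Prod>b\<in>Basis. LINT t|lborel. f b t)"
proof -
 interpret product_sigma_finite "\<lambda>_::'a. lborel :: real measure" ..
 have [measurable]: "f b \<in> borel_measurable borel" if "b \<in> Basis" for b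
  using borel_measurable_integrable[OF int[OF that]] by simp
 have eq: "(\<Prod>b\<in>Basis. f b ((\<Sum>c\<in>Basis. g c *\<^sub>R c) \<bullet> b)) = (\<Prod>b\<in>Basis. f b (g b))" for g
  by (intro prod.cong) (auto simp: inner_sum_left inner_Basis if_distrib cong: if_cong)
 have m: "(\<lambda>x::'a. \<Prod>b\<in>Basis. f b (x \<bullet> b)) \<in> borel_measurable borel" by measurable
 have m2: "(\<lambda>g. \<Sum>b\<in>Basis. g b *\<^sub>R b) \<in> measurable (\<Pi>\<^sub>M b\<in>(Basis::'a set). lborel) borel" by measurable
 show "integrable lborel (\<lambda>x::'a. \<Prod>b\<in>Basis. f b (x \<bullet> b))"
  by (subst lborel_eq, subst integrable_distr_eq[OF m2 m], unfold eq)
   (intro product_integrable_prod int finite_Basis)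
 show "(LINT x|lborel. (\<Prod>b\<in>Basis. f b (x \<bullet> b))) = (\<Prod>b\<in>Basis. LINT t|lborel. f b t)"
  by (subst lborel_eq, subst integral_distr[OF m2 m], unfold eq)
   (intro product_integral_prod int finite_Basis)
qed

section \<open>Gaussians and the Fourier integral\<close>

lemma gaussian_fourier_real:
 fixes e x :: real assumes e: "0 < e"
 shows "integrable lborel (\<lambda>t::real. exp (- of_real (e * t\<^sup>2)) * exp (- (\<i> * of_real (t * x))) :: complex)"
  and "(LINT t|lborel. exp (- of_real (e * t\<^sup>2)) * exp (- (\<i> * of_real (t * x)))) =
     complex_of_real (sqrt (pi / e) * exp (- x\<^sup>2 / (4 * e)))"
proof -
 \<comment> \<open>Substituting \<open>c * t\<close> turns the standard normal density into
   \<open>exp (- e t^2)\<close> up to a factor, and \<open>k\<close> makes the character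
   \<open>exp (i k c t)\<close> equal to \<open>exp (- i t x)\<close>. The value is then read off
   from the characteristic function of the normal distribution.\<close>
 define c where "c = sqrt (2 * e)"
 have c: "c > 0" "c\<^sup>2 = 2 * e" using e by (simp_all add: c_def)
 define k where "k = - x / c"
 have i0: "integrable lborel (\<lambda>t. std_normal_density t *\<^sub>R iexp (k * t))"
 proof (rule Bochner_Integration.integrable_bound)
  show "integrable lborel std_normal_density" by simp
 qed auto
 have v0: "(LINT t|lborel. std_normal_density t *\<^sub>R iexp (k * t)) = exp (- (k\<^sup>2) / 2)"
  using fun_cong[OF char_std_normal_distribution, of k] unfolding char_def
  by (subst (asm) integral_density) (auto simp: normal_density_nonneg)
 have eq: "std_normal_density (0 + c * t) *\<^sub>R iexp (k * (0 + c * t)) =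
   (1 / sqrt (2 * pi)) * (exp (- of_real (e * t\<^sup>2)) * exp (- (\<i> * of_real (t * x))))" for t :: real
 proof -
  have "(c * t)\<^sup>2 / 2 = e * t\<^sup>2" using c(2) by (simp add: power_mult_distrib)
  moreover have "k * (c * t) = - (t * x)" using c(1) by (simp add: k_def)
  ultimately show ?thesis
   by (simp add: std_normal_density_def scaleR_conv_of_real exp_of_real[symmetric] exp_minus
     del: exp_of_real)
 qed
 have i1: "integrable lborel (\<lambda>t. std_normal_density (0 + c * t) *\<^sub>R iexp (k * (0 + c * t)))"
  by (rule lborel_integrable_real_affine[OF i0]) (use c in simp)
 have v1: "(LINT t|lborel. std_normal_density (0 + c * t) *\<^sub>R iexp (k * (0 + c * t))) = exp (- (k\<^sup>2) / 2) / c"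
  using lborel_integral_real_affine[of c "\<lambda>t. std_normal_density t *\<^sub>R iexp (k * t)" 0] c(1) v0
  by (simp add: scaleR_conv_of_real field_simps)
 show "integrable lborel (\<lambda>t::real. exp (- of_real (e * t\<^sup>2)) * exp (- (\<i> * of_real (t * x))) :: complex)"
  using integrable_mult_right[OF i1[unfolded eq], of "complex_of_real (sqrt (2 * pi))"] by simp
 have "(LINT t|lborel. exp (- of_real (e * t\<^sup>2)) * exp (- (\<i> * of_real (t * x)))) =
   complex_of_real (sqrt (2 * pi)) * (exp (- (k\<^sup>2) / 2) / c)"
  using v1 unfolding eq by (simp add: field_simps)
 also have "complex_of_real (sqrt (2 * pi)) * (exp (- (k\<^sup>2) / 2) / c) =
  complex_of_real (sqrt (2 * pi) / c * exp (- (k\<^sup>2) / 2))" by simp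
 also have "sqrt (2 * pi) / c = sqrt (pi / e)"
  using e by (simp add: c_def real_sqrt_divide[symmetric] real_sqrt_mult)
 finally show "(LINT t|lborel. exp (- of_real (e * t\<^sup>2)) * exp (- (\<i> * of_real (t * x)))) =
     complex_of_real (sqrt (pi / e) * exp (- x\<^sup>2 / (4 * e)))"
  using c by (simp add: k_def power_divide)
qed

definition FI :: "('a::euclidean_space => complex) => 'a => complex" where
 "FI u \<zeta> = (LINT z|lborel. exp (- (\<i> * of_real (z \<bullet> \<zeta>))) * u z)"

lemma FI_gaussian:
 fixes x :: "'a::euclidean_space" and e :: real
 assumes e: "0 < e"
 shows "integrable lborel (\<lambda>z::'a. exp (- of_real (e * (norm z)\<^sup>2)) :: complex)"
  and "FI (\<lambda>z. exp (- of_real (e * (norm z)\<^sup>2))) x =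
     complex_of_real (sqrt (pi / e) ^ DIM('a) * exp (- (norm x)\<^sup>2 / (4 * e)))"
proof -
 have sq: "(norm z)\<^sup>2 = (\<Sum>b\<in>Basis. (z \<bullet> b)\<^sup>2)" for z :: 'a
  by (subst power2_norm_eq_inner, subst euclidean_inner) (simp add: power2_eq_square)
 have eq: "exp (- (\<i> * of_real (z \<bullet> x))) * exp (- of_real (e * (norm z)\<^sup>2)) =
   (\<Prod>b\<in>Basis. exp (- of_real (e * (z \<bullet> b)\<^sup>2)) * exp (- (\<i> * of_real ((z \<bullet> b) * (x \<bullet> b)))) :: complex)" for z x :: 'a
  unfolding sq euclidean_inner[of z x] exp_add[symmetric]
  by (subst exp_sum[symmetric]) (simp_all add: sum_distrib_left sum.distrib sum_negf sum_subtractf minus_diff_commute)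
 show "integrable lborel (\<lambda>z::'a. exp (- of_real (e * (norm z)\<^sup>2)) :: complex)"
  using lborel_prod_Basis(1)[of "\<lambda>b::'a. \<lambda>t. exp (- of_real (e * t\<^sup>2)) * exp (- (\<i> * of_real (t * (0 \<bullet> b))))"]
   gaussian_fourier_real(1)[OF e, of 0] unfolding eq[symmetric] by simp
 have "FI (\<lambda>z. exp (- of_real (e * (norm z)\<^sup>2))) x =
   (\<Prod>b\<in>Basis. complex_of_real (sqrt (pi / e) * exp (- (x \<bullet> b)\<^sup>2 / (4 * e))))"
  unfolding FI_def eq
  by (subst lborel_prod_Basis(2)[of "\<lambda>b::'a. \<lambda>t. exp (- of_real (e * t\<^sup>2)) * exp (- (\<i> * of_real (t * (x \<bullet> b))))"])
   (simp_all only: gaussian_fourier_real[OF e])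
 also have "\<dots> = complex_of_real (\<Prod>b\<in>Basis. sqrt (pi / e) * exp (- (x \<bullet> b)\<^sup>2 / (4 * e)))"
  by simp
 also have "(\<Prod>b\<in>Basis. sqrt (pi / e) * exp (- (x \<bullet> b)\<^sup>2 / (4 * e))) = sqrt (pi / e) ^ DIM('a) * exp (- (norm x)\<^sup>2 / (4 * e))"
  unfolding sq prod.distrib by (simp add: exp_sum[symmetric] sum_negf sum_divide_distrib)
 finally show "FI (\<lambda>z. exp (- of_real (e * (norm z)\<^sup>2))) x =
     complex_of_real (sqrt (pi / e) ^ DIM('a) * exp (- (norm x)\<^sup>2 / (4 * e)))" .
qed

lemma norm_exp_iu [simp]: "cmod (exp (- (\<i> * of_real r))) = 1"
 by (simp add: norm_exp_eq_Re)

lemma measurable_FI [measurable]: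
 assumes [measurable]: "u \<in> borel_measurable borel" shows "FI u \<in> borel_measurable borel"
 unfolding FI_def[abs_def] by measurable

lemma integrable_exp_mult:
 fixes u :: "'a::euclidean_space => complex"
 assumes "integrable lborel u"
 shows "integrable lborel (\<lambda>z. exp (- (\<i> * of_real (z \<bullet> \<zeta>))) * u z)"
proof (rule Bochner_Integration.integrable_bound[OF assms])
 have [measurable]: "u \<in> borel_measurable borel" using assms by auto
 show "(\<lambda>z. exp (- (\<i> * of_real (z \<bullet> \<zeta>))) * u z) \<in> borel_measurable lborel" by measurable
qed (auto simp: norm_mult)

lemma norm_FI_le: "cmod (FI u \<zeta>) \<le> (LINT z|lborel. cmod (u z))"
 unfolding FI_def by (rule order_trans[OF integral_norm_bound]) (simp add: norm_mult)

lemma integrable_tensor: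
 fixes u :: "'a::euclidean_space => complex" and w :: "'b::euclidean_space => complex"
 assumes "integrable lborel u" "integrable lborel w"
 shows "integrable (lborel \<Otimes>\<^sub>M lborel) (\<lambda>(x, y). u x * w y)"
proof (rule lborel_pair.Fubini_integrable)
 have [measurable]: "u \<in> borel_measurable borel" "w \<in> borel_measurable borel" using assms by auto
 show "(\<lambda>(x, y). u x * w y) \<in> borel_measurable (lborel \<Otimes>\<^sub>M lborel)" by measurable
 show "integrable lborel (\<lambda>x. LINT y|lborel. norm (case (x, y) of (x, y) => u x * w y))"
  using assms by (simp add: norm_mult)
qed (use assms in auto)

text \<open>The kernel is symmetric in its two variables, so both sides are the same double
  integral. Plancherel's theorem is drawn from this formula.\<close>

lemma FI_mult:
 fixes u w :: "'a::euclidean_space => complex"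
 assumes "integrable lborel u" "integrable lborel w"
 shows "(LINT \<zeta>|lborel. FI u \<zeta> * w \<zeta>) = (LINT z|lborel. u z * FI w z)"
proof -
 have [measurable]: "u \<in> borel_measurable borel" "w \<in> borel_measurable borel" using assms by auto
 have i: "integrable (lborel \<Otimes>\<^sub>M lborel) (\<lambda>(\<zeta>, z). exp (- (\<i> * of_real (z \<bullet> \<zeta>))) * (w \<zeta> * u z))"
  by (rule Bochner_Integration.integrable_bound[OF integrable_tensor[OF assms(2,1)]])
   (auto simp: norm_mult)
 have "(LINT \<zeta>|lborel. FI u \<zeta> * w \<zeta>) = (LINT \<zeta>|lborel. LINT z|lborel. exp (- (\<i> * of_real (z \<bullet> \<zeta>))) * (w \<zeta> * u z))"
  unfolding FI_def
  by (subst integral_mult_left_zero[symmetric]) (simp add: mult_ac)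
 also have "\<dots> = (LINT z|lborel. LINT \<zeta>|lborel. exp (- (\<i> * of_real (z \<bullet> \<zeta>))) * (w \<zeta> * u z))"
  by (rule lborel_pair.Fubini_integral[OF i, symmetric])
 also have "\<dots> = (LINT z|lborel. u z * FI w z)"
  unfolding FI_def
  by (subst integral_mult_right_zero[symmetric]) (simp add: mult_ac inner_commute)
 finally show ?thesis .
qed

section \<open>Continuity of translations in L1 and L2\<close>

lemma L1_translation_close:
 fixes f :: "'a::euclidean_space => real"
 assumes f: "integrable lborel f"
  and g: "\<And>e. 0 < e ==> \<exists>g. integrable lborel g \<and> (LINT x|lborel. \<bar>f x - g x\<bar>) < e \<and>
   (\<lambda>n. LINT x|lborel. \<bar>g (x + h n) - g x\<bar>) \<longlonglongrightarrow> (0::real)"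
 shows "(\<lambda>n. LINT x|lborel. \<bar>f (x + h n) - f x\<bar>) \<longlonglongrightarrow> 0"
proof (rule LIMSEQ_I)
 fix e :: real assume e: "0 < e"
 obtain g where g: "integrable lborel g" "(LINT x|lborel. \<bar>f x - g x\<bar>) < e/4"
  and lim: "(\<lambda>n. LINT x|lborel. \<bar>g (x + h n) - g x\<bar>) \<longlonglongrightarrow> 0"
  using g[of "e/4"] e by auto
 have [measurable]: "f \<in> borel_measurable borel" "g \<in> borel_measurable borel" using f g by auto
 obtain N where N: "\<And>n. n \<ge> N ==> \<bar>LINT x|lborel. \<bar>g (x + h n) - g x\<bar>\<bar> < e/4"
  using LIMSEQ_D[OF lim, of "e/4"] e by auto
 have "norm ((LINT x|lborel. \<bar>f (x + h n) - f x\<bar>) - 0) < e" if n: "n \<ge> N" for n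
 proof -
  have fi: "integrable lborel (\<lambda>x. f (x + h n))" "integrable lborel (\<lambda>x. g (x + h n))"
   using f g by (simp_all add: lborel_translate)
  have "(LINT x|lborel. \<bar>f (x + h n) - f x\<bar>) \<le>
    (LINT x|lborel. \<bar>f (x + h n) - g (x + h n)\<bar> + \<bar>g (x + h n) - g x\<bar> + \<bar>f x - g x\<bar>)"
   using f g fi by (intro integral_mono) auto
  also have "\<dots> = (LINT x|lborel. \<bar>f (x + h n) - g (x + h n)\<bar>) + (LINT x|lborel. \<bar>g (x + h n) - g x\<bar>) + (LINT x|lborel. \<bar>f x - g x\<bar>)"
   using f g fi by (subst Bochner_Integration.integral_add, auto)+
  also have "(LINT x|lborel. \<bar>f (x + h n) - g (x + h n)\<bar>) = (LINT x|lborel. \<bar>f x - g x\<bar>)"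
   by (rule lborel_translate(2)) measurable
  finally show ?thesis using g(2) N[OF n] e by simp
 qed
 then show "\<exists>no. \<forall>n\<ge>no. norm ((LINT x|lborel. \<bar>f (x + h n) - f x\<bar>) - 0) < e" by blast
qed

text \<open>For indicator values \<open>|a - b| = a + b - 2 a b\<close>, so only the product has to
  converge. It vanishes off \<open>G\<close>, and at points of \<open>G\<close> openness makes it
  eventually 1.\<close>

lemma L1_translation_open:
 fixes G :: "'a::euclidean_space set"
 assumes G: "open G" "emeasure lborel G < \<infinity>" and h: "h \<longlonglongrightarrow> (0::'a)"
 shows "(\<lambda>n. LINT x|lborel. \<bar>indicat_real G (x + h n) - indicat_real G x\<bar>) \<longlonglongrightarrow> 0"
proof -
 have [measurable]: "G \<in> sets borel" using G by simp
 have iG: "integrable lborel (indicat_real G)" using G by simp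
 have iGn: "integrable lborel (\<lambda>x. indicat_real G (x + c))" for c
  using iG by (simp add: lborel_translate)
 have ip: "integrable lborel (\<lambda>x. indicat_real G x * indicat_real G (x + c))" for c
  by (rule Bochner_Integration.integrable_bound[OF iG]) (auto split: split_indicator)
 have "(\<lambda>n. LINT x|lborel. indicat_real G x * indicat_real G (x + h n)) \<longlonglongrightarrow> (LINT x|lborel. indicat_real G x)"
 proof (rule integral_dominated_convergence[OF _ _ iG])
  show "AE x in lborel. (\<lambda>n. indicat_real G x * indicat_real G (x + h n)) \<longlonglongrightarrow> indicat_real G x"
  proof (intro AE_I2)
   fix x show "(\<lambda>n. indicat_real G x * indicat_real G (x + h n)) \<longlonglongrightarrow> indicat_real G x"
   proof (cases "x \<in> G")
    case True
    have "(\<lambda>n. x + h n) \<longlonglongrightarrow> x + 0" by (intro tendsto_intros h)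
    then have "\<forall>\<^sub>F n in sequentially. x + h n \<in> G"
     using topological_tendstoD[of "\<lambda>n. x + h n" x sequentially G] G True by simp
    then have "\<forall>\<^sub>F n in sequentially. indicat_real G x * indicat_real G (x + h n) = 1"
     by eventually_elim (use True in simp)
    then show ?thesis using True by (simp add: tendsto_eventually)
   qed simp
  qed
 qed (auto split: split_indicator)
 then have "(\<lambda>n. 2 * (LINT x|lborel. indicat_real G x) - 2 * (LINT x|lborel. indicat_real G x * indicat_real G (x + h n))) \<longlonglongrightarrow>
  2 * (LINT x|lborel. indicat_real G x) - 2 * (LINT x|lborel. indicat_real G x)"
  by (intro tendsto_intros)
 moreover have "(LINT x|lborel. \<bar>indicat_real G (x + c) - indicat_real G x\<bar>) =
   2 * (LINT x|lborel. indicat_real G x) - 2 * (LINT x|lborel. indicat_real G x * indicat_real G (x + c))" for c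
 proof -
  have "(LINT x|lborel. \<bar>indicat_real G (x + c) - indicat_real G x\<bar>) =
   (LINT x|lborel. indicat_real G (x + c) + indicat_real G x - 2 * (indicat_real G x * indicat_real G (x + c)))"
   by (rule Bochner_Integration.integral_cong) (auto split: split_indicator)
  also have "\<dots> = (LINT x|lborel. indicat_real G (x + c)) + (LINT x|lborel. indicat_real G x) - 2 * (LINT x|lborel. indicat_real G x * indicat_real G (x + c))"
   using iG iGn ip by simp
  also have "(LINT x|lborel. indicat_real G (x + c)) = (LINT x|lborel. indicat_real G x)"
   by (rule lborel_translate) measurable
  finally show ?thesis by simp
 qed
 ultimately show ?thesis by simp
qed

text \<open>Translation is isometric, so the functions with this property are closed in L1
  (\<open>L1_translation_close\<close>). Outer regularity passes from open sets to Borel sets of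
  finite measure; sums and dominated limits give the rest.\<close>

lemma L1_translation:
 fixes f :: "'a::euclidean_space => real"
 assumes f: "integrable lborel f" and h: "h \<longlonglongrightarrow> (0::'a)"
 shows "(\<lambda>n. LINT x|lborel. \<bar>f (x + h n) - f x\<bar>) \<longlonglongrightarrow> 0"
 using f
proof (induct rule: integrable_induct)
 case (base A c)
 have A[measurable]: "A \<in> sets borel" using base by simp
 show ?case
 proof (rule L1_translation_close)
  show "integrable lborel (\<lambda>x. indicat_real A x *\<^sub>R c)" using base by auto
  fix e :: real assume e: "0 < e"
  define d where "d = e / (\<bar>c\<bar> + 1)"
  have d: "0 < d" using e by (simp add: d_def)
  obtain G where G: "open G" "A \<subseteq> G" and dG: "emeasure lebesgue (G - A) < ennreal d"
   by (rule sets_lebesgue_outer_open[of A d]) (use d A in auto)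
  have [measurable]: "G \<in> sets borel" using G by simp
  have mdG: "emeasure lborel (G - A) < ennreal d" using dG by simp
  have fG: "emeasure lborel G < \<infinity>"
  proof -
   have "emeasure lborel G = emeasure lborel (A \<union> (G - A))" using G by (simp add: Un_absorb1)
   also have "\<dots> \<le> emeasure lborel A + emeasure lborel (G - A)"
    by (rule emeasure_subadditive) auto
   also have "\<dots> < \<infinity>"
   proof -
    have "emeasure lborel (G - A) < \<infinity>" by (rule order_less_trans[OF mdG]) simp
    then show ?thesis using base(2) by simp
   qed
   finally show ?thesis .
  qed
  have "(\<lambda>n. \<bar>c\<bar> * (LINT x|lborel. \<bar>indicat_real G (x + h n) - indicat_real G x\<bar>)) \<longlonglongrightarrow> \<bar>c\<bar> * 0"
   by (intro tendsto_intros L1_translation_open G fG h)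
  moreover have "\<bar>c\<bar> * (LINT x|lborel. \<bar>indicat_real G (x + h n) - indicat_real G x\<bar>) =
   (LINT x|lborel. \<bar>indicat_real G (x + h n) *\<^sub>R c - indicat_real G x *\<^sub>R c\<bar>)" for n
  proof -
   have "\<bar>c\<bar> * (LINT x|lborel. \<bar>indicat_real G (x + h n) - indicat_real G x\<bar>) =
    (LINT x|lborel. \<bar>c\<bar> * \<bar>indicat_real G (x + h n) - indicat_real G x\<bar>)" by simp
   also have "\<dots> = (LINT x|lborel. \<bar>indicat_real G (x + h n) *\<^sub>R c - indicat_real G x *\<^sub>R c\<bar>)"
    by (rule Bochner_Integration.integral_cong) (auto split: split_indicator)
   finally show ?thesis .
  qed
  ultimately have l: "(\<lambda>n. LINT x|lborel. \<bar>indicat_real G (x + h n) *\<^sub>R c - indicat_real G x *\<^sub>R c\<bar>) \<longlonglongrightarrow> 0"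
   by simp
  have "(LINT x|lborel. \<bar>indicat_real A x *\<^sub>R c - indicat_real G x *\<^sub>R c\<bar>) = (LINT x|lborel. \<bar>c\<bar> * indicat_real (G - A) x)"
   using G by (intro Bochner_Integration.integral_cong) (auto split: split_indicator)
  also have "\<dots> = \<bar>c\<bar> * measure lborel (G - A)" by simp
  also have "\<dots> \<le> \<bar>c\<bar> * d"
   using mdG d by (intro mult_left_mono) (auto simp: measure_def intro!: enn2real_leI)
  also have "\<dots> < e" using e by (simp add: d_def field_simps)
  finally show "\<exists>g. integrable lborel g \<and> (LINT x|lborel. \<bar>indicat_real A x *\<^sub>R c - g x\<bar>) < e \<and>
   (\<lambda>n. LINT x|lborel. \<bar>g (x + h n) - g x\<bar>) \<longlonglongrightarrow> 0"
   using l fG by (intro exI[of _ "\<lambda>x. indicat_real G x *\<^sub>R c"]) auto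
 qed
next
 case (add f g)
 have [measurable]: "f \<in> borel_measurable borel" "g \<in> borel_measurable borel" using add by auto
 have i: "integrable lborel (\<lambda>x. f (x + c))" "integrable lborel (\<lambda>x. g (x + c))" for c
  using add by (simp_all add: lborel_translate)
 show ?case
 proof (rule Lim_null_comparison)
  show "\<forall>\<^sub>F n in sequentially. norm (LINT x|lborel. \<bar>f (x + h n) + g (x + h n) - (f x + g x)\<bar>) \<le>
    (LINT x|lborel. \<bar>f (x + h n) - f x\<bar>) + (LINT x|lborel. \<bar>g (x + h n) - g x\<bar>)"
  proof (intro always_eventually allI)
   fix n
   have "(LINT x|lborel. \<bar>f (x + h n) + g (x + h n) - (f x + g x)\<bar>) \<le> (LINT x|lborel. \<bar>f (x + h n) - f x\<bar> + \<bar>g (x + h n) - g x\<bar>)"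
    using i add by (intro integral_mono) auto
   also have "\<dots> = (LINT x|lborel. \<bar>f (x + h n) - f x\<bar>) + (LINT x|lborel. \<bar>g (x + h n) - g x\<bar>)"
    using i add by (intro Bochner_Integration.integral_add) auto
   finally show "norm (LINT x|lborel. \<bar>f (x + h n) + g (x + h n) - (f x + g x)\<bar>) \<le>
    (LINT x|lborel. \<bar>f (x + h n) - f x\<bar>) + (LINT x|lborel. \<bar>g (x + h n) - g x\<bar>)" by simp
  qed
  show "(\<lambda>n. (LINT x|lborel. \<bar>f (x + h n) - f x\<bar>) + (LINT x|lborel. \<bar>g (x + h n) - g x\<bar>)) \<longlonglongrightarrow> 0"
   using tendsto_add[OF add(2,4)] by simp
 qed
next
 case (lim f s)
 show ?case
 proof (rule L1_translation_close[OF lim(5)])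
  fix e :: real assume e: "0 < e"
  have [measurable]: "f \<in> borel_measurable borel" "s i \<in> borel_measurable borel" for i
   using lim(1)[of i] lim(5) by auto
  have "(\<lambda>i. LINT x|lborel. \<bar>f x - s i x\<bar>) \<longlonglongrightarrow> (LINT x|(lborel::'a measure). 0)"
  proof (rule integral_dominated_convergence[where w = "\<lambda>x. 3 * \<bar>f x\<bar>"])
   show "AE x in lborel. (\<lambda>i. \<bar>f x - s i x\<bar>) \<longlonglongrightarrow> 0"
   proof (intro AE_I2)
    fix x
    have "(\<lambda>i. \<bar>f x - s i x\<bar>) \<longlonglongrightarrow> \<bar>f x - f x\<bar>" by (intro tendsto_intros lim(3)) simp
    then show "(\<lambda>i. \<bar>f x - s i x\<bar>) \<longlonglongrightarrow> 0" by simp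
   qed
   show "AE x in lborel. norm \<bar>f x - s i x\<bar> \<le> 3 * \<bar>f x\<bar>" for i
    using lim(4)[of _ i] by (intro AE_I2) (smt (verit) UNIV_I real_norm_def space_lborel)
  qed (use lim in auto)
  then obtain i where "\<bar>LINT x|lborel. \<bar>f x - s i x\<bar>\<bar> < e"
   using LIMSEQ_D[of _ 0 e] e by fastforce
  then show "\<exists>g. integrable lborel g \<and> (LINT x|lborel. \<bar>f x - g x\<bar>) < e \<and>
   (\<lambda>n. LINT x|lborel. \<bar>g (x + h n) - g x\<bar>) \<longlonglongrightarrow> 0"
   using lim(1,2) by (intro exI[of _ "s i"]) auto
 qed
qed

lemma sqint_translate:
 fixes u :: "'a::euclidean_space => complex"
 assumes "sqint lborel u"
 shows "sqint lborel (\<lambda>x. u (x + c))" "sqnorm lborel (\<lambda>x. u (x + c)) = sqnorm lborel u"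
proof -
 have [measurable]: "u \<in> borel_measurable borel" using sqint_measurable[OF assms] by simp
 show "sqint lborel (\<lambda>x. u (x + c))"
  using sqint_integrable[OF assms] by (intro sqintI) (auto simp: lborel_translate[of "\<lambda>x. (cmod (u x))\<^sup>2"])
 show "sqnorm lborel (\<lambda>x. u (x + c)) = sqnorm lborel u"
  unfolding sqnorm_def by (rule lborel_translate) measurable
qed

text \<open>Reduction to L1 by \<open>(a - b)^2 \<le> |a^2 - b^2|\<close> for nonnegative reals,
  applied to the positive and negative parts of the real and imaginary parts of \<open>u\<close>,
  whose squares are integrable.\<close>

lemma L2_translation:
 fixes u :: "'a::euclidean_space => complex"
 assumes u: "sqint lborel u" and h: "h \<longlonglongrightarrow> (0::'a)"
 shows "(\<lambda>n. sqnorm lborel (\<lambda>x. u (x + h n) - u x)) \<longlonglongrightarrow> 0"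
proof -
 have [measurable]: "u \<in> borel_measurable borel" using sqint_measurable[OF u] by simp
 define p :: "nat => complex => real" where
  "p j z = (if j = 0 then max 0 (Re z) else if j = 1 then max 0 (- Re z)
   else if j = 2 then max 0 (Im z) else max 0 (- Im z))" for j z
 have p0: "0 \<le> p j z" for j z by (simp add: p_def)
 have "p j \<in> borel_measurable borel" for j unfolding p_def by measurable
 note [measurable] = this
 have ple: "(p j z)\<^sup>2 \<le> (cmod z)\<^sup>2" for j z
 proof -
  have "\<bar>p j z\<bar> \<le> cmod z" using abs_Re_le_cmod[of z] abs_Im_le_cmod[of z] by (auto simp: p_def)
  then show ?thesis using p0[of j z] by (simp add: abs_le_square_iff)
 qed
 have pint: "integrable lborel (\<lambda>x. (p j (u x))\<^sup>2)" for j
  by (rule Bochner_Integration.integrable_bound[OF sqint_integrable[OF u]]) (use ple in auto)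
 have pt: "integrable lborel (\<lambda>x. (p j (u (x + c)))\<^sup>2)" for j c
  using pint[of j] lborel_translate(1)[of "\<lambda>x. (p j (u x))\<^sup>2" c] by simp
 have key: "(cmod (z - w))\<^sup>2 \<le> (\<Sum>j<4. 2 * \<bar>(p j z)\<^sup>2 - (p j w)\<^sup>2\<bar>)" for z w
 proof -
  have d: "(p j z - p j w)\<^sup>2 \<le> \<bar>(p j z)\<^sup>2 - (p j w)\<^sup>2\<bar>" for j
  proof -
   have "(p j z - p j w)\<^sup>2 = \<bar>p j z - p j w\<bar> * \<bar>p j z - p j w\<bar>" by (simp add: power2_eq_square)
   also have "\<dots> \<le> \<bar>p j z - p j w\<bar> * \<bar>p j z + p j w\<bar>"
    using p0[of j z] p0[of j w] by (intro mult_left_mono) auto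
   also have "\<dots> = \<bar>(p j z)\<^sup>2 - (p j w)\<^sup>2\<bar>" by (simp add: abs_mult[symmetric] power2_eq_square algebra_simps)
   finally show ?thesis .
  qed
  have e: "Re x = p 0 x - p 1 x" "Im x = p 2 x - p 3 x" for x by (auto simp: p_def)
  have sq: "(a - b)\<^sup>2 \<le> 2 * a\<^sup>2 + 2 * b\<^sup>2" for a b :: real
   using zero_le_power2[of "a + b"] by (simp add: power2_sum power2_diff)
  have "(cmod (z - w))\<^sup>2 = (Re z - Re w)\<^sup>2 + (Im z - Im w)\<^sup>2" by (simp add: cmod_power2)
  also have "Re z - Re w = (p 0 z - p 0 w) - (p 1 z - p 1 w)" unfolding e by simp
  also have "Im z - Im w = (p 2 z - p 2 w) - (p 3 z - p 3 w)" unfolding e by simp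
  also have "((p 0 z - p 0 w) - (p 1 z - p 1 w))\<^sup>2 + ((p 2 z - p 2 w) - (p 3 z - p 3 w))\<^sup>2 \<le>
   (2 * (p 0 z - p 0 w)\<^sup>2 + 2 * (p 1 z - p 1 w)\<^sup>2) + (2 * (p 2 z - p 2 w)\<^sup>2 + 2 * (p 3 z - p 3 w)\<^sup>2)"
   by (intro add_mono sq)
  also have "\<dots> \<le> (\<Sum>j<4. 2 * \<bar>(p j z)\<^sup>2 - (p j w)\<^sup>2\<bar>)"
   using d[of 0] d[of 1] d[of 2] d[of 3] by (simp add: numeral_eq_Suc lessThan_Suc)
  finally show ?thesis .
 qed
 show ?thesis
 proof (rule Lim_null_comparison)
  show "\<forall>\<^sub>F n in sequentially. norm (sqnorm lborel (\<lambda>x. u (x + h n) - u x)) \<le>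
   (\<Sum>j<4. 2 * (LINT x|lborel. \<bar>(p j (u (x + h n)))\<^sup>2 - (p j (u x))\<^sup>2\<bar>))"
  proof (intro always_eventually allI)
   fix n
   have "sqnorm lborel (\<lambda>x. u (x + h n) - u x) \<le> (LINT x|lborel. (\<Sum>j<4. 2 * \<bar>(p j (u (x + h n)))\<^sup>2 - (p j (u x))\<^sup>2\<bar>))"
    unfolding sqnorm_def
    by (intro integral_mono sqint_integrable sqint_diff sqint_translate u key
      Bochner_Integration.integrable_sum integrable_mult_right integrable_abs Bochner_Integration.integrable_diff pint pt)
   also have "\<dots> = (\<Sum>j<4. 2 * (LINT x|lborel. \<bar>(p j (u (x + h n)))\<^sup>2 - (p j (u x))\<^sup>2\<bar>))"
    by (subst Bochner_Integration.integral_sum) (use pint pt in auto)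
   finally show "norm (sqnorm lborel (\<lambda>x. u (x + h n) - u x)) \<le>
   (\<Sum>j<4. 2 * (LINT x|lborel. \<bar>(p j (u (x + h n)))\<^sup>2 - (p j (u x))\<^sup>2\<bar>))"
    by (simp add: sqnorm_nonneg)
  qed
  have "(\<lambda>n. \<Sum>j<4. 2 * (LINT x|lborel. \<bar>(p j (u (x + h n)))\<^sup>2 - (p j (u x))\<^sup>2\<bar>)) \<longlonglongrightarrow> (\<Sum>j<(4::nat). 2 * 0)"
   by (intro tendsto_intros L1_translation[OF pint h])
  then show "(\<lambda>n. \<Sum>j<4. 2 * (LINT x|lborel. \<bar>(p j (u (x + h n)))\<^sup>2 - (p j (u x))\<^sup>2\<bar>)) \<longlonglongrightarrow> 0" by simp
 qed
qed

section \<open>Correlations and Plancherel's theorem for integrable functions\<close>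

lemma inprod_translate_integrable:
 fixes u w :: "'a::euclidean_space => complex"
 assumes "sqint lborel u" "sqint lborel w"
 shows "integrable lborel (\<lambda>x. cmod (u x) * cmod (w (x - h)))"
  and "(LINT x|lborel. cmod (u x) * cmod (w (x - h))) \<le> sqrt (sqnorm lborel u * sqnorm lborel w)"
  and "cmod (inprod lborel u (\<lambda>x. w (x - h))) \<le> sqrt (sqnorm lborel u * sqnorm lborel w)"
proof -
 have w: "sqint lborel (\<lambda>x. w (x - h))" "sqnorm lborel (\<lambda>x. w (x - h)) = sqnorm lborel w"
  using sqint_translate[OF assms(2), of "- h"] by simp_all
 show "integrable lborel (\<lambda>x. cmod (u x) * cmod (w (x - h)))"
  by (rule integrable_norm_mult[OF assms(1) w(1)])
 show "(LINT x|lborel. cmod (u x) * cmod (w (x - h))) \<le> sqrt (sqnorm lborel u * sqnorm lborel w)"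
  using norm_inprod_le(1)[OF assms(1) w(1)] unfolding w(2) by (rule real_le_rsqrt)
 show "cmod (inprod lborel u (\<lambda>x. w (x - h))) \<le> sqrt (sqnorm lborel u * sqnorm lborel w)"
  using norm_inprod_le(2)[OF assms(1) w(1)] unfolding w(2) by (rule real_le_rsqrt)
qed

lemma measurable_inprod_translate:
 fixes u w :: "'a::euclidean_space => complex"
 assumes [measurable]: "u \<in> borel_measurable borel" "w \<in> borel_measurable borel"
 shows "(\<lambda>h. inprod lborel u (\<lambda>x. w (x - h))) \<in> borel_measurable borel"
 unfolding inprod_def by measurable

text \<open>Cauchy-Schwarz bounds the inner integral uniformly in the shift \<open>h\<close>, so
  integrability of \<open>g\<close> carries the double integral.\<close>

lemma conv_Fubini:
 fixes u w g :: "'a::euclidean_space => complex"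
 assumes u: "sqint lborel u" and w: "sqint lborel w" and g: "integrable lborel g"
 shows "integrable (lborel \<Otimes>\<^sub>M lborel) (\<lambda>(h, z). g h * (u z * cnj (w (z - h))))"
proof (rule lborel_pair.Fubini_integrable)
 have [measurable]: "u \<in> borel_measurable borel" "w \<in> borel_measurable borel" "g \<in> borel_measurable borel"
  using sqint_measurable[OF u] sqint_measurable[OF w] g by auto
 show m: "(\<lambda>(h, z). g h * (u z * cnj (w (z - h)))) \<in> borel_measurable (lborel \<Otimes>\<^sub>M lborel)"
  by measurable
 have eq: "(LINT z|lborel. cmod (g h * (u z * cnj (w (z - h))))) = cmod (g h) * (LINT z|lborel. cmod (u z) * cmod (w (z - h)))" for h
  by (simp add: norm_mult)
 have i: "integrable lborel (\<lambda>h. cmod (g h) * (LINT z|lborel. cmod (u z) * cmod (w (z - h))))"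
 proof (rule Bochner_Integration.integrable_bound)
  show "integrable lborel (\<lambda>h. sqrt (sqnorm lborel u * sqnorm lborel w) * cmod (g h))"
   using g by simp
  show "(\<lambda>h. cmod (g h) * (LINT z|lborel. cmod (u z) * cmod (w (z - h)))) \<in> borel_measurable lborel"
   by measurable
  show "AE h in lborel. norm (cmod (g h) * (LINT z|lborel. cmod (u z) * cmod (w (z - h)))) \<le> norm (sqrt (sqnorm lborel u * sqnorm lborel w) * cmod (g h))"
  proof (intro AE_I2)
   fix h
   have "cmod (g h) * (LINT z|lborel. cmod (u z) * cmod (w (z - h))) \<le> cmod (g h) * sqrt (sqnorm lborel u * sqnorm lborel w)"
    by (intro mult_left_mono inprod_translate_integrable(2) u w) simp
   moreover have "0 \<le> (LINT z|lborel. cmod (u z) * cmod (w (z - h)))" by simp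
   ultimately show "norm (cmod (g h) * (LINT z|lborel. cmod (u z) * cmod (w (z - h)))) \<le> norm (sqrt (sqnorm lborel u * sqnorm lborel w) * cmod (g h))"
    by (simp add: abs_mult mult.commute sqnorm_nonneg)
  qed
 qed
 show "integrable lborel (\<lambda>h. LINT z|lborel. norm (case (h, z) of (h, z) => g h * (u z * cnj (w (z - h)))))"
  using i by (simp add: eq)
 show "AE h in lborel. integrable lborel (\<lambda>z. case (h, z) of (h, z) => g h * (u z * cnj (w (z - h))))"
 proof (intro AE_I2)
  fix h
  have "integrable lborel (\<lambda>z. u z * cnj (w (z - h)))"
   by (rule Bochner_Integration.integrable_bound[OF inprod_translate_integrable(1)[OF u w, of h]]) (auto simp: norm_mult)
  then show "integrable lborel (\<lambda>z. case (h, z) of (h, z) => g h * (u z * cnj (w (z - h))))" by simp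
 qed
qed

text \<open>On this class the Fourier integral converges absolutely and is square integrable; the
  transform on all of L2 is obtained from it by approximation.\<close>

definition L12 :: "('a::euclidean_space => complex) => bool" where
 "L12 u \<longleftrightarrow> integrable lborel u \<and> sqint lborel u"

lemma FI_cnj_reflect:
 fixes u :: "'a::euclidean_space => complex"
 assumes [measurable]: "u \<in> borel_measurable borel"
 shows "FI (\<lambda>y. cnj (u (- y))) \<zeta> = cnj (FI u \<zeta>)"
proof -
 have "FI (\<lambda>y. cnj (u (- y))) \<zeta> = (LINT y|lborel. (\<lambda>y. exp (\<i> * of_real (y \<bullet> \<zeta>)) * cnj (u y)) (- y))"
  unfolding FI_def by simp
 also have "\<dots> = (LINT y|lborel. exp (\<i> * of_real (y \<bullet> \<zeta>)) * cnj (u y))"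
  by (rule lborel_reflect(2)) measurable
 also have "\<dots> = (LINT y|lborel. cnj (exp (- (\<i> * of_real (y \<bullet> \<zeta>))) * u y))"
  by (simp add: exp_cnj)
 also have "\<dots> = cnj (FI u \<zeta>)" unfolding FI_def by (rule Bochner_Integration.integral_cnj)
 finally show ?thesis .
qed

text \<open>The Gaussian makes \<open>|FI u|^2\<close> integrable before this is known for the
  function itself. \<open>FI_mult\<close> moves the transform onto \<open>cnj (FI u)\<close> times
  the Gaussian, whose transform is a convolution of a Gaussian with \<open>cnj u\<close>. What
  remains is the autocorrelation of \<open>u\<close> integrated against a Gaussian in the
  shift.\<close>

lemma gauss_parseval:
 fixes u :: "'a::euclidean_space => complex"
 assumes u: "L12 u" and e: "0 < (e::real)"
 shows "integrable lborel (\<lambda>\<zeta>. (cmod (FI u \<zeta>))\<^sup>2 * exp (- (e * (norm \<zeta>)\<^sup>2)))"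
  and "complex_of_real (LINT \<zeta>|lborel. (cmod (FI u \<zeta>))\<^sup>2 * exp (- (e * (norm \<zeta>)\<^sup>2))) =
   (LINT h|lborel. complex_of_real (sqrt (pi / e) ^ DIM('a) * exp (- (norm h)\<^sup>2 / (4 * e))) * inprod lborel u (\<lambda>x. u (x - h)))"
proof -
 have iu: "integrable lborel u" and su: "sqint lborel u" using u by (auto simp: L12_def)
 have [measurable]: "u \<in> borel_measurable borel" using iu by auto
 define g where "g \<zeta> = (exp (- of_real (e * (norm \<zeta>)\<^sup>2)) :: complex)" for \<zeta> :: 'a
 have [measurable]: "g \<in> borel_measurable borel" unfolding g_def by measurable
 have ig: "integrable lborel g" unfolding g_def by (rule FI_gaussian(1)[OF e])
 define G where "G h = complex_of_real (sqrt (pi / e) ^ DIM('a) * exp (- (norm h)\<^sup>2 / (4 * e)))" for h :: 'a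
 have FIg: "FI g = G" unfolding g_def G_def by (rule ext) (rule FI_gaussian(2)[OF e])
 have [measurable]: "G \<in> borel_measurable borel" unfolding G_def by measurable
 have iG: "integrable lborel G"
 proof -
  have eq: "G = (\<lambda>h. of_real (sqrt (pi / e) ^ DIM('a)) * exp (- of_real ((1 / (4 * e)) * (norm h)\<^sup>2)))"
   unfolding G_def by (auto simp: exp_of_real[symmetric])
  show ?thesis unfolding eq by (intro integrable_mult_right FI_gaussian(1)) (use e in simp)
 qed
 define K where "K = (LINT z|lborel. cmod (u z))"
 have bF: "cmod (FI u \<zeta>) \<le> K" for \<zeta> unfolding K_def by (rule norm_FI_le)
 define w where "w \<zeta> = cnj (FI u \<zeta>) * g \<zeta>" for \<zeta>
 have iw: "integrable lborel w"
 proof (rule Bochner_Integration.integrable_bound)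
  show "integrable lborel (\<lambda>\<zeta>. of_real K * g \<zeta>)" using ig by simp
  show "w \<in> borel_measurable lborel" unfolding w_def by measurable
  show "AE \<zeta> in lborel. norm (w \<zeta>) \<le> norm (of_real K * g \<zeta>)"
  proof (intro AE_I2)
   fix \<zeta>
   have "cmod (FI u \<zeta>) * cmod (g \<zeta>) \<le> \<bar>K\<bar> * cmod (g \<zeta>)"
    using bF[of \<zeta>] by (intro mult_right_mono) auto
   then show "norm (w \<zeta>) \<le> norm (of_real K * g \<zeta>)" by (simp add: w_def norm_mult)
  qed
 qed
 have sq: "FI u \<zeta> * w \<zeta> = of_real ((cmod (FI u \<zeta>))\<^sup>2 * exp (- (e * (norm \<zeta>)\<^sup>2)))" for \<zeta>
  unfolding w_def g_def by (simp add: complex_norm_square[symmetric] exp_of_real[symmetric] mult.assoc[symmetric])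
 have "integrable lborel (\<lambda>\<zeta>. FI u \<zeta> * w \<zeta>)"
 proof (rule Bochner_Integration.integrable_bound)
  show "integrable lborel (\<lambda>\<zeta>. of_real K * w \<zeta>)" using iw by simp
  show "(\<lambda>\<zeta>. FI u \<zeta> * w \<zeta>) \<in> borel_measurable lborel" using iw by measurable
  show "AE \<zeta> in lborel. norm (FI u \<zeta> * w \<zeta>) \<le> norm (of_real K * w \<zeta>)"
  proof (intro AE_I2)
   fix \<zeta>
   have "cmod (FI u \<zeta>) * cmod (w \<zeta>) \<le> \<bar>K\<bar> * cmod (w \<zeta>)"
    using bF[of \<zeta>] by (intro mult_right_mono) auto
   then show "norm (FI u \<zeta> * w \<zeta>) \<le> norm (of_real K * w \<zeta>)" by (simp add: norm_mult)
  qed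
 qed
 from integrable_Re[OF this] show "integrable lborel (\<lambda>\<zeta>. (cmod (FI u \<zeta>))\<^sup>2 * exp (- (e * (norm \<zeta>)\<^sup>2)))"
  unfolding sq by (simp only: Re_complex_of_real)
 have FIw: "FI w z = (LINT h|lborel. G h * cnj (u (z - h)))" for z
 proof -
  define ut where "ut y = cnj (u (- y))" for y
  have iut: "integrable lborel ut"
   using iu lborel_reflect(1)[of u] unfolding ut_def by simp
  have FIut: "FI ut \<zeta> = cnj (FI u \<zeta>)" for \<zeta>
   unfolding ut_def by (rule FI_cnj_reflect) measurable
  have ig2: "integrable lborel (\<lambda>\<zeta>. exp (- (\<i> * of_real (\<zeta> \<bullet> z))) * g \<zeta>)"
   by (rule integrable_exp_mult[OF ig])
  have "FI w z = (LINT \<zeta>|lborel. FI ut \<zeta> * (exp (- (\<i> * of_real (\<zeta> \<bullet> z))) * g \<zeta>))"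
   unfolding FI_def[of w] w_def FIut by (simp add: mult_ac)
  also have "\<dots> = (LINT y|lborel. ut y * FI (\<lambda>\<zeta>. exp (- (\<i> * of_real (\<zeta> \<bullet> z))) * g \<zeta>) y)"
   by (rule FI_mult[OF iut ig2])
  also have "\<dots> = (LINT y|lborel. ut y * G (y + z))"
   unfolding FIg[symmetric] FI_def mult.assoc[symmetric] exp_add[symmetric]
   by (simp add: inner_add_right algebra_simps)
  also have "\<dots> = (LINT y|lborel. (\<lambda>h. G h * cnj (u (z - h))) (y + z))"
   unfolding ut_def by (simp add: mult.commute)
  also have "\<dots> = (LINT h|lborel. G h * cnj (u (z - h)))"
   by (rule lborel_translate(2)) measurable
  finally show ?thesis .
 qed
 have "complex_of_real (LINT \<zeta>|lborel. (cmod (FI u \<zeta>))\<^sup>2 * exp (- (e * (norm \<zeta>)\<^sup>2))) = (LINT \<zeta>|lborel. FI u \<zeta> * w \<zeta>)"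
  unfolding sq by (rule integral_complex_of_real[symmetric])
 also have "\<dots> = (LINT z|lborel. u z * FI w z)" by (rule FI_mult[OF iu iw])
 also have "\<dots> = (LINT z|lborel. LINT h|lborel. G h * (u z * cnj (u (z - h))))"
  unfolding FIw by (subst integral_mult_right_zero[symmetric]) (simp add: mult_ac)
 also have "\<dots> = (LINT h|lborel. LINT z|lborel. G h * (u z * cnj (u (z - h))))"
  by (rule lborel_pair.Fubini_integral[OF conv_Fubini[OF su su iG]])
 also have "\<dots> = (LINT h|lborel. G h * inprod lborel u (\<lambda>x. u (x - h)))"
  unfolding inprod_def by simp
 finally show "complex_of_real (LINT \<zeta>|lborel. (cmod (FI u \<zeta>))\<^sup>2 * exp (- (e * (norm \<zeta>)\<^sup>2))) =
   (LINT h|lborel. complex_of_real (sqrt (pi / e) ^ DIM('a) * exp (- (norm h)\<^sup>2 / (4 * e))) * inprod lborel u (\<lambda>x. u (x - h)))"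
  unfolding G_def .
qed

text \<open>As the damping tends to 0, the Gaussian in the shift concentrates at 0, where the
  autocorrelation is continuous with value \<open>sqnorm lborel u\<close>
  (\<open>L2_translation\<close>); on the frequency side the integrands increase to
  \<open>|FI u|^2\<close>.\<close>

lemma plancherel_L12:
 fixes u :: "'a::euclidean_space => complex"
 assumes u: "L12 u"
 shows "sqint lborel (FI u)" "sqnorm lborel (FI u) = (2 * pi) ^ DIM('a) * sqnorm lborel u"
proof -
 have iu: "integrable lborel u" and su: "sqint lborel u" using u by (auto simp: L12_def)
 have [measurable]: "u \<in> borel_measurable borel" using iu by auto
 define C where "C h = inprod lborel u (\<lambda>x. u (x - h))" for h
 have [measurable]: "C \<in> borel_measurable borel" unfolding C_def
  by (rule measurable_inprod_translate) measurable
 have Cb: "cmod (C h) \<le> sqnorm lborel u" for h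
  using inprod_translate_integrable(3)[OF su su, of h] sqnorm_nonneg[of lborel u]
  by (simp add: C_def)
 have C0: "(\<lambda>n. C (h n)) \<longlonglongrightarrow> of_real (sqnorm lborel u)" if "h \<longlonglongrightarrow> 0" for h
 proof -
  have "(\<lambda>n. - h n) \<longlonglongrightarrow> 0" using tendsto_minus[OF that] by simp
  note l = L2_translation[OF su this]
  have "(\<lambda>n. inprod lborel u (\<lambda>x. u (x - h n))) \<longlonglongrightarrow> inprod lborel u u"
   by (rule sqnorm_tendsto_imp_inprod) (use su sqint_translate(1)[OF su, of "- h _"] l in \<open>auto simp: sqnorm_def\<close>)
  then show ?thesis by (simp add: C_def inprod_self)
 qed
 \<comment> \<open>\<open>4 * e n\<close> is the square of \<open>1 / (n + 1)\<close>, so rescaling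
   the shift by this number produces the fixed Gaussian \<open>exp (- |h|^2)\<close> and dominated
   convergence applies.\<close>
 define e where "e n = 1 / (4 * (real (Suc n))\<^sup>2)" for n
 have e: "0 < e n" for n by (simp add: e_def)
 define J where "J n = (LINT \<zeta>|lborel. (cmod (FI u \<zeta>))\<^sup>2 * exp (- (e n * (norm \<zeta>)\<^sup>2)))" for n
 have J: "complex_of_real (J n) = of_real ((2 * sqrt pi) ^ DIM('a)) * (LINT h|lborel. exp (- of_real ((norm h)\<^sup>2)) * C (h /\<^sub>R real (Suc n)))" for n
 proof -
  define c where "c = inverse (real (Suc n))"
  have c: "c > 0" by (simp add: c_def)
  have e4: "4 * e n = c\<^sup>2" by (simp add: e_def c_def power_inverse field_simps)
  have sq: "sqrt (pi / e n) = 2 * sqrt pi / c"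
  proof -
   have "e n = (c / 2)\<^sup>2" using e4 by (simp add: power_divide)
   then show ?thesis using c by (simp add: real_sqrt_divide)
  qed
  have "complex_of_real (J n) = (LINT h|lborel. complex_of_real (sqrt (pi / e n) ^ DIM('a) * exp (- (norm h)\<^sup>2 / (4 * e n))) * C h)"
   unfolding J_def C_def by (rule gauss_parseval(2)[OF u e])
  also have "\<dots> = of_real (c ^ DIM('a)) * (LINT h|lborel. complex_of_real (sqrt (pi / e n) ^ DIM('a) * exp (- (norm (c *\<^sub>R h))\<^sup>2 / (4 * e n))) * C (c *\<^sub>R h))"
   using c by (subst lborel_scale[of _ c]) auto
  also have "\<dots> = of_real (c ^ DIM('a)) * (LINT h|lborel. of_real (sqrt (pi / e n) ^ DIM('a)) * (exp (- of_real ((norm h)\<^sup>2)) * C (c *\<^sub>R h)))"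
   unfolding e4 using c by (simp add: power_mult_distrib exp_of_real[symmetric] mult.assoc)
  also have "\<dots> = of_real (c ^ DIM('a) * sqrt (pi / e n) ^ DIM('a)) * (LINT h|lborel. (exp (- of_real ((norm h)\<^sup>2)) * C (c *\<^sub>R h)))"
   by (subst integral_mult_right_zero) simp
  also have "c ^ DIM('a) * sqrt (pi / e n) ^ DIM('a) = (2 * sqrt pi) ^ DIM('a)"
   unfolding sq power_mult_distrib[symmetric] using c by simp
  finally show ?thesis by (simp add: c_def)
 qed
 have ig: "integrable lborel (\<lambda>z::'a. exp (- of_real ((norm z)\<^sup>2)) :: complex)"
  using FI_gaussian(1)[of 1] by simp
 have ig_val: "(LINT z|(lborel::'a measure). exp (- of_real ((norm z)\<^sup>2)) :: complex) = of_real (sqrt pi ^ DIM('a))"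
  using FI_gaussian(2)[of 1 0] unfolding FI_def by simp
 have "(\<lambda>n. LINT h|lborel. exp (- of_real ((norm h)\<^sup>2)) * C (h /\<^sub>R real (Suc n))) \<longlonglongrightarrow>
   (LINT h|(lborel::'a measure). exp (- of_real ((norm h)\<^sup>2)) * of_real (sqnorm lborel u))"
 proof (rule integral_dominated_convergence[where w = "\<lambda>h. sqnorm lborel u * cmod (exp (- of_real ((norm h)\<^sup>2)))"])
  show "integrable lborel (\<lambda>h::'a. sqnorm lborel u * cmod (exp (- of_real ((norm h)\<^sup>2))))"
   by (intro integrable_mult_right integrable_norm ig)
  show "AE h in lborel. (\<lambda>n. exp (- of_real ((norm h)\<^sup>2)) * C (h /\<^sub>R real (Suc n))) \<longlonglongrightarrow> exp (- of_real ((norm h)\<^sup>2)) * of_real (sqnorm lborel u)"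
  proof (intro AE_I2 tendsto_intros C0)
   fix h :: 'a
   have "(\<lambda>n. inverse (real (Suc n)) *\<^sub>R h) \<longlonglongrightarrow> 0 *\<^sub>R h"
    by (intro tendsto_intros LIMSEQ_inverse_real_of_nat)
   then show "(\<lambda>n. h /\<^sub>R real (Suc n)) \<longlonglongrightarrow> 0" by simp
  qed
  show "AE h in lborel. norm (exp (- of_real ((norm h)\<^sup>2)) * C (h /\<^sub>R real (Suc n))) \<le> sqnorm lborel u * cmod (exp (- of_real ((norm h)\<^sup>2)))" for n
  proof (intro AE_I2)
   fix h :: 'a
   show "norm (exp (- of_real ((norm h)\<^sup>2)) * C (h /\<^sub>R real (Suc n))) \<le> sqnorm lborel u * cmod (exp (- of_real ((norm h)\<^sup>2)))"
    unfolding norm_mult mult.commute[of "cmod (exp _)"] by (rule mult_right_mono[OF Cb norm_ge_zero])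
  qed
 qed measurable
 then have "(\<lambda>n. of_real ((2 * sqrt pi) ^ DIM('a)) * (LINT h|lborel. exp (- of_real ((norm h)\<^sup>2)) * C (h /\<^sub>R real (Suc n)))) \<longlonglongrightarrow>
   of_real ((2 * sqrt pi) ^ DIM('a)) * (LINT h|(lborel::'a measure). exp (- of_real ((norm h)\<^sup>2)) * of_real (sqnorm lborel u))"
  by (rule tendsto_mult_left)
 then have "(\<lambda>n. complex_of_real (J n)) \<longlonglongrightarrow> of_real ((2 * sqrt pi) ^ DIM('a)) * (of_real (sqrt pi ^ DIM('a)) * of_real (sqnorm lborel u))"
  unfolding J[symmetric] integral_mult_left_zero ig_val .
 \<comment> \<open>\<open>2 * sqrt pi\<close> per dimension comes from the rescaled prefactor,
   \<open>sqrt pi\<close> from the integral of the fixed Gaussian.\<close>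
 also have "of_real ((2 * sqrt pi) ^ DIM('a)) * (of_real (sqrt pi ^ DIM('a)) * of_real (sqnorm lborel u)) = complex_of_real ((2 * pi) ^ DIM('a) * sqnorm lborel u)"
 proof -
  have "(2 * sqrt pi) ^ DIM('a) * (sqrt pi ^ DIM('a)) = (2 * pi) ^ DIM('a)"
   unfolding power_mult_distrib[symmetric] by (simp only: mult.assoc real_sqrt_mult_self) (simp add: abs_of_pos)
  then show ?thesis by (metis (no_types, opaque_lifting) mult.assoc of_real_mult)
 qed
 finally have Jlim: "J \<longlonglongrightarrow> (2 * pi) ^ DIM('a) * sqnorm lborel u"
  by (simp only: tendsto_of_real_iff)
 have emono: "e m \<ge> e n" if "m \<le> n" for m n
  unfolding e_def using that by (intro divide_left_mono mult_left_mono power_mono) auto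
 have elim: "e \<longlonglongrightarrow> 0"
 proof -
  have "(\<lambda>n. (1/4) * (inverse (real (Suc n)))\<^sup>2) \<longlonglongrightarrow> (1/4) * 0\<^sup>2"
   by (intro tendsto_intros LIMSEQ_inverse_real_of_nat)
  then show ?thesis by (simp add: e_def[abs_def] field_simps)
 qed
 have mono: "AE \<zeta> in lborel. mono (\<lambda>n. (cmod (FI u \<zeta>))\<^sup>2 * exp (- (e n * (norm \<zeta>)\<^sup>2)))"
  by (intro AE_I2 monoI mult_left_mono) (auto intro!: mult_right_mono emono)
 have lim: "AE \<zeta> in lborel. (\<lambda>n. (cmod (FI u \<zeta>))\<^sup>2 * exp (- (e n * (norm \<zeta>)\<^sup>2))) \<longlonglongrightarrow> (cmod (FI u \<zeta>))\<^sup>2"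
 proof (intro AE_I2)
  fix \<zeta>
  have "(\<lambda>n. (cmod (FI u \<zeta>))\<^sup>2 * exp (- (e n * (norm \<zeta>)\<^sup>2))) \<longlonglongrightarrow> (cmod (FI u \<zeta>))\<^sup>2 * exp (- (0 * (norm \<zeta>)\<^sup>2))"
   by (intro tendsto_intros elim)
  then show "(\<lambda>n. (cmod (FI u \<zeta>))\<^sup>2 * exp (- (e n * (norm \<zeta>)\<^sup>2))) \<longlonglongrightarrow> (cmod (FI u \<zeta>))\<^sup>2" by simp
 qed
 note mc = integral_monotone_convergence_nonneg[of lborel "\<lambda>n \<zeta>. (cmod (FI u \<zeta>))\<^sup>2 * exp (- (e n * (norm \<zeta>)\<^sup>2))"
   "\<lambda>\<zeta>. (cmod (FI u \<zeta>))\<^sup>2" "(2 * pi) ^ DIM('a) * sqnorm lborel u", OF gauss_parseval(1)[OF u e] mono _ lim Jlim[unfolded J_def[abs_def]]]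
 show "sqint lborel (FI u)"
  by (intro sqintI mc(1)) (auto intro!: AE_I2)
 show "sqnorm lborel (FI u) = (2 * pi) ^ DIM('a) * sqnorm lborel u"
  unfolding sqnorm_def[of lborel "FI u"] by (intro mc(2)) (auto intro!: AE_I2)
qed

definition ft :: "('a::euclidean_space => complex) => ('a => complex) => bool" where
 "ft u v \<longleftrightarrow> sqint lborel u \<and> sqint lborel v \<and>
  (\<exists>uk. (\<forall>k::nat. L12 (uk k)) \<and> (\<lambda>k. sqnorm lborel (\<lambda>z. uk k z - u z)) \<longlonglongrightarrow> 0 \<and>
    (\<lambda>k. sqnorm lborel (\<lambda>z. FI (uk k) z - v z)) \<longlonglongrightarrow> 0)"

lemma L12_sqint: "L12 u ==> sqint lborel u" by (simp add: L12_def)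

lemma L12_integrable: "L12 u ==> integrable lborel u" by (simp add: L12_def)

lemma L12_add: "L12 u ==> L12 w ==> L12 (\<lambda>x. u x + w x)"
 by (simp add: L12_def sqint_add)

lemma L12_diff: "L12 u ==> L12 w ==> L12 (\<lambda>x. u x - w x)"
 by (simp add: L12_def sqint_diff)

lemma L12_cmult: "L12 u ==> L12 (\<lambda>x. c * u x)"
 by (simp add: L12_def sqint_cmult)

lemma FI_add: "L12 u ==> L12 w ==> FI (\<lambda>x. u x + w x) \<zeta> = FI u \<zeta> + FI w \<zeta>"
 unfolding FI_def L12_def by (simp add: distrib_left integrable_exp_mult)

lemma FI_diff: "L12 u ==> L12 w ==> FI (\<lambda>x. u x - w x) \<zeta> = FI u \<zeta> - FI w \<zeta>"
 unfolding FI_def L12_def by (simp add: right_diff_distrib integrable_exp_mult)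

lemma FI_cmult: "FI (\<lambda>x. c * u x) \<zeta> = c * FI u \<zeta>"
 unfolding FI_def by (simp add: mult.left_commute)

lemma sqnorm_limit_cong:
 assumes "(\<lambda>k. sqnorm M (\<lambda>z. f k z - g z)) \<longlonglongrightarrow> (0::real)"
  and "\<And>k. sqnorm M (\<lambda>z. f' k z - g' z) \<le> C * sqnorm M (\<lambda>z. f k z - g z)"
 shows "(\<lambda>k. sqnorm M (\<lambda>z. f' k z - g' z)) \<longlonglongrightarrow> 0"
proof (rule Lim_null_comparison)
 show "\<forall>\<^sub>F k in sequentially. norm (sqnorm M (\<lambda>z. f' k z - g' z)) \<le> C * sqnorm M (\<lambda>z. f k z - g z)"
  using assms(2) by (simp add: sqnorm_nonneg)
 show "(\<lambda>k. C * sqnorm M (\<lambda>z. f k z - g z)) \<longlonglongrightarrow> 0"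
  using tendsto_mult_left[OF assms(1), of C] by simp
qed

lemma ftD: assumes "ft u v"
 shows "sqint lborel u" "sqint lborel v" "u \<in> borel_measurable borel" "v \<in> borel_measurable borel"
 using assms by (auto simp: ft_def dest: sqint_measurable)

lemma ftE:
 assumes "ft u v"
 obtains uk where "\<And>k. L12 (uk k)" "(\<lambda>k. sqnorm lborel (\<lambda>z. uk k z - u z)) \<longlonglongrightarrow> 0"
  "(\<lambda>k. sqnorm lborel (\<lambda>z. FI (uk k) z - v z)) \<longlonglongrightarrow> 0"
 using assms unfolding ft_def by blast

lemma ftI:
 assumes "sqint lborel u" "sqint lborel v" "\<And>k. L12 (uk k)" "(\<lambda>k. sqnorm lborel (\<lambda>z. uk k z - u z)) \<longlonglongrightarrow> 0"
  "(\<lambda>k. sqnorm lborel (\<lambda>z. FI (uk k) z - v z)) \<longlonglongrightarrow> 0"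
 shows "ft u v"
 using assms unfolding ft_def by blast

lemma ft_L12: "L12 u ==> ft u (FI u)"
 by (rule ftI[where uk = "\<lambda>_. u"]) (auto simp: L12_sqint plancherel_L12 sqnorm_def)

lemma ft_add:
 assumes "ft u v" "ft u' v'" shows "ft (\<lambda>x. u x + u' x) (\<lambda>x. v x + v' x)"
proof -
 obtain uk where uk: "\<And>k. L12 (uk k)" "(\<lambda>k. sqnorm lborel (\<lambda>z. uk k z - u z)) \<longlonglongrightarrow> 0"
  "(\<lambda>k. sqnorm lborel (\<lambda>z. FI (uk k) z - v z)) \<longlonglongrightarrow> 0" using ftE[OF assms(1)] by blast
 obtain wk where wk: "\<And>k. L12 (wk k)" "(\<lambda>k. sqnorm lborel (\<lambda>z. wk k z - u' z)) \<longlonglongrightarrow> 0"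
  "(\<lambda>k. sqnorm lborel (\<lambda>z. FI (wk k) z - v' z)) \<longlonglongrightarrow> 0" using ftE[OF assms(2)] by blast
 have gen: "(\<lambda>k. sqnorm lborel (\<lambda>z. (f k z + f' k z) - (g z + g' z))) \<longlonglongrightarrow> 0"
  if "(\<lambda>k. sqnorm lborel (\<lambda>z. f k z - g z)) \<longlonglongrightarrow> 0" "(\<lambda>k. sqnorm lborel (\<lambda>z. f' k z - g' z)) \<longlonglongrightarrow> 0"
   "\<And>k. sqint lborel (f k)" "\<And>k. sqint lborel (f' k)" "sqint lborel g" "sqint lborel g'"
  for f f' :: "nat => 'a => complex" and g g'
 proof (rule Lim_null_comparison)
  show "\<forall>\<^sub>F k in sequentially. norm (sqnorm lborel (\<lambda>z. (f k z + f' k z) - (g z + g' z))) \<le>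
    2 * sqnorm lborel (\<lambda>z. f k z - g z) + 2 * sqnorm lborel (\<lambda>z. f' k z - g' z)"
  proof (intro always_eventually allI)
   fix k
   have "(\<lambda>z. (f k z + f' k z) - (g z + g' z)) = (\<lambda>z. (f k z - g z) + (f' k z - g' z))" by auto
   then show "norm (sqnorm lborel (\<lambda>z. (f k z + f' k z) - (g z + g' z))) \<le>
    2 * sqnorm lborel (\<lambda>z. f k z - g z) + 2 * sqnorm lborel (\<lambda>z. f' k z - g' z)"
    using sqnorm_add_le[OF sqint_diff[OF that(3,5)] sqint_diff[OF that(4,6)]] by (simp add: sqnorm_nonneg)
  qed
  show "(\<lambda>k. 2 * sqnorm lborel (\<lambda>z. f k z - g z) + 2 * sqnorm lborel (\<lambda>z. f' k z - g' z)) \<longlonglongrightarrow> 0"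
   using tendsto_add[OF tendsto_mult_left[OF that(1), of 2] tendsto_mult_left[OF that(2), of 2]] by simp
 qed
 show ?thesis
 proof (rule ftI[where uk = "\<lambda>k z. uk k z + wk k z"])
  show "(\<lambda>k. sqnorm lborel (\<lambda>z. (uk k z + wk k z) - (u z + u' z))) \<longlonglongrightarrow> 0"
   by (rule gen) (use uk wk ftD[OF assms(1)] ftD[OF assms(2)] in \<open>auto intro: L12_sqint\<close>)
  show "(\<lambda>k. sqnorm lborel (\<lambda>z. FI (\<lambda>z. uk k z + wk k z) z - (v z + v' z))) \<longlonglongrightarrow> 0"
   unfolding FI_add[OF uk(1) wk(1)]
   by (rule gen) (use uk wk ftD[OF assms(1)] ftD[OF assms(2)] in \<open>auto intro: plancherel_L12\<close>)
 qed (use uk wk ftD[OF assms(1)] ftD[OF assms(2)] in \<open>auto intro: sqint_add L12_add\<close>)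
qed

lemma ft_cmult:
 assumes "ft u v" shows "ft (\<lambda>x. c * u x) (\<lambda>x. c * v x)"
proof -
 obtain uk where uk: "\<And>k. L12 (uk k)" "(\<lambda>k. sqnorm lborel (\<lambda>z. uk k z - u z)) \<longlonglongrightarrow> 0"
  "(\<lambda>k. sqnorm lborel (\<lambda>z. FI (uk k) z - v z)) \<longlonglongrightarrow> 0" using ftE[OF assms(1)] by blast
 have n: "sqnorm lborel (\<lambda>z. c * f z - c * g z) = (cmod c)\<^sup>2 * sqnorm lborel (\<lambda>z. f z - g z)" for f g :: "'a => complex"
  by (simp flip: right_diff_distrib add: sqnorm_cmult)
 show ?thesis
 proof (rule ftI[where uk = "\<lambda>k z. c * uk k z"])
  show "(\<lambda>k. sqnorm lborel (\<lambda>z. c * uk k z - c * u z)) \<longlonglongrightarrow> 0"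
   by (rule sqnorm_limit_cong[OF uk(2), where C = "(cmod c)\<^sup>2"]) (simp add: n)
  show "(\<lambda>k. sqnorm lborel (\<lambda>z. FI (\<lambda>z. c * uk k z) z - c * v z)) \<longlonglongrightarrow> 0"
   by (rule sqnorm_limit_cong[OF uk(3), where C = "(cmod c)\<^sup>2"]) (simp add: n FI_cmult)
 qed (use uk ftD[OF assms(1)] in \<open>auto intro: sqint_cmult L12_cmult\<close>)
qed

lemma ft_diff:
 assumes "ft u v" "ft u' v'" shows "ft (\<lambda>x. u x - u' x) (\<lambda>x. v x - v' x)"
 using ft_add[OF assms(1) ft_cmult[OF assms(2), of "-1"]] by simp

lemma plancherel:
 fixes u :: "'a::euclidean_space => complex"
 assumes "ft u v" shows "sqnorm lborel v = (2 * pi) ^ DIM('a) * sqnorm lborel u"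
proof -
 obtain uk where uk: "\<And>k. L12 (uk k)" "(\<lambda>k. sqnorm lborel (\<lambda>z. uk k z - u z)) \<longlonglongrightarrow> 0"
  "(\<lambda>k. sqnorm lborel (\<lambda>z. FI (uk k) z - v z)) \<longlonglongrightarrow> 0" using ftE[OF assms(1)] by blast
 have 1: "(\<lambda>k. sqnorm lborel (uk k)) \<longlonglongrightarrow> sqnorm lborel u"
  by (rule sqnorm_tendsto) (use uk ftD[OF assms] in \<open>auto intro: L12_sqint\<close>)
 have 2: "(\<lambda>k. sqnorm lborel (FI (uk k))) \<longlonglongrightarrow> sqnorm lborel v"
  by (rule sqnorm_tendsto) (use uk ftD[OF assms] in \<open>auto intro: plancherel_L12\<close>)
 have "(\<lambda>k. sqnorm lborel (FI (uk k))) \<longlonglongrightarrow> (2 * pi) ^ DIM('a) * sqnorm lborel u"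
  unfolding plancherel_L12(2)[OF uk(1)] by (intro tendsto_mult_left 1)
 with 2 show ?thesis by (rule LIMSEQ_unique)
qed

text \<open>Polarisation: the real part comes from Plancherel for \<open>u\<close>, \<open>w\<close>
  and \<open>u - w\<close>, the imaginary part from the same identity with \<open>\<i> * u\<close>
  in place of \<open>u\<close>.\<close>

lemma parseval:
 fixes u w :: "'a::euclidean_space => complex"
 assumes "ft u v" "ft w x" shows "inprod lborel v x = (2 * pi) ^ DIM('a) * inprod lborel u w"
proof -
 have re: "Re (inprod lborel v x) = (2 * pi) ^ DIM('a) * Re (inprod lborel u w)" if a: "ft u v" for u v :: "'a => complex"
 proof -
  have "2 * Re (inprod lborel v x) = sqnorm lborel v + sqnorm lborel x - sqnorm lborel (\<lambda>z. v z - x z)"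
   using sqnorm_diff_expand[of lborel v x] ftD[OF a] ftD[OF assms(2)] by simp
  also have "\<dots> = (2 * pi) ^ DIM('a) * (sqnorm lborel u + sqnorm lborel w - sqnorm lborel (\<lambda>z. u z - w z))"
   unfolding plancherel[OF a] plancherel[OF assms(2)] plancherel[OF ft_diff[OF a assms(2)]]
   by (simp add: algebra_simps)
  also have "\<dots> = (2 * pi) ^ DIM('a) * (2 * Re (inprod lborel u w))"
   using sqnorm_diff_expand[of lborel u w] ftD[OF a] ftD[OF assms(2)] by simp
  finally show ?thesis by simp
 qed
 have im: "Im (inprod lborel v x) = (2 * pi) ^ DIM('a) * Im (inprod lborel u w)"
  using re[OF ft_cmult[OF assms(1), of \<i>]] unfolding inprod_cmult_left by simp
 show ?thesis
 proof -
  have c: "((2 * complex_of_real pi) ^ DIM('a)) = complex_of_real ((2 * pi) ^ DIM('a))" by simp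
  show ?thesis unfolding c by (rule complex_eqI) (use re[OF assms(1)] im in \<open>simp_all only: Re_complex_of_real Im_complex_of_real times_complex.sel mult_zero_left diff_zero add_0_right\<close>)
 qed
qed

lemma ft_cong_left:
 assumes "ft u v" "AE z in lborel. u z = u' z" "u' \<in> borel_measurable borel" shows "ft u' v"
proof -
 obtain uk where uk: "\<And>k. L12 (uk k)" "(\<lambda>k. sqnorm lborel (\<lambda>z. uk k z - u z)) \<longlonglongrightarrow> 0"
  "(\<lambda>k. sqnorm lborel (\<lambda>z. FI (uk k) z - v z)) \<longlonglongrightarrow> 0" using ftE[OF assms(1)] by blast
 have eq: "sqnorm lborel (\<lambda>z. uk k z - u z) = sqnorm lborel (\<lambda>z. uk k z - u' z)" for k
  using assms(2) ftD[OF assms(1)] sqint_measurable[OF L12_sqint[OF uk(1)[of k]]] assms(3)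
  by (intro sqnorm_AE_cong) auto
 show ?thesis
  by (rule ftI[OF _ _ uk(1) _ uk(3)])
   (use assms ftD[OF assms(1)] uk(2) eq in \<open>auto intro: sqint_AE_cong\<close>)
qed

lemma ft_cong_right:
 assumes "ft u v" "AE z in lborel. v z = v' z" "v' \<in> borel_measurable borel" shows "ft u v'"
proof -
 obtain uk where uk: "\<And>k. L12 (uk k)" "(\<lambda>k. sqnorm lborel (\<lambda>z. uk k z - u z)) \<longlonglongrightarrow> 0"
  "(\<lambda>k. sqnorm lborel (\<lambda>z. FI (uk k) z - v z)) \<longlonglongrightarrow> 0" using ftE[OF assms(1)] by blast
 have eq: "sqnorm lborel (\<lambda>z. FI (uk k) z - v z) = sqnorm lborel (\<lambda>z. FI (uk k) z - v' z)" for k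
  using assms(2) ftD[OF assms(1)] sqint_measurable[OF plancherel_L12(1)[OF uk(1)[of k]]] assms(3)
  by (intro sqnorm_AE_cong) auto
 show ?thesis
  by (rule ftI[OF _ _ uk(1) uk(2)])
   (use assms ftD[OF assms(1)] uk(3) eq in \<open>auto intro: sqint_AE_cong\<close>)
qed

lemma ft_unique:
 assumes "ft u v" "ft u v'" shows "AE z in lborel. v z = v' z"
proof -
 have "sqnorm lborel (\<lambda>z. v z - v' z) = 0"
  using plancherel[OF ft_diff[OF assms]] by (simp add: sqnorm_def)
 from sqnorm_0_AE[OF sqint_diff this] show ?thesis using ftD[OF assms(1)] ftD[OF assms(2)] by simp
qed

lemma L12_truncate:
 assumes "sqint lborel (u :: 'a::euclidean_space => complex)"
 shows "L12 (\<lambda>z. indicator (cball 0 R) z * u z)"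
proof -
 have [measurable]: "u \<in> borel_measurable borel" using sqint_measurable[OF assms] by simp
 have [measurable]: "cball (0::'a) R \<in> sets borel" by simp
 have i: "sqint lborel (\<lambda>z::'a. indicator (cball 0 R) z :: complex)"
 proof (rule sqintI)
  have "(\<lambda>z. (cmod (indicator (cball 0 R) z))\<^sup>2) = (indicat_real (cball (0::'a) R))" by (auto split: split_indicator)
  then show "integrable lborel (\<lambda>z::'a. (cmod (indicator (cball 0 R) z))\<^sup>2)"
   using emeasure_lborel_cball_finite[of "0::'a" R] by simp
 qed measurable
 have "sqint lborel (\<lambda>z. indicator (cball 0 R) z * u z)"
  by (rule sqint_bound[OF assms, of _ 1]) (auto simp: norm_mult split: split_indicator)
 with integrable_mult_sqint[OF i assms] show ?thesis by (simp add: L12_def)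
qed

lemma truncate_tendsto:
 assumes "sqint lborel (u :: 'a::euclidean_space => complex)"
 shows "((\<lambda>R. sqnorm lborel (\<lambda>z. indicator (cball 0 R) z * u z - u z)) \<longlongrightarrow> 0) at_top"
proof -
 have [measurable]: "u \<in> borel_measurable borel" using sqint_measurable[OF assms] by simp
 have [measurable]: "cball (0::'a) R \<in> sets borel" for R by simp
 have "((\<lambda>R. LINT z|lborel. (cmod (indicator (cball 0 R) z * u z - u z))\<^sup>2) \<longlongrightarrow> (LINT z|(lborel::'a measure). 0)) at_top"
 proof (rule integral_dominated_convergence_at_top[where w = "\<lambda>z. (cmod (u z))\<^sup>2"])
  show "\<forall>\<^sub>F R in at_top. AE z in lborel. norm ((cmod (indicator (cball 0 R) z * u z - u z))\<^sup>2) \<le> (cmod (u z))\<^sup>2"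
   by (intro always_eventually allI AE_I2) (auto split: split_indicator)
  show "AE z in lborel. ((\<lambda>R. (cmod (indicator (cball 0 R) z * u z - u z))\<^sup>2) \<longlongrightarrow> 0) at_top"
  proof (intro AE_I2 tendsto_eventually)
   fix z
   show "\<forall>\<^sub>F R in at_top. (cmod (indicator (cball 0 R) z * u z - u z))\<^sup>2 = 0"
    using eventually_ge_at_top[of "norm z"] by eventually_elim simp
  qed
 qed (simp_all add: sqint_integrable[OF assms])
 then show ?thesis by (simp add: sqnorm_def)
qed

text \<open>Plancherel applies to the differences of the truncations, so their Fourier integrals
  form a Cauchy sequence.\<close>

lemma ft_exists:
 fixes u :: "'a::euclidean_space => complex"
 assumes u: "sqint lborel u" shows "\<exists>v. ft u v"
proof -
 define uk where "uk k z = indicator (cball 0 (real k)) z * u z" for k z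
 have L: "L12 (uk k)" for k unfolding uk_def by (rule L12_truncate[OF u])
 have lim: "(\<lambda>k. sqnorm lborel (\<lambda>z. uk k z - u z)) \<longlonglongrightarrow> 0"
  unfolding uk_def using filterlim_compose[OF truncate_tendsto[OF u] filterlim_real_sequentially] by simp
 have "\<exists>v. sqint lborel v \<and> (\<lambda>k. sqnorm lborel (\<lambda>x. FI (uk k) x - v x)) \<longlonglongrightarrow> 0"
 proof (rule sqint_complete)
  show "sqint lborel (FI (uk k))" for k by (rule plancherel_L12(1)[OF L])
  fix e :: real assume e: "0 < e"
  define c where "c = (2 * pi) ^ DIM('a)"
  have c: "0 < c" by (simp add: c_def)
  obtain N where N: "\<And>k. k \<ge> N ==> sqnorm lborel (\<lambda>z. uk k z - u z) < e / (4 * c)"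
   using LIMSEQ_D[OF lim, of "e / (4 * c)"] e c by (simp add: sqnorm_nonneg) blast
  have "sqnorm lborel (\<lambda>x. FI (uk m) x - FI (uk n) x) < e" if "m \<ge> N" "n \<ge> N" for m n
  proof -
   have "sqnorm lborel (\<lambda>x. FI (uk m) x - FI (uk n) x) = sqnorm lborel (FI (\<lambda>z. uk m z - uk n z))"
   proof -
    have "FI (\<lambda>z. uk m z - uk n z) = (\<lambda>x. FI (uk m) x - FI (uk n) x)"
     by (rule ext) (rule FI_diff[OF L L])
    then show ?thesis by simp
   qed
   also have "\<dots> = c * sqnorm lborel (\<lambda>z. uk m z - uk n z)"
    unfolding c_def by (rule plancherel_L12(2)[OF L12_diff[OF L L]])
   also have "\<dots> \<le> c * (2 * sqnorm lborel (\<lambda>z. uk m z - u z) + 2 * sqnorm lborel (\<lambda>z. u z - uk n z))"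
    using c by (intro mult_left_mono sqnorm_triangle L12_sqint L u) auto
   also have "\<dots> < c * (2 * (e / (4 * c)) + 2 * (e / (4 * c)))"
    using c N[OF that(1)] N[OF that(2)] sqnorm_commute[of lborel u "uk n"]
    by (intro mult_strict_left_mono add_strict_mono) auto
   also have "\<dots> = e" using c by (simp add: field_simps)
   finally show ?thesis .
  qed
  then show "\<exists>N. \<forall>m\<ge>N. \<forall>n\<ge>N. sqnorm lborel (\<lambda>x. FI (uk m) x - FI (uk n) x) < e" by blast
 qed
 then obtain v where "sqint lborel v" "(\<lambda>k. sqnorm lborel (\<lambda>x. FI (uk k) x - v x)) \<longlonglongrightarrow> 0" by blast
 then show ?thesis using ftI[OF u _ L lim] by blast
qed

text \<open>The bridge to the statement, where \<open>is_fourier\<close> prescribes truncation to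
  balls as the approximation.\<close>

lemma ft_truncate:
 fixes u :: "'a::euclidean_space => complex"
 assumes "ft u v"
 shows "((\<lambda>R. sqnorm lborel (\<lambda>\<zeta>. FI (\<lambda>z. indicator (cball 0 R) z * u z) \<zeta> - v \<zeta>)) \<longlongrightarrow> 0) at_top"
proof -
 have "sqnorm lborel (\<lambda>\<zeta>. FI (\<lambda>z. indicator (cball 0 R) z * u z) \<zeta> - v \<zeta>) =
   (2 * pi) ^ DIM('a) * sqnorm lborel (\<lambda>z. indicator (cball 0 R) z * u z - u z)" for R
  by (rule plancherel[OF ft_diff[OF ft_L12[OF L12_truncate] assms]]) (rule ftD[OF assms])
 then show ?thesis
  using tendsto_mult_left[OF truncate_tendsto[OF ftD(1)[OF assms]], of "(2 * pi) ^ DIM('a)"] by simp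
qed

lemma sqint_reflect:
 fixes u :: "'a::euclidean_space => complex"
 assumes "sqint lborel u"
 shows "sqint lborel (\<lambda>x. u (- x))" "sqnorm lborel (\<lambda>x. u (- x)) = sqnorm lborel u"
proof -
 have [measurable]: "u \<in> borel_measurable borel" using sqint_measurable[OF assms] by simp
 show "sqint lborel (\<lambda>x. u (- x))"
  using sqint_integrable[OF assms] by (intro sqintI) (auto simp: lborel_reflect[of "\<lambda>x. (cmod (u x))\<^sup>2"])
 show "sqnorm lborel (\<lambda>x. u (- x)) = sqnorm lborel u"
  unfolding sqnorm_def by (rule lborel_reflect) measurable
qed

text \<open>
 All the transformation rules of the transform follow this scheme: an operation on the physical side that
 preserves \<open>L\<^sup>1 \<inter> L\<^sup>2\<close> and corresponds to an isometric operation on the frequency side.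
\<close>

lemma ft_transform:
 fixes S :: "('a::euclidean_space => complex) => 'a => complex" and S' :: "('a => complex) => 'a => complex"
 assumes "ft u v"
  and L: "\<And>w. L12 w ==> integrable lborel (S w)"
  and F: "\<And>w \<zeta>. L12 w ==> FI (S w) \<zeta> = S' (FI w) \<zeta>"
  and q: "\<And>w. sqint lborel w ==> sqint lborel (S w)" "\<And>w. sqint lborel w ==> sqint lborel (S' w)"
  and n: "\<And>f g. sqint lborel f ==> sqint lborel g ==> sqnorm lborel (\<lambda>z. S f z - S g z) = sqnorm lborel (\<lambda>z. f z - g z)"
   "\<And>f g. sqint lborel f ==> sqint lborel g ==> sqnorm lborel (\<lambda>z. S' f z - S' g z) = sqnorm lborel (\<lambda>z. f z - g z)"
 shows "ft (S u) (S' v)"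
proof -
 obtain uk where uk: "\<And>k. L12 (uk k)" "(\<lambda>k. sqnorm lborel (\<lambda>z. uk k z - u z)) \<longlonglongrightarrow> 0"
  "(\<lambda>k. sqnorm lborel (\<lambda>z. FI (uk k) z - v z)) \<longlonglongrightarrow> 0" using ftE[OF assms(1)] by blast
 note D = ftD[OF assms(1)]
 show ?thesis
 proof (rule ftI[where uk = "\<lambda>k. S (uk k)"])
  show "L12 (S (uk k))" for k using uk(1) L q by (auto simp: L12_def)
  show "(\<lambda>k. sqnorm lborel (\<lambda>z. S (uk k) z - S u z)) \<longlonglongrightarrow> 0"
   using uk(2) by (simp add: n(1) D L12_sqint[OF uk(1)])
  show "(\<lambda>k. sqnorm lborel (\<lambda>z. FI (S (uk k)) z - S' v z)) \<longlonglongrightarrow> 0"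
   using uk(3) by (simp add: F uk(1) n(2) D plancherel_L12(1)[OF uk(1)])
 qed (use D q in auto)
qed

section \<open>Symmetries of the transform, multiplication formula, surjectivity\<close>

lemma ft_reflect:
 assumes "ft u v" shows "ft (\<lambda>z. u (- z)) (\<lambda>\<zeta>. v (- \<zeta>))"
proof (rule ft_transform[OF assms, where S = "\<lambda>u z. u (- z)" and S' = "\<lambda>u z. u (- z)"])
 fix w :: "'a => complex" and \<zeta> assume w: "L12 w"
 then have [measurable]: "w \<in> borel_measurable borel" by (auto simp: L12_def)
 show "integrable lborel (\<lambda>z. w (- z))" using w by (auto simp: lborel_reflect L12_def)
 show "FI (\<lambda>z. w (- z)) \<zeta> = FI w (- \<zeta>)"
 proof -
  have "FI (\<lambda>z. w (- z)) \<zeta> = (LINT z|lborel. (\<lambda>z. exp (- (\<i> * of_real (z \<bullet> - \<zeta>))) * w z) (- z))"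
   unfolding FI_def by simp
  also have "\<dots> = FI w (- \<zeta>)" unfolding FI_def by (rule lborel_reflect(2)) measurable
  finally show ?thesis .
 qed
qed (use sqint_reflect(1) sqint_reflect(2)[OF sqint_diff] in auto)

lemma sqint_mult_unimodular:
 assumes "sqint M u" "m \<in> borel_measurable M" "\<And>x. cmod (m x) = 1"
 shows "sqint M (\<lambda>x. m x * u x)"
 by (rule sqint_bound[OF assms(1), of _ 1]) (use assms sqint_measurable[OF assms(1)] in \<open>auto simp: norm_mult\<close>)

lemma ft_translate:
 assumes "ft u v" shows "ft (\<lambda>z. u (z - h)) (\<lambda>\<zeta>. exp (- (\<i> * of_real (h \<bullet> \<zeta>))) * v \<zeta>)"
proof (rule ft_transform[OF assms, where S = "\<lambda>u z. u (z - h)" and S' = "\<lambda>v \<zeta>. exp (- (\<i> * of_real (h \<bullet> \<zeta>))) * v \<zeta>"])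
 fix w :: "'a => complex" and \<zeta> assume w: "L12 w"
 then have [measurable]: "w \<in> borel_measurable borel" by (auto simp: L12_def)
 show "integrable lborel (\<lambda>z. w (z - h))" using w lborel_translate(1)[of w "- h"] by (auto simp: L12_def)
 show "FI (\<lambda>z. w (z - h)) \<zeta> = exp (- (\<i> * of_real (h \<bullet> \<zeta>))) * FI w \<zeta>"
 proof -
  have "FI (\<lambda>z. w (z - h)) \<zeta> = (LINT z|lborel. (\<lambda>z. exp (- (\<i> * of_real ((z + h) \<bullet> \<zeta>))) * w z) (z + - h))"
   unfolding FI_def by simp
  also have "\<dots> = (LINT z|lborel. exp (- (\<i> * of_real ((z + h) \<bullet> \<zeta>))) * w z)"
   by (rule lborel_translate(2)) measurable
  also have "\<dots> = (LINT z|lborel. exp (- (\<i> * of_real (h \<bullet> \<zeta>))) * (exp (- (\<i> * of_real (z \<bullet> \<zeta>))) * w z))"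
   by (simp only: mult.assoc[symmetric] exp_add[symmetric] inner_add_left of_real_add distrib_left minus_add_distrib)
    (simp only: add.commute)
  also have "\<dots> = exp (- (\<i> * of_real (h \<bullet> \<zeta>))) * FI w \<zeta>" unfolding FI_def by simp
  finally show ?thesis .
 qed
next
 fix w :: "'a => complex" assume "sqint lborel w"
 then show "sqint lborel (\<lambda>z. w (z - h))" using sqint_translate(1)[of w "- h"] by simp
 show "sqint lborel (\<lambda>\<zeta>. exp (- (\<i> * of_real (h \<bullet> \<zeta>))) * w \<zeta>)"
  by (rule sqint_mult_unimodular[OF \<open>sqint lborel w\<close>]) auto
next
 fix f g :: "'a => complex" assume "sqint lborel f" "sqint lborel g"
 then show "sqnorm lborel (\<lambda>z. f (z - h) - g (z - h)) = sqnorm lborel (\<lambda>z. f z - g z)"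
  using sqint_translate(2)[OF sqint_diff, of f g "- h"] by simp
 show "sqnorm lborel (\<lambda>\<zeta>. exp (- (\<i> * of_real (h \<bullet> \<zeta>))) * f \<zeta> - exp (- (\<i> * of_real (h \<bullet> \<zeta>))) * g \<zeta>) = sqnorm lborel (\<lambda>z. f z - g z)"
  unfolding right_diff_distrib[symmetric] sqnorm_def norm_mult by simp
qed

lemma ft_modulate:
 assumes "ft u v" shows "ft (\<lambda>z. exp (- (\<i> * of_real (h \<bullet> z))) * u z) (\<lambda>\<zeta>. v (\<zeta> + h))"
proof (rule ft_transform[OF assms, where S = "\<lambda>v \<zeta>. exp (- (\<i> * of_real (h \<bullet> \<zeta>))) * v \<zeta>" and S' = "\<lambda>u z. u (z + h)"])
 fix w :: "'a => complex" and \<zeta> assume w: "L12 w"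
 then have [measurable]: "w \<in> borel_measurable borel" by (auto simp: L12_def)
 show "integrable lborel (\<lambda>z. exp (- (\<i> * of_real (h \<bullet> z))) * w z)"
  using integrable_exp_mult[of w h] w by (simp add: L12_def inner_commute)
 show "FI (\<lambda>z. exp (- (\<i> * of_real (h \<bullet> z))) * w z) \<zeta> = FI w (\<zeta> + h)"
  unfolding FI_def mult.assoc[symmetric] exp_add[symmetric] by (simp add: inner_add_right inner_commute algebra_simps)
next
 fix w :: "'a => complex" assume "sqint lborel w"
 then show "sqint lborel (\<lambda>z. w (z + h))" using sqint_translate(1)[of w h] by simp
 show "sqint lborel (\<lambda>\<zeta>. exp (- (\<i> * of_real (h \<bullet> \<zeta>))) * w \<zeta>)"
  by (rule sqint_mult_unimodular[OF \<open>sqint lborel w\<close>]) auto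
next
 fix f g :: "'a => complex" assume "sqint lborel f" "sqint lborel g"
 then show "sqnorm lborel (\<lambda>z. f (z + h) - g (z + h)) = sqnorm lborel (\<lambda>z. f z - g z)"
  using sqint_translate(2)[OF sqint_diff, of f g "h"] by simp
 show "sqnorm lborel (\<lambda>\<zeta>. exp (- (\<i> * of_real (h \<bullet> \<zeta>))) * f \<zeta> - exp (- (\<i> * of_real (h \<bullet> \<zeta>))) * g \<zeta>) = sqnorm lborel (\<lambda>z. f z - g z)"
  unfolding right_diff_distrib[symmetric] sqnorm_def norm_mult by simp
qed

lemma ft_cnj:
 assumes "ft u v" shows "ft (\<lambda>z. cnj (u z)) (\<lambda>\<zeta>. cnj (v (- \<zeta>)))"
proof -
 have "ft (\<lambda>z. cnj (u (- z))) (\<lambda>\<zeta>. cnj (v \<zeta>))"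
 proof (rule ft_transform[OF assms, where S = "\<lambda>u z. cnj (u (- z))" and S' = "\<lambda>v \<zeta>. cnj (v \<zeta>)"])
  fix w :: "'a => complex" and \<zeta> assume w: "L12 w"
  then have m: "w \<in> borel_measurable borel" by (auto simp: L12_def)
  show "integrable lborel (\<lambda>z. cnj (w (- z)))" using w lborel_reflect(1)[OF m] by (auto simp: L12_def)
  show "FI (\<lambda>z. cnj (w (- z))) \<zeta> = cnj (FI w \<zeta>)" by (rule FI_cnj_reflect[OF m])
 next
  fix f g :: "'a => complex" assume "sqint lborel f" "sqint lborel g"
  then have "sqnorm lborel (\<lambda>z. f (- z) - g (- z)) = sqnorm lborel (\<lambda>z. f z - g z)"
   using sqint_reflect(2)[OF sqint_diff, of f g] by simp
  moreover have n: "cmod (cnj a - cnj b) = cmod (a - b)" for a b by (simp flip: complex_cnj_diff)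
  ultimately show "sqnorm lborel (\<lambda>z. cnj (f (- z)) - cnj (g (- z))) = sqnorm lborel (\<lambda>z. f z - g z)"
   by (simp add: sqnorm_def n)
  show "sqnorm lborel (\<lambda>z. cnj (f z) - cnj (g z)) = sqnorm lborel (\<lambda>z. f z - g z)" by (simp add: sqnorm_def n)
 qed (auto intro: sqint_cnj sqint_reflect)
 from ft_reflect[OF this] show ?thesis by simp
qed

lemma ft_mult:
 assumes "ft u U" "ft w W" shows "(LINT z|lborel. U z * w z) = (LINT z|lborel. u z * W z)"
proof -
 obtain uk where uk: "\<And>k. L12 (uk k)" "(\<lambda>k. sqnorm lborel (\<lambda>z. uk k z - u z)) \<longlonglongrightarrow> 0"
  "(\<lambda>k. sqnorm lborel (\<lambda>z. FI (uk k) z - U z)) \<longlonglongrightarrow> 0" using ftE[OF assms(1)] by blast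
 obtain wk where wk: "\<And>k. L12 (wk k)" "(\<lambda>k. sqnorm lborel (\<lambda>z. wk k z - w z)) \<longlonglongrightarrow> 0"
  "(\<lambda>k. sqnorm lborel (\<lambda>z. FI (wk k) z - W z)) \<longlonglongrightarrow> 0" using ftE[OF assms(2)] by blast
 have n: "cmod (cnj a - cnj b) = cmod (a - b)" for a b by (simp flip: complex_cnj_diff)
 have nn: "sqnorm lborel (\<lambda>z. cnj (f z) - cnj (g z)) = sqnorm lborel (\<lambda>z. f z - g z)" for f g :: "'a => complex"
  by (simp add: sqnorm_def n)
 have 1: "(\<lambda>k. inprod lborel (FI (uk k)) (\<lambda>z. cnj (wk k z))) \<longlonglongrightarrow> inprod lborel U (\<lambda>z. cnj (w z))"
  by (rule sqnorm_tendsto_imp_inprod)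
   (use uk wk ftD[OF assms(1)] ftD[OF assms(2)] in \<open>auto simp: nn intro: plancherel_L12 sqint_cnj L12_sqint\<close>)
 have 2: "(\<lambda>k. inprod lborel (uk k) (\<lambda>z. cnj (FI (wk k) z))) \<longlonglongrightarrow> inprod lborel u (\<lambda>z. cnj (W z))"
  by (rule sqnorm_tendsto_imp_inprod)
   (use uk wk ftD[OF assms(1)] ftD[OF assms(2)] in \<open>auto simp: nn intro: plancherel_L12 sqint_cnj L12_sqint\<close>)
 have "inprod lborel (FI (uk k)) (\<lambda>z. cnj (wk k z)) = inprod lborel (uk k) (\<lambda>z. cnj (FI (wk k) z))" for k
  unfolding inprod_def using FI_mult[OF L12_integrable[OF uk(1)] L12_integrable[OF wk(1)]] by simp
 then have "inprod lborel U (\<lambda>z. cnj (w z)) = inprod lborel u (\<lambda>z. cnj (W z))"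
  using LIMSEQ_unique[OF 1] 2 by simp
 then show ?thesis by (simp add: inprod_def)
qed

text \<open>The candidate \<open>u\<close> is the one that the inversion formula predicts. Its
  transform \<open>U\<close> has the norm of \<open>v\<close> by Plancherel, and
  \<open>ft_mult\<close> evaluates the inner product of \<open>U\<close> and \<open>v\<close> to the
  same number; hence their distance is 0.\<close>

lemma ft_surj:
 fixes v :: "'a::euclidean_space => complex"
 assumes v: "sqint lborel v" shows "\<exists>u. ft u v"
proof -
 obtain V where V: "ft v V" using ft_exists[OF v] by blast
 define N where "N = (2 * pi) ^ DIM('a)"
 have N: "N > 0" by (simp add: N_def)
 define u where "u z = of_real (1 / N) * V (- z)" for z
 have su: "sqint lborel u" unfolding u_def by (intro sqint_cmult sqint_reflect ftD[OF V])
 obtain U where U: "ft u U" using ft_exists[OF su] by blast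
 have nu: "sqnorm lborel u = sqnorm lborel v / N"
  unfolding u_def sqnorm_cmult sqint_reflect(2)[OF ftD(2)[OF V]] plancherel[OF V] N_def[symmetric]
  using N by (simp add: power2_eq_square norm_divide)
 have nU: "sqnorm lborel U = sqnorm lborel v"
  unfolding plancherel[OF U] N_def[symmetric] nu using N by simp
 have "inprod lborel U v = (LINT z|lborel. U z * cnj (v z))" by (simp add: inprod_def)
 also have "\<dots> = (LINT z|lborel. u z * cnj (V (- z)))" by (rule ft_mult[OF U ft_cnj[OF V]])
 also have "\<dots> = (LINT z|lborel. of_real N * (u z * cnj (u z)))"
  using N by (simp add: u_def)
 also have "\<dots> = of_real N * inprod lborel u u" by (simp add: inprod_def)
 also have "\<dots> = of_real (sqnorm lborel v)" using N by (simp add: inprod_self nu)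
 finally have "sqnorm lborel (\<lambda>z. U z - v z) = 0"
  using sqnorm_diff_expand[OF ftD(2)[OF U] v] nU by simp
 from sqnorm_0_AE[OF sqint_diff this] have "AE z in lborel. U z = v z" using ftD[OF U] v by simp
 with ft_cong_right[OF U] sqint_measurable[OF v] show ?thesis by auto
qed

lemma inprod_translate_ft:
 fixes u w :: "'a::euclidean_space => complex"
 assumes "ft u U" "ft w W"
 shows "(2 * pi) ^ DIM('a) * inprod lborel (\<lambda>z. u (z - h)) w =
  (LINT \<zeta>|lborel. exp (- (\<i> * of_real (h \<bullet> \<zeta>))) * (U \<zeta> * cnj (W \<zeta>)))"
 using parseval[OF ft_translate[OF assms(1), of h] assms(2)] by (simp add: inprod_def mult.assoc)

section \<open>Fractional powers and the heat semigroup\<close>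

lemma has_vector_derivative_iff_quotient:
 fixes f :: "real => 'a::real_normed_vector"
 shows "(f has_vector_derivative D) (at a) \<longleftrightarrow> ((\<lambda>e. (1 / (e - a)) *\<^sub>R (f e - f a)) \<longlongrightarrow> D) (at a)"
proof -
 have "norm ((1 / norm (e - a)) *\<^sub>R (f e - (f a + (e - a) *\<^sub>R D))) = norm ((1 / (e - a)) *\<^sub>R (f e - f a) - D)" if "e \<noteq> a" for e
 proof -
  have "(1 / (e - a)) *\<^sub>R (f e - f a) - D = (1 / (e - a)) *\<^sub>R (f e - (f a + (e - a) *\<^sub>R D))"
  proof -
   have "(1 / (e - a)) *\<^sub>R (f e - (f a + (e - a) *\<^sub>R D)) = (1 / (e - a)) *\<^sub>R ((f e - f a) - (e - a) *\<^sub>R D)"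
    by (simp only: diff_diff_eq)
   also have "\<dots> = (1 / (e - a)) *\<^sub>R (f e - f a) - (1 / (e - a)) *\<^sub>R ((e - a) *\<^sub>R D)"
    by (rule scaleR_diff_right)
   finally show ?thesis using that by simp
  qed
  then show ?thesis by simp
 qed
 then have *: "((\<lambda>e. norm ((1 / norm (e - a)) *\<^sub>R (f e - (f a + (e - a) *\<^sub>R D)))) \<longlongrightarrow> 0) (at a) \<longleftrightarrow>
  ((\<lambda>e. norm ((1 / (e - a)) *\<^sub>R (f e - f a) - D)) \<longlongrightarrow> 0) (at a)"
  by (intro filterlim_cong refl) (auto simp: eventually_at_filter)
 show ?thesis
  unfolding has_vector_derivative_def has_derivative_within
  using *[unfolded tendsto_norm_zero_iff LIM_zero_iff] by (simp add: bounded_linear_scaleR_left)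
qed

text \<open>Dominated convergence for the difference quotients along arbitrary sequences; the mean
  value inequality transfers the bound on the derivative to the quotients.\<close>

lemma deriv_under_integral:
 fixes f f' :: "real => 'z => complex"
 assumes d: "0 < d"
  and int: "\<And>e. \<bar>e - e0\<bar> < d ==> integrable M (f e)"
  and der: "\<And>e z. \<bar>e - e0\<bar> < d ==> z \<in> space M ==> ((\<lambda>e. f e z) has_vector_derivative f' e z) (at e)"
  and bd: "\<And>e z. \<bar>e - e0\<bar> < d ==> z \<in> space M ==> cmod (f' e z) \<le> B z"
  and B: "integrable M B"
  and meas: "f' e0 \<in> borel_measurable M"
 shows "((\<lambda>e. LINT z|M. f e z) has_vector_derivative (LINT z|M. f' e0 z)) (at e0)"
proof -
 have q: "((\<lambda>e. (1 / (e - e0)) *\<^sub>R ((LINT z|M. f e z) - (LINT z|M. f e0 z))) \<longlongrightarrow> (LINT z|M. f' e0 z)) (at e0)"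
  unfolding tendsto_at_iff_sequentially
 proof (intro allI impI)
  fix X :: "nat => real" assume X: "\<forall>i. X i \<in> UNIV - {e0}" "X \<longlonglongrightarrow> e0"
  obtain N where N: "\<And>n. n \<ge> N ==> \<bar>X n - e0\<bar> < d"
   using LIMSEQ_D[OF X(2) d] by auto
  define Y where "Y n = X (n + N)" for n
  have Y: "\<bar>Y n - e0\<bar> < d" "Y n \<noteq> e0" for n using N X(1) by (auto simp: Y_def)
  have Ylim: "Y \<longlonglongrightarrow> e0" unfolding Y_def by (rule LIMSEQ_ignore_initial_segment[OF X(2)])
  have "(\<lambda>n. LINT z|M. (1 / (Y n - e0)) *\<^sub>R (f (Y n) z - f e0 z)) \<longlonglongrightarrow> (LINT z|M. f' e0 z)"
  proof (rule integral_dominated_convergence[OF meas _ B])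
   show "(\<lambda>z. (1 / (Y n - e0)) *\<^sub>R (f (Y n) z - f e0 z)) \<in> borel_measurable M" for n
    using int[OF Y(1)] int[of e0] d by auto
   show "AE z in M. (\<lambda>n. (1 / (Y n - e0)) *\<^sub>R (f (Y n) z - f e0 z)) \<longlonglongrightarrow> f' e0 z"
   proof (intro AE_I2)
    fix z assume z: "z \<in> space M"
    have "((\<lambda>e. f e z) has_vector_derivative f' e0 z) (at e0)" using der[of e0 z] d z by simp
    then have "((\<lambda>e. (1 / (e - e0)) *\<^sub>R (f e z - f e0 z)) \<longlongrightarrow> f' e0 z) (at e0)"
     by (simp only: has_vector_derivative_iff_quotient)
    then show "(\<lambda>n. (1 / (Y n - e0)) *\<^sub>R (f (Y n) z - f e0 z)) \<longlonglongrightarrow> f' e0 z"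
     unfolding tendsto_at_iff_sequentially using Y(2) Ylim by (auto simp: o_def)
   qed
   show "AE z in M. norm ((1 / (Y n - e0)) *\<^sub>R (f (Y n) z - f e0 z)) \<le> B z" for n
   proof (intro AE_I2)
    fix z assume z: "z \<in> space M"
    define S where "S = {e. \<bar>e - e0\<bar> < d}"
    have S: "S = {e0 - d <..< e0 + d}" by (auto simp: S_def abs_less_iff)
    have cS: "convex S" unfolding S by simp
    have "norm (f (Y n) z - f e0 z) \<le> B z * norm (Y n - e0)"
    proof (rule differentiable_bound[OF cS, where f' = "\<lambda>e t. t *\<^sub>R f' e z"])
     fix e assume e: "e \<in> S"
     show "((\<lambda>e. f e z) has_derivative (\<lambda>t. t *\<^sub>R f' e z)) (at e within S)"
      using der[of e z] e z unfolding has_vector_derivative_def S_def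
      by (auto intro: has_derivative_at_withinI)
     have "cmod (f' e z) \<le> B z" using bd[of e z] e z by (simp add: S_def)
     then show "onorm (\<lambda>t. t *\<^sub>R f' e z) \<le> B z"
      by (intro onorm_le) (simp add: mult.commute[of "B z"] mult_left_mono)
    qed (use Y d in \<open>auto simp: S_def\<close>)
    moreover have "norm ((1 / (Y n - e0)) *\<^sub>R (f (Y n) z - f e0 z)) = norm (f (Y n) z - f e0 z) / norm (Y n - e0)"
     by simp
    ultimately show "norm ((1 / (Y n - e0)) *\<^sub>R (f (Y n) z - f e0 z)) \<le> B z"
     using Y(2)[of n] pos_divide_le_eq[of "norm (Y n - e0)" "cmod (f (Y n) z - f e0 z)" "B z"] by simp
   qed
  qed
  moreover have "(LINT z|M. (1 / (Y n - e0)) *\<^sub>R (f (Y n) z - f e0 z)) =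
    (1 / (Y n - e0)) *\<^sub>R ((LINT z|M. f (Y n) z) - (LINT z|M. f e0 z))" for n
   using int[OF Y(1)] int[of e0] d by simp
  ultimately have "(\<lambda>n. (1 / (X (n + N) - e0)) *\<^sub>R ((LINT z|M. f (X (n + N)) z) - (LINT z|M. f e0 z))) \<longlonglongrightarrow> (LINT z|M. f' e0 z)"
   by (simp only: Y_def)
  then show "((\<lambda>e. (1 / (e - e0)) *\<^sub>R ((LINT z|M. f e z) - (LINT z|M. f e0 z))) \<circ> X) \<longlonglongrightarrow> (LINT z|M. f' e0 z)"
   unfolding o_def by (rule LIMSEQ_offset)
 qed
 then show ?thesis
  by (simp only: has_vector_derivative_iff_quotient)
qed

section \<open>Complex powers as integrals of exponentials\<close>

definition pk :: "real => real => real" where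
 "pk s \<tau> = (if 0 < \<tau> then \<tau> powr (- 1 - s) else 0)"

lemma pk_nonneg: "0 \<le> pk s \<tau>" by (simp add: pk_def)

lemma measurable_pk [measurable]: "pk s \<in> borel_measurable borel"
 unfolding pk_def[abs_def] by measurable

lemma pk_scale:
 fixes f :: "real => 'b::{banach, second_countable_topology}"
 assumes "0 < r"
 shows "(LINT \<tau>|lborel. pk s \<tau> *\<^sub>R f (r * \<tau>)) = r powr s *\<^sub>R (LINT \<tau>|lborel. pk s \<tau> *\<^sub>R f \<tau>)"
proof -
 have eq: "pk s (0 + r * \<tau>) *\<^sub>R f (0 + r * \<tau>) = r powr (-1 - s) *\<^sub>R (pk s \<tau> *\<^sub>R f (r * \<tau>))" for \<tau>
  using assms by (auto simp: pk_def zero_less_mult_iff powr_mult)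
 have "(LINT \<tau>|lborel. pk s \<tau> *\<^sub>R f \<tau>) = \<bar>r\<bar> *\<^sub>R (LINT \<tau>|lborel. pk s (0 + r * \<tau>) *\<^sub>R f (0 + r * \<tau>))"
  by (rule lborel_integral_real_affine) (use assms in simp)
 also have "\<dots> = (r * r powr (-1 - s)) *\<^sub>R (LINT \<tau>|lborel. pk s \<tau> *\<^sub>R f (r * \<tau>))"
  unfolding eq by (subst integral_scaleR_right) (use assms in simp)
 also have "r * r powr (-1 - s) = r powr (- s)"
  using assms powr_add[of r 1 "-1 - s"] by simp
 finally show ?thesis using assms by (simp add: powr_add[symmetric])
qed

lemma pk_integrable:
 assumes s: "0 < s" "s < 1"
 shows "integrable lborel (\<lambda>\<tau>. pk s \<tau> * min 1 \<tau>)"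
proof -
 have a: "set_integrable lborel {0..1} (\<lambda>\<tau>. \<tau> powr (- s))"
 proof -
  have "(\<lambda>\<tau>. \<tau> powr (- s)) integrable_on {0..1}"
   by (rule integrable_on_powr_from_0) (use s in auto)
  then have "(\<lambda>\<tau>. \<tau> powr (- s)) absolutely_integrable_on {0..1}"
   by (rule nonnegative_absolutely_integrable_1) simp
  then show ?thesis unfolding set_integrable_def
   by (subst (asm) integrable_completion) auto
 qed
 have b: "set_integrable lborel {1..} (\<lambda>\<tau>. \<tau> powr (- 1 - s))"
 proof -
  have "(\<lambda>\<tau>. \<tau> powr (- 1 - s)) integrable_on {1..}"
   using has_integral_powr_to_inf[of "-1 - s" 1] s by (auto simp: integrable_on_def)
  then have "(\<lambda>\<tau>. \<tau> powr (- 1 - s)) absolutely_integrable_on {1..}"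
   by (rule nonnegative_absolutely_integrable_1) simp
  then show ?thesis unfolding set_integrable_def
   by (subst (asm) integrable_completion) auto
 qed
 show ?thesis
 proof (rule Bochner_Integration.integrable_bound)
  show "integrable lborel (\<lambda>\<tau>. indicat_real {0..1} \<tau> *\<^sub>R \<tau> powr (- s) + indicat_real {1..} \<tau> *\<^sub>R \<tau> powr (- 1 - s))"
   using a b unfolding set_integrable_def by simp
  show "AE \<tau> in lborel. norm (pk s \<tau> * min 1 \<tau>) \<le> norm (indicat_real {0..1} \<tau> *\<^sub>R \<tau> powr (- s) + indicat_real {1..} \<tau> *\<^sub>R \<tau> powr (- 1 - s))"
  proof (intro AE_I2)
   fix \<tau> :: real
   have "\<tau> powr (- 1 - s) * \<tau> = \<tau> powr (- s)" if "\<tau> > 0"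
    using that powr_add[of \<tau> "-1 - s" 1] by simp
   then show "norm (pk s \<tau> * min 1 \<tau>) \<le> norm (indicat_real {0..1} \<tau> *\<^sub>R \<tau> powr (- s) + indicat_real {1..} \<tau> *\<^sub>R \<tau> powr (- 1 - s))"
    by (auto simp: pk_def abs_mult min_def split: split_indicator)
  qed
 qed measurable
qed

lemma norm_one_minus_exp_le:
 assumes "0 \<le> Re z" shows "cmod (1 - exp (- z)) \<le> min 2 (cmod z)"
proof -
 have "cmod (1 - exp (- z)) \<le> 1 + cmod (exp (- z))" using norm_triangle_ineq4[of 1 "exp (- z)"] by simp
 also have "\<dots> \<le> 2" using assms by (simp add: norm_exp_eq_Re)
 finally have 1: "cmod (1 - exp (- z)) \<le> 2" .
 have "cmod (exp (- z) - exp 0) \<le> 1 * cmod (- z - 0)"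
 proof (rule field_differentiable_bound[where S = "{z. Re z \<le> 0}" and f' = exp])
  show "convex {z. Re z \<le> 0}" by (rule convex_halfspace_Re_le)
  fix x assume "x \<in> {z. Re z \<le> 0}"
  then show "cmod (exp x) \<le> 1" by (simp add: norm_exp_eq_Re)
  show "(exp has_field_derivative exp x) (at x within {z. Re z \<le> 0})"
   by (auto intro!: derivative_eq_intros)
 qed (use assms in auto)
 then have "cmod (1 - exp (- z)) \<le> cmod z" by (simp add: norm_minus_commute)
 with 1 show ?thesis by simp
qed

text \<open>The classical representation of \<open>\<sigma> powr s\<close> for
  \<open>0 < s < 1\<close>, up to the positive constant \<open>pkc s\<close>. Subtracting the
  exponential from 1 gives a factor of order \<open>\<tau>\<close> near 0, which makes the
  singularity of \<open>pk\<close> integrable.\<close>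

definition pkint :: "real => complex => complex" where
 "pkint s \<sigma> = (LINT \<tau>|lborel. pk s \<tau> *\<^sub>R (1 - exp (- (of_real \<tau> * \<sigma>))))"

lemma pk_norm_bound:
 assumes "0 \<le> Re \<sigma>"
 shows "cmod (pk s \<tau> *\<^sub>R (1 - exp (- (of_real \<tau> * \<sigma>)))) \<le> pk s \<tau> * min 2 (cmod \<sigma> * \<tau>)"
proof (cases "\<tau> > 0")
 case True
 then have "cmod (1 - exp (- (of_real \<tau> * \<sigma>))) \<le> min 2 (cmod (of_real \<tau> * \<sigma>))"
  using assms by (intro norm_one_minus_exp_le) auto
 then show ?thesis using True pk_nonneg[of s \<tau>] by (simp add: norm_mult mult.commute mult_left_mono)
qed (simp add: pk_def)

lemma pk_min_integrable:
 assumes s: "0 < s" "s < 1" and r: "0 \<le> r"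
 shows "integrable lborel (\<lambda>\<tau>. pk s \<tau> * min 2 (r * \<tau>))"
proof (rule Bochner_Integration.integrable_bound[OF integrable_mult_right[OF pk_integrable[OF s], of "2 + r"]])
 show "AE \<tau> in lborel. norm (pk s \<tau> * min 2 (r * \<tau>)) \<le> norm ((2 + r) * (pk s \<tau> * min 1 \<tau>))"
 proof (intro AE_I2)
  fix \<tau> :: real
  show "norm (pk s \<tau> * min 2 (r * \<tau>)) \<le> norm ((2 + r) * (pk s \<tau> * min 1 \<tau>))"
  proof (cases "\<tau> > 0")
   case True
   have "min 2 (r * \<tau>) \<le> (2 + r) * min 1 \<tau>" using True r by (auto simp: min_def algebra_simps)
   moreover have "0 \<le> min 2 (r * \<tau>)" using True r by simp
   ultimately have "pk s \<tau> * min 2 (r * \<tau>) \<le> pk s \<tau> * ((2 + r) * min 1 \<tau>)" "0 \<le> pk s \<tau> * min 2 (r * \<tau>)"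
    using pk_nonneg[of s \<tau>] by (auto intro: mult_left_mono)
   then show ?thesis by (simp add: mult.left_commute)
  qed (simp add: pk_def)
 qed
qed measurable

lemma pk_integrable_exp:
 assumes s: "0 < s" "s < 1" and "0 \<le> Re \<sigma>"
 shows "integrable lborel (\<lambda>\<tau>. pk s \<tau> *\<^sub>R (1 - exp (- (of_real \<tau> * \<sigma>))))"
  and "(LINT \<tau>|lborel. cmod (pk s \<tau> *\<^sub>R (1 - exp (- (of_real \<tau> * \<sigma>))))) \<le> (LINT \<tau>|lborel. pk s \<tau> * min 2 \<tau>) * cmod \<sigma> powr s"
proof -
 have i: "integrable lborel (\<lambda>\<tau>. pk s \<tau> * min 2 (cmod \<sigma> * \<tau>))"
  by (rule pk_min_integrable[OF s]) simp
 show i2: "integrable lborel (\<lambda>\<tau>. pk s \<tau> *\<^sub>R (1 - exp (- (of_real \<tau> * \<sigma>))))"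
 proof (rule Bochner_Integration.integrable_bound[OF i])
  show "AE \<tau> in lborel. norm (pk s \<tau> *\<^sub>R (1 - exp (- (of_real \<tau> * \<sigma>)))) \<le> norm (pk s \<tau> * min 2 (cmod \<sigma> * \<tau>))"
   by (intro AE_I2 order_trans[OF pk_norm_bound[OF assms(3)]]) simp
 qed measurable
 show "(LINT \<tau>|lborel. cmod (pk s \<tau> *\<^sub>R (1 - exp (- (of_real \<tau> * \<sigma>))))) \<le> (LINT \<tau>|lborel. pk s \<tau> * min 2 \<tau>) * cmod \<sigma> powr s"
 proof (cases "\<sigma> = 0")
  case False
  have "(LINT \<tau>|lborel. cmod (pk s \<tau> *\<^sub>R (1 - exp (- (of_real \<tau> * \<sigma>))))) \<le> (LINT \<tau>|lborel. pk s \<tau> * min 2 (cmod \<sigma> * \<tau>))"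
   by (intro integral_mono integrable_norm i i2 pk_norm_bound assms)
  also have "\<dots> = (LINT \<tau>|lborel. pk s \<tau> * min 2 \<tau>) * cmod \<sigma> powr s"
   using pk_scale[of "cmod \<sigma>" s "\<lambda>\<tau>. min 2 \<tau>"] False by (simp add: mult.commute)
  finally show ?thesis .
 qed simp
qed

lemma pkint_scale: "0 < r ==> pkint s (of_real r * \<sigma>) = of_real (r powr s) * pkint s \<sigma>"
 unfolding pkint_def using pk_scale[of r s "\<lambda>\<tau>. 1 - exp (- (of_real \<tau> * \<sigma>))"]
 by (simp add: scaleR_conv_of_real mult_ac)

definition pkint' :: "real => complex => complex" where
 "pkint' s \<sigma> = (LINT \<tau>|lborel. pk s \<tau> *\<^sub>R (of_real \<tau> * exp (- (of_real \<tau> * \<sigma>))))"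

text \<open>Only derivatives along real curves occur in \<open>pkint_powr\<close>. Near
  \<open>e0\<close> the real part stays above some \<open>m > 0\<close>, and
  \<open>\<tau> * exp (- m * \<tau>)\<close> is at most a multiple of \<open>min 1 \<tau>\<close>,
  which \<open>pk\<close> integrates.\<close>

lemma pkint_curve_deriv:
 fixes c c' :: "real => complex"
 assumes s: "0 < s" "s < 1"
  and pos: "0 < Re (c e0)" and der: "\<And>e. (c has_vector_derivative c' e) (at e)" and c': "continuous_on UNIV c'"
 shows "((\<lambda>e. pkint s (c e)) has_vector_derivative c' e0 * pkint' s (c e0)) (at e0)"
proof -
 define m where "m = Re (c e0) / 2"
 have m: "m > 0" using pos by (simp add: m_def)
 have cc: "isCont c e0" using der has_vector_derivative_continuous by blast
 have "((\<lambda>e. Re (c e)) \<longlongrightarrow> Re (c e0)) (nhds e0)"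
  using cc by (intro tendsto_Re) (simp add: isCont_def tendsto_at_iff_tendsto_nhds)
 then have "\<forall>\<^sub>F e in nhds e0. m < Re (c e)"
  by (rule order_tendstoD) (use pos in \<open>simp add: m_def\<close>)
 moreover have "((\<lambda>e. cmod (c' e)) \<longlongrightarrow> cmod (c' e0)) (nhds e0)"
  using c' by (intro tendsto_norm) (simp add: continuous_on_eq_continuous_at isCont_def tendsto_at_iff_tendsto_nhds)
 then have "\<forall>\<^sub>F e in nhds e0. cmod (c' e) < cmod (c' e0) + 1"
  by (rule order_tendstoD) simp
 ultimately have "\<forall>\<^sub>F e in nhds e0. m < Re (c e) \<and> cmod (c' e) < cmod (c' e0) + 1"
  by (rule eventually_conj)
 then obtain d where d: "d > 0" "\<And>e. \<bar>e - e0\<bar> < d ==> m < Re (c e)" "\<And>e. \<bar>e - e0\<bar> < d ==> cmod (c' e) < cmod (c' e0) + 1"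
  unfolding eventually_nhds_metric by (auto simp: dist_real_def)
 define K where "K = (cmod (c' e0) + 1) * (1 + 1 / m)"
 have "((\<lambda>e. LINT \<tau>|lborel. pk s \<tau> *\<^sub>R (1 - exp (- (of_real \<tau> * c e)))) has_vector_derivative
  (LINT \<tau>|lborel. pk s \<tau> *\<^sub>R (of_real \<tau> * c' e0 * exp (- (of_real \<tau> * c e0))))) (at e0)"
 proof (rule deriv_under_integral[OF d(1), where B = "\<lambda>\<tau>. K * (pk s \<tau> * min 1 \<tau>)"])
  fix e assume e: "\<bar>e - e0\<bar> < d"
  show "integrable lborel (\<lambda>\<tau>. pk s \<tau> *\<^sub>R (1 - exp (- (of_real \<tau> * c e))))"
   by (rule pk_integrable_exp[OF s]) (use d(2)[OF e] m in simp)
  fix \<tau> :: real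
  show "((\<lambda>e. pk s \<tau> *\<^sub>R (1 - exp (- (of_real \<tau> * c e)))) has_vector_derivative
   pk s \<tau> *\<^sub>R (of_real \<tau> * c' e * exp (- (of_real \<tau> * c e)))) (at e)"
  proof -
   have "((\<lambda>e. - (of_real \<tau> * c e)) has_vector_derivative - (of_real \<tau> * c' e)) (at e)"
    by (intro has_vector_derivative_minus has_vector_derivative_mult_right der)
   from field_vector_diff_chain_at[OF this DERIV_exp]
   have "((\<lambda>e. exp (- (of_real \<tau> * c e))) has_vector_derivative - (of_real \<tau> * c' e) * exp (- (of_real \<tau> * c e))) (at e)"
    by (simp add: o_def)
   then have "((\<lambda>e. pk s \<tau> *\<^sub>R (1 - exp (- (of_real \<tau> * c e)))) has_vector_derivative
    pk s \<tau> *\<^sub>R (0 - - (of_real \<tau> * c' e) * exp (- (of_real \<tau> * c e)))) (at e)"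
    by (intro bounded_linear.has_vector_derivative[OF bounded_linear_scaleR_right] has_vector_derivative_diff has_vector_derivative_const)
   then show ?thesis by simp
  qed
  show "cmod (pk s \<tau> *\<^sub>R (of_real \<tau> * c' e * exp (- (of_real \<tau> * c e)))) \<le> K * (pk s \<tau> * min 1 \<tau>)"
  proof (cases "\<tau> > 0")
   case True
   have "cmod (exp (- (of_real \<tau> * c e))) \<le> exp (- (\<tau> * m))"
    using True d(2)[OF e] by (simp add: norm_exp_eq_Re)
   then have "\<tau> * cmod (exp (- (of_real \<tau> * c e))) \<le> \<tau> * exp (- (\<tau> * m))" using True by simp
   also have "\<dots> \<le> (1 + 1 / m) * min 1 \<tau>"
   proof -
    have 1: "\<tau> * exp (- (\<tau> * m)) \<le> \<tau>" using True m by simp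
    have "\<tau> * m \<le> exp (\<tau> * m)" using exp_ge_add_one_self[of "\<tau> * m"] by linarith
    then have "\<tau> * m * exp (- (\<tau> * m)) \<le> 1" by (simp add: exp_minus field_simps)
    then have 2: "\<tau> * exp (- (\<tau> * m)) \<le> 1 / m" using m by (simp add: field_simps)
    have 3: "0 \<le> 1 / m" "0 \<le> \<tau> / m" using m True by auto
    show ?thesis
    proof (cases "\<tau> \<le> 1")
     case True
     then have "(1 + 1 / m) * min 1 \<tau> = \<tau> + \<tau> / m" by (simp add: min_def algebra_simps)
     then show ?thesis using 1 3 by linarith
    next
     case False
     then have "(1 + 1 / m) * min 1 \<tau> = 1 + 1 / m" by (simp add: min_def)
     then show ?thesis using 2 by linarith
    qed
   qed
   finally have t: "\<tau> * cmod (exp (- (of_real \<tau> * c e))) \<le> (1 + 1 / m) * min 1 \<tau>" .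
   have "cmod (pk s \<tau> *\<^sub>R (of_real \<tau> * c' e * exp (- (of_real \<tau> * c e)))) = pk s \<tau> * (cmod (c' e) * (\<tau> * cmod (exp (- (of_real \<tau> * c e)))))"
    using True pk_nonneg[of s \<tau>] by (simp add: norm_mult)
   also have "\<dots> \<le> pk s \<tau> * ((cmod (c' e0) + 1) * ((1 + 1 / m) * min 1 \<tau>))"
    using d(3)[OF e] True by (intro mult_left_mono mult_mono t pk_nonneg) auto
   finally show ?thesis by (simp add: K_def mult_ac)
  qed (simp add: pk_def)
 next
  show "integrable lborel (\<lambda>\<tau>. K * (pk s \<tau> * min 1 \<tau>))"
   by (intro integrable_mult_right pk_integrable s)
 qed measurable
 moreover have "(LINT \<tau>|lborel. pk s \<tau> *\<^sub>R (of_real \<tau> * c' e0 * exp (- (of_real \<tau> * c e0)))) = c' e0 * pkint' s (c e0)"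
  unfolding pkint'_def by (subst integral_mult_right_zero[symmetric]) (simp add: scaleR_conv_of_real mult_ac)
 ultimately show ?thesis unfolding pkint_def by simp
qed

text \<open>Homogeneity under positive factors, differentiated along a ray, gives Euler's relation
  \<open>\<sigma> * pkint' s \<sigma> = s * pkint s \<sigma>\<close> in the whole half plane. By it
  the quotient of \<open>pkint\<close> and the power is constant along the path
  \<open>exp (e * L)\<close>, which joins 1 to \<open>\<sigma>\<close> inside the half plane because
  the logarithm has imaginary part below \<open>pi / 2\<close> in modulus.\<close>

lemma pkint_powr:
 assumes s: "0 < s" "s < 1" and \<sigma>: "0 < Re \<sigma>"
 shows "pkint s \<sigma> = \<sigma> powr (of_real s) * pkint s 1"
proof -
 have euler: "\<sigma> * pkint' s \<sigma> = of_real s * pkint s \<sigma>" if "0 < Re \<sigma>" for \<sigma>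
 proof -
  have "((\<lambda>e. pkint s (of_real e * \<sigma>)) has_vector_derivative \<sigma> * pkint' s (of_real 1 * \<sigma>)) (at 1)"
  proof (rule pkint_curve_deriv[OF s, where c' = "\<lambda>_. \<sigma>"])
   show "((\<lambda>e. of_real e * \<sigma>) has_vector_derivative \<sigma>) (at e)" for e
    by (auto intro!: derivative_eq_intros simp: has_vector_derivative_def scaleR_conv_of_real)
  qed (use that in auto)
  moreover have "((\<lambda>e. of_real (e powr s) * pkint s \<sigma>) has_vector_derivative of_real (s * 1 powr (s - 1)) * pkint s \<sigma>) (at 1)"
   by (intro has_vector_derivative_mult_left has_vector_derivative_of_real has_real_derivative_powr) simp
  then have "((\<lambda>e. pkint s (of_real e * \<sigma>)) has_vector_derivative of_real (s * 1 powr (s - 1)) * pkint s \<sigma>) (at 1)"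
   by (rule has_vector_derivative_transform_within_open[where S = "{0<..}"]) (auto simp: pkint_scale)
  ultimately show ?thesis using vector_derivative_unique_at by fastforce
 qed
 define L where "L = Ln \<sigma>"
 have \<sigma>0: "\<sigma> \<noteq> 0" using \<sigma> by auto
 have eL: "exp L = \<sigma>" unfolding L_def using \<sigma>0 by simp
 have L: "\<bar>Im L\<bar> < pi / 2" unfolding L_def using \<sigma> Re_Ln_pos_lt[OF \<sigma>0] by simp
 have pos: "0 < Re (exp (of_real e * L))" if "0 \<le> e" "e \<le> 1" for e :: real
 proof -
  have "\<bar>e * Im L\<bar> < pi / 2"
  proof -
   have "\<bar>e * Im L\<bar> \<le> 1 * \<bar>Im L\<bar>" unfolding abs_mult using that by (intro mult_right_mono) auto
   then show ?thesis using L by simp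
  qed
  then show ?thesis by (simp add: Re_exp cos_gt_zero_pi abs_less_iff)
 qed
 have dz: "((\<lambda>e. pkint s (exp (of_real e * L)) * exp (- (of_real s * (of_real e * L)))) has_vector_derivative 0) (at e)"
  if "0 \<le> e" "e \<le> 1" for e :: real
 proof -
  have d1: "((\<lambda>e. exp (of_real e * L)) has_vector_derivative L * exp (of_real e * L)) (at e)" for e
   using exp_scaleR_has_vector_derivative_right[of L e UNIV] by (simp add: scaleR_conv_of_real mult.commute)
  have d2: "((\<lambda>e. exp (- (of_real s * (of_real e * L)))) has_vector_derivative - (of_real s * L) * exp (- (of_real s * (of_real e * L)))) (at e)" for e
   using exp_scaleR_has_vector_derivative_right[of "- (of_real s * L)" e UNIV] by (simp add: scaleR_conv_of_real mult_ac)
  have g: "((\<lambda>e. pkint s (exp (of_real e * L))) has_vector_derivative (L * exp (of_real e * L)) * pkint' s (exp (of_real e * L))) (at e)"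
   by (rule pkint_curve_deriv[OF s pos[OF that] d1]) (intro continuous_intros)
  have g': "(L * exp (of_real e * L)) * pkint' s (exp (of_real e * L)) = L * of_real s * pkint s (exp (of_real e * L))"
   using euler[OF pos[OF that]] by (simp add: mult.assoc)
  show ?thesis
  proof -
   have z: "a * (- b * c) + d * c = 0" if "d = b * a" for a b c d :: complex using that by algebra
   have "((\<lambda>e. pkint s (exp (of_real e * L)) * exp (- (of_real s * (of_real e * L)))) has_vector_derivative
    pkint s (exp (of_real e * L)) * (- (of_real s * L) * exp (- (of_real s * (of_real e * L)))) +
    L * of_real s * pkint s (exp (of_real e * L)) * exp (- (of_real s * (of_real e * L)))) (at e)"
    by (rule has_vector_derivative_mult[OF g[unfolded g'] d2])
   moreover have "L * of_real s * pkint s (exp (of_real e * L)) = of_real s * L * pkint s (exp (of_real e * L))"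
    by (simp only: mult.commute)
   ultimately show ?thesis by (simp only: z)
  qed
 qed
 define P where "P e = pkint s (exp (of_real e * L)) * exp (- (of_real s * (of_real e * L)))" for e :: real
 have "(P has_vector_derivative 0) (at e within {0..1})" if "e \<in> {0..1}" for e
  unfolding P_def[abs_def] by (rule has_vector_derivative_at_within, rule dz) (use that in auto)
 then obtain k where k: "\<And>e. e \<in> {0..1} ==> P e = k"
  using has_vector_derivative_zero_constant[of "{0..1}" P] by (metis convex_real_interval(5))
 have "P 1 = P 0" using k[of 0] k[of 1] by simp
 then have "pkint s \<sigma> * exp (- (of_real s * L)) = pkint s 1" using eL by (simp add: P_def)
 then show ?thesis using \<sigma>0 by (simp add: powr_def L_def exp_minus field_simps)
qed

definition pkc :: "real => real" where
 "pkc s = (LINT \<tau>|lborel. pk s \<tau> * (1 - exp (- \<tau>)))"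

lemma pkint_1: "pkint s 1 = of_real (pkc s)"
 unfolding pkint_def pkc_def integral_complex_of_real[symmetric]
 by (simp add: scaleR_conv_of_real exp_of_real[symmetric])

lemma pk_exp_real:
 assumes s: "0 < s" "s < 1" and "0 < l"
 shows "integrable lborel (\<lambda>\<tau>. pk s \<tau> * (1 - exp (- (l * \<tau>))))"
  and "(LINT \<tau>|lborel. pk s \<tau> * (1 - exp (- (l * \<tau>)))) = l powr s * pkc s"
proof -
 have "integrable lborel (\<lambda>\<tau>. Re (pk s \<tau> *\<^sub>R (1 - exp (- (of_real \<tau> * of_real l)))))"
  by (intro integrable_Re pk_integrable_exp s) (use assms in simp)
 then show "integrable lborel (\<lambda>\<tau>. pk s \<tau> * (1 - exp (- (l * \<tau>))))"
  by (simp add: Re_exp mult.commute)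
 show "(LINT \<tau>|lborel. pk s \<tau> * (1 - exp (- (l * \<tau>)))) = l powr s * pkc s"
  unfolding pkc_def using pk_scale[of l s "\<lambda>\<tau>. 1 - exp (- \<tau>)"] assms by simp
qed

lemma pkc_pos:
 assumes s: "0 < s" "s < 1" shows "0 < pkc s"
proof -
 have i: "integrable lborel (\<lambda>\<tau>. pk s \<tau> * (1 - exp (- \<tau>)))" using pk_exp_real(1)[OF s, of 1] by simp
 have nn: "0 \<le> pk s \<tau> * (1 - exp (- \<tau>))" for \<tau>
  by (cases "\<tau> > 0") (auto simp: pk_def)
 have "0 \<le> pkc s" unfolding pkc_def by (intro integral_nonneg_AE AE_I2 nn)
 moreover have "pkc s \<noteq> 0"
 proof
  assume "pkc s = 0"
  then have "AE \<tau> in lborel. pk s \<tau> * (1 - exp (- \<tau>)) = 0"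
   using integral_nonneg_eq_0_iff_AE[OF i] nn by (auto simp: pkc_def)
  then have "AE \<tau> in lborel. \<not> (0 < \<tau> \<and> \<tau> < (1::real))"
   by (rule eventually_mono) (auto simp: pk_def)
  then have "emeasure lborel {0<..<1::real} = 0"
   by (subst (asm) AE_iff_measurable[where N = "{0<..<1}"]) auto
  then show False by simp
 qed
 ultimately show ?thesis by simp
qed

section \<open>The Lax--Milgram lemma on a space with a seminorm\<close>

text \<open>Elements are functions rather than classes, so \<open>ip\<close> is only semidefinite,
  and completeness provides some limit without uniqueness.\<close>

locale semi_hilbert =
 fixes V :: "('z => complex) set" and ip :: "('z => complex) => ('z => complex) => complex"
 assumes V_add: "\<And>u w. u \<in> V ==> w \<in> V ==> (\<lambda>z. u z + w z) \<in> V"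
  and V_cmult: "\<And>u c. u \<in> V ==> (\<lambda>z. c * u z) \<in> V"
  and V_0: "(\<lambda>z. 0) \<in> V"
  and ip_add: "\<And>u v w. u \<in> V ==> v \<in> V ==> w \<in> V ==> ip (\<lambda>z. u z + v z) w = ip u w + ip v w"
  and ip_cmult: "\<And>u w c. u \<in> V ==> w \<in> V ==> ip (\<lambda>z. c * u z) w = c * ip u w"
  and ip_cnj: "\<And>u w. u \<in> V ==> w \<in> V ==> ip w u = cnj (ip u w)"
  and ip_nonneg: "\<And>u. u \<in> V ==> 0 \<le> Re (ip u u)"
  and ip_complete: "\<And>X. (\<And>k::nat. X k \<in> V) ==>
   (\<And>e. e > 0 ==> \<exists>N. \<forall>m\<ge>N. \<forall>n\<ge>N. Re (ip (\<lambda>z. X m z - X n z) (\<lambda>z. X m z - X n z)) < e) ==>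
   \<exists>x\<in>V. (\<lambda>k. Re (ip (\<lambda>z. X k z - x z) (\<lambda>z. X k z - x z))) \<longlonglongrightarrow> 0"
begin

definition Q :: "('z => complex) => real" where "Q u = Re (ip u u)"

lemma V_diff: "u \<in> V ==> w \<in> V ==> (\<lambda>z. u z - w z) \<in> V"
 using V_add[of u "\<lambda>z. (-1) * w z"] V_cmult[of w "-1"] by simp

lemma ip_add_right: "u \<in> V ==> v \<in> V ==> w \<in> V ==> ip u (\<lambda>z. v z + w z) = ip u v + ip u w"
 using ip_cnj[of "\<lambda>z. v z + w z" u] ip_cnj[of v u] ip_cnj[of w u] by (simp add: V_add ip_add)

lemma ip_cmult_right: "u \<in> V ==> w \<in> V ==> ip u (\<lambda>z. c * w z) = cnj c * ip u w"
 using ip_cnj[of "\<lambda>z. c * w z" u] ip_cnj[of w u] by (simp add: V_cmult ip_cmult)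

lemma ip_diff: "u \<in> V ==> v \<in> V ==> w \<in> V ==> ip (\<lambda>z. u z - v z) w = ip u w - ip v w"
 using ip_add[of u "\<lambda>z. (-1) * v z" w] ip_cmult[of v w "-1"] V_cmult[of v "-1"] by simp

lemma Q_nonneg: "u \<in> V ==> 0 \<le> Q u" by (simp add: Q_def ip_nonneg)

lemma Q_expand:
 assumes "u \<in> V" "w \<in> V"
 shows "Q (\<lambda>z. u z + of_real t * w z) = Q u + 2 * t * Re (ip u w) + t\<^sup>2 * Q w"
proof -
 have tw: "(\<lambda>z. of_real t * w z) \<in> V" by (rule V_cmult[OF assms(2)])
 have "ip (\<lambda>z. u z + of_real t * w z) (\<lambda>z. u z + of_real t * w z) =
   ip u u + of_real t * ip u w + (of_real t * ip w u + of_real t * (of_real t * ip w w))"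
  using assms tw by (simp add: ip_add ip_add_right V_add ip_cmult ip_cmult_right)
 moreover have "Re (ip w u) = Re (ip u w)" using ip_cnj[OF assms] by simp
 ultimately show ?thesis by (simp add: Q_def power2_eq_square)
qed

lemma nonneg_quadratic:
 fixes a b c :: real
 assumes "\<And>t. 0 \<le> a + 2 * t * b + t\<^sup>2 * c" "0 \<le> c" shows "b\<^sup>2 \<le> a * c"
proof (cases "c = 0")
 case True
 have "b = 0"
 proof (rule ccontr)
  assume "b \<noteq> 0"
  with assms(1)[of "- (a + 1) / (2 * b)"] True show False by (simp add: field_simps)
 qed
 then show ?thesis using True by simp
next
 case False
 then have c: "c > 0" using assms(2) by simp
 have "0 \<le> (a + 2 * (- b / c) * b + (- b / c)\<^sup>2 * c) * c"
  using assms(1)[of "- b / c"] c by (intro mult_nonneg_nonneg) auto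
 also have "\<dots> = a * c - b\<^sup>2" using c by (simp add: field_simps power2_eq_square)
 finally show ?thesis by simp
qed

lemma ip_CS: assumes "u \<in> V" "w \<in> V" shows "(Re (ip u w))\<^sup>2 \<le> Q u * Q w"
proof (rule nonneg_quadratic[OF _ Q_nonneg[OF assms(2)]])
 fix t
 have "0 \<le> Q (\<lambda>z. u z + of_real t * w z)" by (intro Q_nonneg V_add V_cmult assms)
 then show "0 \<le> Q u + 2 * t * Re (ip u w) + t\<^sup>2 * Q w" by (simp only: Q_expand[OF assms])
qed

text \<open>Dirichlet principle: minimise \<open>Q w - 2 * Re (l w)\<close>. A midpoint argument
  makes minimising sequences Cauchy, and the first variation at the limit gives the real part of the
  identity; the imaginary part follows by passing from \<open>w\<close> to
  \<open>\<i> * w\<close>.\<close>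

theorem riesz:
 assumes add: "\<And>u w. u \<in> V ==> w \<in> V ==> l (\<lambda>z. u z + w z) = l u + l w"
  and cmult: "\<And>u c. u \<in> V ==> l (\<lambda>z. c * u z) = c * l u"
  and bd: "\<And>u. u \<in> V ==> (cmod (l u))\<^sup>2 \<le> K * Q u" and K: "0 \<le> K"
 shows "\<exists>x\<in>V. \<forall>w\<in>V. l w = ip w x"
proof -
 define J where "J w = Q w - 2 * Re (l w)" for w
 have Jb: "- K \<le> J w" if w: "w \<in> V" for w
 proof -
  have "\<bar>Re (l w)\<bar>\<^sup>2 \<le> (cmod (l w))\<^sup>2" by (intro power_mono abs_Re_le_cmod) simp
  then have a: "(2 * Re (l w))\<^sup>2 \<le> 4 * (K * Q w)" using bd[OF w] by (simp add: power_mult_distrib)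
  show ?thesis
  proof (rule ccontr)
   assume "\<not> - K \<le> J w"
   then have lt: "K + Q w < 2 * Re (l w)" by (simp add: J_def)
   have "(K + Q w)\<^sup>2 < (2 * Re (l w))\<^sup>2" using lt K Q_nonneg[OF w] by (intro power_strict_mono) auto
   then have "(K + Q w)\<^sup>2 < 4 * (K * Q w)" using a by linarith
   moreover have "(K + Q w)\<^sup>2 - 4 * (K * Q w) = (K - Q w)\<^sup>2" by (simp add: power2_eq_square algebra_simps)
   moreover have "0 \<le> (K - Q w)\<^sup>2" by simp
   ultimately show False by linarith
  qed
 qed
 have Jexp: "J (\<lambda>z. x z + of_real t * w z) = J x + 2 * t * (Re (ip x w) - Re (l w)) + t\<^sup>2 * Q w"
  if "x \<in> V" "w \<in> V" for x w t
  using that by (simp add: J_def Q_expand add V_cmult cmult algebra_simps)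
 define m where "m = Inf (J ` V)"
 have bb: "bdd_below (J ` V)" using Jb by (intro bdd_belowI[of _ "- K"]) auto
 have mle: "m \<le> J w" if "w \<in> V" for w unfolding m_def using that bb by (intro cInf_lower) auto
 have "\<exists>x\<in>V. J x < m + 1 / real (Suc k)" for k
 proof (rule ccontr)
  assume "\<not> ?thesis"
  then have "m + 1 / real (Suc k) \<le> Inf (J ` V)" using V_0 by (intro cInf_greatest) (auto simp: not_less)
  then have "1 / real (Suc k) \<le> 0" by (simp add: m_def)
  then show False by simp
 qed
 then obtain X where X: "\<And>k. X k \<in> V" "\<And>k. J (X k) < m + 1 / real (Suc k)" by metis
 have par: "Q (\<lambda>z. b z - a z) \<le> 2 * (J a - m) + 2 * (J b - m)" if "a \<in> V" "b \<in> V" for a b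
 proof -
  define w where "w z = b z - a z" for z
  have w: "w \<in> V" unfolding w_def[abs_def] by (rule V_diff[OF that(2,1)])
  \<comment> \<open>The midpoint of \<open>a\<close> and \<open>b\<close> competes in the infimum;
    eliminating the linear term between this and the expansion of \<open>J b\<close> leaves
    \<open>Q w\<close>.\<close>
  have "m \<le> J (\<lambda>z. a z + of_real (1/2) * w z)" by (intro mle V_add that V_cmult w)
  also have "\<dots> = J a + (Re (ip a w) - Re (l w)) + Q w / 4"
   using Jexp[OF that(1) w, of "1/2"] by (simp add: power2_eq_square)
  finally have 1: "m \<le> J a + (Re (ip a w) - Re (l w)) + Q w / 4" .
  have "J b = J a + 2 * (Re (ip a w) - Re (l w)) + Q w"
   using Jexp[OF that(1) w, of 1] by (simp add: w_def)
  with 1 have "Q w \<le> 2 * (J a - m) + 2 * (J b - m)" by (simp add: field_simps)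
  then show ?thesis by (simp add: w_def[abs_def])
 qed
 have cau: "\<exists>N. \<forall>i\<ge>N. \<forall>j\<ge>N. Re (ip (\<lambda>z. X i z - X j z) (\<lambda>z. X i z - X j z)) < e" if e: "0 < e" for e :: real
 proof -
  obtain N where N: "1 / real (Suc N) < e / 4" using e by (metis nat_approx_posE zero_less_divide_iff zero_less_numeral)
  have "Re (ip (\<lambda>z. X i z - X j z) (\<lambda>z. X i z - X j z)) < e" if ij: "i \<ge> N" "j \<ge> N" for i j
  proof -
   have s: "J (X k) - m < e / 4" if "k \<ge> N" for k
   proof -
    have "1 / real (Suc k) \<le> 1 / real (Suc N)" using that by (intro divide_left_mono) auto
    then show ?thesis using X(2)[of k] N by linarith
   qed
   show ?thesis using par[OF X(1)[of j] X(1)[of i]] s[OF ij(1)] s[OF ij(2)] by (simp add: Q_def)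
  qed
  then show ?thesis by blast
 qed
 obtain x where x: "x \<in> V" and lim: "(\<lambda>k. Q (\<lambda>z. X k z - x z)) \<longlonglongrightarrow> 0"
  unfolding Q_def using ip_complete[OF X(1) cau] by blast
 have re: "Re (l w) = Re (ip w x)" if w: "w \<in> V" for w
 proof -
  define D where "D = Re (ip x w) - Re (l w)"
  have l1: "(\<lambda>k. Re (ip (X k) w)) \<longlonglongrightarrow> Re (ip x w)"
  proof -
   have "(\<lambda>k. sqrt (Q (\<lambda>z. X k z - x z) * Q w)) \<longlonglongrightarrow> sqrt (0 * Q w)" by (intro tendsto_intros lim)
   then have l0: "(\<lambda>k. sqrt (Q (\<lambda>z. X k z - x z) * Q w)) \<longlonglongrightarrow> 0" by simp
   have "\<bar>Re (ip (X k) w) - Re (ip x w)\<bar> \<le> sqrt (Q (\<lambda>z. X k z - x z) * Q w)" for k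
    using ip_CS[OF V_diff[OF X(1)[of k] x] w] ip_diff[OF X(1)[of k] x w] by (intro real_le_rsqrt) simp
   then have "(\<lambda>k. Re (ip (X k) w) - Re (ip x w)) \<longlonglongrightarrow> 0"
    by (intro Lim_null_comparison[OF _ l0]) auto
   then show ?thesis by (simp add: LIM_zero_iff)
  qed
  \<comment> \<open>The variation is taken at \<open>X k\<close>, which misses the infimum by less
    than \<open>1 / (k + 1)\<close>. In the limit the constant term is 0, so the discriminant forces
    \<open>D = 0\<close>.\<close>
  have "0 \<le> 0 + 2 * t * D + t\<^sup>2 * Q w" for t
  proof (rule LIMSEQ_le_const)
   show "(\<lambda>k. 1 / real (Suc k) + 2 * t * (Re (ip (X k) w) - Re (l w)) + t\<^sup>2 * Q w) \<longlonglongrightarrow> 0 + 2 * t * D + t\<^sup>2 * Q w"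
    unfolding D_def using LIMSEQ_inverse_real_of_nat by (intro tendsto_intros l1) (simp add: inverse_eq_divide)
   have "0 \<le> 1 / real (Suc k) + 2 * t * (Re (ip (X k) w) - Re (l w)) + t\<^sup>2 * Q w" for k
   proof -
    have "m \<le> J (\<lambda>z. X k z + of_real t * w z)" by (intro mle V_add X V_cmult w)
    then show ?thesis using X(2)[of k] unfolding Jexp[OF X(1) w] by linarith
   qed
   then show "\<exists>N. \<forall>k\<ge>N. 0 \<le> 1 / real (Suc k) + 2 * t * (Re (ip (X k) w) - Re (l w)) + t\<^sup>2 * Q w" by blast
  qed
  from nonneg_quadratic[OF this Q_nonneg[OF w]] have "D = 0" by simp
  then show ?thesis using ip_cnj[OF x w] by (simp add: D_def)
 qed
 have "l w = ip w x" if w: "w \<in> V" for w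
 proof (rule complex_eqI)
  show "Re (l w) = Re (ip w x)" by (rule re[OF w])
  show "Im (l w) = Im (ip w x)"
   using re[OF V_cmult[OF w, of \<i>]] by (simp add: cmult w ip_cmult x)
 qed
 with x show ?thesis by blast
qed

end

text \<open>
 The Babuska form of the Lax--Milgram lemma: \<open>B u w = ip u (A w)\<close> with \<open>A\<close> bounded below, so that
 \<open>ip (A w) (A w')\<close> is an equivalent inner product, for which the functional is representable.
\<close>

theorem (in semi_hilbert) lax_milgram:
 assumes B_add_left: "\<And>u v w. u \<in> V ==> v \<in> V ==> w \<in> V ==> B (\<lambda>z. u z + v z) w = B u w + B v w"
  and B_cmult_left: "\<And>u w c. u \<in> V ==> w \<in> V ==> B (\<lambda>z. c * u z) w = c * B u w"
  and B_add_right: "\<And>u v w. u \<in> V ==> v \<in> V ==> w \<in> V ==> B u (\<lambda>z. v z + w z) = B u v + B u w"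
  and B_cmult_right: "\<And>u w c. u \<in> V ==> w \<in> V ==> B u (\<lambda>z. c * w z) = cnj c * B u w"
  and B_bd: "\<And>u w. u \<in> V ==> w \<in> V ==> (cmod (B u w))\<^sup>2 \<le> K * Q u * Q w" and K: "0 \<le> K"
  and coer: "\<And>w. w \<in> V ==> \<exists>u\<in>V. Q u \<le> C * Q w \<and> Q w \<le> Re (B u w)" and C: "0 < C"
  and l_add: "\<And>u w. u \<in> V ==> w \<in> V ==> l (\<lambda>z. u z + w z) = l u + l w"
  and l_cmult: "\<And>u c. u \<in> V ==> l (\<lambda>z. c * u z) = cnj c * l u"
  and l_bd: "\<And>u. u \<in> V ==> (cmod (l u))\<^sup>2 \<le> K' * Q u" and K': "0 \<le> K'"
 shows "\<exists>u\<in>V. \<forall>w\<in>V. B u w = l w"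
proof -
 have "\<exists>a\<in>V. \<forall>u\<in>V. B u w = ip u a" if w: "w \<in> V" for w
 proof (rule riesz[where K = "K * Q w"])
  show "(cmod (B u w))\<^sup>2 \<le> K * Q w * Q u" if "u \<in> V" for u
   using B_bd[OF that w] by (simp add: mult_ac)
 qed (use w B_add_left B_cmult_left K Q_nonneg in auto)
 then obtain A where A: "\<And>w. w \<in> V ==> A w \<in> V" and BA: "\<And>u w. u \<in> V ==> w \<in> V ==> B u w = ip u (A w)"
  by metis
 have low: "Q w \<le> C * Q (A w)" if w: "w \<in> V" for w
 proof (cases "Q w = 0")
  case True then show ?thesis using C Q_nonneg[OF A[OF w]] by simp
 next
  case False
  then have pos: "0 < Q w" using Q_nonneg[OF w] by simp
  obtain u where u: "u \<in> V" "Q u \<le> C * Q w" "Q w \<le> Re (B u w)" using coer[OF w] by blast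
  have "(Q w)\<^sup>2 \<le> (Re (ip u (A w)))\<^sup>2" using u(3) pos unfolding BA[OF u(1) w] by (intro power_mono) auto
  also have "\<dots> \<le> Q u * Q (A w)" by (rule ip_CS[OF u(1) A[OF w]])
  also have "\<dots> \<le> (C * Q w) * Q (A w)" by (intro mult_right_mono u Q_nonneg A w)
  finally have "Q w * Q w \<le> Q w * (C * Q (A w))" by (simp add: power2_eq_square mult_ac)
  then show ?thesis using pos by simp
 qed
 have up: "Q (A w) \<le> K * Q w" if w: "w \<in> V" for w
 proof (cases "Q (A w) = 0")
  case True then show ?thesis using K Q_nonneg[OF w] by simp
 next
  case False
  then have pos: "0 < Q (A w)" using Q_nonneg[OF A[OF w]] by simp
  have "Q (A w) = Re (B (A w) w)" unfolding BA[OF A[OF w] w] Q_def ..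
  then have "Q (A w) \<le> cmod (B (A w) w)" by (simp add: complex_Re_le_cmod)
  then have "(Q (A w))\<^sup>2 \<le> (cmod (B (A w) w))\<^sup>2" using pos by (intro power_mono) auto
  also have "\<dots> \<le> K * Q (A w) * Q w" by (rule B_bd[OF A[OF w] w])
  finally have "Q (A w) * Q (A w) \<le> Q (A w) * (K * Q w)" by (simp add: power2_eq_square mult_ac)
  then show ?thesis using pos by simp
 qed
 define ip2 where "ip2 w w' = ip (A w) (A w')" for w w'
 \<comment> \<open>\<open>A\<close> is chosen separately for each \<open>w\<close>, hence linear
   only up to null vectors. Written through \<open>B\<close>, the new product is linear on the
   nose.\<close>
 have cnj2: "ip2 w w' = cnj (B (A w') w)" if "w \<in> V" "w' \<in> V" for w w'
  unfolding ip2_def BA[OF A[OF that(2)] that(1)] by (rule ip_cnj[OF A[OF that(2)] A[OF that(1)]])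
 interpret H: semi_hilbert V ip2
 proof
  fix u v w assume "u \<in> V" "v \<in> V" "w \<in> V"
  then show "ip2 (\<lambda>z. u z + v z) w = ip2 u w + ip2 v w"
   by (simp add: cnj2 V_add B_add_right A)
 next
  fix u w c assume "u \<in> V" "w \<in> V"
  then show "ip2 (\<lambda>z. c * u z) w = c * ip2 u w"
   by (simp add: cnj2 V_cmult B_cmult_right A)
 next
  fix u w assume "u \<in> V" "w \<in> V"
  then show "ip2 w u = cnj (ip2 u w)" unfolding ip2_def by (intro ip_cnj A)
 next
  fix u assume "u \<in> V" then show "0 \<le> Re (ip2 u u)" unfolding ip2_def by (intro ip_nonneg A)
 next
  fix X :: "nat => 'z => complex"
  assume X: "\<And>k. X k \<in> V"
   and cau: "\<And>e. e > 0 ==> \<exists>N. \<forall>m\<ge>N. \<forall>n\<ge>N. Re (ip2 (\<lambda>z. X m z - X n z) (\<lambda>z. X m z - X n z)) < e"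
  have e2: "Re (ip2 w w) = Q (A w)" for w by (simp add: ip2_def Q_def)
  have "\<exists>N. \<forall>m\<ge>N. \<forall>n\<ge>N. Re (ip (\<lambda>z. X m z - X n z) (\<lambda>z. X m z - X n z)) < e" if e: "e > 0" for e
  proof -
   obtain N where N: "\<And>m n. m \<ge> N ==> n \<ge> N ==> Q (A (\<lambda>z. X m z - X n z)) < e / C"
    using cau[of "e / C"] e C unfolding e2 by auto
   have "Re (ip (\<lambda>z. X m z - X n z) (\<lambda>z. X m z - X n z)) < e" if "m \<ge> N" "n \<ge> N" for m n
   proof -
    have "Q (\<lambda>z. X m z - X n z) \<le> C * Q (A (\<lambda>z. X m z - X n z))" by (intro low V_diff X)
    also have "\<dots> < C * (e / C)" using C N[OF that] by (intro mult_strict_left_mono) auto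
    finally show ?thesis using C by (simp add: Q_def)
   qed
   then show ?thesis by blast
  qed
  from ip_complete[OF X this] obtain x where x: "x \<in> V" "(\<lambda>k. Q (\<lambda>z. X k z - x z)) \<longlonglongrightarrow> 0"
   unfolding Q_def by blast
  have "(\<lambda>k. Re (ip2 (\<lambda>z. X k z - x z) (\<lambda>z. X k z - x z))) \<longlonglongrightarrow> 0"
  proof (rule Lim_null_comparison)
   show "(\<lambda>k. K * Q (\<lambda>z. X k z - x z)) \<longlonglongrightarrow> 0" using tendsto_mult_left[OF x(2), of K] by simp
   show "\<forall>\<^sub>F k in sequentially. norm (Re (ip2 (\<lambda>z. X k z - x z) (\<lambda>z. X k z - x z))) \<le> K * Q (\<lambda>z. X k z - x z)"
    unfolding e2 using up[OF V_diff[OF X x(1)]] Q_nonneg[OF A[OF V_diff[OF X x(1)]]] by simp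
  qed
  with x(1) show "\<exists>x\<in>V. (\<lambda>k. Re (ip2 (\<lambda>z. X k z - x z) (\<lambda>z. X k z - x z))) \<longlonglongrightarrow> 0" by blast
 qed (use V_add V_cmult V_0 in auto)
 have "\<exists>v\<in>V. \<forall>w\<in>V. cnj (l w) = ip2 w v"
 proof (rule H.riesz[where K = "K' * C"])
  fix u assume u: "u \<in> V"
  have "(cmod (l u))\<^sup>2 \<le> K' * Q u" by (rule l_bd[OF u])
  also have "\<dots> \<le> K' * (C * Q (A u))" by (intro mult_left_mono low u K')
  finally show "(cmod (cnj (l u)))\<^sup>2 \<le> K' * C * H.Q u" by (simp add: H.Q_def ip2_def Q_def mult.assoc)
 qed (use K' C l_add l_cmult in auto)
 then obtain v where v: "v \<in> V" "\<And>w. w \<in> V ==> cnj (l w) = ip2 w v" by blast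
 have "B (A v) w = l w" if "w \<in> V" for w
  using v(2)[OF that] cnj2[OF that v(1)] by simp
 then show ?thesis using A[OF v(1)] by blast
qed

section \<open>The heat kernel and the form as an integral over time shifts\<close>

definition hker :: "real => real ^ 'n::finite => real" where
 "hker \<tau> y = (1 / sqrt (4 * pi * \<tau>)) ^ CARD('n) * exp (- (norm y)\<^sup>2 / (4 * \<tau>))"

lemma measurable_hker [measurable]: "(\<lambda>x. hker (f x) (g x)) \<in> borel_measurable M"
 if [measurable]: "f \<in> borel_measurable M" "g \<in> borel_measurable M"
 unfolding hker_def by measurable

lemma hker_nonneg: "0 < \<tau> ==> 0 \<le> hker \<tau> y"
 by (simp add: hker_def)

lemma hker_fourier:
 fixes \<xi> :: "real ^ 'n::finite"
 assumes t: "0 < \<tau>"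
 shows "integrable lborel (\<lambda>y :: real ^ 'n. complex_of_real (hker \<tau> y))"
  and "FI (\<lambda>y. complex_of_real (hker \<tau> y)) \<xi> = of_real (exp (- (\<tau> * (norm \<xi>)\<^sup>2)))"
proof -
 define e where "e = 1 / (4 * \<tau>)"
 have e: "0 < e" using t by (simp add: e_def)
 define k where "k = (1 / sqrt (4 * pi * \<tau>)) ^ CARD('n)"
 have eq: "complex_of_real (hker \<tau> y) = of_real k * exp (- of_real (e * (norm y)\<^sup>2))" for y :: "real ^ 'n"
  by (simp add: hker_def k_def e_def exp_of_real[symmetric])
 show "integrable lborel (\<lambda>y :: real ^ 'n. complex_of_real (hker \<tau> y))"
  unfolding eq by (intro integrable_mult_right FI_gaussian(1) e)
 have p: "pi / e = 4 * pi * \<tau>" "4 * e = 1 / \<tau>" using t by (simp_all add: e_def)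
 have "FI (\<lambda>y. complex_of_real (hker \<tau> y)) \<xi> = of_real (k * (sqrt (pi / e) ^ DIM(real ^ 'n) * exp (- (norm \<xi>)\<^sup>2 / (4 * e))))"
  unfolding eq FI_cmult FI_gaussian(2)[OF e] by simp
 also have "k * (sqrt (pi / e) ^ DIM(real ^ 'n) * exp (- (norm \<xi>)\<^sup>2 / (4 * e))) = exp (- (\<tau> * (norm \<xi>)\<^sup>2))"
 proof -
  have "k * sqrt (pi / e) ^ DIM(real ^ 'n) = 1"
   unfolding k_def p(1) using t by (simp flip: power_mult_distrib)
  then show ?thesis unfolding p(2) by (simp flip: mult.assoc add: mult.commute)
 qed
 finally show "FI (\<lambda>y. complex_of_real (hker \<tau> y)) \<xi> = of_real (exp (- (\<tau> * (norm \<xi>)\<^sup>2)))" .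
qed

lemma hker_integral:
 assumes "0 < \<tau>"
 shows "integrable lborel (hker \<tau> :: real ^ 'n::finite => real)" "(LINT y|(lborel :: (real ^ 'n) measure). hker \<tau> y) = 1"
proof -
 show "integrable lborel (hker \<tau> :: real ^ 'n::finite => real)"
  using integrable_Re[OF hker_fourier(1)[OF assms]] by simp
 have "complex_of_real (LINT y|(lborel :: (real ^ 'n) measure). hker \<tau> y) = 1"
  using hker_fourier(2)[OF assms, of "0 :: real ^ 'n"] unfolding FI_def by simp
 then show "(LINT y|(lborel :: (real ^ 'n) measure). hker \<tau> y) = 1" by simp
qed

definition corr :: "('a::euclidean_space => complex) => ('a => complex) => 'a => complex" where
 "corr u w h = inprod lborel (\<lambda>z. u (z - h)) w"

text \<open>
 \<open>heat_diff u w \<tau>\<close> is \<open>(u - exp (- \<tau> (\<partial>\<^sub>t - \<Delta>\<^sub>x)) u, w)\<close>, written with the heat kernel.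
\<close>

definition heat_diff :: "('n::finite spacetime => complex) => ('n spacetime => complex) => real => complex" where
 "heat_diff u w \<tau> = inprod lborel u w - (LINT y|lborel. of_real (hker \<tau> y) * corr u w (\<tau>, y))"

lemma Re_heat_symbol: "Re (heat_symbol \<zeta>) = (norm (snd \<zeta>))\<^sup>2"
 by (cases \<zeta>) (simp add: heat_symbol_def)

lemma measurable_heat_symbol [measurable]: "heat_symbol \<in> borel_measurable borel"
proof -
 have "(\<lambda>\<zeta>::'n::finite spacetime. \<i> * complex_of_real (fst \<zeta>) + complex_of_real ((norm (snd \<zeta>))\<^sup>2)) \<in> borel_measurable borel"
  by (intro borel_measurable_continuous_onI continuous_intros)
 then show ?thesis unfolding heat_symbol_def by (simp add: case_prod_beta')
qed

text \<open>The principal power is continuous off the nonpositive real axis; the symbol meets that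
  axis only at 0, where the power has the value 0.\<close>

lemma measurable_heat_symbol_powr [measurable]:
 "(\<lambda>\<zeta> :: 'n::finite spacetime. heat_symbol \<zeta> powr a) \<in> borel_measurable borel"
proof -
 have "(\<lambda>z. if z \<in> - \<real>\<^sub>\<le>\<^sub>0 then z powr a else 0) \<in> borel_measurable borel"
  by (intro borel_measurable_continuous_on_if continuous_intros) (auto simp: complex_nonpos_Reals_iff)
 from measurable_compose[OF measurable_heat_symbol this]
 have "(\<lambda>\<zeta> :: 'n spacetime. if heat_symbol \<zeta> \<in> - \<real>\<^sub>\<le>\<^sub>0 then heat_symbol \<zeta> powr a else 0) \<in> borel_measurable borel" .
 also have "(\<lambda>\<zeta> :: 'n spacetime. if heat_symbol \<zeta> \<in> - \<real>\<^sub>\<le>\<^sub>0 then heat_symbol \<zeta> powr a else 0) = (\<lambda>\<zeta>. heat_symbol \<zeta> powr a)"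
 proof
  fix \<zeta> :: "'n spacetime"
  have "heat_symbol \<zeta> = 0" if "heat_symbol \<zeta> \<in> \<real>\<^sub>\<le>\<^sub>0"
   using that Re_heat_symbol[of \<zeta>] zero_le_power2[of "norm (snd \<zeta>)"]
   by (auto simp: complex_nonpos_Reals_iff complex_eq_iff)
  then show "(if heat_symbol \<zeta> \<in> - \<real>\<^sub>\<le>\<^sub>0 then heat_symbol \<zeta> powr a else 0) = heat_symbol \<zeta> powr a" by auto
 qed
 finally show ?thesis .
qed

lemma AE_heat_symbol_pos: "AE \<zeta> in (lborel :: 'n::finite spacetime measure). 0 < Re (heat_symbol \<zeta>)"
proof -
 obtain b :: "real ^ 'n" where b: "b \<in> Basis" by (meson SOME_Basis)
 have "negligible {z :: 'n spacetime. z \<bullet> (0, b) = 0}"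
  by (rule negligible_standard_hyperplane) (use b in \<open>simp add: Basis_prod_def\<close>)
 then have "AE z in lborel. (z :: 'n spacetime) \<notin> {z. z \<bullet> (0, b) = 0}"
  by (intro AE_not_in) (simp add: negligible_iff_null_sets null_sets_completion_iff)
 then show ?thesis
  by (rule eventually_mono) (auto simp: Re_heat_symbol inner_prod_def)
qed

text \<open>A shift by \<open>(\<tau>, y)\<close> multiplies the transform by a character; averaging
  the space part against the heat kernel turns it into
  \<open>exp (- \<tau> * heat_symbol \<zeta>)\<close>.\<close>

lemma heat_diff_fourier:
 fixes u w :: "'n::finite spacetime => complex"
 assumes u: "ft u U" and w: "ft w W" and t: "0 < \<tau>"
 shows "(2 * pi) ^ DIM('n spacetime) * heat_diff u w \<tau> =
  (LINT \<zeta>|lborel. (1 - exp (- (of_real \<tau> * heat_symbol \<zeta>))) * (U \<zeta> * cnj (W \<zeta>)))"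
proof -
 define P where "P \<zeta> = U \<zeta> * cnj (W \<zeta>)" for \<zeta>
 have iP: "integrable lborel P" unfolding P_def by (intro integrable_mult_cnj ftD[OF u] ftD[OF w])
 then have [measurable]: "P \<in> borel_measurable borel" by auto
 define c where "c = complex_of_real ((2 * pi) ^ DIM('n spacetime))"
 have ik: "integrable lborel (\<lambda>y :: real ^ 'n. complex_of_real (hker \<tau> y))" by (rule hker_fourier[OF t])
 have iF: "integrable (lborel \<Otimes>\<^sub>M lborel) (\<lambda>(y :: real ^ 'n, \<zeta>). exp (- (\<i> * of_real ((\<tau>, y) \<bullet> \<zeta>))) * (complex_of_real (hker \<tau> y) * P \<zeta>))"
  by (rule Bochner_Integration.integrable_bound[OF integrable_tensor[OF ik iP]]) (auto simp: norm_mult)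
 have "c * (LINT y|lborel. of_real (hker \<tau> y) * corr u w (\<tau>, y)) =
  (LINT y|lborel. of_real (hker \<tau> y) * (c * corr u w (\<tau>, y)))"
  by (subst integral_mult_right_zero[symmetric]) (simp add: mult_ac)
 also have "\<dots> = (LINT y|lborel. LINT \<zeta>|lborel. exp (- (\<i> * of_real ((\<tau>, y) \<bullet> \<zeta>))) * (complex_of_real (hker \<tau> y) * P \<zeta>))"
 proof (rule Bochner_Integration.integral_cong[OF refl])
  fix y :: "real ^ 'n"
  have "c * corr u w (\<tau>, y) = (LINT \<zeta>|lborel. exp (- (\<i> * of_real ((\<tau>, y) \<bullet> \<zeta>))) * P \<zeta>)"
   unfolding c_def corr_def P_def using inprod_translate_ft[OF u w, of "(\<tau>, y)"] by simp
  then show "of_real (hker \<tau> y) * (c * corr u w (\<tau>, y)) = (LINT \<zeta>|lborel. exp (- (\<i> * of_real ((\<tau>, y) \<bullet> \<zeta>))) * (complex_of_real (hker \<tau> y) * P \<zeta>))"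
   by (simp add: mult.left_commute)
 qed
 also have "\<dots> = (LINT \<zeta>|lborel. LINT y|lborel. exp (- (\<i> * of_real ((\<tau>, y) \<bullet> \<zeta>))) * (complex_of_real (hker \<tau> y) * P \<zeta>))"
  by (rule lborel_pair.Fubini_integral[OF iF, symmetric])
 also have "\<dots> = (LINT \<zeta>|lborel. exp (- (of_real \<tau> * heat_symbol \<zeta>)) * P \<zeta>)"
 proof (rule Bochner_Integration.integral_cong[OF refl])
  fix \<zeta> :: "'n spacetime"
  obtain \<rho> \<xi> where \<zeta>: "\<zeta> = (\<rho>, \<xi>)" by (cases \<zeta>)
  have "(LINT y|lborel. exp (- (\<i> * of_real ((\<tau>, y) \<bullet> \<zeta>))) * (complex_of_real (hker \<tau> y) * P \<zeta>)) =
   (LINT y|lborel. (exp (- (\<i> * of_real (\<tau> * \<rho>))) * P \<zeta>) * (exp (- (\<i> * of_real (y \<bullet> \<xi>))) * complex_of_real (hker \<tau> y)))"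
   by (rule Bochner_Integration.integral_cong[OF refl]) (simp add: \<zeta> exp_add distrib_left exp_diff exp_minus divide_inverse)
  also have "\<dots> = (exp (- (\<i> * of_real (\<tau> * \<rho>))) * P \<zeta>) * FI (\<lambda>y. complex_of_real (hker \<tau> y)) \<xi>"
   unfolding FI_def by (rule integral_mult_right_zero)
  also have "\<dots> = exp (- (of_real \<tau> * heat_symbol \<zeta>)) * P \<zeta>"
  proof -
   have "exp (- (\<i> * of_real (\<tau> * \<rho>))) * of_real (exp (- (\<tau> * (norm \<xi>)\<^sup>2))) = exp (- (of_real \<tau> * heat_symbol \<zeta>))"
    by (simp add: \<zeta> heat_symbol_def exp_of_real[symmetric] mult_exp_exp distrib_left mult_ac)
   then show ?thesis unfolding hker_fourier(2)[OF t] by (simp add: mult_ac)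
  qed
  finally show "(LINT y|lborel. exp (- (\<i> * of_real ((\<tau>, y) \<bullet> \<zeta>))) * (complex_of_real (hker \<tau> y) * P \<zeta>)) = exp (- (of_real \<tau> * heat_symbol \<zeta>)) * P \<zeta>" .
 qed
 finally have 1: "c * (LINT y|lborel. of_real (hker \<tau> y) * corr u w (\<tau>, y)) = (LINT \<zeta>|lborel. exp (- (of_real \<tau> * heat_symbol \<zeta>)) * P \<zeta>)" .
 have 2: "c * inprod lborel u w = (LINT \<zeta>|lborel. P \<zeta>)"
  using parseval[OF u w] unfolding c_def inprod_def P_def by simp
 have i: "integrable lborel (\<lambda>\<zeta>. exp (- (of_real \<tau> * heat_symbol \<zeta>)) * P \<zeta>)"
 proof (rule Bochner_Integration.integrable_bound[OF iP])
  show "AE \<zeta> in lborel. norm (exp (- (of_real \<tau> * heat_symbol \<zeta>)) * P \<zeta>) \<le> norm (P \<zeta>)"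
  proof (intro AE_I2)
   fix \<zeta> :: "'n spacetime"
   have "cmod (exp (- (of_real \<tau> * heat_symbol \<zeta>))) \<le> 1" using t by (simp add: norm_exp_eq_Re Re_heat_symbol)
   then show "norm (exp (- (of_real \<tau> * heat_symbol \<zeta>)) * P \<zeta>) \<le> norm (P \<zeta>)"
    unfolding norm_mult by (intro mult_left_le_one_le) auto
  qed
 qed measurable
 have "c * heat_diff u w \<tau> = (LINT \<zeta>|lborel. P \<zeta>) - (LINT \<zeta>|lborel. exp (- (of_real \<tau> * heat_symbol \<zeta>)) * P \<zeta>)"
  unfolding heat_diff_def right_diff_distrib 1 2 ..
 also have "\<dots> = (LINT \<zeta>|lborel. (1 - exp (- (of_real \<tau> * heat_symbol \<zeta>))) * P \<zeta>)"
  using iP i by (simp add: left_diff_distrib)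
 finally show ?thesis unfolding c_def P_def by simp
qed

text \<open>\<open>pkint_powr\<close> at the value of the symbol, with Fubini justified by the bound
  of order \<open>|\<sigma>|^s\<close> in \<open>pk_integrable_exp\<close>. This replaces a Fourier
  multiplier by an integral over positive shifts in time, from which both the weighted coercivity
  and the kernel for separated supports are read off.\<close>

theorem semigroup_formula:
 fixes u w :: "'n::finite spacetime => complex"
 assumes s: "0 < s" "s < 1" and u: "ft u U" and w: "ft w W"
  and P: "integrable lborel (\<lambda>\<zeta>. cmod (heat_symbol \<zeta>) powr s * cmod (U \<zeta> * cnj (W \<zeta>)))"
 shows "integrable lborel (\<lambda>\<tau>. pk s \<tau> *\<^sub>R heat_diff u w \<tau>)"
  and "(2 * pi) ^ DIM('n spacetime) * (LINT \<tau>|lborel. pk s \<tau> *\<^sub>R heat_diff u w \<tau>) =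
   of_real (pkc s) * (LINT \<zeta>|lborel. heat_symbol \<zeta> powr of_real s * (U \<zeta> * cnj (W \<zeta>)))"
proof -
 define p where "p \<zeta> = U \<zeta> * cnj (W \<zeta>)" for \<zeta>
 have iP: "integrable lborel p" unfolding p_def by (intro integrable_mult_cnj ftD[OF u] ftD[OF w])
 then have [measurable]: "p \<in> borel_measurable borel" by auto
 define c where "c = complex_of_real ((2 * pi) ^ DIM('n spacetime))"
 have c0: "c \<noteq> 0" by (simp add: c_def)
 define F where "F \<zeta> \<tau> = (pk s \<tau> *\<^sub>R (1 - exp (- (of_real \<tau> * heat_symbol \<zeta>)))) * p \<zeta>" for \<zeta> \<tau>
 define K where "K = (LINT \<tau>|lborel. pk s \<tau> * min 2 \<tau>)"
 have Re0: "0 \<le> Re (heat_symbol \<zeta>)" for \<zeta> :: "'n spacetime" by (simp add: Re_heat_symbol)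
 have i1: "integrable lborel (F \<zeta>)" for \<zeta>
  unfolding F_def by (intro integrable_mult_left pk_integrable_exp s Re0)
 have n1: "(LINT \<tau>|lborel. cmod (F \<zeta> \<tau>)) \<le> K * (cmod (heat_symbol \<zeta>) powr s * cmod (p \<zeta>))" for \<zeta>
 proof -
  have "(LINT \<tau>|lborel. cmod (F \<zeta> \<tau>)) = (LINT \<tau>|lborel. cmod (pk s \<tau> *\<^sub>R (1 - exp (- (of_real \<tau> * heat_symbol \<zeta>))))) * cmod (p \<zeta>)"
   unfolding F_def norm_mult by (rule integral_mult_left_zero)
  also have "\<dots> \<le> (K * cmod (heat_symbol \<zeta>) powr s) * cmod (p \<zeta>)"
   unfolding K_def by (intro mult_right_mono pk_integrable_exp(2) s Re0 norm_ge_zero)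
  finally show ?thesis by (simp add: mult_ac)
 qed
 have [measurable]: "case_prod F \<in> borel_measurable (lborel \<Otimes>\<^sub>M lborel)"
  unfolding F_def by measurable
 have iF: "integrable (lborel \<Otimes>\<^sub>M lborel) (case_prod F)"
 proof (rule lborel_pair.Fubini_integrable)
  show "integrable lborel (\<lambda>\<zeta>. LINT \<tau>|lborel. norm (case_prod F (\<zeta>, \<tau>)))"
  proof (rule Bochner_Integration.integrable_bound)
   show "integrable lborel (\<lambda>\<zeta>. K * (cmod (heat_symbol \<zeta>) powr s * cmod (p \<zeta>)))"
    using P by (simp add: p_def)
   show "AE \<zeta> in lborel. norm (LINT \<tau>|lborel. norm (case_prod F (\<zeta>, \<tau>))) \<le> norm (K * (cmod (heat_symbol \<zeta>) powr s * cmod (p \<zeta>)))"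
    using n1 by (intro AE_I2) (simp add: order_trans[OF _ abs_ge_self])
  qed measurable
 qed (use i1 in auto)
 have hd: "(LINT \<zeta>|lborel. F \<zeta> \<tau>) = c * (pk s \<tau> *\<^sub>R heat_diff u w \<tau>)" for \<tau>
 proof (cases "0 < \<tau>")
  case True
  have "(LINT \<zeta>|lborel. F \<zeta> \<tau>) = pk s \<tau> *\<^sub>R (LINT \<zeta>|lborel. (1 - exp (- (of_real \<tau> * heat_symbol \<zeta>))) * p \<zeta>)"
   unfolding F_def by (simp only: mult_scaleR_left integral_scaleR_right)
  also have "(LINT \<zeta>|lborel. (1 - exp (- (of_real \<tau> * heat_symbol \<zeta>))) * p \<zeta>) = c * heat_diff u w \<tau>"
   unfolding p_def c_def using heat_diff_fourier[OF u w True] by simp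
  finally show ?thesis by simp
 qed (simp add: F_def pk_def)
 have "integrable lborel (\<lambda>\<tau>. LINT \<zeta>|lborel. F \<zeta> \<tau>)" by (rule lborel_pair.integrable_snd[OF iF])
 then have "integrable lborel (\<lambda>\<tau>. (1 / c) * (c * (pk s \<tau> *\<^sub>R heat_diff u w \<tau>)))"
  unfolding hd by (rule integrable_mult_right)
 then show "integrable lborel (\<lambda>\<tau>. pk s \<tau> *\<^sub>R heat_diff u w \<tau>)" using c0 by simp
 have "c * (LINT \<tau>|lborel. pk s \<tau> *\<^sub>R heat_diff u w \<tau>) = (LINT \<tau>|lborel. LINT \<zeta>|lborel. F \<zeta> \<tau>)"
  unfolding hd by (rule integral_mult_right_zero[symmetric])
 also have "\<dots> = (LINT \<zeta>|lborel. LINT \<tau>|lborel. F \<zeta> \<tau>)" by (rule lborel_pair.Fubini_integral[OF iF])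
 also have "\<dots> = (LINT \<zeta>|lborel. pkint s (heat_symbol \<zeta>) * p \<zeta>)"
  unfolding F_def pkint_def integral_mult_left_zero ..
 also have "\<dots> = (LINT \<zeta>|lborel. of_real (pkc s) * (heat_symbol \<zeta> powr of_real s * p \<zeta>))"
 proof (rule integral_cong_AE)
  have "(\<lambda>\<zeta>. LINT \<tau>|lborel. F \<zeta> \<tau>) \<in> borel_measurable lborel" by measurable
  then show "(\<lambda>\<zeta>. pkint s (heat_symbol \<zeta>) * p \<zeta>) \<in> borel_measurable lborel"
   unfolding F_def pkint_def integral_mult_left_zero .
  show "AE \<zeta> in lborel. pkint s (heat_symbol \<zeta>) * p \<zeta> = of_real (pkc s) * (heat_symbol \<zeta> powr of_real s * p \<zeta>)"
   using AE_heat_symbol_pos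
   by eventually_elim (simp only: pkint_powr[OF s] pkint_1 mult_ac)
  show "(\<lambda>\<zeta>. of_real (pkc s) * (heat_symbol \<zeta> powr of_real s * p \<zeta>)) \<in> borel_measurable lborel"
   by measurable
 qed
 also have "\<dots> = of_real (pkc s) * (LINT \<zeta>|lborel. heat_symbol \<zeta> powr of_real s * p \<zeta>)"
  by (rule integral_mult_right_zero)
 finally show "(2 * pi) ^ DIM('n spacetime) * (LINT \<tau>|lborel. pk s \<tau> *\<^sub>R heat_diff u w \<tau>) =
   of_real (pkc s) * (LINT \<zeta>|lborel. heat_symbol \<zeta> powr of_real s * (U \<zeta> * cnj (W \<zeta>)))"
  unfolding c_def p_def by simp
qed

section \<open>Unique continuation for the kernel of the fractional heat operator\<close>

definition kap :: "real => real => real => real" where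
 "kap m c \<tau> = (if 0 < \<tau> then \<tau> powr (- m) * exp (- c / \<tau>) else 0)"

lemma kap_nonneg: "0 \<le> kap m c \<tau>" by (simp add: kap_def)

lemma measurable_kap [measurable]: "(\<lambda>x. kap m (f x) (g x)) \<in> borel_measurable M"
 if [measurable]: "f \<in> borel_measurable M" "g \<in> borel_measurable M"
 unfolding kap_def by measurable

lemma kap_Suc: "kap (m + 1) c \<tau> * \<tau> = kap m c \<tau>"
proof (cases "0 < \<tau>")
 case True
 then have "\<tau> powr (- (m + 1)) * \<tau> = \<tau> powr (- m)" using powr_add[of \<tau> "- (m + 1)" 1] by simp
 then show ?thesis using True by (simp add: kap_def mult_ac)
qed (simp add: kap_def)

text \<open>In \<open>q = 1 / \<tau>\<close> the exponential beats the power. Uniformity in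
  \<open>c \<ge> c0\<close> is the point: at a positive distance from the support the kernels of all
  exponents are bounded, which dominates every integral and derivative below.\<close>

lemma kap_bound:
 assumes m: "0 \<le> m" and c0: "0 < c0"
 obtains M where "0 \<le> M" "\<And>c \<tau>. c0 \<le> c ==> kap m c \<tau> \<le> M"
proof -
 \<comment> \<open>An integer of at least \<open>m\<close> and at least 1, so that
   \<open>(1 + x / k) ^ k \<le> exp x\<close> can be used.\<close>
 define k where "k = Suc (nat \<lceil>m\<rceil>)"
 have k: "m \<le> real k" "0 < k" using m by (auto simp: k_def) linarith
 define M where "M = max 1 ((real k / c0) ^ k)"
 have "kap m c \<tau> \<le> M" if c: "c0 \<le> c" for c \<tau>
 proof (cases "0 < \<tau>")
  case True
  define q where "q = 1 / \<tau>"
  have q: "0 < q" using True by (simp add: q_def)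
  have eq: "kap m c \<tau> = q powr m * exp (- (c * q))"
   using True by (simp add: kap_def q_def powr_divide powr_minus_divide)
  have le: "exp (- (c * q)) \<le> exp (- (c0 * q))" using c q by simp
  show ?thesis
  proof (cases "q \<le> 1")
   case True
   then have "q powr m \<le> 1" using q m by (simp add: powr_le1)
   moreover have "exp (- (c * q)) \<le> 1" using c c0 q by simp
   ultimately have "q powr m * exp (- (c * q)) \<le> 1 * 1" by (intro mult_mono) auto
   then show ?thesis unfolding eq M_def by simp
  next
   case False
   have "q powr m \<le> q powr (real k)" using False k by (intro powr_mono) auto
   also have "\<dots> = q ^ k" using q by (simp add: powr_realpow)
   also have "\<dots> \<le> (real k / c0) ^ k * exp (c0 * q)"
   proof -
    have "q ^ k = (real k / c0) ^ k * (c0 * q / real k) ^ k"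
     using c0 k q by (simp flip: power_mult_distrib)
    also have "\<dots> \<le> (real k / c0) ^ k * (1 + c0 * q / real k) ^ k"
     using c0 q k by (intro mult_left_mono power_mono) auto
    also have "\<dots> \<le> (real k / c0) ^ k * exp (c0 * q)"
     using c0 q k by (intro mult_left_mono exp_ge_one_plus_x_over_n_power_n) (auto intro: order_trans[of _ 0])
    finally show ?thesis .
   qed
   finally have "q powr m * exp (- (c * q)) \<le> ((real k / c0) ^ k * exp (c0 * q)) * exp (- (c0 * q))"
    using le c0 by (intro mult_mono) auto
   also have "\<dots> = (real k / c0) ^ k" by (simp add: exp_minus)
   finally show ?thesis unfolding eq M_def by simp
  qed
 qed (simp add: kap_def M_def)
 moreover have "0 \<le> M" by (simp add: M_def)
 ultimately show ?thesis using that by blast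
qed

text \<open>The delicate point is 0: there \<open>kap m c\<close> is \<open>\<tau>^2\<close> times
  the bounded \<open>kap (m + 2) c\<close>, so the difference quotient tends to 0. The cut-off at
  negative times, which encodes causality, thus costs no regularity.\<close>

lemma kap_deriv_tau:
 assumes m: "0 \<le> m" and c: "0 < c"
 shows "(kap m c has_real_derivative (- m * kap (m + 1) c \<tau> + c * kap (m + 2) c \<tau>)) (at \<tau>)"
proof -
 consider "\<tau> < 0" | "\<tau> = 0" | "\<tau> > 0" by linarith
 then show ?thesis
 proof cases
  case 1
  have "((\<lambda>_. 0) has_real_derivative (- m * kap (m + 1) c \<tau> + c * kap (m + 2) c \<tau>)) (at \<tau>)"
   using 1 by (simp add: kap_def)
  then show ?thesis
   by (rule has_field_derivative_transform_within_open[where S = "{..<0}"]) (use 1 in \<open>auto simp: kap_def\<close>)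
 next
  case 2
  obtain M where M: "0 \<le> M" "\<And>\<tau>. kap (m + 2) c \<tau> \<le> M" by (rule kap_bound[of "m + 2" c]) (use m c in auto)
  have "(\<lambda>h. (kap m c (0 + h) - kap m c 0) / h) \<midarrow>0\<rightarrow> 0"
  proof (rule Lim_null_comparison)
   show "\<forall>\<^sub>F h in at 0. norm ((kap m c (0 + h) - kap m c 0) / h) \<le> M * \<bar>h\<bar>"
   proof (intro always_eventually allI)
    fix h
    have "kap m c h = kap (m + 2) c h * h * h"
     using kap_Suc[of "m + 1" c h] kap_Suc[of m c h] by (simp add: add.assoc)
    moreover have "kap m c 0 = 0" by (simp add: kap_def)
    ultimately have "norm ((kap m c (0 + h) - kap m c 0) / h) = \<bar>kap (m + 2) c h * h * h / h\<bar>" by simp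
    also have "kap (m + 2) c h * h * h / h = kap (m + 2) c h * h" by simp
    also have "\<bar>kap (m + 2) c h * h\<bar> = kap (m + 2) c h * \<bar>h\<bar>"
     by (simp only: abs_mult abs_of_nonneg[OF kap_nonneg])
    also have "\<dots> \<le> M * \<bar>h\<bar>" by (intro mult_right_mono M) simp
    finally show "norm ((kap m c (0 + h) - kap m c 0) / h) \<le> M * \<bar>h\<bar>" .
   qed
   have "((\<lambda>h. M * \<bar>h\<bar>) \<longlongrightarrow> M * \<bar>0\<bar>) (at 0)" by (intro tendsto_intros)
   then show "((\<lambda>h. M * \<bar>h\<bar>) \<longlongrightarrow> 0) (at 0)" by simp
  qed
  then show ?thesis using 2 by (simp add: DERIV_def kap_def[of _ _ 0])
 next
  case 3
  have "((\<lambda>\<tau>. \<tau> powr (- m) * exp (- c / \<tau>)) has_real_derivative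
   (- m * \<tau> powr (- m - 1)) * exp (- c / \<tau>) + \<tau> powr (- m) * (exp (- c / \<tau>) * (c / (\<tau> * \<tau>)))) (at \<tau>)"
   using 3 by (auto intro!: derivative_eq_intros simp: power2_eq_square)
  moreover have "(- m * \<tau> powr (- m - 1)) * exp (- c / \<tau>) + \<tau> powr (- m) * (exp (- c / \<tau>) * (c / (\<tau> * \<tau>))) =
    - m * kap (m + 1) c \<tau> + c * kap (m + 2) c \<tau>"
  proof -
   have "kap m c \<tau> = kap (m + 2) c \<tau> * \<tau> * \<tau>"
    using kap_Suc[of "m + 1" c \<tau>] kap_Suc[of m c \<tau>] by (simp add: add.assoc)
   then have b: "kap (m + 2) c \<tau> = kap m c \<tau> / (\<tau> * \<tau>)" using 3 by simp
   have e1: "- (m + 1) = - m - 1" by simp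
   have a: "kap (m + 1) c \<tau> = \<tau> powr (- m - 1) * exp (- c / \<tau>)" "kap m c \<tau> = \<tau> powr (- m) * exp (- c / \<tau>)"
    using 3 by (simp_all only: kap_def e1 if_True)
   show ?thesis unfolding b a by (simp add: mult_ac)
  qed
  ultimately have "((\<lambda>\<tau>. \<tau> powr (- m) * exp (- c / \<tau>)) has_real_derivative (- m * kap (m + 1) c \<tau> + c * kap (m + 2) c \<tau>)) (at \<tau>)"
   by simp
  then show ?thesis
   by (rule has_field_derivative_transform_within_open[where S = "{0<..}"]) (use 3 in \<open>auto simp: kap_def\<close>)
 qed
qed

lemma kap_deriv_c: "((\<lambda>c. kap m c \<tau>) has_real_derivative (- kap (m + 1) c \<tau>)) (at c)"
proof (cases "0 < \<tau>")
 case True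
 have "((\<lambda>c. \<tau> powr (- m) * exp (- c / \<tau>)) has_real_derivative \<tau> powr (- m) * (exp (- c / \<tau>) * (- 1 / \<tau>))) (at c)"
  using True by (auto intro!: derivative_eq_intros)
 moreover have "\<tau> powr (- m) * (exp (- c / \<tau>) * (- 1 / \<tau>)) = - kap (m + 1) c \<tau>"
 proof -
  have "kap (m + 1) c \<tau> = kap m c \<tau> / \<tau>"
   using kap_Suc[of m c \<tau>] True by (simp add: nonzero_eq_divide_eq)
  then show ?thesis using True by (simp add: kap_def)
 qed
 ultimately show ?thesis using True by (simp add: kap_def)
qed (simp add: kap_def)

text \<open>Lets a weight \<open>exp (- z / \<tau>)\<close> be absorbed into
  \<open>c\<close>.\<close>

lemma kap_shift: "kap m c \<tau> * exp (- z / \<tau>) = kap m (c + z) \<tau>"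
 by (simp add: kap_def mult.assoc exp_add[symmetric] add_divide_distrib diff_divide_distrib)

lemma borel_measurable_fst_snd [measurable]:
 "fst \<in> borel_measurable (borel :: ('a::second_countable_topology \<times> 'b::second_countable_topology) measure)"
 "snd \<in> borel_measurable (borel :: ('a \<times> 'b) measure)"
 by (auto intro!: borel_measurable_continuous_onI continuous_intros)

text \<open>
 The sign \<open>e\<close> is \<open>1\<close> for the operator of the adjoint problem, whose kernel looks into the future of \<open>t\<close>, and \<open>-1\<close>
 for the forward operator.
\<close>

locale cylinder_supported =
 fixes v :: "'n::finite spacetime => complex" and T :: real and C B :: "(real ^ 'n) set" and e c0 :: real
 assumes v: "sqint lborel v" and T: "0 < T" and e: "e = 1 \<or> e = -1"
  and v0: "\<And>z. z \<notin> {-T..T} \<times> C ==> v z = 0"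
  and C: "compact C" and B: "open B" "B \<noteq> {}" "bounded B"
  and c0: "0 < c0" "\<And>x y. x \<in> B ==> y \<in> C ==> c0 \<le> (norm (y - x))\<^sup>2 / 4"
begin

definition K :: "'n spacetime set" where "K = {-T..T} \<times> C"

lemma compact_K: "compact K" unfolding K_def by (intro compact_Times C) simp

lemma v_measurable [measurable]: "v \<in> borel_measurable borel"
 using sqint_measurable[OF v] by simp

lemma v_out: "z \<notin> K ==> v z = 0" using v0 by (simp add: K_def)

lemma v_integrable: "integrable lborel v"
proof -
 obtain R where R: "\<And>z. z \<in> K ==> norm z \<le> R" using compact_imp_bounded[OF compact_K] by (auto simp: bounded_iff)
 have "(\<lambda>z. indicator (cball 0 R) z * v z) = v"
  using R v_out by (force split: split_indicator)
 then show ?thesis using L12_integrable[OF L12_truncate[OF v, of R]] by simp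
qed

definition cc :: "real ^ 'n => 'n spacetime => real" where "cc x z = (norm (snd z - x))\<^sup>2 / 4"

text \<open>The potential at \<open>(t, x)\<close> of the density \<open>f * v\<close>. Because
  \<open>f\<close> depends on the source point, derivatives in \<open>(t, x)\<close> only raise
  \<open>m\<close> and multiply \<open>f\<close> by polynomials in the source point.\<close>

definition G :: "('n spacetime => real) => real => real => real ^ 'n => complex" where
 "G f m t x = (LINT z|lborel. of_real (f z * kap m (cc x z) (e * (fst z - t))) * v z)"

lemma measurable_cc [measurable]: "cc x \<in> borel_measurable borel"
 unfolding cc_def[abs_def] by (intro borel_measurable_continuous_onI) (auto intro!: continuous_intros)

lemma cc_ge: "x \<in> B ==> z \<in> K ==> c0 \<le> cc x z"
 using c0(2) by (auto simp: cc_def K_def)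

lemma cont_bound:
 assumes "continuous_on UNIV (f :: 'n spacetime => real)"
 obtains M where "0 \<le> M" "\<And>z. z \<in> K ==> \<bar>f z\<bar> \<le> M"
proof -
 have "compact (f ` K)" by (rule compact_continuous_image[OF continuous_on_subset[OF assms] compact_K]) simp
 from compact_imp_bounded[OF this] obtain M where M: "\<And>y. y \<in> f ` K ==> norm y \<le> M" by (auto simp: bounded_iff)
 show ?thesis by (rule that[of "max 0 M"]) (use M in \<open>force intro: max.coboundedI2\<close>)+
qed

lemma G_integrable:
 assumes f: "continuous_on UNIV f" and m: "0 \<le> m" and x: "x \<in> B"
 shows "integrable lborel (\<lambda>z. complex_of_real (f z * kap m (cc x z) (e * (fst z - t))) * v z)"
proof -
 have [measurable]: "f \<in> borel_measurable borel" using f by (rule borel_measurable_continuous_onI)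
 obtain A where A: "0 \<le> A" "\<And>z. z \<in> K ==> \<bar>f z\<bar> \<le> A" using cont_bound[OF f] by blast
 obtain M where M: "0 \<le> M" "\<And>c \<tau>. c0 \<le> c ==> kap m c \<tau> \<le> M" using kap_bound[OF m c0(1)] by blast
 show ?thesis
 proof (rule Bochner_Integration.integrable_bound)
  show "integrable lborel (\<lambda>z. of_real (A * M) * v z)" using v_integrable by simp
  show "AE z in lborel. norm (complex_of_real (f z * kap m (cc x z) (e * (fst z - t))) * v z) \<le> norm (of_real (A * M) * v z)"
  proof (intro AE_I2)
   fix z
   show "norm (complex_of_real (f z * kap m (cc x z) (e * (fst z - t))) * v z) \<le> norm (of_real (A * M) * v z)"
   proof (cases "z \<in> K")
    case True
    have "\<bar>f z\<bar> * kap m (cc x z) (e * (fst z - t)) \<le> A * M"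
     by (intro mult_mono A M cc_ge x True kap_nonneg)
    then have "\<bar>f z * kap m (cc x z) (e * (fst z - t))\<bar> \<le> \<bar>A * M\<bar>"
     using A(1) M(1) by (simp add: abs_mult kap_nonneg)
    then show ?thesis unfolding norm_mult[of _ "v z"] norm_of_real by (intro mult_right_mono) auto
   qed (simp add: v_out)
  qed
 qed measurable
qed

lemma G_cong:
 assumes "\<And>z. z \<in> K ==> f z * kap m (cc x z) (e * (fst z - t)) = f' z * kap m' (cc x z) (e * (fst z - t))"
 shows "G f m t x = G f' m' t x"
 unfolding G_def
proof (rule Bochner_Integration.integral_cong[OF refl])
 fix z show "complex_of_real (f z * kap m (cc x z) (e * (fst z - t))) * v z = complex_of_real (f' z * kap m' (cc x z) (e * (fst z - t))) * v z"
  by (cases "z \<in> K") (simp_all add: assms v_out del: of_real_mult)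
qed

lemma G_add:
 assumes "continuous_on UNIV f" "continuous_on UNIV g" "0 \<le> m" "x \<in> B"
 shows "G (\<lambda>z. f z + g z) m t x = G f m t x + G g m t x"
proof -
 have "G f m t x + G g m t x = (LINT z|lborel. complex_of_real (f z * kap m (cc x z) (e * (fst z - t))) * v z +
   complex_of_real (g z * kap m (cc x z) (e * (fst z - t))) * v z)"
  unfolding G_def using assms by (intro Bochner_Integration.integral_add[symmetric] G_integrable)
 then show ?thesis unfolding G_def by (simp add: distrib_right)
qed

lemma G_cmult: "G (\<lambda>z. a * f z) m t x = of_real a * G f m t x"
 unfolding G_def by (simp add: mult.assoc)

lemma G_sum:
 assumes "finite I" "\<And>i. i \<in> I ==> continuous_on UNIV (f i)" "0 \<le> m" "x \<in> B"
 shows "G (\<lambda>z. \<Sum>i\<in>I. f i z) m t x = (\<Sum>i\<in>I. G (f i) m t x)"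
 using assms
proof (induction I rule: finite_induct)
 case empty then show ?case by (simp add: G_def)
next
 case (insert i I)
 then show ?case by (simp add: G_add continuous_on_sum)
qed

text \<open>The separation from \<open>C\<close> holds throughout the open set \<open>B\<close>,
  hence near \<open>x\<close>, and there \<open>kap_bound\<close> dominates the differentiated
  kernel.\<close>

lemma G_space_deriv:
 assumes f: "continuous_on UNIV f" and m: "0 \<le> m" and x: "x \<in> B"
 shows "((\<lambda>h. G f m t (x + h *\<^sub>R b)) has_vector_derivative G (\<lambda>z. f z * ((snd z - x) \<bullet> b / 2)) (m + 1) t x) (at 0)"
proof -
 have "((\<lambda>h. x + h *\<^sub>R b) \<longlongrightarrow> x + 0 *\<^sub>R b) (nhds (0::real))"
  by (intro tendsto_intros filterlim_ident)
 then have "\<forall>\<^sub>F h in nhds 0. x + h *\<^sub>R b \<in> B" using topological_tendstoD[OF _ B(1)] x by fastforce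
 then obtain d where d: "0 < d" "\<And>h. \<bar>h\<bar> < d ==> x + h *\<^sub>R b \<in> B"
  unfolding eventually_nhds_metric by (auto simp: dist_real_def)
 obtain A where A: "0 \<le> A" "\<And>z. z \<in> K ==> \<bar>f z\<bar> \<le> A" using cont_bound[OF f] by blast
 obtain M where M: "0 \<le> M" "\<And>c \<tau>. c0 \<le> c ==> kap (m + 1) c \<tau> \<le> M" by (rule kap_bound[of "m + 1", OF _ c0(1)]) (use m in auto)
 obtain R1 where R1: "\<And>x. x \<in> B ==> norm x \<le> R1" using B(3) by (auto simp: bounded_iff)
 obtain R2 where R2: "\<And>y. y \<in> C ==> norm y \<le> R2" using compact_imp_bounded[OF C] by (auto simp: bounded_iff)
 define R where "R = (R1 + R2) * norm b / 2"
 have Rb: "\<bar>(snd z - x') \<bullet> b / 2\<bar> \<le> R" if "x' \<in> B" "z \<in> K" for x' z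
 proof -
  have "\<bar>(snd z - x') \<bullet> b\<bar> \<le> norm (snd z - x') * norm b" by (rule Cauchy_Schwarz_ineq2)
  also have "\<dots> \<le> (R1 + R2) * norm b"
   using R1[OF that(1)] R2[of "snd z"] that(2) norm_triangle_ineq4[of "snd z" x']
   by (intro mult_right_mono) (auto simp: K_def)
  finally show ?thesis by (simp add: R_def)
 qed
 have R0: "0 \<le> R" if "z \<in> K" for z using Rb[OF x that] by linarith
 have [measurable]: "f \<in> borel_measurable borel" using f by (rule borel_measurable_continuous_onI)
 define f' where "f' h z = complex_of_real ((f z * ((snd z - (x + h *\<^sub>R b)) \<bullet> b / 2)) * kap (m + 1) (cc (x + h *\<^sub>R b) z) (e * (fst z - t))) * v z" for h z
 have "((\<lambda>h. LINT z|lborel. complex_of_real (f z * kap m (cc (x + h *\<^sub>R b) z) (e * (fst z - t))) * v z) has_vector_derivative (LINT z|lborel. f' 0 z)) (at 0)"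
 proof (rule deriv_under_integral[OF d(1)])
  fix h assume h: "\<bar>h - 0\<bar> < d"
  then have xh: "x + h *\<^sub>R b \<in> B" using d(2) by simp
  show "integrable lborel (\<lambda>z. complex_of_real (f z * kap m (cc (x + h *\<^sub>R b) z) (e * (fst z - t))) * v z)"
   by (rule G_integrable[OF f m xh])
  fix z :: "'n spacetime"
  have c: "((\<lambda>h. cc (x + h *\<^sub>R b) z) has_real_derivative - ((snd z - (x + h *\<^sub>R b)) \<bullet> b / 2)) (at h)"
  proof -
   define Y where "Y = snd z - x"
   have eq: "cc (x + h *\<^sub>R b) z = (Y \<bullet> Y - 2 * h * (Y \<bullet> b) + h\<^sup>2 * (b \<bullet> b)) / 4" for h
   proof -
    have "snd z - (x + h *\<^sub>R b) = Y - h *\<^sub>R b" by (simp add: Y_def)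
    then show ?thesis unfolding cc_def power2_norm_eq_inner
     by (simp add: inner_diff_left inner_diff_right inner_commute power2_eq_square algebra_simps)
   qed
   have "((\<lambda>h. (Y \<bullet> Y - 2 * h * (Y \<bullet> b) + h\<^sup>2 * (b \<bullet> b)) / 4) has_real_derivative (- 2 * (Y \<bullet> b) + 2 * h * (b \<bullet> b)) / 4) (at h)"
    by (auto intro!: derivative_eq_intros)
   moreover have "(- 2 * (Y \<bullet> b) + 2 * h * (b \<bullet> b)) / 4 = - ((snd z - (x + h *\<^sub>R b)) \<bullet> b / 2)"
    by (simp add: Y_def inner_diff_left inner_add_left field_simps)
   ultimately show ?thesis unfolding eq by simp
  qed
  have "((\<lambda>h. f z * kap m (cc (x + h *\<^sub>R b) z) (e * (fst z - t))) has_real_derivative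
    f z * (- kap (m + 1) (cc (x + h *\<^sub>R b) z) (e * (fst z - t)) * - ((snd z - (x + h *\<^sub>R b)) \<bullet> b / 2))) (at h)"
   by (intro DERIV_cmult DERIV_chain2[OF kap_deriv_c c])
  then have "((\<lambda>h. complex_of_real (f z * kap m (cc (x + h *\<^sub>R b) z) (e * (fst z - t)))) has_vector_derivative
    of_real (f z * (- kap (m + 1) (cc (x + h *\<^sub>R b) z) (e * (fst z - t)) * - ((snd z - (x + h *\<^sub>R b)) \<bullet> b / 2)))) (at h)"
   by (rule has_vector_derivative_of_real)
  from has_vector_derivative_mult_left[OF this, of "v z"]
  show "((\<lambda>h. complex_of_real (f z * kap m (cc (x + h *\<^sub>R b) z) (e * (fst z - t))) * v z) has_vector_derivative f' h z) (at h)"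
   by (simp add: f'_def mult_ac)
  show "cmod (f' h z) \<le> A * R * M * cmod (v z)"
  proof (cases "z \<in> K")
   case True
   have "\<bar>f z\<bar> * \<bar>(snd z - (x + h *\<^sub>R b)) \<bullet> b / 2\<bar> * kap (m + 1) (cc (x + h *\<^sub>R b) z) (e * (fst z - t)) \<le> A * R * M"
    by (intro mult_mono A M Rb xh True cc_ge kap_nonneg mult_nonneg_nonneg R0[OF True] A(1)) auto
   then show ?thesis
    unfolding f'_def norm_mult norm_of_real abs_mult[of _ "kap _ _ _"] abs_mult[of "f z"] abs_of_nonneg[OF kap_nonneg]
    by (rule mult_right_mono) simp
  qed (simp add: v_out f'_def)
 next
  show "integrable lborel (\<lambda>z. A * R * M * cmod (v z))" using v_integrable by simp
  show "f' 0 \<in> borel_measurable lborel" unfolding f'_def[abs_def] by measurable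
 qed
 then show ?thesis unfolding G_def f'_def by simp
qed

lemma G_time_deriv:
 assumes f: "continuous_on UNIV f" and m: "0 \<le> m" and x: "x \<in> B"
 shows "((\<lambda>h. G f m (t + h) x) has_vector_derivative
  of_real e * (of_real m * G f (m + 1) t x - G (\<lambda>z. f z * cc x z) (m + 2) t x)) (at 0)"
proof -
 have fc: "continuous_on UNIV (\<lambda>z. f z * cc x z)" unfolding cc_def using f by (intro continuous_intros) auto
 obtain A where A: "0 \<le> A" "\<And>z. z \<in> K ==> \<bar>f z\<bar> \<le> A" using cont_bound[OF f] by blast
 obtain A2 where A2: "0 \<le> A2" "\<And>z. z \<in> K ==> \<bar>f z * cc x z\<bar> \<le> A2" using cont_bound[OF fc] by blast
 obtain M where M: "0 \<le> M" "\<And>c \<tau>. c0 \<le> c ==> kap (m + 1) c \<tau> \<le> M" by (rule kap_bound[of "m + 1", OF _ c0(1)]) (use m in auto)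
 obtain M2 where M2: "0 \<le> M2" "\<And>c \<tau>. c0 \<le> c ==> kap (m + 2) c \<tau> \<le> M2" by (rule kap_bound[of "m + 2", OF _ c0(1)]) (use m in auto)
 have [measurable]: "f \<in> borel_measurable borel" using f by (rule borel_measurable_continuous_onI)
 have ae: "\<bar>e\<bar> = 1" using e by auto
 define f' where "f' h z = complex_of_real (e * (m * (f z * kap (m + 1) (cc x z) (e * (fst z - (t + h)))) -
  (f z * cc x z) * kap (m + 2) (cc x z) (e * (fst z - (t + h))))) * v z" for h z
 have "((\<lambda>h. LINT z|lborel. complex_of_real (f z * kap m (cc x z) (e * (fst z - (t + h)))) * v z) has_vector_derivative (LINT z|lborel. f' 0 z)) (at 0)"
 proof (rule deriv_under_integral[where d = 1])
  fix h :: real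
  show "integrable lborel (\<lambda>z. complex_of_real (f z * kap m (cc x z) (e * (fst z - (t + h)))) * v z)"
   by (rule G_integrable[OF f m x])
  fix z :: "'n spacetime"
  show "((\<lambda>h. complex_of_real (f z * kap m (cc x z) (e * (fst z - (t + h)))) * v z) has_vector_derivative f' h z) (at h)"
  proof (cases "z \<in> K")
   case True
   then have cpos: "0 < cc x z" using cc_ge[OF x True] c0(1) by linarith
   have l: "((\<lambda>h. e * (fst z - (t + h))) has_real_derivative - e) (at h)"
    by (auto intro!: derivative_eq_intros)
   have "((\<lambda>h. f z * kap m (cc x z) (e * (fst z - (t + h)))) has_real_derivative
    f z * ((- m * kap (m + 1) (cc x z) (e * (fst z - (t + h))) + cc x z * kap (m + 2) (cc x z) (e * (fst z - (t + h)))) * - e)) (at h)"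
    by (intro DERIV_cmult DERIV_chain2[OF kap_deriv_tau[OF m cpos] l])
   then have "((\<lambda>h. complex_of_real (f z * kap m (cc x z) (e * (fst z - (t + h))))) has_vector_derivative
    of_real (f z * ((- m * kap (m + 1) (cc x z) (e * (fst z - (t + h))) + cc x z * kap (m + 2) (cc x z) (e * (fst z - (t + h)))) * - e))) (at h)"
    by (rule has_vector_derivative_of_real)
   from has_vector_derivative_mult_left[OF this, of "v z"]
   show ?thesis unfolding f'_def
    by (rule has_vector_derivative_eq_rhs) (simp add: algebra_simps)
  qed (simp add: v_out f'_def)
  show "cmod (f' h z) \<le> (m * (A * M) + A2 * M2) * cmod (v z)"
  proof (cases "z \<in> K")
   case True
   have "\<bar>e * (m * (f z * kap (m + 1) (cc x z) (e * (fst z - (t + h)))) - (f z * cc x z) * kap (m + 2) (cc x z) (e * (fst z - (t + h))))\<bar>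
    \<le> \<bar>m * (f z * kap (m + 1) (cc x z) (e * (fst z - (t + h))))\<bar> + \<bar>(f z * cc x z) * kap (m + 2) (cc x z) (e * (fst z - (t + h)))\<bar>"
    unfolding abs_mult[of e] ae using abs_triangle_ineq4 by simp
   also have "\<dots> = m * (\<bar>f z\<bar> * kap (m + 1) (cc x z) (e * (fst z - (t + h)))) + \<bar>f z * cc x z\<bar> * kap (m + 2) (cc x z) (e * (fst z - (t + h)))"
    unfolding abs_mult[of m] abs_mult[of _ "kap _ _ _"] abs_of_nonneg[OF kap_nonneg] abs_of_nonneg[OF m] ..
   also have "\<dots> \<le> m * (A * M) + A2 * M2"
    by (intro add_mono mult_mono A A2 M M2 True cc_ge x kap_nonneg m mult_left_mono mult_nonneg_nonneg) auto
   finally show ?thesis unfolding f'_def norm_mult norm_of_real by (rule mult_right_mono) simp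
  qed (simp add: v_out f'_def)
 next
  show "integrable lborel (\<lambda>z. (m * (A * M) + A2 * M2) * cmod (v z))" using v_integrable by simp
  show "f' 0 \<in> borel_measurable lborel" unfolding f'_def[abs_def] by measurable
 qed simp
 moreover have "(LINT z|lborel. f' 0 z) = of_real e * (of_real m * G f (m + 1) t x - G (\<lambda>z. f z * cc x z) (m + 2) t x)"
 proof -
  define g1 where "g1 z = complex_of_real (f z * kap (m + 1) (cc x z) (e * (fst z - t))) * v z" for z
  define g2 where "g2 z = complex_of_real ((f z * cc x z) * kap (m + 2) (cc x z) (e * (fst z - t))) * v z" for z
  have i: "integrable lborel g1" "integrable lborel g2"
   unfolding g1_def g2_def using m by (intro G_integrable f fc x; simp)+
  have "(LINT z|lborel. f' 0 z) = (LINT z|lborel. of_real e * (of_real m * g1 z - g2 z))"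
   unfolding f'_def g1_def g2_def by (simp add: algebra_simps)
  also have "\<dots> = of_real e * (of_real m * (LINT z|lborel. g1 z) - (LINT z|lborel. g2 z))"
   using i by simp
  finally show ?thesis unfolding g1_def g2_def G_def .
 qed
 ultimately show ?thesis unfolding G_def by simp
qed

definition Z :: "('n spacetime => real) => real => bool" where
 "Z f m \<longleftrightarrow> (\<forall>t\<in>{-T<..<T}. \<forall>x\<in>B. G f m t x = 0)"

lemma deriv_eq_near:
 fixes f g :: "real => complex"
 assumes "(f has_vector_derivative a) (at 0)" "(g has_vector_derivative b) (at 0)" "\<forall>\<^sub>F h in nhds 0. f h = g h"
 shows "a = b"
proof -
 obtain S where S: "open S" "0 \<in> S" "\<And>h. h \<in> S ==> f h = g h" using assms(3) unfolding eventually_nhds by blast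
 have "(g has_vector_derivative a) (at 0)"
  by (rule has_vector_derivative_transform_within_open[OF assms(1) S(1,2)]) (rule S(3))
 then show ?thesis using assms(2) by (rule vector_derivative_unique_at)
qed

lemma eventually_B: "x \<in> B ==> \<forall>\<^sub>F h in nhds (0::real). x + h *\<^sub>R b \<in> B"
proof -
 assume x: "x \<in> B"
 have "((\<lambda>h. x + h *\<^sub>R b) \<longlongrightarrow> x + 0 *\<^sub>R b) (nhds (0::real))" by (intro tendsto_intros filterlim_ident)
 then show ?thesis using topological_tendstoD[OF _ B(1)] x by fastforce
qed

lemma Z_space:
 assumes "Z f m" "continuous_on UNIV f" "0 \<le> m" "t \<in> {-T<..<T}" "x \<in> B"
 shows "G (\<lambda>z. f z * ((snd z - x) \<bullet> b / 2)) (m + 1) t x = 0"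
proof (rule deriv_eq_near[OF G_space_deriv[OF assms(2,3,5)]])
 show "((\<lambda>h. 0 :: complex) has_vector_derivative 0) (at 0)" by simp
 show "\<forall>\<^sub>F h in nhds 0. G f m t (x + h *\<^sub>R b) = 0"
  using eventually_B[OF assms(5), of b] by eventually_elim (use assms in \<open>simp add: Z_def\<close>)
qed

lemma Z_time:
 assumes "Z f m" "continuous_on UNIV f" "0 \<le> m" "t \<in> {-T<..<T}" "x \<in> B"
 shows "of_real m * G f (m + 1) t x = G (\<lambda>z. f z * cc x z) (m + 2) t x"
proof -
 have "of_real e * (of_real m * G f (m + 1) t x - G (\<lambda>z. f z * cc x z) (m + 2) t x) = 0"
 proof (rule deriv_eq_near[OF G_time_deriv[OF assms(2,3,5)]])
  show "((\<lambda>h. 0 :: complex) has_vector_derivative 0) (at 0)" by simp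
  have "((\<lambda>h. t + h) \<longlongrightarrow> t + 0) (nhds 0)" by (intro tendsto_intros filterlim_ident)
  then have "\<forall>\<^sub>F h in nhds 0. t + h \<in> {-T<..<T}"
   using assms(4) topological_tendstoD[of "\<lambda>h. t + h" t "nhds 0" "{-T<..<T}"] by simp
  then show "\<forall>\<^sub>F h in nhds 0. G f m (t + h) x = 0"
   by eventually_elim (use assms in \<open>simp add: Z_def\<close>)
 qed
 then show ?thesis using e by auto
qed

text \<open>The heat operator is applied to a potential that vanishes on an open set. The second
  space derivatives, summed over the basis, give \<open>2 * G cc (m + 2) = n * G 1 (m + 1)\<close>,
  the time derivative gives \<open>G cc (m + 2) = m * G 1 (m + 1)\<close>. Subtracting leaves the
  factor \<open>2 * m - n\<close>, which is nonzero since \<open>m\<close> exceeds the exponent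
  \<open>n / 2\<close> of the heat kernel.\<close>

lemma Z_Suc:
 assumes Z1: "Z (\<lambda>_. 1) m" and m: "real CARD('n) / 2 < m"
 shows "Z (\<lambda>_. 1) (m + 1)"
 unfolding Z_def
proof (intro ballI)
 fix t x assume t: "t \<in> {-T<..<T}" and x: "x \<in> B"
 have m0: "0 \<le> m" using m by (simp add: order_trans[OF _ less_imp_le[OF m]])
 have c1: "continuous_on UNIV (\<lambda>z::'n spacetime. 1::real)" by simp
 have cb: "continuous_on UNIV (\<lambda>z::'n spacetime. snd z \<bullet> b)" for b by (intro continuous_intros)
 \<comment> \<open>The first derivative vanishes; moving the observation point \<open>x'\<close> to
   the other side gives an identity that can be differentiated in \<open>x'\<close> once
   more.\<close>
 have J: "G (\<lambda>z. snd z \<bullet> b) (m + 1) t x' = of_real (x' \<bullet> b) * G (\<lambda>_. 1) (m + 1) t x'" if x': "x' \<in> B" for b x'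
 proof -
  have "G (\<lambda>z. 1 * ((snd z - x') \<bullet> b / 2)) (m + 1) t x' = 0" by (rule Z_space[OF Z1 c1 m0 t x'])
  also have "(\<lambda>z::'n spacetime. 1 * ((snd z - x') \<bullet> b / 2)) = (\<lambda>z. (1/2) * (snd z \<bullet> b) + (- (x' \<bullet> b) / 2) * 1)"
   by (auto simp: inner_diff_left field_simps)
  also have "G (\<lambda>z. (1/2) * (snd z \<bullet> b) + (- (x' \<bullet> b) / 2) * 1) (m + 1) t x' =
    of_real (1/2) * G (\<lambda>z. snd z \<bullet> b) (m + 1) t x' + of_real (- (x' \<bullet> b) / 2) * G (\<lambda>_. 1) (m + 1) t x'"
   using m0 x' by (subst G_add) (auto intro!: continuous_intros simp only: G_cmult)
  finally show ?thesis by (simp add: field_simps)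
 qed
 have sq: "G (\<lambda>z. ((snd z - x) \<bullet> b)\<^sup>2 / 2) (m + 2) t x = G (\<lambda>_. 1) (m + 1) t x" if b: "b \<in> Basis" for b
 proof -
  have m1: "0 \<le> m + 1" "m + 1 + 1 = m + 2" using m0 by auto
  have d1: "((\<lambda>h. G (\<lambda>z. snd z \<bullet> b) (m + 1) t (x + h *\<^sub>R b)) has_vector_derivative
    G (\<lambda>z. (snd z \<bullet> b) * ((snd z - x) \<bullet> b / 2)) (m + 2) t x) (at 0)"
   using G_space_deriv[OF cb m1(1) x, of b t b] unfolding m1(2) .
  have d2: "((\<lambda>h. G (\<lambda>_. 1) (m + 1) t (x + h *\<^sub>R b)) has_vector_derivative
    G (\<lambda>z. 1 * ((snd z - x) \<bullet> b / 2)) (m + 2) t x) (at 0)"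
   using G_space_deriv[OF c1 m1(1) x, of t b] unfolding m1(2) .
  have "((\<lambda>h. (x + h *\<^sub>R b) \<bullet> b) has_real_derivative 1) (at 0)"
   using b by (auto intro!: derivative_eq_intros simp: inner_add_left)
  then have d3: "((\<lambda>h. complex_of_real ((x + h *\<^sub>R b) \<bullet> b)) has_vector_derivative of_real 1) (at 0)"
   by (rule has_vector_derivative_of_real)
  have "G (\<lambda>z. (snd z \<bullet> b) * ((snd z - x) \<bullet> b / 2)) (m + 2) t x =
   of_real ((x + 0 *\<^sub>R b) \<bullet> b) * G (\<lambda>z. 1 * ((snd z - x) \<bullet> b / 2)) (m + 2) t x + of_real 1 * G (\<lambda>_. 1) (m + 1) t (x + 0 *\<^sub>R b)"
   by (rule deriv_eq_near[OF d1 has_vector_derivative_mult[OF d3 d2] eventually_mono[OF eventually_B[OF x, of b] J]])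
  then have "G (\<lambda>z. (snd z \<bullet> b) * ((snd z - x) \<bullet> b / 2)) (m + 2) t x - of_real (x \<bullet> b) * G (\<lambda>z. (snd z - x) \<bullet> b / 2) (m + 2) t x =
   G (\<lambda>_. 1) (m + 1) t x"
   by simp
  also have "G (\<lambda>z. (snd z \<bullet> b) * ((snd z - x) \<bullet> b / 2)) (m + 2) t x - of_real (x \<bullet> b) * G (\<lambda>z. (snd z - x) \<bullet> b / 2) (m + 2) t x =
   G (\<lambda>z. (snd z \<bullet> b) * ((snd z - x) \<bullet> b / 2) + (- (x \<bullet> b)) * ((snd z - x) \<bullet> b / 2)) (m + 2) t x"
  proof -
   have k: "continuous_on UNIV (\<lambda>z::'n spacetime. (snd z \<bullet> b) * ((snd z - x) \<bullet> b / 2))"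
    "continuous_on UNIV (\<lambda>z::'n spacetime. (- (x \<bullet> b)) * ((snd z - x) \<bullet> b / 2))"
    by (intro continuous_intros; simp)+
   show ?thesis
    using G_add[OF k _ x, of "m + 2" t] G_cmult[of "- (x \<bullet> b)" "\<lambda>z. (snd z - x) \<bullet> b / 2" "m + 2" t x] m0 by simp
  qed
  also have "(\<lambda>z::'n spacetime. (snd z \<bullet> b) * ((snd z - x) \<bullet> b / 2) + (- (x \<bullet> b)) * ((snd z - x) \<bullet> b / 2)) = (\<lambda>z. ((snd z - x) \<bullet> b)\<^sup>2 / 2)"
   by (auto simp: inner_diff_left power2_eq_square field_simps)
  finally show ?thesis .
 qed
 have "G (\<lambda>z. 2 * cc x z) (m + 2) t x = G (\<lambda>z. \<Sum>b\<in>Basis. ((snd z - x) \<bullet> b)\<^sup>2 / 2) (m + 2) t x"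
 proof (rule G_cong)
  fix z :: "'n spacetime"
  have "(norm (snd z - x))\<^sup>2 = (\<Sum>b\<in>Basis. ((snd z - x) \<bullet> b)\<^sup>2)"
   by (subst power2_norm_eq_inner, subst euclidean_inner) (simp add: power2_eq_square)
  then show "2 * cc x z * kap (m + 2) (cc x z) (e * (fst z - t)) = (\<Sum>b\<in>Basis. ((snd z - x) \<bullet> b)\<^sup>2 / 2) * kap (m + 2) (cc x z) (e * (fst z - t))"
   unfolding sum_divide_distrib[symmetric] by (simp add: cc_def)
 qed
 also have "\<dots> = (\<Sum>b\<in>(Basis :: (real ^ 'n) set). G (\<lambda>z. ((snd z - x) \<bullet> b)\<^sup>2 / 2) (m + 2) t x)"
  using m0 x by (intro G_sum) (auto intro!: continuous_intros)
 also have "\<dots> = of_nat CARD('n) * G (\<lambda>_. 1) (m + 1) t x" by (simp add: sq)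
 finally have 1: "2 * G (\<lambda>z. cc x z) (m + 2) t x = of_nat CARD('n) * G (\<lambda>_. 1) (m + 1) t x" by (simp add: G_cmult)
 have 2: "of_real m * G (\<lambda>_. 1) (m + 1) t x = G (\<lambda>z. cc x z) (m + 2) t x"
  using Z_time[OF Z1 c1 m0 t x] by simp
 have "(2 * of_real m - of_nat CARD('n)) * G (\<lambda>_. 1) (m + 1) t x = 0"
  unfolding left_diff_distrib mult.assoc 2 1 by simp
 moreover have "2 * complex_of_real m - of_nat CARD('n) \<noteq> 0"
 proof -
  have "complex_of_real (2 * m - real CARD('n)) \<noteq> 0" using m unfolding of_real_eq_0_iff by simp
  then show ?thesis by simp
 qed
 ultimately show "G (\<lambda>_. 1) (m + 1) t x = 0" by simp
qed

end

context cylinder_supported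
begin

text \<open>By \<open>kap_shift\<close> this is the potential of \<open>v\<close> with the
  additional time weight \<open>exp (- \<eta> / \<tau>)\<close>.\<close>

definition Gs :: "real => real => real => real ^ 'n => complex" where
 "Gs \<eta> m t x = (LINT z|lborel. of_real (kap m (cc x z + \<eta>) (e * (fst z - t))) * v z)"

lemma kap_add_nat: "kap (m + real i) c \<tau> = (1 / \<tau>) ^ i * kap m c \<tau>"
proof (cases "0 < \<tau>")
 case True
 then have "\<tau> powr (- (m + real i)) = (1 / \<tau>) ^ i * \<tau> powr (- m)"
  by (simp add: powr_diff powr_realpow power_one_over field_simps powr_minus)
 then show ?thesis using True by (simp add: kap_def)
qed (simp add: kap_def)

text \<open>Expand \<open>exp (- d / \<tau>)\<close>: the \<open>i\<close>-th term raises the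
  exponent of the kernel by \<open>i\<close>, so each partial sum integrates to 0. The partial sums
  are bounded by \<open>exp (d / \<tau>)\<close>, which lowers \<open>c\<close> by \<open>d\<close>;
  the condition \<open>d \<le> c0 / 2\<close> leaves at least \<open>c0 / 2\<close>, enough for a
  bounded kernel and dominated convergence.\<close>

lemma Gs_step:
 assumes x: "x \<in> B" and m: "0 \<le> m" and \<eta>: "0 \<le> \<eta>" and d: "0 \<le> d" "d \<le> c0 / 2"
  and z: "\<And>i :: nat. Gs \<eta> (m + real i) t x = 0"
 shows "Gs (\<eta> + d) m t x = 0"
proof -
 obtain M where M: "0 \<le> M" "\<And>c \<tau>. c0 / 2 \<le> c ==> kap m c \<tau> \<le> M" by (rule kap_bound[OF m, of "c0 / 2"]) (use c0(1) in auto)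
 define \<tau> where "\<tau> z = e * (fst z - t)" for z :: "'n spacetime"
 have [measurable]: "\<tau> \<in> borel_measurable borel" unfolding \<tau>_def by measurable
 have exps: "(\<lambda>i. (r :: real) ^ i / fact i) sums exp r" for r
  using exp_converges[of r] by (simp add: scaleR_conv_of_real divide_inverse mult.commute)
 define S where "S n z = (\<Sum>i<n. complex_of_real ((- d) ^ i / fact i * kap (m + real i) (cc x z + \<eta>) (\<tau> z)) * v z)" for n z
 have term_eq: "(- d) ^ i / fact i * kap (m + real i) c s = kap m c s * ((- d / s) ^ i / fact i)" for i c s
 proof -
  have "(- d) ^ i / fact i * kap (m + real i) c s = kap m c s * (((- d) * (1 / s)) ^ i / fact i)"
   unfolding kap_add_nat power_mult_distrib by (simp only: mult_ac times_divide_eq_right times_divide_eq_left)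
  then show ?thesis by simp
 qed
 have term_int: "integrable lborel (\<lambda>z. complex_of_real ((- d) ^ i / fact i * kap (m + real i) (cc x z + \<eta>) (\<tau> z)) * v z)" for i :: nat
 proof -
  obtain Mi where Mi: "0 \<le> Mi" "\<And>c \<tau>. c0 \<le> c ==> kap (m + real i) c \<tau> \<le> Mi" by (rule kap_bound[of "m + real i" c0]) (use m c0(1) in auto)
  show ?thesis
  proof (rule Bochner_Integration.integrable_bound)
   show "integrable lborel (\<lambda>z. of_real ((- d) ^ i / fact i * Mi) * v z)" using v_integrable by (rule integrable_mult_right)
   show "AE z in lborel. norm (complex_of_real ((- d) ^ i / fact i * kap (m + real i) (cc x z + \<eta>) (\<tau> z)) * v z) \<le> norm (of_real ((- d) ^ i / fact i * Mi) * v z)"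
   proof (intro AE_I2)
    fix z
    show "norm (complex_of_real ((- d) ^ i / fact i * kap (m + real i) (cc x z + \<eta>) (\<tau> z)) * v z) \<le> norm (of_real ((- d) ^ i / fact i * Mi) * v z)"
    proof (cases "z \<in> K")
     case True
     have "kap (m + real i) (cc x z + \<eta>) (\<tau> z) \<le> Mi" by (rule Mi(2)) (use cc_ge[OF x True] \<eta> in simp)
     then have "\<bar>(- d) ^ i / fact i * kap (m + real i) (cc x z + \<eta>) (\<tau> z)\<bar> \<le> \<bar>(- d) ^ i / fact i * Mi\<bar>"
      unfolding abs_mult using kap_nonneg[of "m + real i" "cc x z + \<eta>" "\<tau> z"] by (intro mult_left_mono) auto
     then show ?thesis unfolding norm_mult[of _ "v z"] norm_of_real by (intro mult_right_mono) auto
    qed (simp add: v_out)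
   qed
  qed measurable
 qed
 have S0: "(LINT z|lborel. S n z) = 0" for n
 proof -
  have "(LINT z|lborel. S n z) = (\<Sum>i<n. LINT z|lborel. complex_of_real ((- d) ^ i / fact i * kap (m + real i) (cc x z + \<eta>) (\<tau> z)) * v z)"
   unfolding S_def by (rule Bochner_Integration.integral_sum) (rule term_int)
  also have "\<dots> = (\<Sum>i<n. of_real ((- d) ^ i / fact i) * Gs \<eta> (m + real i) t x)"
   unfolding Gs_def \<tau>_def of_real_mult mult.assoc by simp
  finally show ?thesis using z by simp
 qed
 have "(\<lambda>n. LINT z|lborel. S n z) \<longlonglongrightarrow> (LINT z|lborel. of_real (kap m (cc x z + (\<eta> + d)) (\<tau> z)) * v z)"
 proof (rule integral_dominated_convergence[where w = "\<lambda>z. M * cmod (v z)"])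
  show "integrable lborel (\<lambda>z. M * cmod (v z))" using v_integrable by simp
  have Seq: "S n z = of_real (kap m (cc x z + \<eta>) (\<tau> z) * (\<Sum>i<n. (- d / \<tau> z) ^ i / fact i)) * v z" for n z
   unfolding S_def term_eq sum_distrib_left by (simp only: of_real_sum sum_distrib_right)
  show "AE z in lborel. (\<lambda>n. S n z) \<longlonglongrightarrow> of_real (kap m (cc x z + (\<eta> + d)) (\<tau> z)) * v z"
  proof (intro AE_I2)
   fix z
   have "(\<lambda>n. \<Sum>i<n. (- d / \<tau> z) ^ i / fact i) \<longlonglongrightarrow> exp (- d / \<tau> z)"
    using exps[of "- d / \<tau> z"] by (simp add: sums_def)
   then have "(\<lambda>n. S n z) \<longlonglongrightarrow> of_real (kap m (cc x z + \<eta>) (\<tau> z) * exp (- d / \<tau> z)) * v z"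
    unfolding Seq by (intro tendsto_intros)
   then show "(\<lambda>n. S n z) \<longlonglongrightarrow> of_real (kap m (cc x z + (\<eta> + d)) (\<tau> z)) * v z"
    unfolding kap_shift by (simp only: add.assoc)
  qed
  show "AE z in lborel. norm (S n z) \<le> M * cmod (v z)" for n
  proof (intro AE_I2)
   fix z
   show "norm (S n z) \<le> M * cmod (v z)"
   proof (cases "z \<in> K \<and> 0 < \<tau> z")
    case True
    then have t: "0 < \<tau> z" by simp
    have "\<bar>\<Sum>i<n. (- d / \<tau> z) ^ i / fact i\<bar> \<le> (\<Sum>i<n. \<bar>(- d / \<tau> z) ^ i / fact i\<bar>)" by (rule sum_abs)
    also have "\<dots> = (\<Sum>i<n. (d / \<tau> z) ^ i / fact i)"
     using d t by (intro sum.cong) (auto simp: power_abs abs_divide)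
    also have "\<dots> \<le> exp (d / \<tau> z)"
     using exps[of "d / \<tau> z"] d t sum_le_suminf[OF sums_summable[OF exps[of "d / \<tau> z"]], of "{..<n}"]
     by (simp add: sums_unique[symmetric])
    finally have "kap m (cc x z + \<eta>) (\<tau> z) * \<bar>\<Sum>i<n. (- d / \<tau> z) ^ i / fact i\<bar> \<le> kap m (cc x z + \<eta>) (\<tau> z) * exp (- (- d) / \<tau> z)"
     by (intro mult_left_mono kap_nonneg) simp
    also have "\<dots> \<le> M" unfolding kap_shift
     by (rule M(2)) (use cc_ge[OF x, of z] True d \<eta> in simp)
    finally show ?thesis
     unfolding Seq norm_mult[of _ "v z"] norm_of_real abs_mult abs_of_nonneg[OF kap_nonneg] by (rule mult_right_mono) simp
   next
    case False
    then show ?thesis using M(1) by (auto simp: Seq v_out kap_def)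
   qed
  qed
  show "(\<lambda>z. of_real (kap m (cc x z + (\<eta> + d)) (\<tau> z)) * v z) \<in> borel_measurable lborel" by measurable
  show "S n \<in> borel_measurable lborel" for n unfolding S_def by measurable
 qed
 then have "(LINT z|lborel. of_real (kap m (cc x z + (\<eta> + d)) (\<tau> z)) * v z) = 0"
  unfolding S0 using LIMSEQ_unique tendsto_const by blast
 then show ?thesis by (simp add: Gs_def \<tau>_def)
qed

context
 fixes m0 :: real
 assumes m0: "real CARD('n) / 2 < m0" and Z0: "Z (\<lambda>_. 1) m0"
begin

lemma m0_nonneg: "0 \<le> m0" using m0 by (simp add: order_trans[OF _ less_imp_le[OF m0]])

lemma Z_all: "Z (\<lambda>_. 1) (m0 + real j)"
proof (induction j)
 case 0 then show ?case using Z0 by simp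
next
 case (Suc j)
 have "real CARD('n) / 2 < m0 + real j" using m0 by simp
 from Z_Suc[OF Suc this] have "Z (\<lambda>_. 1) (m0 + real j + 1)" .
 moreover have "m0 + real j + 1 = m0 + real (Suc j)" by simp
 ultimately show ?case by (simp only:)
qed

text \<open>One step of \<open>Gs_step\<close> needs all higher exponents at the previous shift, so
  the induction on the number of steps runs for all \<open>j\<close> at once.\<close>

lemma Gs_zero:
 assumes t: "t \<in> {-T<..<T}" and x: "x \<in> B"
 shows "Gs (real k * (c0 / 2)) (m0 + real j) t x = 0"
proof (induction k arbitrary: j)
 case 0
 show ?case using Z_all[of j] t x by (simp add: Z_def G_def Gs_def)
next
 case (Suc k)
 have "Gs (real k * (c0 / 2) + c0 / 2) (m0 + real j) t x = 0"
 proof (rule Gs_step[OF x])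
  show "Gs (real k * (c0 / 2)) (m0 + real j + real i) t x = 0" for i
   using Suc[of "j + i"] by (simp add: add.assoc)
 qed (use m0_nonneg c0(1) in auto)
 moreover have "real k * (c0 / 2) + c0 / 2 = real (Suc k) * (c0 / 2)" by (simp add: distrib_right)
 ultimately show ?case by (simp only:)
qed

text \<open>
 By the Weierstrass theorem in the variable \<open>exp (- \<eta> / \<tau>)\<close>, which separates times, all continuous
 functions of time are admissible weights.
\<close>

lemma G_time_weight:
 assumes t: "t \<in> {-T<..<T}" and x: "x \<in> B" and \<phi>: "continuous_on UNIV (\<phi> :: real => real)"
 shows "G (\<lambda>z. \<phi> (fst z)) m0 t x = 0"
proof -
 define \<eta> where "\<eta> = c0 / 2"
 have \<eta>: "0 < \<eta>" using c0(1) by (simp add: \<eta>_def)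
 \<comment> \<open>This is \<open>exp (- \<eta> / \<tau>)\<close> at the times that the kernel sees
   and 0 at the others; its powers are the weights treated in \<open>Gs_zero\<close>.\<close>
 define q where "q r = kap 0 \<eta> (e * (r - t))" for r
 have qc: "continuous_on UNIV q"
 proof -
  have "continuous_on UNIV (kap 0 \<eta>)"
   using kap_deriv_tau[OF _ \<eta>, of 0] by (auto intro!: DERIV_continuous_on)
  then show ?thesis unfolding q_def by (rule continuous_on_compose2) (auto intro!: continuous_intros)
 qed
 \<comment> \<open>The endpoint \<open>\<tau> = 0\<close> is included for compactness. Within
   \<open>I\<close> the function \<open>q\<close> vanishes only there, so it still separates
   points.\<close>
 define I where "I = {-T..T} \<inter> {r. 0 \<le> e * (r - t)}"
 have cI: "compact I"
  unfolding I_def by (intro compact_Int_closed closed_Collect_le continuous_intros) simp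
 have qinj: "q r \<noteq> q r'" if rr: "r \<in> I" "r' \<in> I" "r \<noteq> r'" for r r'
 proof
  assume eq: "q r = q r'"
  have k: "kap 0 \<eta> a \<noteq> kap 0 \<eta> b" if "0 \<le> a" "a < b" for a b
  proof (cases "a = 0")
   case True then show ?thesis using that by (simp add: kap_def)
  next
   case False
   then have "\<eta> / b < \<eta> / a" using that \<eta> by (intro divide_strict_left_mono) auto
   then show ?thesis using that False \<eta> by (simp add: kap_def)
  qed
  have "e * (r - t) \<noteq> e * (r' - t)" using rr(3) e by auto
  then show False using k[of "e * (r - t)" "e * (r' - t)"] k[of "e * (r' - t)" "e * (r - t)"] eq rr(1,2)
   by (auto simp: q_def I_def neq_iff)
 qed
 have pw: "G (\<lambda>z. (q (fst z)) ^ k) m0 t x = 0" for k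
 proof -
  have "(q r) ^ k * kap m0 c (e * (r - t)) = kap m0 (c + real k * \<eta>) (e * (r - t))" for r c
  proof (cases "0 < e * (r - t)")
   case True
   then have "e \<noteq> 0" "r \<noteq> t" by auto
   with True have "(q r) ^ k = exp (- (real k * \<eta>) / (e * (r - t)))"
    by (simp add: q_def kap_def exp_of_nat_mult[symmetric])
   then show ?thesis using kap_shift[of m0 c "e * (r - t)" "real k * \<eta>"] by (simp add: mult.commute)
  qed (simp add: kap_def)
  then have "G (\<lambda>z. (q (fst z)) ^ k) m0 t x = Gs (real k * \<eta>) m0 t x" by (simp add: G_def Gs_def)
  then show ?thesis using Gs_zero[OF t x, of k 0] by (simp add: \<eta>_def)
 qed
 have qk: "continuous_on UNIV (\<lambda>z::'n spacetime. (q (fst z)) ^ k)" for k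
  by (intro continuous_intros continuous_on_compose2[OF qc]) auto
 have poly: "G (\<lambda>z. g (q (fst z))) m0 t x = 0" if g: "real_polynomial_function g" for g :: "real => real"
 proof -
  obtain a n where gn: "g = (\<lambda>x. \<Sum>i\<le>n. a i * x ^ i)" using g unfolding real_polynomial_function_iff_sum by blast
  have "G (\<lambda>z. g (q (fst z))) m0 t x = (\<Sum>i\<le>n. G (\<lambda>z. a i * (q (fst z)) ^ i) m0 t x)"
   unfolding gn by (rule G_sum) (auto intro!: continuous_on_mult qk continuous_on_const m0_nonneg x)
  also have "\<dots> = 0" by (simp add: G_cmult pw)
  finally show ?thesis .
 qed
 have iv: "integrable lborel (\<lambda>z. complex_of_real (1 * kap m0 (cc x z) (e * (fst z - t))) * v z)"
  by (rule G_integrable) (use m0_nonneg x in auto)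
 define L where "L = (LINT z|lborel. cmod (of_real (1 * kap m0 (cc x z) (e * (fst z - t))) * v z))"
 have L0: "0 \<le> L" by (simp add: L_def)
 have "cmod (G (\<lambda>z. \<phi> (fst z)) m0 t x) \<le> 0 + \<epsilon>" if \<epsilon>: "0 < \<epsilon>" for \<epsilon>
 proof -
  define \<delta> where "\<delta> = \<epsilon> / (L + 1)"
  have \<delta>: "0 < \<delta>" using \<epsilon> L0 by (simp add: \<delta>_def)
  have "\<exists>f. (\<exists>g. real_polynomial_function g \<and> f = g \<circ> q) \<and> (\<forall>r\<in>I. \<bar>\<phi> r - f r\<bar> < \<delta>)"
  proof (rule Stone_Weierstrass_HOL[OF cI])
   show "\<exists>g. real_polynomial_function g \<and> (\<lambda>x. c) = g \<circ> q" for c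
    by (rule exI[of _ "\<lambda>_. c"]) auto
   show "continuous_on I f" if gex: "\<exists>g. real_polynomial_function g \<and> f = g \<circ> q" for f
   proof -
    obtain g where g: "real_polynomial_function g" "f = g \<circ> q" using gex by auto
    have cg: "continuous_on UNIV g" using g(1)
     by (simp add: continuous_on_polymonial_function real_polynomial_function_eq)
    have "continuous_on UNIV (g \<circ> q)"
     by (rule continuous_on_compose[OF qc], rule continuous_on_subset[OF cg]) simp
    then show ?thesis unfolding g(2) by (rule continuous_on_subset) simp
   qed
   fix f g assume "(\<exists>a. real_polynomial_function a \<and> f = a \<circ> q) \<and> (\<exists>b. real_polynomial_function b \<and> g = b \<circ> q)"
   then obtain a b where ab: "real_polynomial_function a" "f = a \<circ> q" "real_polynomial_function b" "g = b \<circ> q" by auto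
   show "\<exists>h. real_polynomial_function h \<and> (\<lambda>x. f x + g x) = h \<circ> q"
    by (rule exI[of _ "\<lambda>x. a x + b x"]) (use ab in auto)
   show "\<exists>h. real_polynomial_function h \<and> (\<lambda>x. f x * g x) = h \<circ> q"
    by (rule exI[of _ "\<lambda>x. a x * b x"]) (use ab in auto)
  next
   fix r r' assume "r \<in> I \<and> r' \<in> I \<and> r \<noteq> r'"
   then show "\<exists>f. (\<exists>g. real_polynomial_function g \<and> f = g \<circ> q) \<and> f r \<noteq> f r'"
    using qinj by (intro exI[of _ q] conjI exI[of _ "\<lambda>x. x"]) auto
  next
   show "continuous_on I \<phi>" by (rule continuous_on_subset[OF \<phi>]) simp
  qed (rule \<delta>)
  then obtain g where g: "real_polynomial_function g" "\<And>r. r \<in> I ==> \<bar>\<phi> r - g (q r)\<bar> < \<delta>" by auto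
  have gc: "continuous_on UNIV (\<lambda>z::'n spacetime. g (q (fst z)))"
  proof -
   have "continuous_on UNIV g" using g(1)
    by (simp add: continuous_on_polymonial_function real_polynomial_function_eq)
   then show ?thesis by (rule continuous_on_compose2) (auto intro!: continuous_on_compose2[OF qc] continuous_intros)
  qed
  have \<phi>c: "continuous_on UNIV (\<lambda>z::'n spacetime. \<phi> (fst z))"
   by (intro continuous_on_compose2[OF \<phi>] continuous_intros) auto
  have cdiff: "continuous_on UNIV (\<lambda>z::'n spacetime. \<phi> (fst z) - g (q (fst z)))" by (intro continuous_intros \<phi>c gc)
  have "G (\<lambda>z. \<phi> (fst z)) m0 t x = G (\<lambda>z. (\<phi> (fst z) - g (q (fst z))) + g (q (fst z))) m0 t x" by simp
  also have "\<dots> = G (\<lambda>z. \<phi> (fst z) - g (q (fst z))) m0 t x + 0"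
   unfolding poly[OF g(1), symmetric] by (rule G_add[OF cdiff gc m0_nonneg x])
  finally have "cmod (G (\<lambda>z. \<phi> (fst z)) m0 t x) = cmod (G (\<lambda>z. \<phi> (fst z) - g (q (fst z))) m0 t x)" by simp
  also have "\<dots> \<le> (LINT z|lborel. \<delta> * cmod (of_real (1 * kap m0 (cc x z) (e * (fst z - t))) * v z))"
   unfolding G_def
  proof (rule Bochner_Integration.integral_norm_bound_integral)
   show "integrable lborel (\<lambda>z. complex_of_real ((\<phi> (fst z) - g (q (fst z))) * kap m0 (cc x z) (e * (fst z - t))) * v z)"
    by (rule G_integrable[OF cdiff m0_nonneg x])
   show "integrable lborel (\<lambda>z. \<delta> * cmod (of_real (1 * kap m0 (cc x z) (e * (fst z - t))) * v z))"
    by (intro integrable_mult_right integrable_norm iv)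
   fix z :: "'n spacetime"
   show "norm (complex_of_real ((\<phi> (fst z) - g (q (fst z))) * kap m0 (cc x z) (e * (fst z - t))) * v z) \<le> \<delta> * cmod (of_real (1 * kap m0 (cc x z) (e * (fst z - t))) * v z)"
   proof (cases "z \<in> K \<and> 0 < e * (fst z - t)")
    case True
    then have "fst z \<in> I" by (auto simp: I_def K_def)
    then have "\<bar>\<phi> (fst z) - g (q (fst z))\<bar> \<le> \<delta>" using g(2) by (simp add: less_imp_le)
    then have "\<bar>\<phi> (fst z) - g (q (fst z))\<bar> * (kap m0 (cc x z) (e * (fst z - t)) * cmod (v z)) \<le> \<delta> * (kap m0 (cc x z) (e * (fst z - t)) * cmod (v z))"
     by (intro mult_right_mono mult_nonneg_nonneg kap_nonneg) auto
    then show ?thesis by (simp only: norm_mult norm_of_real abs_mult abs_of_nonneg[OF kap_nonneg] mult_1 mult.assoc abs_one)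
   next
    case False
    then have "kap m0 (cc x z) (e * (fst z - t)) = 0 \<or> v z = 0" by (auto simp: v_out kap_def)
    then show ?thesis by auto
   qed
  qed
  also have "\<dots> = \<delta> * L" unfolding L_def by simp
  also have "\<dots> \<le> \<epsilon>" using \<epsilon> L0 by (simp add: \<delta>_def field_simps)
  finally show ?thesis by simp
 qed
 then have "cmod (G (\<lambda>z. \<phi> (fst z)) m0 t x) \<le> 0" by (rule field_le_epsilon)
 then show ?thesis by simp
qed

text \<open>Admissible weights, with an arbitrary further time weight built in. The quantifier over
  \<open>\<phi>\<close> makes the class stable under multiplication by functions of time, and so
  leaves room to cancel powers of \<open>1 / \<tau>\<close>.\<close>

definition wts :: "('n spacetime => real) set" where
 "wts = {f. continuous_on UNIV f \<and> (\<forall>\<phi>. continuous_on UNIV \<phi> \<longrightarrow> Z (\<lambda>z. \<phi> (fst z) * f z) m0)}"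

lemma cont_fst: "continuous_on UNIV (\<phi> :: real => real) ==> continuous_on UNIV (\<lambda>z::'n spacetime. \<phi> (fst z))"
 by (rule continuous_on_compose2[of UNIV \<phi>]) (auto intro: continuous_intros)

lemma wts_1: "(\<lambda>_. 1) \<in> wts"
 using G_time_weight by (simp add: wts_def Z_def)

lemma wts_add: assumes "f \<in> wts" "g \<in> wts" shows "(\<lambda>z. f z + g z) \<in> wts"
 unfolding wts_def
proof (intro CollectI conjI allI impI)
 have fg: "continuous_on UNIV f" "continuous_on UNIV g" using assms by (auto simp: wts_def)
 then show "continuous_on UNIV (\<lambda>z. f z + g z)" by (intro continuous_intros)
 fix \<phi> :: "real => real" assume \<phi>: "continuous_on UNIV \<phi>"
 show "Z (\<lambda>z. \<phi> (fst z) * (f z + g z)) m0"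
  unfolding Z_def distrib_left
 proof (intro ballI)
  fix t x assume "t \<in> {-T<..<T}" "x \<in> B"
  then show "G (\<lambda>z. \<phi> (fst z) * f z + \<phi> (fst z) * g z) m0 t x = 0"
   using assms \<phi> by (subst G_add) (auto intro!: continuous_on_mult cont_fst fg m0_nonneg simp: wts_def Z_def)
 qed
qed

lemma wts_time: assumes "f \<in> wts" "continuous_on UNIV (\<psi> :: real => real)" shows "(\<lambda>z. \<psi> (fst z) * f z) \<in> wts"
 unfolding wts_def
proof (intro CollectI conjI allI impI)
 show "continuous_on UNIV (\<lambda>z. \<psi> (fst z) * f z)"
  using assms by (intro continuous_on_mult cont_fst) (auto simp: wts_def)
 fix \<phi> :: "real => real" assume "continuous_on UNIV \<phi>"
 then have "continuous_on UNIV (\<lambda>r. \<phi> r * \<psi> r)" using assms(2) by (intro continuous_on_mult)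
 then have "Z (\<lambda>z. \<phi> (fst z) * \<psi> (fst z) * f z) m0" using assms(1) by (auto simp: wts_def)
 then show "Z (\<lambda>z. \<phi> (fst z) * (\<psi> (fst z) * f z)) m0" by (simp add: mult.assoc)
qed

text \<open>
 An \<open>x\<close>-derivative of the kernel produces the factor \<open>(y - x) / (2 \<tau>)\<close>; the factor \<open>1 / \<tau>\<close> is undone
 by the freedom in the time weight.
\<close>

lemma wts_space: assumes f: "f \<in> wts" shows "(\<lambda>z. (snd z \<bullet> b) * f z) \<in> wts"
 unfolding wts_def
proof (intro CollectI conjI allI impI)
 have fc: "continuous_on UNIV f" using f by (auto simp: wts_def)
 then show "continuous_on UNIV (\<lambda>z. (snd z \<bullet> b) * f z)" by (intro continuous_intros)
 fix \<phi> :: "real => real" assume \<phi>: "continuous_on UNIV \<phi>"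
 show "Z (\<lambda>z. \<phi> (fst z) * ((snd z \<bullet> b) * f z)) m0"
  unfolding Z_def
 proof (intro ballI)
  fix t x assume t: "t \<in> {-T<..<T}" and x: "x \<in> B"
  \<comment> \<open>This weight involves the fixed \<open>t\<close>, which is harmless because
    \<open>Z_space\<close> differentiates in \<open>x\<close> only.\<close>
  define \<psi> where "\<psi> r = \<phi> r * (2 * (e * (r - t)))" for r
  have \<psi>: "continuous_on UNIV \<psi>" unfolding \<psi>_def by (intro continuous_intros \<phi>)
  have "Z (\<lambda>z. \<psi> (fst z) * f z) m0" using f \<psi> by (auto simp: wts_def)
  then have "G (\<lambda>z. (\<psi> (fst z) * f z) * ((snd z - x) \<bullet> b / 2)) (m0 + 1) t x = 0"
   by (rule Z_space) (use t x m0_nonneg in \<open>auto intro!: continuous_on_mult cont_fst \<psi> fc\<close>)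
  moreover have "G (\<lambda>z. (\<psi> (fst z) * f z) * ((snd z - x) \<bullet> b / 2)) (m0 + 1) t x =
    G (\<lambda>z. \<phi> (fst z) * ((snd z \<bullet> b) * f z) + (- (x \<bullet> b)) * (\<phi> (fst z) * f z)) m0 t x"
  proof (rule G_cong)
   fix z :: "'n spacetime"
   have gen: "(p * (2 * P) * f) * ((y - x) / 2) * k = (p * (y * f) + (- x) * (p * f)) * (k * P)" for p P f y x k :: real
    by (simp add: field_simps)
   show "(\<psi> (fst z) * f z) * ((snd z - x) \<bullet> b / 2) * kap (m0 + 1) (cc x z) (e * (fst z - t)) =
    (\<phi> (fst z) * ((snd z \<bullet> b) * f z) + (- (x \<bullet> b)) * (\<phi> (fst z) * f z)) * kap m0 (cc x z) (e * (fst z - t))"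
    by (simp only: \<psi>_def kap_Suc[of m0, symmetric] inner_diff_left gen)
  qed
  moreover have "\<dots> = G (\<lambda>z. \<phi> (fst z) * ((snd z \<bullet> b) * f z)) m0 t x + of_real (- (x \<bullet> b)) * G (\<lambda>z. \<phi> (fst z) * f z) m0 t x"
   unfolding G_cmult[symmetric]
   by (rule G_add) (use x m0_nonneg in \<open>auto intro!: continuous_intros cont_fst \<phi> fc\<close>)
  moreover have "G (\<lambda>z. \<phi> (fst z) * f z) m0 t x = 0" using f \<phi> t x by (auto simp: wts_def Z_def)
  ultimately show "G (\<lambda>z. \<phi> (fst z) * ((snd z \<bullet> b) * f z)) m0 t x = 0" by simp
 qed
qed

lemma wts_sum:
 assumes "finite I" "\<And>i. i \<in> I ==> g i \<in> wts" shows "(\<lambda>z. \<Sum>i\<in>I. g i z) \<in> wts"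
 using assms
proof (induction I rule: finite_induct)
 case empty
 show ?case using wts_time[OF wts_1, of "\<lambda>_. 0"] by simp
qed (simp add: wts_add)

lemma wts_poly:
 assumes "real_polynomial_function p" "f \<in> wts" shows "(\<lambda>z. p z * f z) \<in> wts"
 using assms
proof (induction p arbitrary: f rule: real_polynomial_function.induct)
 case (linear p)
 note fw = linear(2)
 interpret bounded_linear p by (rule linear(1))
 have pz: "p z = p (1, 0) * fst z + (\<Sum>b\<in>Basis. (snd z \<bullet> b) * p (0, b))" for z :: "'n spacetime"
 proof -
  have "z = fst z *\<^sub>R (1, 0) + (\<Sum>b\<in>Basis. (snd z \<bullet> b) *\<^sub>R (0, b))"
  proof (rule prod_eqI)
   show "fst z = fst (fst z *\<^sub>R (1, 0::real^'n) + (\<Sum>b\<in>Basis. (snd z \<bullet> b) *\<^sub>R (0, b)))"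
    by (simp add: fst_sum)
   show "snd z = snd (fst z *\<^sub>R (1::real, 0::real^'n) + (\<Sum>b\<in>Basis. (snd z \<bullet> b) *\<^sub>R (0, b)))"
    by (simp add: snd_sum euclidean_representation)
  qed
  then have "p z = p (fst z *\<^sub>R (1, 0) + (\<Sum>b\<in>Basis. (snd z \<bullet> b) *\<^sub>R (0, b)))" by (rule arg_cong)
  also have "\<dots> = fst z *\<^sub>R p (1, 0) + (\<Sum>b\<in>Basis. (snd z \<bullet> b) *\<^sub>R p (0, b))"
   by (simp only: add sum scaleR)
  finally show ?thesis by (simp add: mult.commute)
 qed
 have eq: "(\<lambda>z. p z * f z) = (\<lambda>z. (p (1, 0) * fst z) * f z + (\<Sum>b\<in>Basis. p (0, b) * ((snd z \<bullet> b) * f z)))"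
  by (rule ext, subst pz) (simp only: distrib_right sum_distrib_right mult.assoc, simp only: mult.left_commute)
 show ?case unfolding eq
 proof (rule wts_add)
  show "(\<lambda>z. (p (1, 0) * fst z) * f z) \<in> wts"
   by (rule wts_time[OF fw, of "\<lambda>r. p (1, 0) * r"]) (intro continuous_intros)
  show "(\<lambda>z. \<Sum>b\<in>Basis. p (0, b) * ((snd z \<bullet> b) * f z)) \<in> wts"
   by (rule wts_sum) (auto intro: wts_time[OF wts_space[OF fw], of "\<lambda>_. p (0, _)"])
 qed
next
 case (const c)
 then show ?case using wts_time[of f "\<lambda>_. c"] by simp
next
 case (add p q)
 then show ?case using wts_add[of "\<lambda>z. p z * f z" "\<lambda>z. q z * f z"] by (simp add: distrib_right)
next
 case (mult p q)
 then show ?case by (simp add: mult.assoc)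
qed

lemma G_cont_zero:
 assumes t: "t \<in> {-T<..<T}" and x: "x \<in> B" and f: "continuous_on UNIV f"
 shows "G f m0 t x = 0"
proof -
 have iv: "integrable lborel (\<lambda>z. complex_of_real (1 * kap m0 (cc x z) (e * (fst z - t))) * v z)"
  by (rule G_integrable) (use m0_nonneg x in auto)
 define L where "L = (LINT z|lborel. cmod (of_real (1 * kap m0 (cc x z) (e * (fst z - t))) * v z))"
 have L0: "0 \<le> L" by (simp add: L_def)
 have "cmod (G f m0 t x) \<le> 0 + \<epsilon>" if \<epsilon>: "0 < \<epsilon>" for \<epsilon>
 proof -
  define \<delta> where "\<delta> = \<epsilon> / (L + 1)"
  have \<delta>: "0 < \<delta>" using \<epsilon> L0 by (simp add: \<delta>_def)
  obtain g where g: "real_polynomial_function g" "\<And>z. z \<in> K ==> \<bar>f z - g z\<bar> < \<delta>"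
   using Stone_Weierstrass_real_polynomial_function[OF compact_K continuous_on_subset[OF f] \<delta>] by auto
  have gc: "continuous_on UNIV g" using g(1)
   by (simp add: continuous_on_polymonial_function real_polynomial_function_eq)
  have "(\<lambda>z. g z * 1) \<in> wts" by (rule wts_poly[OF g(1) wts_1])
  then have "\<forall>\<phi>. continuous_on UNIV \<phi> \<longrightarrow> Z (\<lambda>z. \<phi> (fst z) * (g z * 1)) m0" unfolding wts_def by simp
  from spec[OF this, of "\<lambda>_. 1"] have gz: "G g m0 t x = 0" using t x by (simp add: Z_def)
  have cdiff: "continuous_on UNIV (\<lambda>z. f z - g z)" by (intro continuous_intros f gc)
  have "G f m0 t x = G (\<lambda>z. (f z - g z) + g z) m0 t x" by simp
  also have "\<dots> = G (\<lambda>z. f z - g z) m0 t x + 0"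
   unfolding gz[symmetric] by (rule G_add[OF cdiff gc m0_nonneg x])
  finally have "cmod (G f m0 t x) = cmod (G (\<lambda>z. f z - g z) m0 t x)" by simp
  also have "\<dots> \<le> (LINT z|lborel. \<delta> * cmod (of_real (1 * kap m0 (cc x z) (e * (fst z - t))) * v z))"
   unfolding G_def
  proof (rule Bochner_Integration.integral_norm_bound_integral)
   show "integrable lborel (\<lambda>z. complex_of_real ((f z - g z) * kap m0 (cc x z) (e * (fst z - t))) * v z)"
    by (rule G_integrable[OF cdiff m0_nonneg x])
   show "integrable lborel (\<lambda>z. \<delta> * cmod (of_real (1 * kap m0 (cc x z) (e * (fst z - t))) * v z))"
    by (intro integrable_mult_right integrable_norm iv)
   fix z :: "'n spacetime"
   show "norm (complex_of_real ((f z - g z) * kap m0 (cc x z) (e * (fst z - t))) * v z) \<le> \<delta> * cmod (of_real (1 * kap m0 (cc x z) (e * (fst z - t))) * v z)"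
   proof (cases "z \<in> K")
    case True
    then have "\<bar>f z - g z\<bar> \<le> \<delta>" using g(2) by (simp add: less_imp_le)
    then have "\<bar>f z - g z\<bar> * (kap m0 (cc x z) (e * (fst z - t)) * cmod (v z)) \<le> \<delta> * (kap m0 (cc x z) (e * (fst z - t)) * cmod (v z))"
     by (intro mult_right_mono mult_nonneg_nonneg kap_nonneg) auto
    then show ?thesis by (simp only: norm_mult norm_of_real abs_mult abs_of_nonneg[OF kap_nonneg] mult_1 mult.assoc abs_one)
   qed (simp add: v_out)
  qed
  also have "\<dots> = \<delta> * L" unfolding L_def by simp
  also have "\<dots> \<le> \<epsilon>" using \<epsilon> L0 by (simp add: \<delta>_def field_simps)
  finally show ?thesis by simp
 qed
 then have "cmod (G f m0 t x) \<le> 0" by (rule field_le_epsilon)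
 then show ?thesis by simp
qed

text \<open>For fixed \<open>(t, x)\<close> the kernel times \<open>v\<close> is orthogonal to all
  continuous functions, in particular to characters, so its Fourier integral is 0 and Plancherel
  makes it vanish. The kernel is positive at every source time on the visible side of
  \<open>t\<close>; letting \<open>t\<close> approach the end from which everything is visible
  uncovers all of \<open>v\<close>.\<close>

theorem vanishing: "AE z in lborel. v z = 0"
proof -
 obtain x where x: "x \<in> B" using B(2) by blast
 have slice: "AE z in lborel. of_real (kap m0 (cc x z) (e * (fst z - t))) * v z = 0" if t: "t \<in> {-T<..<T}" for t
 proof -
  define w where "w z = of_real (kap m0 (cc x z) (e * (fst z - t))) * v z" for z
  obtain M where M: "0 \<le> M" "\<And>c \<tau>. c0 \<le> c ==> kap m0 c \<tau> \<le> M" using kap_bound[OF m0_nonneg c0(1)] by blast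
  have [measurable]: "w \<in> borel_measurable borel" unfolding w_def by measurable
  have iw: "integrable lborel w"
   unfolding w_def using G_integrable[of "\<lambda>_. 1" m0 x t] m0_nonneg x by simp
  have "sqint lborel w"
  proof (rule sqint_bound[OF v, of _ M])
   show "AE z in lborel. cmod (w z) \<le> M * cmod (v z)"
   proof (intro AE_I2)
    fix z show "cmod (w z) \<le> M * cmod (v z)"
    proof (cases "z \<in> K")
     case True
     then have "kap m0 (cc x z) (e * (fst z - t)) * cmod (v z) \<le> M * cmod (v z)"
      by (intro mult_right_mono M cc_ge x) auto
     then show ?thesis by (simp add: w_def norm_mult kap_nonneg)
    qed (simp add: w_def v_out)
   qed
  qed measurable
  with iw have L: "L12 w" by (simp add: L12_def)
  have FI0: "FI w \<zeta> = 0" for \<zeta>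
  proof -
   have c: "continuous_on UNIV (\<lambda>z::'n spacetime. cos (z \<bullet> \<zeta>))" "continuous_on UNIV (\<lambda>z::'n spacetime. sin (z \<bullet> \<zeta>))"
    by (intro continuous_intros)+
   have i: "integrable lborel (\<lambda>z. complex_of_real (cos (z \<bullet> \<zeta>) * kap m0 (cc x z) (e * (fst z - t))) * v z)"
    "integrable lborel (\<lambda>z. complex_of_real (sin (z \<bullet> \<zeta>) * kap m0 (cc x z) (e * (fst z - t))) * v z)"
    by (intro G_integrable c m0_nonneg x)+
   have "FI w \<zeta> = (LINT z|lborel. complex_of_real (cos (z \<bullet> \<zeta>) * kap m0 (cc x z) (e * (fst z - t))) * v z
     - \<i> * (complex_of_real (sin (z \<bullet> \<zeta>) * kap m0 (cc x z) (e * (fst z - t))) * v z))"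
    unfolding FI_def w_def
   proof (rule Bochner_Integration.integral_cong[OF refl])
    fix z
    have "exp (- (\<i> * complex_of_real (z \<bullet> \<zeta>))) = cos (of_real (z \<bullet> \<zeta>)) - \<i> * sin (of_real (z \<bullet> \<zeta>))"
     by (simp add: exp_minus_Euler)
    also have "\<dots> = of_real (cos (z \<bullet> \<zeta>)) - \<i> * of_real (sin (z \<bullet> \<zeta>))"
     by (simp only: cos_of_real sin_of_real)
    finally have ex: "exp (- (\<i> * complex_of_real (z \<bullet> \<zeta>))) = of_real (cos (z \<bullet> \<zeta>)) - \<i> * of_real (sin (z \<bullet> \<zeta>))" .
    have gen: "(a - \<i> * b) * (k * c) = a * k * c - \<i> * (b * k * c)" for a b c k :: complex by (simp add: algebra_simps)
    show "exp (- (\<i> * complex_of_real (z \<bullet> \<zeta>))) * (of_real (kap m0 (cc x z) (e * (fst z - t))) * v z) =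
     complex_of_real (cos (z \<bullet> \<zeta>) * kap m0 (cc x z) (e * (fst z - t))) * v z
     - \<i> * (complex_of_real (sin (z \<bullet> \<zeta>) * kap m0 (cc x z) (e * (fst z - t))) * v z)"
     unfolding ex of_real_mult gen ..
   qed
   also have "\<dots> = G (\<lambda>z. cos (z \<bullet> \<zeta>)) m0 t x - \<i> * G (\<lambda>z. sin (z \<bullet> \<zeta>)) m0 t x"
    unfolding G_def using i by simp
   also have "\<dots> = 0" using G_cont_zero[OF t x c(1)] G_cont_zero[OF t x c(2)] by simp
   finally show ?thesis .
  qed
  have "sqnorm lborel (FI w) = 0" unfolding FI0 by (simp add: sqnorm_def)
  then have "sqnorm lborel w = 0" using plancherel_L12(2)[OF L] by simp
  from sqnorm_0_AE[OF L12_sqint[OF L] this] show ?thesis by (simp add: w_def)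
 qed
 \<comment> \<open>The limit is \<open>- e * T\<close>, the start of the interval when the kernel
   looks forward and its end when it looks back. With \<open>k + 2\<close> the last factor lies
   strictly between 0 and 1.\<close>
 define tk where "tk k = - e * T * (1 - 1 / real (k + 2))" for k :: nat
 have tk: "tk k \<in> {-T<..<T}" for k
 proof -
  have a: "0 < 1 - 1 / real (k + 2)" "1 - 1 / real (k + 2) < 1" by (auto simp: field_simps)
  define c where "c = T * (1 - 1 / real (k + 2))"
  have "T * (1 - 1 / real (k + 2)) < T * 1" by (rule mult_strict_left_mono[OF a(2) T])
  then have "0 < c" "c < T" using mult_pos_pos[OF T a(1)] unfolding c_def by simp_all
  moreover have "tk k = - e * c" by (simp add: tk_def c_def)
  ultimately show ?thesis using e by auto
 qed
 have "AE z in lborel. \<forall>k. of_real (kap m0 (cc x z) (e * (fst z - tk k))) * v z = 0"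
  unfolding AE_all_countable using slice[OF tk] by blast
 \<comment> \<open>The slice at time \<open>- e * T\<close> is seen from no \<open>tk k\<close>, but
   it is a null set.\<close>
 moreover have "AE z in lborel. z \<bullet> ((1, 0) :: 'n spacetime) \<noteq> - e * T"
 proof -
  have "negligible {z :: 'n spacetime. z \<bullet> (1, 0) = - e * T}"
   by (rule negligible_standard_hyperplane) (simp add: Basis_prod_def)
  then have "AE z in lborel. (z :: 'n spacetime) \<notin> {z. z \<bullet> (1, 0) = - e * T}"
   by (intro AE_not_in) (simp add: negligible_iff_null_sets null_sets_completion_iff)
  then show ?thesis by simp
 qed
 ultimately show ?thesis
 proof eventually_elim
  case (elim z)
  show "v z = 0"
  proof (rule ccontr)
   assume nz: "v z \<noteq> 0"
   then have zK: "z \<in> K" using v_out by blast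
   then have "\<bar>fst z\<bar> \<le> T" by (auto simp: K_def)
   moreover have "fst z \<noteq> - e * T" using elim(2) by (cases z) (simp add: inner_prod_def)
   ultimately have "0 < e * fst z + T" using e by auto
   then obtain k where k: "T / (e * fst z + T) < real k" using reals_Archimedean2 by blast
   have "0 < e * (fst z - tk k)"
   proof -
    have "T < real k * (e * fst z + T)" using k \<open>0 < e * fst z + T\<close> by (simp add: field_simps)
    also have "\<dots> \<le> real (k + 2) * (e * fst z + T)" using \<open>0 < e * fst z + T\<close> by (intro mult_right_mono) auto
    finally have "T / real (k + 2) < e * fst z + T" by (simp add: field_simps)
    moreover have "e * (fst z - tk k) = e * fst z + T - T / real (k + 2)"
     using e by (auto simp: tk_def right_diff_distrib)
    ultimately show ?thesis by simp
   qed
   then have "kap m0 (cc x z) (e * (fst z - tk k)) \<noteq> 0" by (auto simp: kap_def)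
   with elim(1) nz show False by simp
  qed
 qed
qed

end

end

section \<open>Test functions\<close>

text \<open>\<open>Ck\<close> is defined by recursion over directional derivatives, so a family
  closed under these is smooth by induction. A derivative of \<open>kap\<close> raises the exponent
  and produces linear factors; hence all \<open>j\<close>, linear functions, constants, sums and
  products.\<close>

inductive_set bump_ring :: "'a::euclidean_space => real => ('a => complex) set" for p \<delta> where
 kap: "(\<lambda>z. of_real (kap (real j) 1 (\<delta>\<^sup>2 - (norm (z - p))\<^sup>2))) \<in> bump_ring p \<delta>"
| lin: "(\<lambda>z. of_real (z \<bullet> h)) \<in> bump_ring p \<delta>"
| const: "(\<lambda>z. c) \<in> bump_ring p \<delta>"
| add: "f \<in> bump_ring p \<delta> ==> g \<in> bump_ring p \<delta> ==> (\<lambda>z. f z + g z) \<in> bump_ring p \<delta>"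
| mult: "f \<in> bump_ring p \<delta> ==> g \<in> bump_ring p \<delta> ==> (\<lambda>z. f z * g z) \<in> bump_ring p \<delta>"

lemma bump_ring_deriv:
 assumes "f \<in> bump_ring p \<delta>"
 shows "\<exists>f'. (\<forall>z. (f has_derivative f' z) (at z)) \<and> (\<forall>h. (\<lambda>z. f' z h) \<in> bump_ring p \<delta>)"
 using assms
proof induct
 case (kap j)
 define q where "q z = \<delta>\<^sup>2 - (norm (z - p))\<^sup>2" for z
 define f' where "f' z h = complex_of_real ((- real j * kap (real (Suc j)) 1 (q z) + 1 * kap (real (Suc (Suc j))) 1 (q z)) * (- 2 * ((z - p) \<bullet> h)))" for z h
 have "((\<lambda>z. of_real (kap (real j) 1 (q z))) has_derivative f' z) (at z)" for z
 proof -
  have dq: "(q has_derivative (\<lambda>h. - 2 * ((z - p) \<bullet> h))) (at z)"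
   unfolding q_def power2_norm_eq_inner
   by (auto intro!: derivative_eq_intros simp: inner_commute)
  have "(kap (real j) 1 has_derivative (*) (- real j * kap (real j + 1) 1 (q z) + 1 * kap (real j + 2) 1 (q z))) (at (q z))"
   using kap_deriv_tau[of "real j" 1 "q z"] unfolding has_field_derivative_def by simp
  from has_derivative_compose[OF dq this]
  have "((\<lambda>z. kap (real j) 1 (q z)) has_derivative (\<lambda>h. (- real j * kap (real j + 1) 1 (q z) + 1 * kap (real j + 2) 1 (q z)) * (- 2 * ((z - p) \<bullet> h)))) (at z)" .
  from has_derivative_of_real[OF this] show ?thesis
   by (simp add: f'_def[abs_def] add.commute)
 qed
 moreover have "(\<lambda>z. f' z h) \<in> bump_ring p \<delta>" for h
 proof -
  have "(\<lambda>z. (of_real (- real j) * of_real (kap (real (Suc j)) 1 (\<delta>\<^sup>2 - (norm (z - p))\<^sup>2)) + of_real (kap (real (Suc (Suc j))) 1 (\<delta>\<^sup>2 - (norm (z - p))\<^sup>2)))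
    * (of_real (- 2) * (of_real (z \<bullet> h) + of_real (- (p \<bullet> h))))) \<in> bump_ring p \<delta>"
   by (intro bump_ring.intros)
  also have "(\<lambda>z. (of_real (- real j) * of_real (kap (real (Suc j)) 1 (\<delta>\<^sup>2 - (norm (z - p))\<^sup>2)) + of_real (kap (real (Suc (Suc j))) 1 (\<delta>\<^sup>2 - (norm (z - p))\<^sup>2)))
    * (of_real (- 2) * (of_real (z \<bullet> h) + of_real (- (p \<bullet> h))))) = (\<lambda>z. f' z h)"
   by (simp add: f'_def q_def inner_diff_left fun_eq_iff)
  finally show ?thesis .
 qed
 ultimately show ?case unfolding q_def by blast
next
 case (lin h)
 have "((\<lambda>z. complex_of_real (z \<bullet> h)) has_derivative (\<lambda>k. of_real (k \<bullet> h))) (at z)" for z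
  by (auto intro!: derivative_eq_intros)
 then show ?case by (intro exI[of _ "\<lambda>z k. of_real (k \<bullet> h)"]) (auto intro: bump_ring.const)
next
 case (const c)
 show ?case by (intro exI[of _ "\<lambda>z k. 0"]) (auto intro: bump_ring.const)
next
 case (add f g)
 from add(2) obtain f' where f': "\<forall>z. (f has_derivative f' z) (at z)" "\<forall>h. (\<lambda>z. f' z h) \<in> bump_ring p \<delta>"
  by (elim exE conjE) (rule that)
 from add(4) obtain g' where g': "\<forall>z. (g has_derivative g' z) (at z)" "\<forall>h. (\<lambda>z. g' z h) \<in> bump_ring p \<delta>"
  by (elim exE conjE) (rule that)
 show ?case
 proof (intro exI[of _ "\<lambda>z h. f' z h + g' z h"] conjI allI)
  show "((\<lambda>z. f z + g z) has_derivative (\<lambda>h. f' z h + g' z h)) (at z)" for z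
   using f'(1) g'(1) by (intro has_derivative_add) auto
  show "(\<lambda>z. f' z h + g' z h) \<in> bump_ring p \<delta>" for h
   using f'(2) g'(2) by (intro bump_ring.add) auto
 qed
next
 case (mult f g)
 from mult(2) obtain f' where f': "\<forall>z. (f has_derivative f' z) (at z)" "\<forall>h. (\<lambda>z. f' z h) \<in> bump_ring p \<delta>"
  by (elim exE conjE) (rule that)
 from mult(4) obtain g' where g': "\<forall>z. (g has_derivative g' z) (at z)" "\<forall>h. (\<lambda>z. g' z h) \<in> bump_ring p \<delta>"
  by (elim exE conjE) (rule that)
 show ?case
 proof (intro exI[of _ "\<lambda>z h. f z * g' z h + f' z h * g z"] conjI allI)
  show "((\<lambda>z. f z * g z) has_derivative (\<lambda>h. f z * g' z h + f' z h * g z)) (at z)" for z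
   using f'(1) g'(1) by (intro has_derivative_mult) auto
  show "(\<lambda>z. f z * g' z h + f' z h * g z) \<in> bump_ring p \<delta>" for h
   using f'(2) g'(2) mult(1,3) by (intro bump_ring.add bump_ring.mult) auto
 qed
qed

lemma bump_ring_Ck: "f \<in> bump_ring p \<delta> ==> Ck k f"
proof (induction k arbitrary: f)
 case 0
 from bump_ring_deriv[OF 0] obtain f' where f': "\<forall>z. (f has_derivative f' z) (at z)"
  by (elim exE conjE) (rule that)
 have "continuous_on UNIV f"
  by (rule has_derivative_continuous_on[of UNIV f f']) (use f' in simp)
 then show ?case by simp
next
 case (Suc k)
 from bump_ring_deriv[OF Suc(2)] obtain f' where
  f': "\<forall>z. (f has_derivative f' z) (at z)" "\<forall>h. (\<lambda>z. f' z h) \<in> bump_ring p \<delta>"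
  by (elim exE conjE) (rule that)
 have fd: "frechet_derivative f (at z) = f' z" for z
  using frechet_derivative_at[OF spec[OF f'(1), of z]] by simp
 have "f differentiable at z" for z using spec[OF f'(1), of z] by (rule differentiableI)
 moreover have "Ck k (\<lambda>z. f' z h)" for h by (rule Suc(1)) (use f'(2) in simp)
 ultimately show ?case by (simp add: fd)
qed

text \<open>The standard mollifier \<open>exp (- 1 / (\<delta>^2 - |z - p|^2))\<close> on the ball,
  written with \<open>kap\<close> to inherit its smoothness and bounds.\<close>

definition bump :: "'a::euclidean_space => real => 'a => real" where
 "bump p \<delta> z = kap 0 1 (\<delta>\<^sup>2 - (norm (z - p))\<^sup>2)"

lemma bump_nonneg: "0 \<le> bump p \<delta> z" by (simp add: bump_def kap_nonneg)

lemma bump_pos_iff: assumes "0 < \<delta>" shows "bump p \<delta> z \<noteq> 0 \<longleftrightarrow> norm (z - p) < \<delta>"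
proof -
 have "0 < \<delta>\<^sup>2 - (norm (z - p))\<^sup>2 \<longleftrightarrow> norm (z - p) < \<delta>"
 proof
  assume "0 < \<delta>\<^sup>2 - (norm (z - p))\<^sup>2"
  then show "norm (z - p) < \<delta>" using assms power2_less_imp_less[of "norm (z - p)" \<delta>] by simp
 next
  assume "norm (z - p) < \<delta>"
  then have "(norm (z - p))\<^sup>2 < \<delta>\<^sup>2" by (intro power_strict_mono) auto
  then show "0 < \<delta>\<^sup>2 - (norm (z - p))\<^sup>2" by simp
 qed
 then show ?thesis by (auto simp: bump_def kap_def)
qed

lemma bump_Cc_infty:
 assumes "0 < \<delta>" "cball p \<delta> \<subseteq> A"
 shows "(\<lambda>z. complex_of_real (bump p \<delta> z)) \<in> Cc_infty A"
proof -
 have "(\<lambda>z. complex_of_real (bump p \<delta> z)) \<in> bump_ring p \<delta>"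
  unfolding bump_def using bump_ring.kap[of 0 \<delta> p] by simp
 then have ck: "Ck k (\<lambda>z. complex_of_real (bump p \<delta> z))" for k by (rule bump_ring_Ck)
 have "{z. complex_of_real (bump p \<delta> z) \<noteq> 0} \<subseteq> cball p \<delta>"
 proof
  fix z assume "z \<in> {z. complex_of_real (bump p \<delta> z) \<noteq> 0}"
  then show "z \<in> cball p \<delta>"
   using bump_pos_iff[OF assms(1), of p z] by (simp add: dist_norm norm_minus_commute)
 qed
 then have cl: "closure {z. complex_of_real (bump p \<delta> z) \<noteq> 0} \<subseteq> cball p \<delta>"
  by (rule closure_minimal) simp
 then have "compact (closure {z. complex_of_real (bump p \<delta> z) \<noteq> 0})"
  by (meson bounded_cball bounded_subset closed_closure compact_eq_bounded_closed)
 then show ?thesis using ck cl assms(2) by (auto simp: Cc_infty_def)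
qed

lemma bump_lipschitz:
 assumes "0 < \<delta>" obtains L where "\<And>z w. \<bar>bump p \<delta> z - bump p \<delta> w\<bar> \<le> L * norm (z - w)"
proof -
 obtain M where M: "0 \<le> M" "\<And>\<tau>. kap 2 1 \<tau> \<le> M" by (rule kap_bound[of 2 1]) auto
 have lip: "\<bar>kap 0 1 a - kap 0 1 b\<bar> \<le> M * \<bar>a - b\<bar>" for a b
 proof -
  have "norm (kap 0 1 a - kap 0 1 b) \<le> M * norm (a - b)"
  proof (rule field_differentiable_bound[of UNIV "kap 0 1" "kap 2 1"])
   show "(kap 0 1 has_field_derivative kap 2 1 z) (at z within UNIV)" for z
    using kap_deriv_tau[of 0 1 z] by simp
   show "norm (kap 2 1 z) \<le> M" for z using M kap_nonneg[of 2 1 z] by simp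
  qed auto
  then show ?thesis by simp
 qed
 \<comment> \<open>The squared distance is not globally Lipschitz. Cutting the distance off at
   \<open>\<delta>\<close> leaves the bump unchanged and bounds \<open>m z + m w\<close> by
   \<open>2 * \<delta>\<close>.\<close>
 define m where "m z = min (norm (z - p)) \<delta>" for z
 have eq: "bump p \<delta> z = kap 0 1 (\<delta>\<^sup>2 - (m z)\<^sup>2)" for z
 proof (cases "norm (z - p) \<le> \<delta>")
  case False
  then have "\<delta>\<^sup>2 \<le> (norm (z - p))\<^sup>2" using assms by (intro power_mono) auto
  then show ?thesis using False by (simp add: bump_def m_def min_def kap_def)
 qed (simp add: bump_def m_def min_def)
 have "\<bar>bump p \<delta> z - bump p \<delta> w\<bar> \<le> (M * (2 * \<delta>)) * norm (z - w)" for z w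
 proof -
  have mb: "0 \<le> m z" "m z \<le> \<delta>" for z using assms by (auto simp: m_def)
  have md: "\<bar>m z - m w\<bar> \<le> norm (z - w)"
  proof -
   have "\<bar>m z - m w\<bar> \<le> \<bar>norm (z - p) - norm (w - p)\<bar>" by (auto simp: m_def min_def)
   also have "\<dots> \<le> norm ((z - p) - (w - p))" by (rule norm_triangle_ineq3)
   finally show ?thesis by simp
  qed
  have "\<bar>bump p \<delta> z - bump p \<delta> w\<bar> \<le> M * \<bar>(\<delta>\<^sup>2 - (m z)\<^sup>2) - (\<delta>\<^sup>2 - (m w)\<^sup>2)\<bar>"
   unfolding eq by (rule lip)
  also have "\<bar>(\<delta>\<^sup>2 - (m z)\<^sup>2) - (\<delta>\<^sup>2 - (m w)\<^sup>2)\<bar> = \<bar>m z - m w\<bar> * (m z + m w)"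
  proof -
   have "(\<delta>\<^sup>2 - (m z)\<^sup>2) - (\<delta>\<^sup>2 - (m w)\<^sup>2) = - ((m z - m w) * (m z + m w))" by (simp add: power2_eq_square algebra_simps)
   then show ?thesis using mb[of z] mb[of w] by (simp add: abs_mult)
  qed
  also have "M * (\<bar>m z - m w\<bar> * (m z + m w)) \<le> M * (norm (z - w) * (2 * \<delta>))"
   using mb[of z] mb[of w] by (intro mult_left_mono mult_mono md M) auto
  finally show ?thesis by (simp add: mult_ac)
 qed
 then show ?thesis using that by blast
qed

lemma lipschitz_L12:
 fixes u :: "'a::euclidean_space => complex"
 assumes lip: "\<And>z w. cmod (u z - u w) \<le> L * norm (z - w)" and supp: "\<And>z. R < norm z ==> u z = 0" and R: "0 \<le> R"
 shows "L12 u"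
proof -
 have L: "0 \<le> L"
 proof -
  obtain b :: 'a where "b \<in> Basis" by (meson SOME_Basis)
  then show ?thesis using order_trans[OF norm_ge_zero lip[of b 0]] by simp
 qed
 have "continuous_on UNIV u"
  by (rule lipschitz_on_continuous_on[of L]) (auto intro!: lipschitz_onI simp: dist_norm lip L)
 then have [measurable]: "u \<in> borel_measurable borel" by (rule borel_measurable_continuous_onI)
 obtain b :: 'a where b: "b \<in> Basis" by (meson SOME_Basis)
 have bd: "cmod (u z) \<le> L * (2 * R + 1)" if "norm z \<le> R" for z
 proof -
  \<comment> \<open>A point outside the support, within distance \<open>2 * R + 1\<close> of every
    point of the ball, turns the Lipschitz bound into a bound on \<open>u\<close>.\<close>
  have "u ((R + 1) *\<^sub>R b) = 0" by (rule supp) (use b R in simp)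
  then have "cmod (u z) \<le> L * norm (z - (R + 1) *\<^sub>R b)" using lip[of z "(R + 1) *\<^sub>R b"] by simp
  also have "\<dots> \<le> L * (2 * R + 1)"
   using that b R norm_triangle_ineq4[of z "(R + 1) *\<^sub>R b"] by (intro mult_left_mono L) simp
  finally show ?thesis .
 qed
 have "sqint lborel u"
 proof (rule sqintI)
  show "integrable lborel (\<lambda>z. (cmod (u z))\<^sup>2)"
  proof (rule Bochner_Integration.integrable_bound)
   show "integrable lborel (\<lambda>z::'a. (L * (2 * R + 1))\<^sup>2 * indicat_real (cball 0 R) z)"
    using emeasure_lborel_cball_finite[of "0::'a" R] by (intro integrable_mult_right) simp
   show "AE z in lborel. norm ((cmod (u z))\<^sup>2) \<le> norm ((L * (2 * R + 1))\<^sup>2 * indicat_real (cball 0 R) z)"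
   proof (intro AE_I2)
    fix z :: 'a
    show "norm ((cmod (u z))\<^sup>2) \<le> norm ((L * (2 * R + 1))\<^sup>2 * indicat_real (cball 0 R) z)"
     using bd[of z] supp[of z] L R
     by (cases "norm z \<le> R") (auto intro!: power_mono split: split_indicator)
   qed
  qed measurable
 qed measurable
 from L12_truncate[OF this, of R] show ?thesis
 proof -
  have "(\<lambda>z. indicator (cball 0 R) z * u z) = u"
   using supp by (force split: split_indicator)
  then show ?thesis using \<open>L12 (\<lambda>z. indicator (cball 0 R) z * u z)\<close> by simp
 qed
qed

text \<open>This is read off from the \<open>L\<^sup>2\<close> bound on the difference quotients in direction \<open>b\<close>.\<close>

lemma lipschitz_frequency:
 fixes u :: "'a::euclidean_space => complex"
 assumes lip: "\<And>z w. cmod (u z - u w) \<le> L * norm (z - w)" and supp: "\<And>z. R < norm z ==> u z = 0" and R: "0 \<le> R"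
  and U: "ft u U" and b: "b \<in> Basis"
 shows "integrable lborel (\<lambda>\<zeta>. (\<zeta> \<bullet> b)\<^sup>2 * (cmod (U \<zeta>))\<^sup>2)"
proof -
 note D = ftD[OF U]
 have [measurable]: "U \<in> borel_measurable borel" by (rule D)
 define V where "V = measure lborel (cball (0::'a) (R + 1))"
 define c where "c = (2 * pi) ^ DIM('a) * (L\<^sup>2 * V)"
 have c0: "0 \<le> c" by (simp add: c_def V_def)
 define g where "g k \<zeta> = exp (- (\<i> * of_real ((b /\<^sub>R real (Suc k)) \<bullet> \<zeta>))) * U \<zeta> - U \<zeta>" for k \<zeta>
 have gs: "sqint lborel (g k)" for k
  unfolding g_def by (intro ftD(2)[OF ft_diff[OF ft_translate[OF U] U]])
 have gn: "sqnorm lborel (g k) \<le> c * (1 / real (Suc k))\<^sup>2" for k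
 proof -
  define h where "h = b /\<^sub>R real (Suc k)"
  have h: "norm h = 1 / real (Suc k)" "norm h \<le> 1" using b by (auto simp: h_def divide_simps)
  have "sqnorm lborel (g k) = (2 * pi) ^ DIM('a) * sqnorm lborel (\<lambda>z. u (z - h) - u z)"
   unfolding g_def h_def[symmetric] by (rule plancherel[OF ft_diff[OF ft_translate[OF U] U]])
  also have "sqnorm lborel (\<lambda>z. u (z - h) - u z) \<le> (LINT z|lborel. (L * norm h)\<^sup>2 * indicat_real (cball (0::'a) (R + 1)) z)"
   unfolding sqnorm_def
  proof (rule Bochner_Integration.integral_mono)
   show "integrable lborel (\<lambda>z. (cmod (u (z - h) - u z))\<^sup>2)"
    by (rule sqint_integrable[OF ftD(1)[OF ft_diff[OF ft_translate[OF U] U]]])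
   show "integrable lborel (\<lambda>z::'a. (L * norm h)\<^sup>2 * indicat_real (cball 0 (R + 1)) z)"
    using emeasure_lborel_cball_finite[of "0::'a" "R + 1"] by (intro integrable_mult_right) simp
   fix z :: 'a
   show "(cmod (u (z - h) - u z))\<^sup>2 \<le> (L * norm h)\<^sup>2 * indicat_real (cball 0 (R + 1)) z"
   proof (cases "norm z \<le> R + 1")
    case True
    have "cmod (u (z - h) - u z) \<le> L * norm h" using lip[of "z - h" z] by simp
    then have "(cmod (u (z - h) - u z))\<^sup>2 \<le> (L * norm h)\<^sup>2" by (intro power_mono) auto
    then show ?thesis using True by simp
   next
    case False
    then have "R < norm (z - h)" using h(2) norm_triangle_ineq2[of z h] by linarith
    then show ?thesis using False supp[of z] supp[of "z - h"] by simp
   qed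
  qed
  also have "(LINT z|lborel. (L * norm h)\<^sup>2 * indicat_real (cball (0::'a) (R + 1)) z) = (L * norm h)\<^sup>2 * V"
   by (simp add: V_def)
  finally have "sqnorm lborel (g k) \<le> (2 * pi) ^ DIM('a) * ((L * norm h)\<^sup>2 * V)" by simp
  then show ?thesis unfolding c_def h power_mult_distrib by (simp only: mult_ac)
 qed
 have "(\<integral>\<^sup>+\<zeta>. ennreal ((\<zeta> \<bullet> b)\<^sup>2 * (cmod (U \<zeta>))\<^sup>2) \<partial>lborel) \<le> (\<integral>\<^sup>+\<zeta>. liminf (\<lambda>k. ennreal ((real (Suc k))\<^sup>2 * (cmod (g k \<zeta>))\<^sup>2)) \<partial>lborel)"
 proof (rule nn_integral_mono)
  fix \<zeta> :: 'a
  \<comment> \<open>The increment of the character over the step \<open>b / (k + 1)\<close>, divided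
    by the length of the step, tends to \<open>A\<close>. Fatou's lemma then bounds the integral
    with \<open>|A|^2\<close>.\<close>
  define A where "A = - (\<i> * of_real (b \<bullet> \<zeta>))"
  have "((\<lambda>e. exp (e *\<^sub>R A)) has_vector_derivative exp (0 *\<^sub>R A) * A) (at 0)"
   by (rule exp_scaleR_has_vector_derivative_right)
  then have l: "((\<lambda>e. (1 / e) *\<^sub>R (exp (e *\<^sub>R A) - 1)) \<longlongrightarrow> A) (at 0)"
   unfolding has_vector_derivative_iff_quotient by simp
  have "filterlim (\<lambda>k. inverse (real (Suc k))) (at 0) sequentially"
   unfolding filterlim_at using LIMSEQ_inverse_real_of_nat by auto
  from filterlim_compose[OF l this]
  have "(\<lambda>k. real (Suc k) *\<^sub>R (exp (inverse (real (Suc k)) *\<^sub>R A) - 1)) \<longlonglongrightarrow> A" by (simp add: field_simps)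
  then have "(\<lambda>k. ennreal ((cmod (real (Suc k) *\<^sub>R (exp (inverse (real (Suc k)) *\<^sub>R A) - 1) * U \<zeta>))\<^sup>2)) \<longlonglongrightarrow> ennreal ((cmod (A * U \<zeta>))\<^sup>2)"
   by (intro tendsto_intros)
  also have "(\<lambda>k. ennreal ((cmod (real (Suc k) *\<^sub>R (exp (inverse (real (Suc k)) *\<^sub>R A) - 1) * U \<zeta>))\<^sup>2)) = (\<lambda>k. ennreal ((real (Suc k))\<^sup>2 * (cmod (g k \<zeta>))\<^sup>2))"
  proof
   fix k
   have "inverse (real (Suc k)) *\<^sub>R A = - (\<i> * of_real ((b /\<^sub>R real (Suc k)) \<bullet> \<zeta>))"
    by (simp add: A_def scaleR_conv_of_real)
   then have "g k \<zeta> = (exp (inverse (real (Suc k)) *\<^sub>R A) - 1) * U \<zeta>" by (simp add: g_def left_diff_distrib)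
   then show "ennreal ((cmod (real (Suc k) *\<^sub>R (exp (inverse (real (Suc k)) *\<^sub>R A) - 1) * U \<zeta>))\<^sup>2) = ennreal ((real (Suc k))\<^sup>2 * (cmod (g k \<zeta>))\<^sup>2)"
    by (simp only: norm_mult norm_scaleR mult_scaleR_left power_mult_distrib power2_abs)
  qed
  finally have "liminf (\<lambda>k. ennreal ((real (Suc k))\<^sup>2 * (cmod (g k \<zeta>))\<^sup>2)) = ennreal ((cmod (A * U \<zeta>))\<^sup>2)"
   by (intro lim_imp_Liminf) auto
  then show "ennreal ((\<zeta> \<bullet> b)\<^sup>2 * (cmod (U \<zeta>))\<^sup>2) \<le> liminf (\<lambda>k. ennreal ((real (Suc k))\<^sup>2 * (cmod (g k \<zeta>))\<^sup>2))"
   by (simp add: A_def norm_mult power_mult_distrib inner_commute)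
 qed
 also have "\<dots> \<le> liminf (\<lambda>k. \<integral>\<^sup>+\<zeta>. ennreal ((real (Suc k))\<^sup>2 * (cmod (g k \<zeta>))\<^sup>2) \<partial>lborel)"
  by (rule nn_integral_liminf) (use sqint_measurable[OF gs] in measurable)
 also have "\<dots> \<le> ennreal c"
 proof (rule Liminf_le)
  show "\<forall>\<^sub>F k in sequentially. (\<integral>\<^sup>+\<zeta>. ennreal ((real (Suc k))\<^sup>2 * (cmod (g k \<zeta>))\<^sup>2) \<partial>lborel) \<le> ennreal c"
  proof (intro always_eventually allI)
   fix k
   have [measurable]: "g k \<in> borel_measurable borel" using sqint_measurable[OF gs] by simp
   have "(\<integral>\<^sup>+\<zeta>. ennreal ((real (Suc k))\<^sup>2 * (cmod (g k \<zeta>))\<^sup>2) \<partial>lborel) = ennreal ((real (Suc k))\<^sup>2) * ennreal (sqnorm lborel (g k))"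
    by (simp add: ennreal_mult nn_integral_cmult nn_integral_sqint[OF gs])
   also have "\<dots> = ennreal ((real (Suc k))\<^sup>2 * sqnorm lborel (g k))" by (simp add: ennreal_mult sqnorm_nonneg)
   also have "\<dots> \<le> ennreal ((real (Suc k))\<^sup>2 * (c * (1 / real (Suc k))\<^sup>2))"
    by (intro ennreal_leI mult_left_mono gn) simp
   also have "(real (Suc k))\<^sup>2 * (c * (1 / real (Suc k))\<^sup>2) = c" by (simp add: power_divide)
   finally show "(\<integral>\<^sup>+\<zeta>. ennreal ((real (Suc k))\<^sup>2 * (cmod (g k \<zeta>))\<^sup>2) \<partial>lborel) \<le> ennreal c" .
  qed
 qed simp
 finally have "(\<integral>\<^sup>+\<zeta>. ennreal ((\<zeta> \<bullet> b)\<^sup>2 * (cmod (U \<zeta>))\<^sup>2) \<partial>lborel) < \<infinity>" by (rule order.strict_trans1) simp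
 then show ?thesis by (intro integrableI_bounded) auto
qed

section \<open>Parabolic Sobolev spaces\<close>

definition FT :: "('a::euclidean_space => complex) => 'a => complex" where
 "FT u = (SOME U. ft u U)"

lemma ft_FT: "sqint lborel u ==> ft u (FT u)"
 unfolding FT_def by (rule someI_ex[OF ft_exists])

definition wt :: "real => 'n::finite spacetime => real" where
 "wt s \<zeta> = (1 + cmod (heat_symbol \<zeta>)) powr s"

text \<open>With the root of the weight attached to the transform, the Sobolev norm is a plain
  \<open>sqnorm\<close> and the L2 lemmas apply to it directly.\<close>

definition rw :: "real => 'n::finite spacetime => complex" where
 "rw s \<zeta> = of_real (sqrt (wt s \<zeta>))"

lemma measurable_wt [measurable]: "wt s \<in> borel_measurable borel"
 unfolding wt_def[abs_def] by measurable

lemma measurable_rw [measurable]: "rw s \<in> borel_measurable borel"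
 unfolding rw_def[abs_def] by measurable

lemma wt_ge_1: "0 \<le> s ==> 1 \<le> wt s \<zeta>"
 by (simp add: wt_def ge_one_powr_ge_zero)

lemma wt_pos: "0 < wt s \<zeta>"
proof -
 have "0 < 1 + cmod (heat_symbol \<zeta>)" by (simp add: add_pos_nonneg)
 then show ?thesis by (simp add: wt_def)
qed

lemma cmod_rw_sq: "(cmod (rw s \<zeta> * x))\<^sup>2 = wt s \<zeta> * (cmod x)\<^sup>2"
 using wt_pos[of s \<zeta>] by (simp add: rw_def norm_mult power_mult_distrib)

lemma rw_mult_cnj: "rw s \<zeta> * a * cnj (rw s \<zeta> * b) = of_real (wt s \<zeta>) * (a * cnj b)"
proof -
 have "rw s \<zeta> * cnj (rw s \<zeta>) = of_real (wt s \<zeta>)"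
  using wt_pos[of s \<zeta>] by (simp add: rw_def flip: of_real_mult)
 then show ?thesis by (simp add: mult_ac)
qed

definition hs :: "real => ('n::finite spacetime => complex) set" where
 "hs s = {u. sqint lborel u \<and> sqint lborel (\<lambda>\<zeta>. rw s \<zeta> * FT u \<zeta>)}"

definition ips :: "real => ('n::finite spacetime => complex) => ('n spacetime => complex) => complex" where
 "ips s u w = inprod lborel (\<lambda>\<zeta>. rw s \<zeta> * FT u \<zeta>) (\<lambda>\<zeta>. rw s \<zeta> * FT w \<zeta>)"

abbreviation nrm :: "real => ('n::finite spacetime => complex) => real" where
 "nrm s u \<equiv> sqnorm lborel (\<lambda>\<zeta>. rw s \<zeta> * FT u \<zeta>)"

lemma hsD: assumes "u \<in> hs s"
 shows "sqint lborel u" "sqint lborel (\<lambda>\<zeta>. rw s \<zeta> * FT u \<zeta>)" "ft u (FT u)" "u \<in> borel_measurable borel" "FT u \<in> borel_measurable borel"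
 using assms ft_FT[of u] ftD[of u "FT u"] by (auto simp: hs_def)

lemma AE_FT: "ft u U ==> AE \<zeta> in lborel. FT u \<zeta> = U \<zeta>"
 using ft_unique[OF ft_FT] ftD(1) by blast

lemma AE_rw_FT:
 assumes "ft u U" shows "AE \<zeta> in lborel. rw s \<zeta> * FT u \<zeta> = rw s \<zeta> * U \<zeta>"
 using AE_FT[OF assms] by (rule eventually_mono) simp

lemma measurable_rw_mult: "U \<in> borel_measurable borel ==> (\<lambda>\<zeta>. rw s \<zeta> * U \<zeta>) \<in> borel_measurable lborel"
 by measurable

lemma hs_iff: assumes "ft u U" shows "u \<in> hs s \<longleftrightarrow> sqint lborel (\<lambda>\<zeta>. rw s \<zeta> * U \<zeta>)"
proof -
 have m: "(\<lambda>\<zeta>. rw s \<zeta> * U \<zeta>) \<in> borel_measurable lborel" "(\<lambda>\<zeta>. rw s \<zeta> * FT u \<zeta>) \<in> borel_measurable lborel"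
  using ftD[OF assms] ftD[OF ft_FT[OF ftD(1)[OF assms]]] by (auto intro: measurable_rw_mult)
 have ae: "AE \<zeta> in lborel. rw s \<zeta> * U \<zeta> = rw s \<zeta> * FT u \<zeta>"
  using AE_FT[OF assms] by (rule eventually_mono) simp
 show ?thesis
  using sqint_AE_cong[OF _ AE_rw_FT[OF assms] m(1)] sqint_AE_cong[OF _ ae m(2)] ftD(1)[OF assms] by (auto simp: hs_def)
qed

lemma nrm_eq: assumes "ft u U" shows "nrm s u = sqnorm lborel (\<lambda>\<zeta>. rw s \<zeta> * U \<zeta>)"
 using ftD[OF assms] ftD[OF ft_FT[OF ftD(1)[OF assms]]]
 by (intro sqnorm_AE_cong AE_rw_FT assms measurable_rw_mult)

lemma inprod_cong_AE:
 assumes "AE x in M. u x = u' x" "AE x in M. w x = w' x"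
  and [measurable]: "u \<in> borel_measurable M" "u' \<in> borel_measurable M" "w \<in> borel_measurable M" "w' \<in> borel_measurable M"
 shows "inprod M u w = inprod M u' w'"
 unfolding inprod_def
proof (rule integral_cong_AE)
 show "AE x in M. u x * cnj (w x) = u' x * cnj (w' x)" using assms(1,2) by eventually_elim simp
qed measurable

lemma ips_eq: assumes "ft u U" "ft w W" shows "ips s u w = inprod lborel (\<lambda>\<zeta>. rw s \<zeta> * U \<zeta>) (\<lambda>\<zeta>. rw s \<zeta> * W \<zeta>)"
 unfolding ips_def
 using ftD[OF assms(1)] ftD[OF assms(2)] ftD[OF ft_FT[OF ftD(1)[OF assms(1)]]] ftD[OF ft_FT[OF ftD(1)[OF assms(2)]]]
 by (intro inprod_cong_AE AE_rw_FT assms measurable_rw_mult)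

lemma hs_add: assumes "u \<in> hs s" "w \<in> hs s" shows "(\<lambda>z. u z + w z) \<in> hs s"
 unfolding hs_iff[OF ft_add[OF hsD(3)[OF assms(1)] hsD(3)[OF assms(2)]]] distrib_left
 by (intro sqint_add hsD(2) assms)

lemma hs_cmult: assumes "u \<in> hs s" shows "(\<lambda>z. c * u z) \<in> hs s"
 unfolding hs_iff[OF ft_cmult[OF hsD(3)[OF assms]]] mult.left_commute[of _ c]
 by (intro sqint_cmult hsD(2) assms)

lemma hs_diff: "u \<in> hs s ==> w \<in> hs s ==> (\<lambda>z. u z - w z) \<in> hs s"
 using hs_add[of u s "\<lambda>z. (-1) * w z"] hs_cmult[of w s "-1"] by simp

lemma hs_0: "(\<lambda>z. 0) \<in> hs s"
proof -
 have "ft (\<lambda>z::'a spacetime. 0) (FI (\<lambda>z. 0))" by (rule ft_L12) (simp add: L12_def sqint_0)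
 moreover have "FI (\<lambda>z::'a spacetime. 0) = (\<lambda>\<zeta>. 0)" by (simp add: FI_def fun_eq_iff)
 ultimately have "ft (\<lambda>z::'a spacetime. 0) (\<lambda>\<zeta>. 0)" by simp
 from hs_iff[OF this, of s] show ?thesis by (simp add: sqint_0)
qed

lemma ips_add:
 assumes "u \<in> hs s" "v \<in> hs s" "w \<in> hs s" shows "ips s (\<lambda>z. u z + v z) w = ips s u w + ips s v w"
 unfolding ips_eq[OF ft_add[OF hsD(3)[OF assms(1)] hsD(3)[OF assms(2)]] hsD(3)[OF assms(3)]] distrib_left
 by (subst inprod_add_left) (simp_all add: hsD(2) assms ips_def)

lemma ips_cmult:
 assumes "u \<in> hs s" "w \<in> hs s" shows "ips s (\<lambda>z. c * u z) w = c * ips s u w"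
 unfolding ips_eq[OF ft_cmult[OF hsD(3)[OF assms(1)]] hsD(3)[OF assms(2)]] mult.left_commute[of _ c]
 by (subst inprod_cmult_left) (simp add: ips_def)

lemma ips_self: "ips s u u = of_real (nrm s u)"
 unfolding ips_def by (rule inprod_self)

lemma sqnorm_le_rw:
 assumes s: "0 \<le> s" and "sqint lborel (\<lambda>\<zeta>. rw s \<zeta> * U \<zeta>)" and m: "U \<in> borel_measurable lborel"
 shows "sqint lborel U" "sqnorm lborel U \<le> sqnorm lborel (\<lambda>\<zeta>. rw s \<zeta> * U \<zeta>)"
proof -
 have le: "(cmod (U \<zeta>))\<^sup>2 \<le> (cmod (rw s \<zeta> * U \<zeta>))\<^sup>2" for \<zeta>
  unfolding cmod_rw_sq using mult_right_mono[OF wt_ge_1[OF s, of \<zeta>], of "(cmod (U \<zeta>))\<^sup>2"] by simp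
 show i: "sqint lborel U"
  by (rule sqint_bound[OF assms(2) m, of 1]) (use le in \<open>auto simp: power2_le_iff_abs_le intro: power2_le_imp_le\<close>)
 show "sqnorm lborel U \<le> sqnorm lborel (\<lambda>\<zeta>. rw s \<zeta> * U \<zeta>)"
  unfolding sqnorm_def by (intro integral_mono sqint_integrable i assms le)
qed

lemma sqnorm_le_nrm:
 fixes u :: "'n::finite spacetime => complex"
 assumes "0 \<le> s" "u \<in> hs s" shows "(2 * pi) ^ DIM('n spacetime) * sqnorm lborel u \<le> nrm s u"
 using sqnorm_le_rw(2)[OF assms(1) hsD(2)[OF assms(2)]] hsD(5)[OF assms(2)] plancherel[OF hsD(3)[OF assms(2)]] by simp

text \<open>Vanishing is required at every point off \<open>E\<close>, not almost everywhere: linear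
  operations and pointwise cancellations are then exact. The classes of the statement are reached by
  cutting off with the indicator of \<open>E\<close>.\<close>

definition hsv :: "real => 'n::finite spacetime set => ('n spacetime => complex) set" where
 "hsv s E = {u \<in> hs s. \<forall>z. z \<notin> E \<longrightarrow> u z = 0}"

lemma sqnorm_indicator_le:
 assumes "sqint lborel (u :: 'a::euclidean_space => complex)" "E \<in> sets borel"
 shows "sqint lborel (\<lambda>z. indicator E z * u z)" "sqnorm lborel (\<lambda>z. indicator E z * u z) \<le> sqnorm lborel u"
proof -
 have [measurable]: "u \<in> borel_measurable borel" "E \<in> sets borel" using sqint_measurable[OF assms(1)] assms(2) by auto
 show i: "sqint lborel (\<lambda>z. indicator E z * u z)"
  by (rule sqint_bound[OF assms(1), of _ 1]) (auto split: split_indicator)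
 show "sqnorm lborel (\<lambda>z. indicator E z * u z) \<le> sqnorm lborel u"
  unfolding sqnorm_def by (intro integral_mono sqint_integrable i assms) (auto split: split_indicator)
qed

text \<open>Completeness is obtained for the weighted transforms, and \<open>ft_surj\<close> brings
  the limit back to physical space. That limit vanishes off \<open>E\<close> only almost everywhere,
  since convergence in the Sobolev norm implies convergence in L2, so it is multiplied by the
  indicator of \<open>E\<close>.\<close>

lemma semi_hilbert_hsv:
 fixes E :: "'n::finite spacetime set"
 assumes s: "0 \<le> s" and E: "E \<in> sets borel"
 shows "semi_hilbert (hsv s E) (ips s)"
proof
 fix u w :: "'n spacetime => complex" and c assume u: "u \<in> hsv s E"
 then have u': "u \<in> hs s" by (auto simp: hsv_def)
 show "0 \<le> Re (ips s u u)" by (simp add: ips_self sqnorm_nonneg)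
 show "(\<lambda>z. c * u z) \<in> hsv s E" using u by (simp add: hsv_def hs_cmult)
 assume w: "w \<in> hsv s E"
 then have w': "w \<in> hs s" by (auto simp: hsv_def)
 show "(\<lambda>z. u z + w z) \<in> hsv s E" using u w by (simp add: hsv_def hs_add)
 show "ips s (\<lambda>z. c * u z) w = c * ips s u w" by (rule ips_cmult[OF u' w'])
 show "ips s w u = cnj (ips s u w)" unfolding ips_def by (rule inprod_cnj[symmetric])
next
 show "(\<lambda>z. 0) \<in> hsv s E" by (simp add: hsv_def hs_0)
next
 fix u v w assume "u \<in> hsv s E" "v \<in> hsv s E" "w \<in> hsv s E"
 then show "ips s (\<lambda>z. u z + v z) w = ips s u w + ips s v w" by (intro ips_add) (auto simp: hsv_def)
next
 fix X :: "nat => 'n spacetime => complex"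
 assume X: "\<And>k. X k \<in> hsv s E"
  and cau: "\<And>e. 0 < e ==> \<exists>N. \<forall>m\<ge>N. \<forall>n\<ge>N. Re (ips s (\<lambda>z. X m z - X n z) (\<lambda>z. X m z - X n z)) < e"
 have Xh: "X k \<in> hs s" for k using X by (simp add: hsv_def)
 have dif: "nrm s (\<lambda>z. X m z - u z) = sqnorm lborel (\<lambda>\<zeta>. rw s \<zeta> * FT (X m) \<zeta> - rw s \<zeta> * U \<zeta>)" if "ft u U" for m u U
  unfolding nrm_eq[OF ft_diff[OF hsD(3)[OF Xh] that]] right_diff_distrib ..
 have "\<exists>\<Phi>. sqint lborel \<Phi> \<and> (\<lambda>k. sqnorm lborel (\<lambda>\<zeta>. rw s \<zeta> * FT (X k) \<zeta> - \<Phi> \<zeta>)) \<longlonglongrightarrow> 0"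
 proof (rule sqint_complete)
  show "sqint lborel (\<lambda>\<zeta>. rw s \<zeta> * FT (X k) \<zeta>)" for k by (rule hsD(2)[OF Xh])
  fix e :: real assume "0 < e"
  from cau[OF this] show "\<exists>N. \<forall>m\<ge>N. \<forall>n\<ge>N. sqnorm lborel (\<lambda>\<zeta>. rw s \<zeta> * FT (X m) \<zeta> - rw s \<zeta> * FT (X n) \<zeta>) < e"
   by (simp add: ips_self dif[OF hsD(3)[OF Xh]])
 qed
 then obtain \<Phi> where \<Phi>: "sqint lborel \<Phi>" and lim: "(\<lambda>k. sqnorm lborel (\<lambda>\<zeta>. rw s \<zeta> * FT (X k) \<zeta> - \<Phi> \<zeta>)) \<longlonglongrightarrow> 0" by blast
 have [measurable]: "\<Phi> \<in> borel_measurable borel" using sqint_measurable[OF \<Phi>] by simp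
 define U where "U \<zeta> = \<Phi> \<zeta> / rw s \<zeta>" for \<zeta>
 have [measurable]: "U \<in> borel_measurable borel" unfolding U_def[abs_def] by measurable
 have rw0: "rw s \<zeta> \<noteq> 0" for \<zeta> :: "'n spacetime" using wt_pos[of s \<zeta>] by (simp add: rw_def)
 have rU: "rw s \<zeta> * U \<zeta> = \<Phi> \<zeta>" for \<zeta> using rw0 by (simp add: U_def)
 have sU: "sqint lborel U" by (rule sqnorm_le_rw(1)[OF s]) (simp_all add: rU \<Phi>)
 obtain x where x: "ft x U" using ft_surj[OF sU] by blast
 have xh: "x \<in> hs s" unfolding hs_iff[OF x] rU by (rule \<Phi>)
 have lim2: "(\<lambda>k. nrm s (\<lambda>z. X k z - x z)) \<longlonglongrightarrow> 0" using lim by (simp add: dif[OF x] rU)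
 have "sqnorm lborel (\<lambda>z. indicator (- E) z * x z) = 0"
 proof -
  define N where "N = (2 * pi) ^ DIM('n spacetime)"
  have N: "N > 0" by (simp add: N_def)
  have "sqnorm lborel (\<lambda>z. indicator (- E) z * x z) \<le> nrm s (\<lambda>z. X k z - x z) / N" for k
  proof -
   have d: "(\<lambda>z. X k z - x z) \<in> hs s" by (intro hs_diff Xh xh)
   have "X k z = 0" if "z \<notin> E" for z using X[of k] that unfolding hsv_def by blast
   then have "indicator (- E) z * x z = - (indicator (- E) z * (X k z - x z))" for z
    by (cases "z \<in> E") simp_all
   then have "sqnorm lborel (\<lambda>z. indicator (- E) z * x z) = sqnorm lborel (\<lambda>z. - (indicator (- E) z * (X k z - x z)))"
    by presburger
   also have "\<dots> = sqnorm lborel (\<lambda>z. indicator (- E) z * (X k z - x z))" by (simp add: sqnorm_def)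
   also have "\<dots> \<le> sqnorm lborel (\<lambda>z. X k z - x z)"
    by (rule sqnorm_indicator_le(2)[OF hsD(1)[OF d]]) (use E in auto)
   also have "\<dots> \<le> nrm s (\<lambda>z. X k z - x z) / N"
    using sqnorm_le_nrm[OF s d] N by (simp add: N_def field_simps)
   finally show ?thesis .
  qed
  moreover have "(\<lambda>k. nrm s (\<lambda>z. X k z - x z) / N) \<longlonglongrightarrow> 0" using tendsto_divide[OF lim2 tendsto_const[of N]] N by simp
  ultimately have "sqnorm lborel (\<lambda>z. indicator (- E) z * x z) \<le> 0" by (intro LIMSEQ_le_const) auto
  then show ?thesis using sqnorm_nonneg[of lborel "\<lambda>z. indicator (- E) z * x z"] by linarith
 qed
 from sqnorm_0_AE[OF sqnorm_indicator_le(1)[OF hsD(1)[OF xh]] this] E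
 have "AE z in lborel. indicator (- E) z * x z = 0" by auto
 then have ae: "AE z in lborel. x z = indicator E z * x z"
  by (rule eventually_mono) (auto split: split_indicator_asm split_indicator)
 have x': "ft (\<lambda>z. indicator E z * x z) U"
  by (rule ft_cong_left[OF x ae]) (use hsD(4)[OF xh] E in measurable)
 have "(\<lambda>z. indicator E z * x z) \<in> hsv s E" using hs_iff[OF x'] \<Phi> by (simp add: hsv_def rU)
 moreover have "(\<lambda>k. nrm s (\<lambda>z. X k z - indicator E z * x z)) \<longlonglongrightarrow> 0" using lim by (simp add: dif[OF x'] rU)
 ultimately show "\<exists>x\<in>hsv s E. (\<lambda>k. Re (ips s (\<lambda>z. X k z - x z) (\<lambda>z. X k z - x z))) \<longlonglongrightarrow> 0"
  by (intro bexI[of _ "\<lambda>z. indicator E z * x z"]) (simp_all add: ips_self)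
qed

section \<open>The energy form of the fractional heat operator\<close>

definition Ef :: "real => ('n::finite spacetime => complex) => ('n spacetime => complex) => complex" where
 "Ef s u w = (LINT \<zeta>|lborel. heat_symbol \<zeta> powr of_real s * (FT u \<zeta> * cnj (FT w \<zeta>))) / (2 * pi) ^ DIM('n spacetime)"

lemma norm_heat_powr: "cmod (heat_symbol \<zeta> powr of_real s) = cmod (heat_symbol \<zeta>) powr s"
 by (simp add: norm_powr_real_powr')

lemma norm_heat_powr_le: "0 \<le> s ==> cmod (heat_symbol \<zeta>) powr s \<le> wt s \<zeta>"
 unfolding wt_def by (intro powr_mono2) auto

lemma Ef_integrable:
 assumes s: "0 \<le> s" and u: "u \<in> hs s" and w: "w \<in> hs s"
 shows "integrable lborel (\<lambda>\<zeta>. heat_symbol \<zeta> powr of_real s * (FT u \<zeta> * cnj (FT w \<zeta>)))"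
  and "integrable lborel (\<lambda>\<zeta>. cmod (heat_symbol \<zeta>) powr s * cmod (FT u \<zeta> * cnj (FT w \<zeta>)))"
  and "(cmod (LINT \<zeta>|lborel. heat_symbol \<zeta> powr of_real s * (FT u \<zeta> * cnj (FT w \<zeta>))))\<^sup>2 \<le> nrm s u * nrm s w"
proof -
 have [measurable]: "FT u \<in> borel_measurable borel" "FT w \<in> borel_measurable borel" using hsD[OF u] hsD[OF w] by auto
 have i: "integrable lborel (\<lambda>\<zeta>. cmod (rw s \<zeta> * FT u \<zeta>) * cmod (rw s \<zeta> * FT w \<zeta>))"
  by (intro integrable_norm_mult hsD(2) u w)
 have le: "cmod (heat_symbol \<zeta>) powr s * cmod (FT u \<zeta> * cnj (FT w \<zeta>)) \<le> cmod (rw s \<zeta> * FT u \<zeta>) * cmod (rw s \<zeta> * FT w \<zeta>)" for \<zeta>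
 proof -
  have "cmod (rw s \<zeta> * FT u \<zeta>) * cmod (rw s \<zeta> * FT w \<zeta>) = cmod (rw s \<zeta> * FT u \<zeta> * cnj (rw s \<zeta> * FT w \<zeta>))" by (simp add: norm_mult)
  also have "\<dots> = wt s \<zeta> * cmod (FT u \<zeta> * cnj (FT w \<zeta>))"
   unfolding rw_mult_cnj norm_mult[of "of_real _"] norm_of_real using wt_pos[of s \<zeta>] by simp
  finally show ?thesis using mult_right_mono[OF norm_heat_powr_le[OF s, of \<zeta>], of "cmod (FT u \<zeta> * cnj (FT w \<zeta>))"] by simp
 qed
 have eq: "cmod (heat_symbol \<zeta> powr of_real s * (FT u \<zeta> * cnj (FT w \<zeta>))) = cmod (heat_symbol \<zeta>) powr s * cmod (FT u \<zeta> * cnj (FT w \<zeta>))" for \<zeta>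
  by (simp only: norm_mult[of "heat_symbol \<zeta> powr of_real s"] norm_heat_powr)
 show i1: "integrable lborel (\<lambda>\<zeta>. heat_symbol \<zeta> powr of_real s * (FT u \<zeta> * cnj (FT w \<zeta>)))"
 proof (rule Bochner_Integration.integrable_bound[OF i])
  show "AE \<zeta> in lborel. norm (heat_symbol \<zeta> powr of_real s * (FT u \<zeta> * cnj (FT w \<zeta>))) \<le> norm (cmod (rw s \<zeta> * FT u \<zeta>) * cmod (rw s \<zeta> * FT w \<zeta>))"
   unfolding eq by (intro AE_I2 order_trans[OF le]) simp
 qed measurable
 from integrable_norm[OF this] show "integrable lborel (\<lambda>\<zeta>. cmod (heat_symbol \<zeta>) powr s * cmod (FT u \<zeta> * cnj (FT w \<zeta>)))"
  unfolding eq .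
 have "cmod (LINT \<zeta>|lborel. heat_symbol \<zeta> powr of_real s * (FT u \<zeta> * cnj (FT w \<zeta>))) \<le> (LINT \<zeta>|lborel. cmod (rw s \<zeta> * FT u \<zeta>) * cmod (rw s \<zeta> * FT w \<zeta>))"
  by (rule Bochner_Integration.integral_norm_bound_integral[OF i1 i]) (simp only: eq le)
 then have "(cmod (LINT \<zeta>|lborel. heat_symbol \<zeta> powr of_real s * (FT u \<zeta> * cnj (FT w \<zeta>))))\<^sup>2 \<le> (LINT \<zeta>|lborel. cmod (rw s \<zeta> * FT u \<zeta>) * cmod (rw s \<zeta> * FT w \<zeta>))\<^sup>2"
  by (rule power_mono) simp
 also have "\<dots> \<le> nrm s u * nrm s w" by (rule norm_inprod_le(1)[OF hsD(2)[OF u] hsD(2)[OF w]])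
 finally show "(cmod (LINT \<zeta>|lborel. heat_symbol \<zeta> powr of_real s * (FT u \<zeta> * cnj (FT w \<zeta>))))\<^sup>2 \<le> nrm s u * nrm s w" .
qed

lemma Ef_eq:
 fixes u w :: "'n::finite spacetime => complex"
 assumes u: "ft u U" and w: "ft w W"
 shows "Ef s u w = (LINT \<zeta>|lborel. heat_symbol \<zeta> powr of_real s * (U \<zeta> * cnj (W \<zeta>))) / (2 * pi) ^ DIM('n spacetime)"
proof -
 have [measurable]: "U \<in> borel_measurable borel" "W \<in> borel_measurable borel" "FT u \<in> borel_measurable borel" "FT w \<in> borel_measurable borel"
  using ftD[OF u] ftD[OF w] ftD[OF ft_FT[OF ftD(1)[OF u]]] ftD[OF ft_FT[OF ftD(1)[OF w]]] by auto
 have "(LINT \<zeta>|lborel. heat_symbol \<zeta> powr of_real s * (FT u \<zeta> * cnj (FT w \<zeta>))) = (LINT \<zeta>|lborel. heat_symbol \<zeta> powr of_real s * (U \<zeta> * cnj (W \<zeta>)))"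
 proof (rule integral_cong_AE)
  show "AE \<zeta> in lborel. heat_symbol \<zeta> powr of_real s * (FT u \<zeta> * cnj (FT w \<zeta>)) = heat_symbol \<zeta> powr of_real s * (U \<zeta> * cnj (W \<zeta>))"
   using AE_FT[OF u] AE_FT[OF w] by eventually_elim simp
 qed measurable
 then show ?thesis by (simp add: Ef_def)
qed

lemma Ef_add_left:
 assumes "0 \<le> s" "u \<in> hs s" "v \<in> hs s" "w \<in> hs s" shows "Ef s (\<lambda>z. u z + v z) w = Ef s u w + Ef s v w"
 unfolding Ef_eq[OF ft_add[OF hsD(3)[OF assms(2)] hsD(3)[OF assms(3)]] hsD(3)[OF assms(4)]]
 unfolding Ef_def
 using Ef_integrable(1)[OF assms(1,2,4)] Ef_integrable(1)[OF assms(1,3,4)]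
 by (simp add: distrib_left distrib_right add_divide_distrib)

lemma Ef_add_right:
 assumes "0 \<le> s" "u \<in> hs s" "v \<in> hs s" "w \<in> hs s" shows "Ef s u (\<lambda>z. v z + w z) = Ef s u v + Ef s u w"
 unfolding Ef_eq[OF hsD(3)[OF assms(2)] ft_add[OF hsD(3)[OF assms(3)] hsD(3)[OF assms(4)]]]
 unfolding Ef_def
 using Ef_integrable(1)[OF assms(1,2,3)] Ef_integrable(1)[OF assms(1,2,4)]
 by (simp add: distrib_left add_divide_distrib)

lemma Ef_cmult_left:
 assumes "u \<in> hs s" "w \<in> hs s" shows "Ef s (\<lambda>z. c * u z) w = c * Ef s u w"
 unfolding Ef_eq[OF ft_cmult[OF hsD(3)[OF assms(1)]] hsD(3)[OF assms(2)]]
 unfolding Ef_def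
 by (simp add: mult.assoc mult.left_commute[of _ c])

lemma Ef_cmult_right:
 assumes "u \<in> hs s" "w \<in> hs s" shows "Ef s u (\<lambda>z. c * w z) = cnj c * Ef s u w"
 unfolding Ef_eq[OF hsD(3)[OF assms(1)] ft_cmult[OF hsD(3)[OF assms(2)]]]
 unfolding Ef_def
 by (simp add: mult.assoc mult.left_commute[of _ "cnj c"])

lemma Ef_bound:
 fixes u w :: "'n::finite spacetime => complex"
 assumes "0 \<le> s" "u \<in> hs s" "w \<in> hs s" shows "(cmod (Ef s u w))\<^sup>2 \<le> nrm s u * nrm s w"
proof -
 define N where "N = (2 * pi) ^ DIM('n spacetime)"
 have N: "1 \<le> N" unfolding N_def using pi_ge_two by (intro one_le_power) auto
 define I where "I = (LINT \<zeta>|lborel. heat_symbol \<zeta> powr of_real s * (FT u \<zeta> * cnj (FT w \<zeta>)))"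
 have "Ef s u w = I / of_real N" by (simp add: Ef_def I_def N_def)
 then have "cmod (Ef s u w) = cmod I / N" using N by (simp add: norm_divide)
 also have "\<dots> \<le> cmod I / 1" using N by (intro divide_left_mono) auto
 finally have "(cmod (Ef s u w))\<^sup>2 \<le> (cmod I)\<^sup>2" by (intro power_mono) auto
 then show ?thesis using Ef_integrable(3)[OF assms] unfolding I_def by linarith
qed

lemma Ef_semigroup:
 fixes u w :: "'n::finite spacetime => complex"
 assumes s: "0 < s" "s < 1" and u: "u \<in> hs s" and w: "w \<in> hs s"
 shows "integrable lborel (\<lambda>\<tau>. pk s \<tau> *\<^sub>R heat_diff u w \<tau>)"
  and "of_real (pkc s) * Ef s u w = (LINT \<tau>|lborel. pk s \<tau> *\<^sub>R heat_diff u w \<tau>)"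
proof -
 note sf = semigroup_formula[OF s hsD(3)[OF u] hsD(3)[OF w] Ef_integrable(2)[OF less_imp_le[OF s(1)] u w]]
 show "integrable lborel (\<lambda>\<tau>. pk s \<tau> *\<^sub>R heat_diff u w \<tau>)" by (rule sf(1))
 show "of_real (pkc s) * Ef s u w = (LINT \<tau>|lborel. pk s \<tau> *\<^sub>R heat_diff u w \<tau>)"
  using sf(2) unfolding Ef_def by (simp add: field_simps)
qed

text \<open>The symbol has argument at most \<open>pi / 2\<close> in modulus, so the real part of
  its power is at least \<open>cos (s * pi / 2)\<close> times the power of its modulus, and this
  cosine is nonnegative for \<open>s < 1\<close>. The comparison
  \<open>wt / 2 - 1 \<le> |symbol|^s\<close> gives the loss of an L2 term at low
  frequencies.\<close>

lemma Ef_garding: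
 fixes u :: "'n::finite spacetime => complex"
 assumes s: "0 < s" "s < 1" and u: "u \<in> hs s"
 shows "cos (s * pi / 2) * (nrm s u / 2 / (2 * pi) ^ DIM('n spacetime) - sqnorm lborel u) \<le> Re (Ef s u u)"
proof -
 define N where "N = (2 * pi) ^ DIM('n spacetime)"
 have N: "N > 0" by (simp add: N_def)
 define c where "c = cos (s * pi / 2)"
 have sp: "0 \<le> s * pi" "s * pi \<le> pi" using s mult_right_mono[of s 1 pi] by auto
 have c: "0 \<le> c" unfolding c_def by (rule cos_ge_zero) (use sp pi_gt_zero in linarith)+
 have s0: "0 \<le> s" using s by simp
 have Re: "c * (wt s \<zeta> / 2 - 1) \<le> Re (heat_symbol \<zeta> powr of_real s)" for \<zeta> :: "'n spacetime"
 proof (cases "heat_symbol \<zeta> = 0")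
  case True
  then show ?thesis using c by (simp add: wt_def)
 next
  case False
  define r where "r = cmod (heat_symbol \<zeta>)"
  have r: "0 < r" using False by (simp add: r_def)
  have "\<bar>Im (Ln (heat_symbol \<zeta>))\<bar> \<le> pi / 2"
   using Re_Ln_pos_le[OF False] by (simp add: Re_heat_symbol)
  then have "s * \<bar>Im (Ln (heat_symbol \<zeta>))\<bar> \<le> s * (pi / 2)" using s by (intro mult_left_mono) auto
  then have "cos (s * (pi / 2)) \<le> cos (s * \<bar>Im (Ln (heat_symbol \<zeta>))\<bar>)"
   using s sp by (intro cos_monotone_0_pi_le) (auto simp: field_simps)
  also have "s * \<bar>Im (Ln (heat_symbol \<zeta>))\<bar> = \<bar>s * Im (Ln (heat_symbol \<zeta>))\<bar>" using s by (simp add: abs_mult)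
  finally have cc: "c \<le> cos (s * Im (Ln (heat_symbol \<zeta>)))" by (simp add: c_def)
  have "Re (heat_symbol \<zeta> powr of_real s) = r powr s * cos (s * Im (Ln (heat_symbol \<zeta>)))"
   using False r by (simp add: powr_def Re_exp r_def Re_Ln)
  then have "c * r powr s \<le> Re (heat_symbol \<zeta> powr of_real s)"
   using mult_left_mono[OF cc, of "r powr s"] by (simp add: mult.commute)
  moreover have "wt s \<zeta> / 2 - 1 \<le> r powr s"
  proof (cases "r \<le> 1")
   case True
   have "wt s \<zeta> \<le> 2 powr s" unfolding wt_def r_def[symmetric] using True r s by (intro powr_mono2) auto
   also have "\<dots> \<le> 2 powr 1" using s by (intro powr_mono) auto
   finally have "wt s \<zeta> \<le> 2" by simp
   then show ?thesis using powr_ge_zero[of r s] by linarith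
  next
   case False
   have "wt s \<zeta> \<le> (2 * r) powr s" unfolding wt_def r_def[symmetric] using False r s by (intro powr_mono2) auto
   also have "\<dots> = 2 powr s * r powr s" using r by (simp add: powr_mult)
   also have "\<dots> \<le> 2 powr 1 * r powr s" using s by (intro mult_right_mono powr_mono) auto
   finally show ?thesis by simp
  qed
  ultimately show ?thesis using mult_left_mono[OF _ c] by (meson order_trans)
 qed
 have iw: "integrable lborel (\<lambda>\<zeta>. wt s \<zeta> * (cmod (FT u \<zeta>))\<^sup>2)"
  using sqint_integrable[OF hsD(2)[OF u]] unfolding cmod_rw_sq .
 have iu: "integrable lborel (\<lambda>\<zeta>. (cmod (FT u \<zeta>))\<^sup>2)" by (rule sqint_integrable[OF ftD(2)[OF hsD(3)[OF u]]])
 have iE: "integrable lborel (\<lambda>\<zeta>. heat_symbol \<zeta> powr of_real s * (FT u \<zeta> * cnj (FT u \<zeta>)))"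
  by (rule Ef_integrable(1)[OF s0 u u])
 have "c * (nrm s u / 2 - N * sqnorm lborel u) = (LINT \<zeta>|lborel. c * (wt s \<zeta> * (cmod (FT u \<zeta>))\<^sup>2 / 2 - (cmod (FT u \<zeta>))\<^sup>2))"
 proof -
  have p: "N * sqnorm lborel u = sqnorm lborel (FT u)" unfolding N_def by (rule plancherel[OF hsD(3)[OF u], symmetric])
  show ?thesis unfolding p unfolding sqnorm_def cmod_rw_sq using iw iu by simp
 qed
 also have "\<dots> \<le> (LINT \<zeta>|lborel. Re (heat_symbol \<zeta> powr of_real s * (FT u \<zeta> * cnj (FT u \<zeta>))))"
 proof (rule Bochner_Integration.integral_mono)
  show "integrable lborel (\<lambda>\<zeta>. c * (wt s \<zeta> * (cmod (FT u \<zeta>))\<^sup>2 / 2 - (cmod (FT u \<zeta>))\<^sup>2))" using iw iu by simp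
  show "integrable lborel (\<lambda>\<zeta>. Re (heat_symbol \<zeta> powr of_real s * (FT u \<zeta> * cnj (FT u \<zeta>))))" by (rule integrable_Re[OF iE])
  fix \<zeta>
  have "Re (heat_symbol \<zeta> powr of_real s * (FT u \<zeta> * cnj (FT u \<zeta>))) = Re (heat_symbol \<zeta> powr of_real s) * (cmod (FT u \<zeta>))\<^sup>2"
   unfolding complex_norm_square[symmetric] by simp
  then show "c * (wt s \<zeta> * (cmod (FT u \<zeta>))\<^sup>2 / 2 - (cmod (FT u \<zeta>))\<^sup>2) \<le> Re (heat_symbol \<zeta> powr of_real s * (FT u \<zeta> * cnj (FT u \<zeta>)))"
   using mult_right_mono[OF Re[of \<zeta>], of "(cmod (FT u \<zeta>))\<^sup>2"] by (simp add: algebra_simps)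
 qed
 also have "\<dots> = Re (Ef s u u) * N"
 proof -
  have "of_real N * Ef s u u = (LINT \<zeta>|lborel. heat_symbol \<zeta> powr of_real s * (FT u \<zeta> * cnj (FT u \<zeta>)))"
   using N by (simp add: Ef_def N_def)
  then have "Re (of_real N * Ef s u u) = (LINT \<zeta>|lborel. Re (heat_symbol \<zeta> powr of_real s * (FT u \<zeta> * cnj (FT u \<zeta>))))"
   by (simp only: integral_Re[OF iE])
  then show ?thesis by (simp add: mult.commute)
 qed
 finally show ?thesis using N unfolding c_def[symmetric] N_def[symmetric] by (simp add: field_simps)
qed

text \<open>A character in time shifts the time frequency by \<open>\<eta>\<close>, and the weight
  \<open>1 + |symbol|\<close> changes by at most the factor \<open>1 + |\<eta>|\<close>.\<close>

lemma modulate_hs: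
 fixes u :: "'n::finite spacetime => complex"
 assumes s: "0 \<le> s" and u: "u \<in> hs s"
 shows "(\<lambda>z. exp (- (\<i> * of_real (\<eta> * fst z))) * u z) \<in> hs s"
  and "nrm s (\<lambda>z. exp (- (\<i> * of_real (\<eta> * fst z))) * u z) \<le> (1 + \<bar>\<eta>\<bar>) powr s * nrm s u"
proof -
 define h where "h = (\<eta>, 0 :: real ^ 'n)"
 have f: "ft (\<lambda>z. exp (- (\<i> * of_real (\<eta> * fst z))) * u z) (\<lambda>\<zeta>. FT u (\<zeta> + h))"
  using ft_modulate[OF hsD(3)[OF u], of h] by (simp add: h_def inner_prod_def)
 have [measurable]: "FT u \<in> borel_measurable borel" using hsD(5)[OF u] .
 define C where "C = (1 + \<bar>\<eta>\<bar>) powr s"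
 have wle: "wt s \<zeta> \<le> C * wt s (\<zeta> + h)" for \<zeta>
 proof -
  have "heat_symbol \<zeta> = heat_symbol (\<zeta> + h) + (- (\<i> * of_real \<eta>))"
   by (cases \<zeta>) (simp add: heat_symbol_def h_def algebra_simps)
  then have "cmod (heat_symbol \<zeta>) \<le> cmod (heat_symbol (\<zeta> + h)) + cmod (- (\<i> * of_real \<eta>))" by (metis norm_triangle_ineq)
  then have "1 + cmod (heat_symbol \<zeta>) \<le> 1 + cmod (heat_symbol (\<zeta> + h)) + \<bar>\<eta>\<bar>" by (simp add: norm_mult)
  also have "\<dots> \<le> (1 + \<bar>\<eta>\<bar>) * (1 + cmod (heat_symbol (\<zeta> + h)))" by (simp add: algebra_simps)
  finally have "wt s \<zeta> \<le> ((1 + \<bar>\<eta>\<bar>) * (1 + cmod (heat_symbol (\<zeta> + h)))) powr s"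
   unfolding wt_def using s by (intro powr_mono2) auto
  then show ?thesis unfolding wt_def C_def by (simp add: powr_mult)
 qed
 have nn: "(cmod (rw s \<zeta> * FT u (\<zeta> + h)))\<^sup>2 \<le> C * (cmod (rw s (\<zeta> + h) * FT u (\<zeta> + h)))\<^sup>2" for \<zeta>
  unfolding cmod_rw_sq using mult_right_mono[OF wle[of \<zeta>], of "(cmod (FT u (\<zeta> + h)))\<^sup>2"] by (simp add: mult.assoc)
 note tr = sqint_translate[OF hsD(2)[OF u], of h]
 have i: "integrable lborel (\<lambda>\<zeta>. C * (cmod (rw s (\<zeta> + h) * FT u (\<zeta> + h)))\<^sup>2)"
  by (intro integrable_mult_right sqint_integrable tr)
 have sq: "sqint lborel (\<lambda>\<zeta>. rw s \<zeta> * FT u (\<zeta> + h))"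
 proof (rule sqintI)
  show "integrable lborel (\<lambda>\<zeta>. (cmod (rw s \<zeta> * FT u (\<zeta> + h)))\<^sup>2)"
   by (rule Bochner_Integration.integrable_bound[OF i]) (use nn in \<open>auto intro!: AE_I2 order_trans[OF nn abs_ge_self] simp del: norm_mult\<close>)
 qed measurable
 then show "(\<lambda>z. exp (- (\<i> * of_real (\<eta> * fst z))) * u z) \<in> hs s" unfolding hs_iff[OF f] .
 have "sqnorm lborel (\<lambda>\<zeta>. rw s \<zeta> * FT u (\<zeta> + h)) \<le> (LINT \<zeta>|lborel. C * (cmod (rw s (\<zeta> + h) * FT u (\<zeta> + h)))\<^sup>2)"
  unfolding sqnorm_def by (intro Bochner_Integration.integral_mono sqint_integrable sq i nn)
 also have "\<dots> = C * nrm s u" using tr(2) by (simp add: sqnorm_def)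
 finally show "nrm s (\<lambda>z. exp (- (\<i> * of_real (\<eta> * fst z))) * u z) \<le> (1 + \<bar>\<eta>\<bar>) powr s * nrm s u"
  unfolding nrm_eq[OF f] C_def .
qed

section \<open>Solvability\<close>

text \<open>Bounded multipliers that depend on time alone. The type argument fixes the space
  dimension, which \<open>m\<close> does not mention.\<close>

definition tmult :: "'n::finite itself => real => (real => complex) => bool" where
 "tmult _ s m \<longleftrightarrow> (\<exists>K\<ge>0. \<forall>u\<in>hs s. (\<lambda>z :: 'n spacetime. m (fst z) * u z) \<in> hs s \<and> nrm s (\<lambda>z. m (fst z) * u z) \<le> K * nrm s u)"

lemma nrm_add_le:
 assumes "u \<in> hs s" "w \<in> hs s" shows "nrm s (\<lambda>z. u z + w z) \<le> 2 * nrm s u + 2 * nrm s w"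
 unfolding nrm_eq[OF ft_add[OF hsD(3)[OF assms(1)] hsD(3)[OF assms(2)]]] distrib_left
 by (rule sqnorm_add_le[OF hsD(2)[OF assms(1)] hsD(2)[OF assms(2)]])

lemma nrm_cmult:
 assumes "u \<in> hs s" shows "nrm s (\<lambda>z. c * u z) = (cmod c)\<^sup>2 * nrm s u"
 unfolding nrm_eq[OF ft_cmult[OF hsD(3)[OF assms]]] mult.left_commute[of _ c] by (rule sqnorm_cmult)

lemma tmult_const: "tmult TYPE('n::finite) s (\<lambda>_. c)"
 unfolding tmult_def
proof (intro exI[of _ "(cmod c)\<^sup>2"] conjI ballI)
 fix u :: "'n spacetime => complex" assume "u \<in> hs s"
 then show "(\<lambda>z. c * u z) \<in> hs s" "nrm s (\<lambda>z. c * u z) \<le> (cmod c)\<^sup>2 * nrm s u"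
  by (simp_all add: hs_cmult nrm_cmult)
qed simp

lemma tmult_exp: "0 \<le> s ==> tmult TYPE('n::finite) s (\<lambda>t. exp (- (\<i> * of_real (\<eta> * t))))"
 unfolding tmult_def
 by (intro exI[of _ "(1 + \<bar>\<eta>\<bar>) powr s"] conjI ballI modulate_hs) auto

lemma tmult_add:
 assumes "tmult TYPE('n::finite) s m" "tmult TYPE('n) s m'" shows "tmult TYPE('n) s (\<lambda>t. m t + m' t)"
proof -
 obtain K where K: "0 \<le> K" "\<And>u. u \<in> hs s ==> (\<lambda>z :: 'n spacetime. m (fst z) * u z) \<in> hs s"
  "\<And>u :: 'n spacetime => complex. u \<in> hs s ==> nrm s (\<lambda>z. m (fst z) * u z) \<le> K * nrm s u"
  using assms(1) unfolding tmult_def by auto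
 obtain K' where K': "0 \<le> K'" "\<And>u. u \<in> hs s ==> (\<lambda>z :: 'n spacetime. m' (fst z) * u z) \<in> hs s"
  "\<And>u :: 'n spacetime => complex. u \<in> hs s ==> nrm s (\<lambda>z. m' (fst z) * u z) \<le> K' * nrm s u"
  using assms(2) unfolding tmult_def by auto
 show ?thesis unfolding tmult_def distrib_right
 proof (intro exI[of _ "2 * K + 2 * K'"] conjI ballI)
  fix u :: "'n spacetime => complex" assume u: "u \<in> hs s"
  show "(\<lambda>z. m (fst z) * u z + m' (fst z) * u z) \<in> hs s" by (intro hs_add K K' u)
  show "nrm s (\<lambda>z. m (fst z) * u z + m' (fst z) * u z) \<le> (2 * K + 2 * K') * nrm s u"
   using nrm_add_le[OF K(2)[OF u] K'(2)[OF u]] K(3)[OF u] K'(3)[OF u] by (simp add: distrib_right)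
 qed (use K K' in auto)
qed

lemma tmult_mult:
 assumes "tmult TYPE('n::finite) s m" "tmult TYPE('n) s m'" shows "tmult TYPE('n) s (\<lambda>t. m t * m' t)"
proof -
 obtain K where K: "0 \<le> K" "\<And>u. u \<in> hs s ==> (\<lambda>z :: 'n spacetime. m (fst z) * u z) \<in> hs s"
  "\<And>u :: 'n spacetime => complex. u \<in> hs s ==> nrm s (\<lambda>z. m (fst z) * u z) \<le> K * nrm s u"
  using assms(1) unfolding tmult_def by auto
 obtain K' where K': "0 \<le> K'" "\<And>u. u \<in> hs s ==> (\<lambda>z :: 'n spacetime. m' (fst z) * u z) \<in> hs s"
  "\<And>u :: 'n spacetime => complex. u \<in> hs s ==> nrm s (\<lambda>z. m' (fst z) * u z) \<le> K' * nrm s u"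
  using assms(2) unfolding tmult_def by auto
 show ?thesis unfolding tmult_def mult.assoc
 proof (intro exI[of _ "K * K'"] conjI ballI)
  fix u :: "'n spacetime => complex" assume u: "u \<in> hs s"
  show "(\<lambda>z. m (fst z) * (m' (fst z) * u z)) \<in> hs s" by (intro K K' u)
  have "nrm s (\<lambda>z. m (fst z) * (m' (fst z) * u z)) \<le> K * nrm s (\<lambda>z. m' (fst z) * u z)" by (rule K(3)[OF K'(2)[OF u]])
  also have "\<dots> \<le> K * (K' * nrm s u)" by (intro mult_left_mono K' u K)
  finally show "nrm s (\<lambda>z. m (fst z) * (m' (fst z) * u z)) \<le> K * K' * nrm s u" by (simp only: mult.assoc)
 qed (use K K' in auto)
qed

lemma tmult_pow: "tmult TYPE('n::finite) s m ==> tmult TYPE('n) s (\<lambda>t. m t ^ k)"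
 by (induction k) (simp_all add: tmult_const tmult_mult)

text \<open>
 On the time interval these weights decay at least like \<open>exp (- 2 * l * t)\<close> if \<open>k * \<omega>\<close> is large and \<open>\<omega>\<close> small;
 unlike the exponential, they are trigonometric polynomials and therefore act on \<open>hs s\<close>.
\<close>

definition twt :: "real => nat => real => real" where
 "twt \<omega> k t = (2 - sin (\<omega> * t)) ^ k"

lemma tmult_twt:
 assumes s: "0 \<le> s" shows "tmult TYPE('n::finite) s (\<lambda>t. of_real (twt \<omega> k t))"
proof -
 have "tmult TYPE('n) s (\<lambda>t. 2 + ((\<i> / 2) * exp (- (\<i> * of_real ((- \<omega>) * t))) + (- \<i> / 2) * exp (- (\<i> * of_real (\<omega> * t)))))"
  by (intro tmult_add tmult_const tmult_mult tmult_exp s)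
 also have "(\<lambda>t. 2 + ((\<i> / 2) * exp (- (\<i> * of_real ((- \<omega>) * t))) + (- \<i> / 2) * exp (- (\<i> * of_real (\<omega> * t))))) = (\<lambda>t. of_real (2 - sin (\<omega> * t)))"
 proof
  fix t
  have a: "exp (- (\<i> * of_real (\<omega> * t))) = of_real (cos (\<omega> * t)) - \<i> * of_real (sin (\<omega> * t))"
   unfolding exp_minus_Euler cos_of_real sin_of_real ..
  have b: "exp (- (\<i> * of_real ((- \<omega>) * t))) = of_real (cos (\<omega> * t)) + \<i> * of_real (sin (\<omega> * t))"
   unfolding exp_minus_Euler cos_of_real sin_of_real by simp
  show "2 + ((\<i> / 2) * exp (- (\<i> * of_real ((- \<omega>) * t))) + (- \<i> / 2) * exp (- (\<i> * of_real (\<omega> * t)))) = of_real (2 - sin (\<omega> * t))"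
   unfolding a b by (simp add: complex_eq_iff)
 qed
 finally have "tmult TYPE('n) s (\<lambda>t. of_real (2 - sin (\<omega> * t)) ^ k)" by (rule tmult_pow)
 then show ?thesis by (simp add: twt_def)
qed

lemma twt_ge_1: "1 \<le> twt \<omega> k t"
 unfolding twt_def using sin_le_one[of "\<omega> * t"] by (intro one_le_power) linarith

text \<open>The claim is that \<open>twt \<omega> k t * exp (2 * l * t)\<close> does not increase.
  With \<open>\<omega> = pi / (3 * T)\<close> the angle stays within \<open>pi / 3\<close>, so the
  cosine is at least 1/2. The sign of the derivative then follows from
  \<open>3 * 2 * l \<le> k * \<omega> / 2\<close>, which is the origin of the constant 12.\<close>

lemma twt_decay:
 assumes T: "0 < T" and l: "0 < l"
 obtains \<omega> k where "\<And>t t'. t' \<in> {-T..T} ==> t \<in> {-T..T} ==> t' \<le> t ==> twt \<omega> k t \<le> exp (- 2 * l * (t - t')) * twt \<omega> k t'"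
proof -
 define \<omega> where "\<omega> = pi / (3 * T)"
 have \<omega>: "0 < \<omega>" using T by (simp add: \<omega>_def)
 obtain k0 :: nat where k0: "12 * l / \<omega> < real k0" using reals_Archimedean2 by blast
 define k where "k = Suc k0"
 have k: "12 * l \<le> real k * \<omega>" using k0 \<omega> by (simp add: k_def field_simps)
 define g where "g t = twt \<omega> k t * exp (2 * l * t)" for t
 have dec: "g t \<le> g t'" if tt: "t' \<in> {-T..T}" "t \<in> {-T..T}" "t' \<le> t" for t t'
 proof (rule DERIV_nonpos_imp_nonincreasing[OF tt(3)])
  fix x assume x: "t' \<le> x" "x \<le> t"
  have der: "(g has_real_derivative (real k * (2 - sin (\<omega> * x)) ^ (k - 1) * (- (cos (\<omega> * x) * \<omega>))) * exp (2 * l * x) +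
   (2 - sin (\<omega> * x)) ^ k * (exp (2 * l * x) * (2 * l))) (at x)"
   unfolding g_def[abs_def] twt_def by (auto intro!: derivative_eq_intros)
  have "\<bar>\<omega> * x\<bar> \<le> pi / 3"
  proof -
   have "\<bar>\<omega> * x\<bar> = \<omega> * \<bar>x\<bar>" using \<omega> by (simp add: abs_mult)
   also have "\<dots> \<le> \<omega> * T" using x tt \<omega> by (intro mult_left_mono) auto
   finally show ?thesis using T by (simp add: \<omega>_def)
  qed
  then have "cos (pi / 3) \<le> cos \<bar>\<omega> * x\<bar>" by (intro cos_monotone_0_pi_le) auto
  then have c: "1 / 2 \<le> cos (\<omega> * x)" by (simp add: cos_60)
  define p where "p = (2 - sin (\<omega> * x)) ^ (k - 1)"
  have p: "0 \<le> p" unfolding p_def using sin_le_one[of "\<omega> * x"] by (intro zero_le_power) linarith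
  have pk: "(2 - sin (\<omega> * x)) ^ k = (2 - sin (\<omega> * x)) * p" by (simp add: p_def k_def)
  have "real k * \<omega> * (1 / 2) \<le> real k * \<omega> * cos (\<omega> * x)" using c \<omega> by (intro mult_left_mono) auto
  moreover have "(2 - sin (\<omega> * x)) * (2 * l) \<le> 3 * (2 * l)"
   using l sin_ge_minus_one[of "\<omega> * x"] by (intro mult_right_mono) auto
  ultimately have "(2 - sin (\<omega> * x)) * (2 * l) - real k * \<omega> * cos (\<omega> * x) \<le> 0" using k by linarith
  then have "p * exp (2 * l * x) * ((2 - sin (\<omega> * x)) * (2 * l) - real k * \<omega> * cos (\<omega> * x)) \<le> 0"
   using p by (intro mult_nonneg_nonpos) auto
  also have "p * exp (2 * l * x) * ((2 - sin (\<omega> * x)) * (2 * l) - real k * \<omega> * cos (\<omega> * x)) =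
   (real k * (2 - sin (\<omega> * x)) ^ (k - 1) * (- (cos (\<omega> * x) * \<omega>))) * exp (2 * l * x) +
   (2 - sin (\<omega> * x)) ^ k * (exp (2 * l * x) * (2 * l))"
   unfolding pk p_def[symmetric] by (simp add: algebra_simps)
  finally show "\<exists>y. (g has_real_derivative y) (at x) \<and> y \<le> 0" using der by blast
 qed
 show ?thesis
 proof (rule that[of \<omega> k])
  fix t t' assume tt: "t' \<in> {-T..T}" "t \<in> {-T..T}" "t' \<le> t"
  have "twt \<omega> k t = g t * exp (- (2 * l * t))" by (simp add: g_def exp_minus)
  also have "\<dots> \<le> g t' * exp (- (2 * l * t))" by (intro mult_right_mono dec tt) simp
  also have "\<dots> = exp (- 2 * l * (t - t')) * twt \<omega> k t'" by (simp add: g_def mult.assoc exp_add[symmetric] algebra_simps)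
  finally show "twt \<omega> k t \<le> exp (- 2 * l * (t - t')) * twt \<omega> k t'" .
 qed
qed

text \<open>In \<open>heat_diff\<close> the first argument is evaluated at time
  \<open>t - \<tau>\<close>, the second at \<open>t\<close>. The decay hypothesis bounds each such
  correlation by \<open>exp (- l * \<tau>)\<close> times the squared norm \<open>n\<close> of
  \<open>\<rho> * u\<close>, and the heat kernel has mass 1. So the real part of
  \<open>heat_diff\<close> is at least \<open>(1 - exp (- l * \<tau>)) * n\<close>, whose integral
  against \<open>pk\<close> is \<open>l powr s * pkc s * n\<close>.\<close>

lemma weighted_coercivity:
 fixes u :: "'n::finite spacetime => complex" and \<alpha> \<beta> \<rho> :: "real => real"
 assumes s: "0 < s" "s < 1" and l: "0 < l"
  and ua: "(\<lambda>z. of_real (\<alpha> (fst z)) * u z) \<in> hs s" and ub: "(\<lambda>z. of_real (\<beta> (fst z)) * u z) \<in> hs s"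
  and ur: "sqint lborel (\<lambda>z. of_real (\<rho> (fst z)) * u z)"
  and supp: "\<And>z. fst z \<notin> {-T..T} ==> u z = 0"
  and pos: "\<And>t. 0 \<le> \<alpha> t" "\<And>t. 0 \<le> \<beta> t" "\<And>t. 0 \<le> \<rho> t" and sq: "\<And>t. \<alpha> t * \<beta> t = (\<rho> t)\<^sup>2"
  and decay: "\<And>t t'. t' \<in> {-T..T} ==> t \<in> {-T..T} ==> t' \<le> t ==> \<alpha> t' * \<beta> t \<le> exp (- l * (t - t')) * (\<rho> t' * \<rho> t)"
 shows "l powr s * sqnorm lborel (\<lambda>z. of_real (\<rho> (fst z)) * u z) \<le> Re (Ef s (\<lambda>z. of_real (\<alpha> (fst z)) * u z) (\<lambda>z. of_real (\<beta> (fst z)) * u z))"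
proof -
 define A where "A z = of_real (\<alpha> (fst z)) * u z" for z
 define B where "B z = of_real (\<beta> (fst z)) * u z" for z
 define R where "R z = of_real (\<rho> (fst z)) * u z" for z
 define n where "n = sqnorm lborel R"
 have Ah: "A \<in> hs s" and Bh: "B \<in> hs s" and Rs: "sqint lborel R"
  using ua ub ur by (simp_all add: A_def[abs_def] B_def[abs_def] R_def[abs_def])
 \<comment> \<open>\<open>\<alpha> * \<beta> = \<rho>^2\<close> makes the unshifted product equal to
   the same \<open>n\<close> that bounds the correlations.\<close>
 have ip0: "inprod lborel A B = of_real n"
 proof -
  have "A z * cnj (B z) = R z * cnj (R z)" for z
  proof -
   have "A z * cnj (B z) = of_real (\<alpha> (fst z) * \<beta> (fst z)) * (u z * cnj (u z))" by (simp add: A_def B_def mult_ac)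
   then show ?thesis unfolding sq by (simp add: R_def power2_eq_square mult_ac)
  qed
  then show ?thesis unfolding n_def inprod_self[symmetric] by (simp add: inprod_def)
 qed
 have corr_le: "cmod (corr A B (\<tau>, y)) \<le> exp (- l * \<tau>) * n" if t: "0 < \<tau>" for \<tau> y
 proof -
  have "cmod (corr A B (\<tau>, y)) \<le> (LINT z|lborel. cmod (A (z - (\<tau>, y)) * cnj (B z)))"
   unfolding corr_def inprod_def by (rule integral_norm_bound)
  also have "\<dots> \<le> (LINT z|lborel. exp (- l * \<tau>) * (cmod (R z) * cmod (R (z - (\<tau>, y)))))"
  proof (rule integral_mono')
   show "integrable lborel (\<lambda>z. exp (- l * \<tau>) * (cmod (R z) * cmod (R (z - (\<tau>, y)))))"
    by (intro integrable_mult_right inprod_translate_integrable(1) Rs)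
   fix z :: "'n spacetime"
   show "cmod (A (z - (\<tau>, y)) * cnj (B z)) \<le> exp (- l * \<tau>) * (cmod (R z) * cmod (R (z - (\<tau>, y))))"
   proof (cases "fst z \<in> {-T..T} \<and> fst z - \<tau> \<in> {-T..T}")
    case True
    have "\<alpha> (fst z - \<tau>) * \<beta> (fst z) \<le> exp (- l * (fst z - (fst z - \<tau>))) * (\<rho> (fst z - \<tau>) * \<rho> (fst z))"
     by (rule decay) (use True t in auto)
    then have "\<alpha> (fst z - \<tau>) * \<beta> (fst z) * (cmod (u (z - (\<tau>, y))) * cmod (u z)) \<le>
      exp (- l * \<tau>) * (\<rho> (fst z - \<tau>) * \<rho> (fst z)) * (cmod (u (z - (\<tau>, y))) * cmod (u z))"
     by (intro mult_right_mono) auto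
    then show ?thesis by (simp add: A_def B_def R_def norm_mult pos mult_ac)
   next
    case False
    then have "u z = 0 \<or> u (z - (\<tau>, y)) = 0" using supp[of z] supp[of "z - (\<tau>, y)"] by auto
    then show ?thesis by (auto simp: A_def B_def R_def)
   qed
  qed auto
  also have "\<dots> \<le> exp (- l * \<tau>) * n"
   using inprod_translate_integrable(2)[OF Rs Rs, of "(\<tau>, y)"] sqnorm_nonneg[of lborel R] by (simp add: n_def)
  finally show ?thesis .
 qed
 have hd: "(1 - exp (- (l * \<tau>))) * n \<le> Re (heat_diff A B \<tau>)" if t: "0 < \<tau>" for \<tau>
 proof -
  have "cmod (LINT y|lborel. of_real (hker \<tau> y) * corr A B (\<tau>, y)) \<le> (LINT y|lborel. cmod (of_real (hker \<tau> y) * corr A B (\<tau>, y)))"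
   by (rule integral_norm_bound)
  also have "\<dots> \<le> (LINT y|(lborel :: (real ^ 'n) measure). hker \<tau> y * (exp (- l * \<tau>) * n))"
  proof (rule integral_mono')
   show "integrable lborel (\<lambda>y :: real ^ 'n. hker \<tau> y * (exp (- l * \<tau>) * n))"
    by (intro integrable_mult_left hker_integral t)
   fix y :: "real ^ 'n"
   show "cmod (of_real (hker \<tau> y) * corr A B (\<tau>, y)) \<le> hker \<tau> y * (exp (- l * \<tau>) * n)"
    using hker_nonneg[OF t, of y] mult_left_mono[OF corr_le[OF t, of y] hker_nonneg[OF t, of y]] by (simp add: norm_mult)
   show "0 \<le> hker \<tau> y * (exp (- l * \<tau>) * n)" by (intro mult_nonneg_nonneg hker_nonneg t) (auto simp: n_def sqnorm_nonneg)
  qed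
  also have "\<dots> = exp (- (l * \<tau>)) * n" using hker_integral(2)[OF t, where 'n = 'n] by simp
  finally have "Re (LINT y|lborel. of_real (hker \<tau> y) * corr A B (\<tau>, y)) \<le> exp (- (l * \<tau>)) * n"
   using complex_Re_le_cmod order_trans by blast
  then show ?thesis by (simp add: heat_diff_def ip0 left_diff_distrib)
 qed
 note sg = Ef_semigroup[OF s Ah Bh]
 have "(l powr s * pkc s) * n = (LINT \<tau>|lborel. (pk s \<tau> * (1 - exp (- (l * \<tau>)))) * n)"
  using pk_exp_real(2)[OF s l] by simp
 also have "\<dots> \<le> (LINT \<tau>|lborel. Re (pk s \<tau> *\<^sub>R heat_diff A B \<tau>))"
 proof (rule Bochner_Integration.integral_mono)
  show "integrable lborel (\<lambda>\<tau>. (pk s \<tau> * (1 - exp (- (l * \<tau>)))) * n)"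
   by (intro integrable_mult_left pk_exp_real(1) s l)
  show "integrable lborel (\<lambda>\<tau>. Re (pk s \<tau> *\<^sub>R heat_diff A B \<tau>))" by (rule integrable_Re[OF sg(1)])
  fix \<tau> :: real
  show "pk s \<tau> * (1 - exp (- (l * \<tau>))) * n \<le> Re (pk s \<tau> *\<^sub>R heat_diff A B \<tau>)"
  proof (cases "0 < \<tau>")
   case True
   then show ?thesis using mult_left_mono[OF hd[OF True] pk_nonneg[of s \<tau>]] by (simp add: mult.assoc)
  qed (simp add: pk_def)
 qed
 also have "\<dots> = Re (of_real (pkc s) * Ef s A B)" unfolding sg(2) by (rule integral_Re[OF sg(1)])
 finally have "pkc s * (l powr s * n) \<le> pkc s * Re (Ef s A B)" by (simp add: mult_ac)
 then have "l powr s * n \<le> Re (Ef s A B)" using pkc_pos[OF s] by simp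
 then show ?thesis by (simp add: n_def A_def[abs_def] B_def[abs_def] R_def[abs_def])
qed

section \<open>The form with a bounded potential and its solvability\<close>

definition qf :: "('n::finite spacetime => real) => ('n spacetime => complex) => ('n spacetime => complex) => complex" where
 "qf q u w = (LINT z|lborel. of_real (q z) * (u z * cnj (w z)))"

definition Bf :: "real => ('n::finite spacetime => real) => ('n spacetime => complex) => ('n spacetime => complex) => complex" where
 "Bf s q u w = Ef s u w + qf q u w"

text \<open>\<open>E\<close> stays abstract while only its extent in time matters; later it is the
  closed cylinder.\<close>

locale bounded_potential =
 fixes s T M :: real and q :: "'n::finite spacetime => real" and E :: "'n spacetime set"
 assumes s: "0 < s" "s < 1" and T: "0 < T" and M: "0 \<le> M"
  and qm [measurable]: "q \<in> borel_measurable borel" and qb: "\<And>z. \<bar>q z\<bar> \<le> M"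
  and Em: "E \<in> sets borel" and ET: "\<And>z. z \<in> E ==> fst z \<in> {-T..T}"
begin

lemma s0: "0 \<le> s" using s by simp

lemma qf_integrable:
 assumes "sqint lborel u" "sqint lborel w"
 shows "integrable lborel (\<lambda>z. of_real (q z) * (u z * cnj (w z)))"
proof (rule Bochner_Integration.integrable_bound)
 have [measurable]: "u \<in> borel_measurable borel" "w \<in> borel_measurable borel"
  using sqint_measurable[OF assms(1)] sqint_measurable[OF assms(2)] by auto
 show "integrable lborel (\<lambda>z. M * (cmod (u z) * cmod (w z)))" by (intro integrable_mult_right integrable_norm_mult assms)
 show "(\<lambda>z. of_real (q z) * (u z * cnj (w z))) \<in> borel_measurable lborel" by measurable
 show "AE z in lborel. norm (of_real (q z) * (u z * cnj (w z))) \<le> norm (M * (cmod (u z) * cmod (w z)))"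
  using M by (intro AE_I2) (auto simp: norm_mult intro!: mult_right_mono qb)
qed

lemma norm_qf_le:
 assumes "sqint lborel u" "sqint lborel w"
 shows "cmod (qf q u w) \<le> M * (LINT z|lborel. cmod (u z) * cmod (w z))"
proof -
 have "cmod (qf q u w) \<le> (LINT z|lborel. M * (cmod (u z) * cmod (w z)))"
  unfolding qf_def
  by (rule Bochner_Integration.integral_norm_bound_integral[OF qf_integrable[OF assms]])
   (auto intro!: integrable_mult_right integrable_norm_mult assms mult_right_mono qb simp: norm_mult)
 then show ?thesis by simp
qed

lemma qf_bound:
 assumes u: "u \<in> hs s" and w: "w \<in> hs s" shows "(cmod (qf q u w))\<^sup>2 \<le> M\<^sup>2 * (nrm s u * nrm s w)"
proof -
 note su = hsD(1)[OF u] and sw = hsD(1)[OF w]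
 have le: "sqnorm lborel v \<le> nrm s v" if v: "v \<in> hs s" for v :: "'n spacetime => complex"
 proof -
  have "1 \<le> (2 * pi) ^ DIM('n spacetime)" using pi_ge_two by (intro one_le_power) auto
  then have "1 * sqnorm lborel v \<le> (2 * pi) ^ DIM('n spacetime) * sqnorm lborel v" by (intro mult_right_mono sqnorm_nonneg)
  then show ?thesis using sqnorm_le_nrm[OF s0 v] by simp
 qed
 have "(cmod (qf q u w))\<^sup>2 \<le> (M * (LINT z|lborel. cmod (u z) * cmod (w z)))\<^sup>2" by (intro power_mono norm_qf_le su sw) simp
 also have "\<dots> \<le> M\<^sup>2 * (sqnorm lborel u * sqnorm lborel w)"
  unfolding power_mult_distrib by (intro mult_left_mono norm_inprod_le su sw) simp
 also have "\<dots> \<le> M\<^sup>2 * (nrm s u * nrm s w)" by (intro mult_left_mono mult_mono le u w sqnorm_nonneg) auto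
 finally show ?thesis .
qed

lemma Bf_bound:
 assumes u: "u \<in> hs s" and w: "w \<in> hs s" shows "(cmod (Bf s q u w))\<^sup>2 \<le> (2 + 2 * M\<^sup>2) * nrm s u * nrm s w"
proof -
 have "(cmod (Bf s q u w))\<^sup>2 \<le> 2 * (cmod (Ef s u w))\<^sup>2 + 2 * (cmod (qf q u w))\<^sup>2"
  unfolding Bf_def by (rule norm_add_sq_le)
 then show ?thesis using Ef_bound[OF s0 u w] qf_bound[OF u w] by (simp add: algebra_simps)
qed

lemma Bf_add_left:
 "u \<in> hs s ==> v \<in> hs s ==> w \<in> hs s ==> Bf s q (\<lambda>z. u z + v z) w = Bf s q u w + Bf s q v w"
 using qf_integrable[OF hsD(1) hsD(1), of u s w] qf_integrable[OF hsD(1) hsD(1), of v s w]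
 by (simp add: Bf_def Ef_add_left[OF s0] qf_def distrib_left distrib_right)

lemma Bf_add_right:
 "u \<in> hs s ==> v \<in> hs s ==> w \<in> hs s ==> Bf s q u (\<lambda>z. v z + w z) = Bf s q u v + Bf s q u w"
 using qf_integrable[OF hsD(1) hsD(1), of u s v] qf_integrable[OF hsD(1) hsD(1), of u s w]
 by (simp add: Bf_def Ef_add_right[OF s0] qf_def distrib_left distrib_right)

lemma Bf_cmult_left: "u \<in> hs s ==> w \<in> hs s ==> Bf s q (\<lambda>z. c * u z) w = c * Bf s q u w"
 by (simp add: Bf_def Ef_cmult_left qf_def distrib_left mult.assoc mult.left_commute[of _ c])

lemma Bf_cmult_right: "u \<in> hs s ==> w \<in> hs s ==> Bf s q u (\<lambda>z. c * w z) = cnj c * Bf s q u w"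
 by (simp add: Bf_def Ef_cmult_right qf_def distrib_left mult.assoc mult.left_commute[of _ "cnj c"])

text \<open>The potential term sees the two weights only through
  \<open>\<alpha> * \<beta> = \<rho>^2\<close>, so it is at least \<open>- M\<close> times the
  squared norm of \<open>\<rho> * u\<close>. With \<open>l powr s \<ge> M + 1\<close> a full
  multiple of that norm survives, and \<open>\<rho> \<ge> 1\<close> bounds it below by that of
  \<open>u\<close>.\<close>

lemma weighted_step:
 fixes \<alpha> \<beta> \<rho> :: "real => real"
 assumes u: "u \<in> hsv s E" and l: "0 < l" "M + 1 \<le> l powr s"
  and ua: "(\<lambda>z. of_real (\<alpha> (fst z)) * u z) \<in> hs s" and ub: "(\<lambda>z. of_real (\<beta> (fst z)) * u z) \<in> hs s"
  and rm: "\<rho> \<in> borel_measurable borel"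
  and pos: "\<And>t. 0 \<le> \<alpha> t" "\<And>t. 0 \<le> \<beta> t" "\<And>t. 1 \<le> \<rho> t" and rb: "\<And>t. \<rho> t \<le> r" and sq: "\<And>t. \<alpha> t * \<beta> t = (\<rho> t)\<^sup>2"
  and decay: "\<And>t t'. t' \<in> {-T..T} ==> t \<in> {-T..T} ==> t' \<le> t ==> \<alpha> t' * \<beta> t \<le> exp (- l * (t - t')) * (\<rho> t' * \<rho> t)"
 shows "sqnorm lborel u \<le> Re (Bf s q (\<lambda>z. of_real (\<alpha> (fst z)) * u z) (\<lambda>z. of_real (\<beta> (fst z)) * u z))"
proof -
 have uh: "u \<in> hs s" and u0: "\<And>z. z \<notin> E ==> u z = 0" using u by (auto simp: hsv_def)
 have [measurable]: "u \<in> borel_measurable borel" "\<rho> \<in> borel_measurable borel" using hsD(4)[OF uh] rm by auto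
 define R where "R z = of_real (\<rho> (fst z)) * u z" for z
 have rp: "0 \<le> \<rho> t" for t using pos(3)[of t] by linarith
 have Rs: "sqint lborel R"
  by (rule sqint_bound[OF hsD(1)[OF uh], of _ r]) (auto simp: R_def[abs_def] norm_mult rp intro!: mult_right_mono rb)
 have "l powr s * sqnorm lborel (\<lambda>z. of_real (\<rho> (fst z)) * u z) \<le> Re (Ef s (\<lambda>z. of_real (\<alpha> (fst z)) * u z) (\<lambda>z. of_real (\<beta> (fst z)) * u z))"
 proof (rule weighted_coercivity[OF s l(1) ua ub _ _ pos(1,2) rp sq decay])
  show "sqint lborel (\<lambda>z. of_real (\<rho> (fst z)) * u z)" using Rs by (simp add: R_def[abs_def])
  show "u z = 0" if "fst z \<notin> {-T..T}" for z using u0 ET that by blast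
 qed
 then have 1: "l powr s * sqnorm lborel R \<le> Re (Ef s (\<lambda>z. of_real (\<alpha> (fst z)) * u z) (\<lambda>z. of_real (\<beta> (fst z)) * u z))"
  by (simp add: R_def[abs_def])
 have "qf q (\<lambda>z. of_real (\<alpha> (fst z)) * u z) (\<lambda>z. of_real (\<beta> (fst z)) * u z) = qf q R R"
  unfolding qf_def
 proof (rule Bochner_Integration.integral_cong[OF refl])
  fix z
  have "of_real (\<alpha> (fst z)) * u z * cnj (of_real (\<beta> (fst z)) * u z) = of_real (\<alpha> (fst z) * \<beta> (fst z)) * (u z * cnj (u z))" by (simp add: mult_ac)
  also have "\<dots> = R z * cnj (R z)" unfolding sq by (simp add: R_def power2_eq_square mult_ac)
  finally show "of_real (q z) * (of_real (\<alpha> (fst z)) * u z * cnj (of_real (\<beta> (fst z)) * u z)) = of_real (q z) * (R z * cnj (R z))" by simp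
 qed
 moreover have "cmod (qf q R R) \<le> M * sqnorm lborel R"
  using norm_qf_le[OF Rs Rs] by (simp add: sqnorm_def power2_eq_square)
 ultimately have 2: "- (M * sqnorm lborel R) \<le> Re (qf q (\<lambda>z. of_real (\<alpha> (fst z)) * u z) (\<lambda>z. of_real (\<beta> (fst z)) * u z))"
  using abs_Re_le_cmod[of "qf q R R"] by simp
 have "sqnorm lborel u \<le> sqnorm lborel R"
  unfolding sqnorm_def
 proof (intro Bochner_Integration.integral_mono sqint_integrable Rs hsD(1)[OF uh])
  fix z
  have "1 * cmod (u z) \<le> \<rho> (fst z) * cmod (u z)" by (intro mult_right_mono pos) simp
  then show "(cmod (u z))\<^sup>2 \<le> (cmod (R z))\<^sup>2" by (intro power_mono) (auto simp: R_def norm_mult rp)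
 qed
 also have "\<dots> = (M + 1) * sqnorm lborel R - M * sqnorm lborel R" by (simp add: algebra_simps)
 also have "\<dots> \<le> l powr s * sqnorm lborel R - M * sqnorm lborel R"
  using mult_right_mono[OF l(2) sqnorm_nonneg[of lborel R]] by simp
 finally show ?thesis using 1 2 by (simp add: Bf_def)
qed

lemma garding:
 obtains c C where "0 < c" "0 \<le> C" "\<And>u. u \<in> hs s ==> c * nrm s u - C * sqnorm lborel u \<le> Re (Bf s q u u)"
proof -
 define N where "N = (2 * pi) ^ DIM('n spacetime)"
 have N: "N > 0" by (simp add: N_def)
 define k where "k = cos (s * pi / 2)"
 have k: "0 < k" unfolding k_def using s by (intro cos_gt_zero) auto
 show ?thesis
 proof (rule that[of "k / (2 * N)" "k + M"])
  fix u :: "'n spacetime => complex" assume u: "u \<in> hs s"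
  have "cmod (qf q u u) \<le> M * sqnorm lborel u"
   using norm_qf_le[OF hsD(1)[OF u] hsD(1)[OF u]] by (simp add: sqnorm_def power2_eq_square)
  then have "- (M * sqnorm lborel u) \<le> Re (qf q u u)" using abs_Re_le_cmod[of "qf q u u"] by linarith
  moreover have "k * (nrm s u / 2 / N - sqnorm lborel u) \<le> Re (Ef s u u)"
   unfolding k_def N_def by (rule Ef_garding[OF s u])
  ultimately show "k / (2 * N) * nrm s u - (k + M) * sqnorm lborel u \<le> Re (Bf s q u u)"
   by (simp add: Bf_def algebra_simps)
 qed (use k N M in auto)
qed

text \<open>Supplies one decaying weight for both inf-sup estimates: \<open>a\<close> itself
  multiplies the second argument of the form, its time reflection the first.\<close>

lemma weight_bounds:
 obtains a :: "real => real" and l r where "0 < l" "M + 1 \<le> l powr s" "a \<in> borel_measurable borel"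
  "\<And>t. 1 \<le> a t" "\<And>t. a t \<le> r"
  "tmult TYPE('n) s (\<lambda>t. of_real (a t))" "tmult TYPE('n) s (\<lambda>t. of_real (a (- t)))"
  "\<And>t t'. t' \<in> {-T..T} ==> t \<in> {-T..T} ==> t' \<le> t ==> a t \<le> exp (- l * (t - t')) * (sqrt (a t') * sqrt (a t))"
proof -
 \<comment> \<open>Solves \<open>l powr s = M + 1\<close>, one more than the potential can
   cancel.\<close>
 define l where "l = (M + 1) powr (1 / s)"
 have l: "0 < l" "l powr s = M + 1" using M s by (simp_all add: l_def powr_powr)
 obtain \<omega> k where wk: "\<And>t t'. t' \<in> {-T..T} ==> t \<in> {-T..T} ==> t' \<le> t ==> twt \<omega> k t \<le> exp (- 2 * l * (t - t')) * twt \<omega> k t'"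
  by (rule twt_decay[OF T l(1)]) (rule that; assumption)
 show ?thesis
 proof (rule that[of l "twt \<omega> k" "3 ^ k"])
  show "twt \<omega> k \<in> borel_measurable borel" unfolding twt_def[abs_def] by measurable
  show "twt \<omega> k t \<le> 3 ^ k" for t
   unfolding twt_def using sin_le_one[of "\<omega> * t"] sin_ge_minus_one[of "\<omega> * t"] by (intro power_mono) linarith+
  show "tmult TYPE('n) s (\<lambda>t. of_real (twt \<omega> k t))" by (rule tmult_twt[OF s0])
  show "tmult TYPE('n) s (\<lambda>t. of_real (twt \<omega> k (- t)))"
   using tmult_twt[OF s0, of "- \<omega>" k, where 'n = 'n] by (simp add: twt_def)
  fix t t' assume tt: "t' \<in> {-T..T}" "t \<in> {-T..T}" "t' \<le> t"
  have nn: "0 \<le> twt \<omega> k t" for t using twt_ge_1[of \<omega> k t] by linarith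
  \<comment> \<open>Half of the decay is kept by the product of the roots, so the rate
    \<open>2 * l\<close> of \<open>twt_decay\<close> becomes \<open>l\<close>.\<close>
  have "sqrt (twt \<omega> k t) \<le> sqrt ((exp (- l * (t - t')))\<^sup>2 * twt \<omega> k t')"
   using wk[OF tt] by (intro real_sqrt_le_mono) (simp add: power2_eq_square exp_add[symmetric] algebra_simps)
  also have "\<dots> = exp (- l * (t - t')) * sqrt (twt \<omega> k t')" by (simp add: real_sqrt_mult)
  finally have "sqrt (twt \<omega> k t) * sqrt (twt \<omega> k t) \<le> exp (- l * (t - t')) * sqrt (twt \<omega> k t') * sqrt (twt \<omega> k t)"
   by (rule mult_right_mono) (simp add: nn)
  then show "twt \<omega> k t \<le> exp (- l * (t - t')) * (sqrt (twt \<omega> k t') * sqrt (twt \<omega> k t))"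
   using nn[of t] by (simp add: mult.assoc)
 qed (use l twt_ge_1 in auto)
qed

lemma coercive_aux:
 assumes c: "0 < c" and C: "0 \<le> C" and K: "0 \<le> K" and u: "u \<in> hsv s E" and v: "v \<in> hsv s E" "nrm s v \<le> K * nrm s u"
 shows "(\<lambda>z. of_real (1 / c) * (u z + of_real C * v z)) \<in> hsv s E"
  and "nrm s (\<lambda>z. of_real (1 / c) * (u z + of_real C * v z)) \<le> ((1 / c)\<^sup>2 * (2 + 2 * C\<^sup>2 * K) + 1) * nrm s u"
proof -
 interpret semi_hilbert "hsv s E" "ips s" by (rule semi_hilbert_hsv[OF s0 Em])
 show "(\<lambda>z. of_real (1 / c) * (u z + of_real C * v z)) \<in> hsv s E" by (intro V_cmult V_add u v)
 have h: "u \<in> hs s" "v \<in> hs s" using u v by (auto simp: hsv_def)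
 have "nrm s (\<lambda>z. of_real (1 / c) * (u z + of_real C * v z)) = (1 / c)\<^sup>2 * nrm s (\<lambda>z. u z + of_real C * v z)"
  using c by (subst nrm_cmult[OF hs_add[OF h(1) hs_cmult[OF h(2)]]]) (simp add: norm_divide power_divide)
 also have "\<dots> \<le> (1 / c)\<^sup>2 * (2 * nrm s u + 2 * (C\<^sup>2 * (K * nrm s u)))"
 proof (rule mult_left_mono)
  have "nrm s (\<lambda>z. of_real C * v z) = C\<^sup>2 * nrm s v" by (simp add: nrm_cmult[OF h(2)])
  also have "\<dots> \<le> C\<^sup>2 * (K * nrm s u)" by (intro mult_left_mono v) simp
  finally show "nrm s (\<lambda>z. u z + of_real C * v z) \<le> 2 * nrm s u + 2 * (C\<^sup>2 * (K * nrm s u))"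
   using nrm_add_le[OF h(1) hs_cmult[OF h(2), of "of_real C"]] by linarith
 qed simp
 also have "\<dots> \<le> ((1 / c)\<^sup>2 * (2 + 2 * C\<^sup>2 * K) + 1) * nrm s u"
  using sqnorm_nonneg[of lborel "\<lambda>\<zeta>. rw s \<zeta> * FT u \<zeta>"] by (simp add: algebra_simps)
 finally show "nrm s (\<lambda>z. of_real (1 / c) * (u z + of_real C * v z)) \<le> ((1 / c)\<^sup>2 * (2 + 2 * C\<^sup>2 * K) + 1) * nrm s u" .
qed

text \<open>Garding's inequality falls short by \<open>C\<close> times the L2 norm, and the weighted
  step returns that norm. So the form is tested with \<open>u + C * a * u\<close>, divided by
  \<open>c\<close>; the multiplier bound keeps the norm of this test function under control. Both
  arguments need such an estimate, one for each of the two dual problems.\<close>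

lemma coercive:
 obtains C where "0 < C" "\<And>u. u \<in> hsv s E ==> \<exists>w\<in>hsv s E. nrm s w \<le> C * nrm s u \<and> nrm s u \<le> Re (Bf s q u w)"
  "\<And>u. u \<in> hsv s E ==> \<exists>w\<in>hsv s E. nrm s w \<le> C * nrm s u \<and> nrm s u \<le> Re (Bf s q w u)"
proof -
 obtain c C where cC: "0 < c" "0 \<le> C" and gard: "\<And>u. u \<in> hs s ==> c * nrm s u - C * sqnorm lborel u \<le> Re (Bf s q u u)"
  by (rule garding) (rule that; assumption)
 obtain a :: "real => real" and l r where l: "0 < l" "M + 1 \<le> l powr s" and am: "a \<in> borel_measurable borel"
  and a1: "\<And>t. 1 \<le> a t" and ar: "\<And>t. a t \<le> r"
  and tm: "tmult TYPE('n) s (\<lambda>t. of_real (a t))" "tmult TYPE('n) s (\<lambda>t. of_real (a (- t)))"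
  and dec: "\<And>t t'. t' \<in> {-T..T} ==> t \<in> {-T..T} ==> t' \<le> t ==> a t \<le> exp (- l * (t - t')) * (sqrt (a t') * sqrt (a t))"
  by (rule weight_bounds) (rule that; assumption)
 have [measurable]: "a \<in> borel_measurable borel" by (rule am)
 have a0: "0 \<le> a t" for t using a1[of t] by linarith
 obtain K1 where K1: "0 \<le> K1" "\<And>u. u \<in> hs s ==> (\<lambda>z :: 'n spacetime. of_real (a (fst z)) * u z) \<in> hs s"
  "\<And>u :: 'n spacetime => complex. u \<in> hs s ==> nrm s (\<lambda>z. of_real (a (fst z)) * u z) \<le> K1 * nrm s u"
  using tm(1) unfolding tmult_def by auto
 obtain K2 where K2: "0 \<le> K2" "\<And>u. u \<in> hs s ==> (\<lambda>z :: 'n spacetime. of_real (a (- fst z)) * u z) \<in> hs s"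
  "\<And>u :: 'n spacetime => complex. u \<in> hs s ==> nrm s (\<lambda>z. of_real (a (- fst z)) * u z) \<le> K2 * nrm s u"
  using tm(2) unfolding tmult_def by auto
 define K where "K = max K1 K2"
 have K: "0 \<le> K" "K1 \<le> K" "K2 \<le> K" using K1(1) by (auto simp: K_def)
 define D where "D = (1 / c)\<^sup>2 * (2 + 2 * C\<^sup>2 * K) + 1"
 have D: "0 < D" unfolding D_def using K by (intro add_nonneg_pos mult_nonneg_nonneg) auto
 have sa: "1 \<le> sqrt (a t)" "sqrt (a t) \<le> sqrt r" for t using a1[of t] ar[of t] by auto
 have n0: "0 \<le> nrm s u" for u :: "'n spacetime => complex" by (rule sqnorm_nonneg)
 show ?thesis
 proof (rule that[OF D])
  fix u assume u: "u \<in> hsv s E"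
  then have uh: "u \<in> hs s" by (simp add: hsv_def)
  define v where "v z = of_real (a (fst z)) * u z" for z
  have v: "v \<in> hsv s E" using K1(2)[OF uh] u by (simp add: hsv_def v_def[abs_def])
  then have vh: "v \<in> hs s" by (simp add: hsv_def)
  have vn: "nrm s v \<le> K * nrm s u"
   using K1(3)[OF uh] mult_right_mono[OF K(2) n0[of u]] by (simp add: v_def[abs_def])
  have "sqnorm lborel u \<le> Re (Bf s q (\<lambda>z. of_real ((\<lambda>_. 1) (fst z)) * u z) (\<lambda>z. of_real (a (fst z)) * u z))"
  proof (rule weighted_step[OF u l, where \<rho> = "\<lambda>t. sqrt (a t)" and r = "sqrt r"])
   show "(\<lambda>_. 1) t' * a t \<le> exp (- l * (t - t')) * (sqrt (a t') * sqrt (a t))"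
    if "t' \<in> {-T..T}" "t \<in> {-T..T}" "t' \<le> t" for t t' using dec[OF that] by simp
  qed (use uh K1(2)[OF uh] sa a0 in auto)
  then have sv: "sqnorm lborel u \<le> Re (Bf s q u v)" by (simp add: v_def[abs_def])
  define w where "w z = of_real (1 / c) * (u z + of_real C * v z)" for z
  have w: "w \<in> hsv s E" "nrm s w \<le> D * nrm s u"
   unfolding w_def[abs_def] D_def by (rule coercive_aux[OF cC K(1) u v vn])+
  have "Bf s q u w = of_real (1 / c) * (Bf s q u u + of_real C * Bf s q u v)"
   unfolding w_def[abs_def]
   by (simp only: Bf_cmult_right[OF uh hs_add[OF uh hs_cmult[OF vh]]] Bf_add_right[OF uh uh hs_cmult[OF vh]] Bf_cmult_right[OF uh vh] complex_cnj_complex_of_real)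
  then have "Re (Bf s q u w) = (1 / c) * (Re (Bf s q u u) + C * Re (Bf s q u v))" by simp
  moreover have "c * nrm s u \<le> Re (Bf s q u u) + C * Re (Bf s q u v)"
   using gard[OF uh] mult_left_mono[OF sv cC(2)] by linarith
  ultimately have "c * nrm s u \<le> c * Re (Bf s q u w)" using cC(1) by simp
  then have "nrm s u \<le> Re (Bf s q u w)" by (simp only: mult_le_cancel_left_pos[OF cC(1)])
  with w show "\<exists>w\<in>hsv s E. nrm s w \<le> D * nrm s u \<and> nrm s u \<le> Re (Bf s q u w)" by blast
 next
  fix u assume u: "u \<in> hsv s E"
  then have uh: "u \<in> hs s" by (simp add: hsv_def)
  define v where "v z = of_real (a (- fst z)) * u z" for z
  have v: "v \<in> hsv s E" using K2(2)[OF uh] u by (simp add: hsv_def v_def[abs_def])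
  then have vh: "v \<in> hs s" by (simp add: hsv_def)
  have vn: "nrm s v \<le> K * nrm s u"
   using K2(3)[OF uh] mult_right_mono[OF K(3) n0[of u]] by (simp add: v_def[abs_def])
  \<comment> \<open>The weight now sits on the first argument, which the semigroup formula evaluates
    at the earlier time; it has to grow in time, hence the reflection.\<close>
  have "sqnorm lborel u \<le> Re (Bf s q (\<lambda>z. of_real ((\<lambda>t. a (- t)) (fst z)) * u z) (\<lambda>z. of_real ((\<lambda>_. 1) (fst z)) * u z))"
  proof (rule weighted_step[OF u l, where \<rho> = "\<lambda>t. sqrt (a (- t))" and r = "sqrt r"])
   show "a (- t') * (\<lambda>_. 1) t \<le> exp (- l * (t - t')) * (sqrt (a (- t')) * sqrt (a (- t)))"
    if "t' \<in> {-T..T}" "t \<in> {-T..T}" "t' \<le> t" for t t'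
    using dec[of "- t" "- t'"] that by (simp add: mult.commute)
  qed (use uh K2(2)[OF uh] sa a0 in auto)
  then have sv: "sqnorm lborel u \<le> Re (Bf s q v u)" by (simp add: v_def[abs_def])
  define w where "w z = of_real (1 / c) * (u z + of_real C * v z)" for z
  have w: "w \<in> hsv s E" "nrm s w \<le> D * nrm s u"
   unfolding w_def[abs_def] D_def by (rule coercive_aux[OF cC K(1) u v vn])+
  have "Bf s q w u = of_real (1 / c) * (Bf s q u u + of_real C * Bf s q v u)"
   unfolding w_def[abs_def]
   by (simp only: Bf_cmult_left[OF hs_add[OF uh hs_cmult[OF vh]] uh] Bf_add_left[OF uh hs_cmult[OF vh] uh] Bf_cmult_left[OF vh uh])
  then have "Re (Bf s q w u) = (1 / c) * (Re (Bf s q u u) + C * Re (Bf s q v u))" by simp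
  moreover have "c * nrm s u \<le> Re (Bf s q u u) + C * Re (Bf s q v u)"
   using gard[OF uh] mult_left_mono[OF sv cC(2)] by linarith
  ultimately have "c * nrm s u \<le> c * Re (Bf s q w u)" using cC(1) by simp
  then have "nrm s u \<le> Re (Bf s q w u)" by (simp only: mult_le_cancel_left_pos[OF cC(1)])
  with w show "\<exists>w\<in>hsv s E. nrm s w \<le> D * nrm s u \<and> nrm s u \<le> Re (Bf s q w u)" by blast
 qed
qed

theorem solvable:
 assumes l_add: "\<And>u w. u \<in> hsv s E ==> w \<in> hsv s E ==> f (\<lambda>z. u z + w z) = f u + f w"
  and l_cmult: "\<And>u c. u \<in> hsv s E ==> f (\<lambda>z. c * u z) = cnj c * f u"
  and l_bd: "\<And>u. u \<in> hsv s E ==> (cmod (f u))\<^sup>2 \<le> K * nrm s u" and K: "0 \<le> K"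
 shows "\<exists>u\<in>hsv s E. \<forall>w\<in>hsv s E. Bf s q u w = f w"
  and "\<exists>u\<in>hsv s E. \<forall>w\<in>hsv s E. Bf s q w u = cnj (f w)"
proof -
 interpret H: semi_hilbert "hsv s E" "ips s" by (rule semi_hilbert_hsv[OF s0 Em])
 have Q: "H.Q = nrm s" by (rule ext) (simp add: H.Q_def ips_self)
 have h: "u \<in> hs s" if "u \<in> hsv s E" for u using that by (simp add: hsv_def)
 obtain C where C: "0 < C" and co: "\<And>u. u \<in> hsv s E ==> \<exists>w\<in>hsv s E. nrm s w \<le> C * nrm s u \<and> nrm s u \<le> Re (Bf s q u w)"
  "\<And>u. u \<in> hsv s E ==> \<exists>w\<in>hsv s E. nrm s w \<le> C * nrm s u \<and> nrm s u \<le> Re (Bf s q w u)"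
  by (rule coercive) (rule that; assumption)
 have M0: "0 \<le> 2 + 2 * M\<^sup>2" by simp
 \<comment> \<open>\<open>lax_milgram\<close> asks for a good first argument for every second one,
   which is the second estimate of \<open>coercive\<close>; for the adjoint form below it is the
   first.\<close>
 show "\<exists>u\<in>hsv s E. \<forall>w\<in>hsv s E. Bf s q u w = f w"
  by (rule H.lax_milgram[where K = "2 + 2 * M\<^sup>2" and C = C and K' = K])
   (use h Bf_add_left Bf_add_right Bf_cmult_left Bf_cmult_right Bf_bound M0 C co(2) l_add l_cmult l_bd K in \<open>simp_all add: Q\<close>)
 have "\<exists>u\<in>hsv s E. \<forall>w\<in>hsv s E. (\<lambda>u w. cnj (Bf s q w u)) u w = f w"
 proof (rule H.lax_milgram[where K = "2 + 2 * M\<^sup>2" and C = C and K' = K])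
  show "(cmod (cnj (Bf s q w u)))\<^sup>2 \<le> (2 + 2 * M\<^sup>2) * H.Q u * H.Q w" if "u \<in> hsv s E" "w \<in> hsv s E" for u w
   using Bf_bound[OF h[OF that(2)] h[OF that(1)]] by (simp add: Q mult_ac)
 qed (use h Bf_add_left Bf_add_right Bf_cmult_left Bf_cmult_right M0 C co(1) l_add l_cmult l_bd K in \<open>simp_all add: Q\<close>)
 then show "\<exists>u\<in>hsv s E. \<forall>w\<in>hsv s E. Bf s q w u = cnj (f w)" by (metis complex_cnj_cnj)
qed

end

section \<open>Unique continuation for the fractional heat operator\<close>

lemma lborel_subtract:
 fixes f :: "'a::euclidean_space => 'b::{banach, second_countable_topology}"
 assumes [measurable]: "f \<in> borel_measurable borel"
 shows "integrable lborel (\<lambda>h. f (z - h)) \<longleftrightarrow> integrable lborel f" "(LINT h|lborel. f (z - h)) = (LINT h|lborel. f h)"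
proof -
 have m: "(\<lambda>x. f (- x)) \<in> borel_measurable borel" by measurable
 have e: "(\<lambda>h. f (z - h)) = (\<lambda>h. (\<lambda>x. f (- x)) (h + - z))" by simp
 show "integrable lborel (\<lambda>h. f (z - h)) \<longleftrightarrow> integrable lborel f"
  unfolding e lborel_translate(1)[OF m] by (rule lborel_reflect(1)) measurable
 show "(LINT h|lborel. f (z - h)) = (LINT h|lborel. f h)"
  unfolding e lborel_translate(2)[OF m] by (rule lborel_reflect(2)) measurable
qed

lemma cmod_heat_symbol_le: "cmod (heat_symbol \<zeta>) \<le> 1 + (\<Sum>b\<in>Basis. (\<zeta> \<bullet> b)\<^sup>2)"
proof -
 have "cmod (heat_symbol \<zeta>) \<le> \<bar>fst \<zeta>\<bar> + (norm (snd \<zeta>))\<^sup>2"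
  unfolding heat_symbol_def by (cases \<zeta>) (auto intro!: order_trans[OF norm_triangle_ineq] simp: norm_mult norm_power)
 also have "\<bar>fst \<zeta>\<bar> \<le> 1 + (fst \<zeta>)\<^sup>2" using zero_le_power2[of "\<bar>fst \<zeta>\<bar> - 1"] zero_le_power2[of "fst \<zeta>"]
  by (simp add: power2_diff)
 also have "1 + (fst \<zeta>)\<^sup>2 + (norm (snd \<zeta>))\<^sup>2 = 1 + \<zeta> \<bullet> \<zeta>"
  unfolding power2_norm_eq_inner by (simp add: inner_prod_def power2_eq_square)
 also have "\<dots> = 1 + (\<Sum>b\<in>Basis. (\<zeta> \<bullet> b)\<^sup>2)" by (simp add: euclidean_inner[of \<zeta> \<zeta>] power2_eq_square)
 finally show ?thesis by simp
qed

text \<open>The weight is at most \<open>2 + |\<zeta>|^2\<close> because \<open>s < 1\<close>, and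
  \<open>lipschitz_frequency\<close> integrates each square of a coordinate.\<close>

lemma lipschitz_hs:
 fixes u :: "'n::finite spacetime => complex"
 assumes s: "0 < s" "s < 1" and lip: "\<And>z w. cmod (u z - u w) \<le> L * norm (z - w)" and supp: "\<And>z. R < norm z ==> u z = 0" and R: "0 \<le> R"
 shows "u \<in> hs s"
proof -
 have l: "L12 u" by (rule lipschitz_L12[OF lip supp R])
 note f = ft_L12[OF l]
 note D = ftD[OF f]
 have [measurable]: "FI u \<in> borel_measurable borel" by (rule D)
 have "integrable lborel (\<lambda>\<zeta>. 2 * (cmod (FI u \<zeta>))\<^sup>2 + (\<Sum>b\<in>Basis. (\<zeta> \<bullet> b)\<^sup>2 * (cmod (FI u \<zeta>))\<^sup>2))"
  using sqint_integrable[OF D(2)] by (intro Bochner_Integration.integrable_add Bochner_Integration.integrable_sum lipschitz_frequency[OF lip supp R f]) auto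
 then have "integrable lborel (\<lambda>\<zeta>. (cmod (rw s \<zeta> * FI u \<zeta>))\<^sup>2)"
 proof (rule Bochner_Integration.integrable_bound)
  have "wt s \<zeta> * (cmod (FI u \<zeta>))\<^sup>2 \<le> 2 * (cmod (FI u \<zeta>))\<^sup>2 + (\<Sum>b\<in>Basis. (\<zeta> \<bullet> b)\<^sup>2 * (cmod (FI u \<zeta>))\<^sup>2)" for \<zeta> :: "'n spacetime"
  proof -
   have "wt s \<zeta> \<le> (1 + cmod (heat_symbol \<zeta>)) powr 1" unfolding wt_def using s by (intro powr_mono) auto
   also have "\<dots> = 1 + cmod (heat_symbol \<zeta>)" by simp
   also have "\<dots> \<le> 2 + (\<Sum>b\<in>Basis. (\<zeta> \<bullet> b)\<^sup>2)" using cmod_heat_symbol_le[of \<zeta>] by simp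
   finally have "wt s \<zeta> * (cmod (FI u \<zeta>))\<^sup>2 \<le> (2 + (\<Sum>b\<in>Basis. (\<zeta> \<bullet> b)\<^sup>2)) * (cmod (FI u \<zeta>))\<^sup>2" by (rule mult_right_mono) simp
   then show ?thesis by (simp add: distrib_right sum_distrib_right)
  qed
  then show "AE \<zeta> in lborel. norm ((cmod (rw s \<zeta> * FI u \<zeta>))\<^sup>2) \<le> norm (2 * (cmod (FI u \<zeta>))\<^sup>2 + (\<Sum>b\<in>Basis. (\<zeta> \<bullet> b)\<^sup>2 * (cmod (FI u \<zeta>))\<^sup>2))"
   unfolding cmod_rw_sq by (intro AE_I2) (auto simp: wt_def intro: order_trans[OF _ abs_ge_self])
 qed measurable
 then have "sqint lborel (\<lambda>\<zeta>. rw s \<zeta> * FI u \<zeta>)" by (intro sqintI) measurable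
 with hs_iff[OF f] show ?thesis by blast
qed

section \<open>Bump functions as Sobolev and test functions\<close>

lemma bump_eq_0: "0 < \<delta> ==> \<delta> \<le> norm (z - p) ==> bump p \<delta> z = 0"
 using bump_pos_iff[of \<delta> p z] by linarith

lemma bump_far:
 assumes "0 < \<delta>" "norm p + \<delta> < norm z" shows "complex_of_real (bump p \<delta> z) = 0"
 using bump_eq_0[OF assms(1), of z p] assms norm_triangle_ineq2[of z p] by simp

lemma bump_lipschitz_complex:
 assumes "0 < \<delta>" obtains L where "\<And>z w. cmod (of_real (bump p \<delta> z) - of_real (bump p \<delta> w)) \<le> L * norm (z - w)"
proof -
 obtain L where "\<And>z w. \<bar>bump p \<delta> z - bump p \<delta> w\<bar> \<le> L * norm (z - w)" by (rule bump_lipschitz[OF assms]) (rule that; assumption)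
 then show ?thesis by (intro that[of L]) (simp flip: of_real_diff)
qed

lemma bump_L12: assumes "0 < \<delta>" shows "L12 (\<lambda>z. complex_of_real (bump p \<delta> z))"
proof -
 obtain L where "\<And>z w. cmod (of_real (bump p \<delta> z) - of_real (bump p \<delta> w)) \<le> L * norm (z - w)"
  by (rule bump_lipschitz_complex[OF assms]) (rule that; assumption)
 from lipschitz_L12[OF this bump_far[OF assms]] show ?thesis using assms by simp
qed

lemma bump_hs:
 fixes p :: "'n::finite spacetime" assumes "0 < s" "s < 1" "0 < \<delta>" shows "(\<lambda>z. complex_of_real (bump p \<delta> z)) \<in> hs s"
proof -
 obtain L where "\<And>z w. cmod (of_real (bump p \<delta> z) - of_real (bump p \<delta> w)) \<le> L * norm (z - w)"
  by (rule bump_lipschitz_complex[OF assms(3)]) (rule that; assumption)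
 from lipschitz_hs[OF assms(1,2) this bump_far[OF assms(3)]] show ?thesis using assms by simp
qed

lemma bump_integral_pos: assumes d: "0 < \<delta>" shows "0 < (LINT z|lborel. bump p \<delta> z)"
proof -
 have i: "integrable lborel (bump p \<delta>)"
  using integrable_Re[OF L12_integrable[OF bump_L12[OF d, of p]]] by simp
 have "(LINT z|lborel. bump p \<delta> z) \<noteq> 0"
 proof
  assume "(LINT z|lborel. bump p \<delta> z) = 0"
  then have "AE z in lborel. bump p \<delta> z = 0"
   using integral_nonneg_eq_0_iff_AE[OF i] bump_nonneg[of p \<delta>] by auto
  then have "AE z in lborel. \<not> z \<in> ball p \<delta>"
   by (rule eventually_mono) (use bump_pos_iff[OF d, of p] in \<open>auto simp: dist_norm norm_minus_commute\<close>)
  then have "ball p \<delta> \<in> null_sets lborel" by (subst (asm) AE_iff_null_sets[symmetric]) auto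
  then have "negligible (ball p \<delta>)" by (simp add: negligible_iff_null_sets null_sets_completionI)
  then show False using open_not_negligible[of "ball p \<delta>"] d by auto
 qed
 moreover have "0 \<le> (LINT z|lborel. bump p \<delta> z)" by (intro integral_nonneg_AE AE_I2 bump_nonneg)
 ultimately show ?thesis by simp
qed

text \<open>Averages over shrinking bumps approach the value at \<open>p\<close>: were it nonzero,
  \<open>g\<close> would stay within half of its modulus near \<open>p\<close>, and the integral
  against a positive bump could not vanish.\<close>

lemma bump_test:
 fixes g :: "'a::euclidean_space => complex"
 assumes c: "isCont g p" and d: "0 < d"
  and I: "\<And>\<delta>. 0 < \<delta> ==> \<delta> \<le> d ==> integrable lborel (\<lambda>z. of_real (bump p \<delta> z) * g z)"
  and Z: "\<And>\<delta>. 0 < \<delta> ==> \<delta> \<le> d ==> (LINT z|lborel. of_real (bump p \<delta> z) * g z) = 0"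
 shows "g p = 0"
proof (rule ccontr)
 assume "g p \<noteq> 0"
 define e where "e = cmod (g p) / 2"
 have e: "0 < e" using \<open>g p \<noteq> 0\<close> by (simp add: e_def)
 obtain r where r: "0 < r" "\<And>z. dist z p < r ==> dist (g z) (g p) < e"
  using c e unfolding continuous_at_eps_delta by blast
 define \<delta> where "\<delta> = min r d"
 have dl: "0 < \<delta>" "\<delta> \<le> d" "\<delta> \<le> r" using r d by (auto simp: \<delta>_def)
 define b where "b = bump p \<delta>"
 have bi: "integrable lborel (\<lambda>z. complex_of_real (b z))" using L12_integrable[OF bump_L12[OF dl(1)]] by (simp add: b_def)
 then have bi': "integrable lborel b" using integrable_Re[OF bi] by simp
 have I': "integrable lborel (\<lambda>z. of_real (b z) * g z)" "(LINT z|lborel. of_real (b z) * g z) = 0"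
  unfolding b_def by (rule I[OF dl(1,2)]) (rule Z[OF dl(1,2)])
 have "complex_of_real (LINT z|lborel. b z) * g p = (LINT z|lborel. of_real (b z) * g p) - (LINT z|lborel. of_real (b z) * g z)"
  using I' by simp
 also have "\<dots> = (LINT z|lborel. of_real (b z) * g p - of_real (b z) * g z)"
  using bi I' by (intro Bochner_Integration.integral_diff[symmetric]) auto
 finally have "cmod (complex_of_real (LINT z|lborel. b z) * g p) = cmod (LINT z|lborel. of_real (b z) * g p - of_real (b z) * g z)" by simp
 also have "\<dots> \<le> (LINT z|lborel. b z * e)"
 proof (rule Bochner_Integration.integral_norm_bound_integral)
  show "norm (of_real (b z) * g p - of_real (b z) * g z) \<le> b z * e" for z
  proof (cases "norm (z - p) < \<delta>")
   case True
   then have "cmod (g p - g z) \<le> e" using r(2)[of z] dl(3) by (simp add: dist_norm norm_minus_commute less_imp_le)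
   then show ?thesis unfolding right_diff_distrib[symmetric] norm_mult
    using bump_nonneg[of p \<delta> z] by (simp add: b_def mult_left_mono)
  qed (use bump_eq_0[OF dl(1), of z p] in \<open>simp add: b_def\<close>)
 qed (use bi I' bi' in auto)
 finally have "(LINT z|lborel. b z) * (2 * e) \<le> (LINT z|lborel. b z) * e"
  using bump_integral_pos[OF dl(1), of p] by (simp add: norm_mult e_def b_def)
 then show False using bump_integral_pos[OF dl(1), of p] e by (simp add: b_def)
qed

text \<open>The origin of the exponent: \<open>pk\<close> contributes \<open>1 + s\<close>, the heat
  kernel \<open>n / 2\<close>.\<close>

lemma pk_hker:
 fixes y :: "real ^ 'n::finite"
 shows "pk s \<tau> * hker \<tau> y = (1 / sqrt (4 * pi)) ^ CARD('n) * kap (1 + s + real CARD('n) / 2) ((norm y)\<^sup>2 / 4) \<tau>"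
proof (cases "0 < \<tau>")
 case True
 have "1 / sqrt (4 * pi * \<tau>) = 1 / sqrt (4 * pi) * \<tau> powr (- (1 / 2))"
  unfolding powr_minus powr_half_sqrt[OF less_imp_le[OF True]] real_sqrt_mult[of "4 * pi" \<tau>] by (simp add: field_simps)
 moreover have "(\<tau> powr (- (1 / 2))) ^ CARD('n) = \<tau> powr (real CARD('n) * (- (1 / 2)))"
  using powr_power[of \<tau> "- (1 / 2)" "CARD('n)"] True by simp
 ultimately have "(1 / sqrt (4 * pi * \<tau>)) ^ CARD('n) = (1 / sqrt (4 * pi)) ^ CARD('n) * \<tau> powr (real CARD('n) * (- (1 / 2)))"
  by (simp only: power_mult_distrib)
 moreover have "\<tau> powr (- 1 - s) * \<tau> powr (real CARD('n) * (- (1 / 2))) = \<tau> powr (- (1 + s + real CARD('n) / 2))"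
  by (simp add: powr_add[symmetric] algebra_simps)
 moreover have "- (norm y)\<^sup>2 / (4 * \<tau>) = - ((norm y)\<^sup>2 / 4) / \<tau>" by simp
 moreover have "P = k * P' ==> A * P' = R ==> X = Y ==> A * (P * exp X) = k * (R * exp Y)" for P P' A R X Y k :: real
  by (auto simp: mult_ac)
 ultimately show ?thesis using True unfolding pk_def hker_def kap_def by simp
qed (simp add: pk_def kap_def)

text \<open>When the supports are separated in space, the term without shift in
  \<open>heat_diff\<close> drops out and only the kernel part of the semigroup formula remains. The
  separation bounds the kernel, so Fubini applies. The first argument acts at times before those of
  the second.\<close>

lemma Ef_disjoint:
 fixes a b :: "'n::finite spacetime => complex" and s :: real
 defines "m \<equiv> 1 + s + real CARD('n) / 2"
 assumes s: "0 < s" "s < 1" and a: "a \<in> hs s" "integrable lborel a" and b: "b \<in> hs s" "integrable lborel b"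
  and c0: "0 < c0" and sep: "\<forall>z p. a p \<noteq> 0 \<longrightarrow> b z \<noteq> 0 \<longrightarrow> c0 \<le> (norm (snd z - snd p))\<^sup>2 / 4"
 shows "integrable (lborel \<Otimes>\<^sub>M lborel) (\<lambda>(z, p). of_real (kap m ((norm (snd z - snd p))\<^sup>2 / 4) (fst z - fst p)) * (a p * cnj (b z)))"
  and "of_real (pkc s) * Ef s a b = - of_real ((1 / sqrt (4 * pi)) ^ CARD('n)) *
   (LINT z|lborel. LINT p|lborel. of_real (kap m ((norm (snd z - snd p))\<^sup>2 / 4) (fst z - fst p)) * (a p * cnj (b z)))"
proof -
 define k where "k = complex_of_real ((1 / sqrt (4 * pi)) ^ CARD('n))"
 define N where "N h = complex_of_real (kap m ((norm (snd h))\<^sup>2 / 4) (fst h))" for h :: "'n spacetime"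
 have [measurable]: "a \<in> borel_measurable borel" "b \<in> borel_measurable borel" using hsD(4)[OF a(1)] hsD(4)[OF b(1)] by auto
 have Nm [measurable]: "N \<in> borel_measurable borel" unfolding N_def[abs_def] by measurable
 have m0: "0 \<le> m" using s by (simp add: m_def)
 obtain M where M: "0 \<le> M" "\<And>c \<tau>. c0 \<le> c ==> kap m c \<tau> \<le> M" by (rule kap_bound[OF m0 c0]) (rule that; assumption)
 have N: "of_real (kap m ((norm (snd z - snd p))\<^sup>2 / 4) (fst z - fst p)) = N (z - p)" for z p :: "'n spacetime" by (simp add: N_def)
 define V where "V z p = N (z - p) * (a p * cnj (b z))" for z p
 have Vle: "cmod (V z p) \<le> M * (cmod (a p) * cmod (b z))" for z p
 proof (cases "a p \<noteq> 0 \<and> b z \<noteq> 0")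
  case True
  then have "cmod (N (z - p)) \<le> M" using M(2)[OF sep[rule_format], of p z] by (simp add: N_def kap_nonneg)
  then show ?thesis unfolding V_def norm_mult complex_mod_cnj by (intro mult_right_mono) auto
 qed (auto simp: V_def)
 have Vi: "integrable (lborel \<Otimes>\<^sub>M lborel) (case_prod V)"
 proof (rule Bochner_Integration.integrable_bound)
  show "integrable (lborel \<Otimes>\<^sub>M lborel) (\<lambda>x. of_real M * (case x of (z, p) => b z * a p))"
   by (intro integrable_mult_right integrable_tensor a b)
  show "case_prod V \<in> borel_measurable (lborel \<Otimes>\<^sub>M lborel)" unfolding V_def by measurable
  show "AE x in lborel \<Otimes>\<^sub>M lborel. norm (case_prod V x) \<le> norm (of_real M * (case x of (z, p) => b z * a p))"
   using Vle M(1) by (intro AE_I2) (auto simp: norm_mult mult_ac)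
 qed
 then show "integrable (lborel \<Otimes>\<^sub>M lborel) (\<lambda>(z, p). of_real (kap m ((norm (snd z - snd p))\<^sup>2 / 4) (fst z - fst p)) * (a p * cnj (b z)))"
  unfolding N V_def .
 \<comment> \<open>The same integrand with the shift \<open>h = z - p\<close> as second variable,
   which is how the correlations enter.\<close>
 define W where "W z h = N h * (a (z - h) * cnj (b z))" for z h
 have WV: "W z h = V z (z - h)" for z h by (simp add: W_def V_def)
 have Vm: "V z \<in> borel_measurable borel" for z unfolding V_def by measurable
 have Wi: "integrable (lborel \<Otimes>\<^sub>M lborel) (case_prod W)"
 proof (rule lborel_pair.Fubini_integrable)
  show "case_prod W \<in> borel_measurable (lborel \<Otimes>\<^sub>M lborel)" unfolding W_def by measurable
  have "(LINT h|lborel. norm (W z h)) = (LINT p|lborel. norm (V z p))" for z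
   unfolding WV using Vm[of z] by (intro lborel_subtract(2)) measurable
  then show "integrable lborel (\<lambda>z. LINT h|lborel. norm (case (z, h) of (z, h) => W z h))"
   using lborel_pair.integrable_fst'[OF integrable_norm[OF Vi]] by simp
  show "AE z in lborel. integrable lborel (\<lambda>h. case (z, h) of (z, h) => W z h)"
   using lborel_pair.AE_integrable_fst'[OF Vi]
   by (rule eventually_mono) (simp add: WV lborel_subtract(1)[OF Vm])
 qed
 have Wc: "(LINT z|lborel. W z h) = N h * corr a b h" for h
  by (simp add: W_def corr_def inprod_def)
 have Ci: "integrable lborel (\<lambda>h. N h * corr a b h)"
  using lborel_pair.integrable_snd[OF Wi] by (simp add: Wc)
 have ip: "inprod lborel a b = 0"
 proof -
  have "a z * cnj (b z) = 0" for z using sep[rule_format, of z z] c0 by (cases "a z = 0") auto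
  then have "(\<lambda>z. a z * cnj (b z)) = (\<lambda>z. 0)" by blast
  then show ?thesis unfolding inprod_def by (simp only: Bochner_Integration.integral_zero)
 qed
 have "pk s \<tau> *\<^sub>R heat_diff a b \<tau> = - k * (LINT y|lborel. N (\<tau>, y) * corr a b (\<tau>, y))" for \<tau>
 proof -
  have "pk s \<tau> *\<^sub>R heat_diff a b \<tau> = - (LINT y|lborel. of_real (pk s \<tau>) * (of_real (hker \<tau> y) * corr a b (\<tau>, y)))"
   by (simp add: heat_diff_def ip scaleR_conv_of_real)
  also have "\<dots> = - (LINT y|lborel. k * (N (\<tau>, y) * corr a b (\<tau>, y)))"
   unfolding k_def N_def fst_conv snd_conv m_def mult.assoc[symmetric] of_real_mult[symmetric] pk_hker ..
  finally show ?thesis by simp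
 qed
 then have "of_real (pkc s) * Ef s a b = - k * (LINT \<tau>|lborel. LINT y|lborel. N (\<tau>, y) * corr a b (\<tau>, y))"
  unfolding Ef_semigroup(2)[OF s a(1) b(1)] by simp
 also have "(LINT \<tau>|lborel. LINT y|lborel. N (\<tau>, y) * corr a b (\<tau>, y)) = (LINT h|lborel. N h * corr a b h)"
  using lborel_pair.integral_fst'[of "\<lambda>h. N h * corr a b h"] Ci by (simp add: lborel_prod)
 also have "\<dots> = (LINT h|lborel. LINT z|lborel. W z h)" by (simp add: Wc)
 also have "\<dots> = (LINT z|lborel. LINT h|lborel. W z h)" by (rule lborel_pair.Fubini_integral[OF Wi])
 also have "\<dots> = (LINT z|lborel. LINT p|lborel. V z p)" unfolding WV lborel_subtract(2)[OF Vm] ..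
 finally show "of_real (pkc s) * Ef s a b = - of_real ((1 / sqrt (4 * pi)) ^ CARD('n)) *
   (LINT z|lborel. LINT p|lborel. of_real (kap m ((norm (snd z - snd p))\<^sup>2 / 4) (fst z - fst p)) * (a p * cnj (b z)))"
  unfolding k_def V_def N .
qed

text \<open>Near \<open>c\<close> the kernel is Lipschitz in its second argument with a constant
  independent of \<open>\<tau>\<close>; together with continuity in \<open>\<tau>\<close> for fixed
  \<open>c\<close> this gives joint continuity.\<close>

lemma kap_tendsto:
 assumes m: "0 \<le> m" and c: "0 < c" and x: "x \<longlonglongrightarrow> c" and y: "y \<longlonglongrightarrow> \<tau>"
 shows "(\<lambda>n. kap m (x n) (y n)) \<longlonglongrightarrow> kap m c \<tau>"
proof -
 have c2: "0 < c / 2" and m1: "0 \<le> m + 1" using c m by auto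
 obtain M where M: "0 \<le> M" "\<And>c' \<tau>. c / 2 \<le> c' ==> kap (m + 1) c' \<tau> \<le> M"
  by (rule kap_bound[OF m1 c2]) (rule that; assumption)
 have le: "\<bar>kap m a t - kap m c t\<bar> \<le> M * \<bar>a - c\<bar>" if "c / 2 \<le> a" for a t
 proof -
  have "norm (kap m a t - kap m c t) \<le> M * norm (a - c)"
  proof (rule field_differentiable_bound[of "{c / 2..}" "\<lambda>c. kap m c t" "\<lambda>c. - kap (m + 1) c t"])
   show "((\<lambda>c. kap m c t) has_field_derivative - kap (m + 1) z t) (at z within {c / 2..})" for z
    using kap_deriv_c by (rule has_field_derivative_at_within)
   show "norm (- kap (m + 1) z t) \<le> M" if "z \<in> {c / 2..}" for z
    using M(2)[of z t] that by (simp add: kap_nonneg)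
  qed (use that c in simp_all)
  then show ?thesis by simp
 qed
 have "\<forall>\<^sub>F n in sequentially. c / 2 < x n" by (rule order_tendstoD(1)[OF x]) (use c in simp)
 then have "\<forall>\<^sub>F n in sequentially. norm (kap m (x n) (y n) - kap m c (y n)) \<le> M * \<bar>x n - c\<bar>"
  by (rule eventually_mono) (use le in auto)
 moreover have "(\<lambda>n. M * \<bar>x n - c\<bar>) \<longlonglongrightarrow> 0"
  using tendsto_mult[OF tendsto_const[of M] tendsto_rabs[OF tendsto_diff[OF x tendsto_const[of c]]]] by simp
 ultimately have "(\<lambda>n. kap m (x n) (y n) - kap m c (y n)) \<longlonglongrightarrow> 0"
  by (rule Lim_null_comparison)
 moreover have "(\<lambda>n. kap m c (y n)) \<longlonglongrightarrow> kap m c \<tau>"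
  by (rule isCont_tendsto_compose[OF DERIV_isCont[OF kap_deriv_tau[OF m c]] y])
 ultimately have "(\<lambda>n. (kap m (x n) (y n) - kap m c (y n)) + kap m c (y n)) \<longlonglongrightarrow> 0 + kap m c \<tau>" by (rule tendsto_add)
 then show ?thesis by simp
qed

context cylinder_supported
begin

lemma G_isCont:
 assumes m: "0 \<le> m" and p: "snd p \<in> B" shows "isCont (\<lambda>p. G (\<lambda>_. 1) m (fst p) (snd p)) p"
 unfolding continuous_at_sequentially
proof (intro allI impI)
 fix x :: "nat => real \<times> (real, 'n) vec" assume x: "x \<longlonglongrightarrow> p"
 obtain M where M: "0 \<le> M" "\<And>c \<tau>. c0 \<le> c ==> kap m c \<tau> \<le> M" by (rule kap_bound[OF m c0(1)]) (rule that; assumption)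
 have "(\<lambda>n. snd (x n)) \<longlonglongrightarrow> snd p" by (rule tendsto_snd[OF x])
 then have "\<forall>\<^sub>F n in sequentially. snd (x n) \<in> B" by (rule topological_tendstoD[OF _ B(1) p])
 then obtain n0 where n0: "\<And>n. n0 \<le> n ==> snd (x n) \<in> B" unfolding eventually_sequentially by blast
 define y where "y n = x (n + n0)" for n
 have yB: "snd (y n) \<in> B" for n using n0[of "n + n0"] by (simp add: y_def)
 have y: "y \<longlonglongrightarrow> p" unfolding y_def by (rule LIMSEQ_ignore_initial_segment[OF x])
 have "(\<lambda>n. G (\<lambda>_. 1) m (fst (y n)) (snd (y n))) \<longlonglongrightarrow> G (\<lambda>_. 1) m (fst p) (snd p)"
  unfolding G_def
 proof (rule integral_dominated_convergence[where w = "\<lambda>z. M * cmod (v z)"])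
  show "integrable lborel (\<lambda>z. M * cmod (v z))" using v_integrable by simp
  show "AE z in lborel. (\<lambda>n. complex_of_real (1 * kap m (cc (snd (y n)) z) (e * (fst z - fst (y n)))) * v z) \<longlonglongrightarrow> complex_of_real (1 * kap m (cc (snd p) z) (e * (fst z - fst p))) * v z"
  proof (intro AE_I2)
   fix z show "(\<lambda>n. complex_of_real (1 * kap m (cc (snd (y n)) z) (e * (fst z - fst (y n)))) * v z) \<longlonglongrightarrow> complex_of_real (1 * kap m (cc (snd p) z) (e * (fst z - fst p))) * v z"
   proof (cases "z \<in> K")
    case True
    have "0 < cc (snd p) z" using cc_ge[OF p True] c0(1) by linarith
    moreover have "(\<lambda>n. cc (snd (y n)) z) \<longlonglongrightarrow> cc (snd p) z" unfolding cc_def by (intro tendsto_intros y) simp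
    moreover have "(\<lambda>n. e * (fst z - fst (y n))) \<longlonglongrightarrow> e * (fst z - fst p)" by (intro tendsto_intros y)
    ultimately have "(\<lambda>n. kap m (cc (snd (y n)) z) (e * (fst z - fst (y n)))) \<longlonglongrightarrow> kap m (cc (snd p) z) (e * (fst z - fst p))"
     by (rule kap_tendsto[OF m])
    then show ?thesis unfolding mult_1 by (intro tendsto_intros)
   qed (simp add: v_out)
  qed
  show "AE z in lborel. norm (complex_of_real (1 * kap m (cc (snd (y n)) z) (e * (fst z - fst (y n)))) * v z) \<le> M * cmod (v z)" for n
  proof (intro AE_I2)
   fix z show "norm (complex_of_real (1 * kap m (cc (snd (y n)) z) (e * (fst z - fst (y n)))) * v z) \<le> M * cmod (v z)"
   proof (cases "z \<in> K")
    case True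
    then show ?thesis unfolding norm_mult norm_of_real using M(2)[OF cc_ge[OF yB True]] by (intro mult_right_mono) (auto simp: kap_nonneg)
   qed (simp add: v_out)
  qed
 qed measurable
 then show "((\<lambda>p. G (\<lambda>_. 1) m (fst p) (snd p)) \<circ> x) \<longlonglongrightarrow> G (\<lambda>_. 1) m (fst p) (snd p)"
  unfolding y_def comp_def by (rule LIMSEQ_offset)
qed

text \<open>By \<open>Ef_disjoint\<close> the pairing with a bump is a nonzero multiple of the
  integral of the bump against the potential \<open>V\<close> of \<open>v\<close>. With
  \<open>v\<close> in the second slot, \<open>V\<close> appears conjugated and collects later times
  (\<open>e = 1\<close>); with \<open>v\<close> in the first slot it collects earlier times. Since
  \<open>V\<close> is continuous, shrinking bumps give its pointwise vanishing, which starts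
  \<open>vanishing\<close>.\<close>

lemma vanishing_of_bumps:
 assumes s: "0 < s" "s < 1" and vh: "v \<in> hs s"
  and Z: "\<And>p \<delta>. 0 < \<delta> ==> cball p \<delta> \<subseteq> {-T<..<T} \<times> B ==>
   (if e = 1 then Ef s (\<lambda>z. of_real (bump p \<delta> z)) v else Ef s v (\<lambda>z. of_real (bump p \<delta> z))) = 0"
 shows "AE z in lborel. v z = 0"
proof -
 define m where "m = 1 + s + real CARD('n) / 2"
 have m: "0 \<le> m" "real CARD('n) / 2 < m" using s by (auto simp: m_def)
 have nz: "complex_of_real ((1 / sqrt (4 * pi)) ^ CARD('n)) \<noteq> 0" by simp
 define V where "V p = G (\<lambda>_. 1) m (fst p) (snd p)" for p
 have "V p = 0" if p: "p \<in> {-T<..<T} \<times> B" for p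
 proof -
  have "open ({-T<..<T} \<times> B)" by (intro open_Times B) simp
  then obtain d where d: "0 < d" "cball p d \<subseteq> {-T<..<T} \<times> B" using p unfolding open_contains_cball by blast
  have V: "isCont V p" unfolding V_def using p by (intro G_isCont m) auto
  have key: "integrable lborel (\<lambda>z. of_real (bump p \<delta> z) * (if e = 1 then cnj (V z) else V z)) \<and>
   (LINT z|lborel. of_real (bump p \<delta> z) * (if e = 1 then cnj (V z) else V z)) = 0" if \<delta>: "0 < \<delta>" "\<delta> \<le> d" for \<delta>
  proof -
   define f where "f z = complex_of_real (bump p \<delta> z)" for z
   have fh: "f \<in> hs s" unfolding f_def using bump_hs[OF s \<delta>(1)] .
   have fi: "integrable lborel f" unfolding f_def by (rule L12_integrable[OF bump_L12[OF \<delta>(1)]])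
   have fr: "cnj (f z) = f z" for z by (simp add: f_def)
   have cb: "cball p \<delta> \<subseteq> {-T<..<T} \<times> B" using d(2) \<delta>(2) by (rule_tac order_trans[OF subset_cball]) auto
   have fB: "snd z \<in> B" if "f z \<noteq> 0" for z
   proof -
    have "z \<in> cball p \<delta>" using that bump_pos_iff[OF \<delta>(1), of p z] by (simp add: f_def dist_norm norm_minus_commute)
    then show ?thesis using cb by (cases z) auto
   qed
   have vC: "snd z \<in> C" if "v z \<noteq> 0" for z using v0[of z] that by (cases z) auto
   have pc: "complex_of_real (pkc s) \<noteq> 0" using pkc_pos[OF s] by simp
   show ?thesis
   proof (cases "e = 1")
    case True
    have sep: "\<forall>z p. f p \<noteq> 0 \<longrightarrow> v z \<noteq> 0 \<longrightarrow> c0 \<le> (norm (snd z - snd p))\<^sup>2 / 4" using c0(2)[OF fB vC] by blast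
    note E = Ef_disjoint[OF s fh fi vh v_integrable c0(1) sep, folded m_def]
    have in_eq: "(LINT z|lborel. of_real (kap m ((norm (snd z - snd p))\<^sup>2 / 4) (fst z - fst p)) * (f p * cnj (v z))) = f p * cnj (V p)" for p
     unfolding V_def G_def Bochner_Integration.integral_cnj[symmetric] integral_mult_right_zero[symmetric]
     by (rule Bochner_Integration.integral_cong) (auto simp: True cc_def mult_ac)
    have "Ef s f v = 0" using Z[OF \<delta>(1) cb] True by (simp add: f_def[abs_def])
    then have "(LINT z|lborel. LINT p|lborel. of_real (kap m ((norm (snd z - snd p))\<^sup>2 / 4) (fst z - fst p)) * (f p * cnj (v z))) = 0"
     using E(2) nz by simp
    then have "(LINT p|lborel. f p * cnj (V p)) = 0"
     using lborel_pair.Fubini_integral[OF E(1)] by (simp only: in_eq)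
    moreover have "integrable lborel (\<lambda>p. f p * cnj (V p))"
     using lborel_pair.integrable_snd[OF E(1)] by (simp only: in_eq)
    ultimately show ?thesis using True by (simp add: f_def)
   next
    case False
    then have em: "e = -1" using e by simp
    have sep: "\<forall>z p. v p \<noteq> 0 \<longrightarrow> f z \<noteq> 0 \<longrightarrow> c0 \<le> (norm (snd z - snd p))\<^sup>2 / 4"
     using c0(2)[OF fB vC] by (simp add: norm_minus_commute)
    note E = Ef_disjoint[OF s vh v_integrable fh fi c0(1) sep, folded m_def]
    have in_eq: "(LINT p|lborel. of_real (kap m ((norm (snd z - snd p))\<^sup>2 / 4) (fst z - fst p)) * (v p * cnj (f z))) = f z * V z" for z
     unfolding V_def G_def integral_mult_right_zero[symmetric]
     by (rule Bochner_Integration.integral_cong) (auto simp: em cc_def fr norm_minus_commute mult_ac)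
    have "Ef s v f = 0" using Z[OF \<delta>(1) cb] False by (simp add: f_def[abs_def])
    then have "(LINT z|lborel. f z * V z) = 0" using E(2) nz by (simp add: in_eq)
    moreover have "integrable lborel (\<lambda>p. f p * V p)"
     using lborel_pair.integrable_fst'[OF E(1)] by (simp add: in_eq)
    ultimately show ?thesis using False by (simp add: f_def)
   qed
  qed
  have "isCont (\<lambda>z. if e = 1 then cnj (V z) else V z) p" using V by (cases "e = 1") (auto intro!: continuous_intros)
  from bump_test[OF this d(1)] key have "(if e = 1 then cnj (V p) else V p) = 0" by blast
  then show ?thesis by (simp split: if_splits)
 qed
 then have "cylinder_supported.Z v T B e (\<lambda>_. 1) m" unfolding Z_def V_def by fastforce
 then show ?thesis by (rule vanishing[OF m(2)])
qed

end

section \<open>Runge approximation\<close>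

lemma Ef_cong_AE:
 assumes "u \<in> hs s" "w \<in> hs s" "AE z in lborel. u z = u' z" "AE z in lborel. w z = w' z"
  "u' \<in> borel_measurable borel" "w' \<in> borel_measurable borel"
 shows "Ef s u w = Ef s u' w'"
 unfolding Ef_eq[OF ft_cong_left[OF hsD(3)[OF assms(1)] assms(3,5)] ft_cong_left[OF hsD(3)[OF assms(2)] assms(4,6)]]
  Ef_eq[OF hsD(3)[OF assms(1)] hsD(3)[OF assms(2)]] ..

lemma qf_cong_AE:
 assumes "AE z in lborel. u z * cnj (w z) = u' z * cnj (w' z)"
  and [measurable]: "u \<in> borel_measurable borel" "w \<in> borel_measurable borel" "u' \<in> borel_measurable borel" "w' \<in> borel_measurable borel" "q \<in> borel_measurable borel"
 shows "qf q u w = qf q u' w'"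
 unfolding qf_def by (rule integral_cong_AE) (measurable, use assms(1) in \<open>auto elim: eventually_mono\<close>)

lemma Ef_0: "u \<in> hs s ==> Ef s u (\<lambda>_. 0) = 0" "u \<in> hs s ==> Ef s (\<lambda>_. 0) u = 0"
 using Ef_cmult_right[OF _ hs_0, of u s 0] Ef_cmult_left[OF hs_0, of u s 0] by simp_all

lemma norm_iexp_diff: "cmod (exp (\<i> * of_real a) - exp (\<i> * of_real b)) \<le> \<bar>a - b\<bar>"
proof -
 have "exp (\<i> * of_real a) - exp (\<i> * of_real b) = exp (\<i> * of_real b) * (iexp (a - b) - 1)"
  by (simp add: right_diff_distrib exp_add[symmetric] algebra_simps)
 then have "cmod (exp (\<i> * of_real a) - exp (\<i> * of_real b)) = cmod (iexp (a - b) - 1)" by (simp add: norm_mult)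
 also have "\<dots> \<le> \<bar>a - b\<bar>" using iexp_approx1[of "a - b" 0] by simp
 finally show ?thesis .
qed

text \<open>The tests are characters times the distance to the complement of \<open>A\<close>, cut
  off at 1. They are Lipschitz with bounded support, hence in the space, and together they say that
  the Fourier integral of \<open>\<phi> * cnj F\<close> vanishes; \<open>\<phi>\<close> is positive
  on \<open>A\<close>, where \<open>F\<close> lives.\<close>

lemma L2_zero_of_tests:
 fixes F :: "'n::finite spacetime => complex"
 assumes s: "0 < s" "s < 1" and A: "open A" "bounded A" "A \<subseteq> E" and F: "sqint lborel F" "\<And>z. z \<notin> A ==> F z = 0"
  and I: "\<And>w. w \<in> hsv s E ==> inprod lborel w F = 0"
 shows "AE z in lborel. F z = 0"
proof -
 \<comment> \<open>\<open>infdist\<close> to the empty set is 0 and would make \<open>\<phi>\<close>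
   vanish identically.\<close>
 have ne: "- A \<noteq> {}" using A(2) not_bounded_UNIV[where 'a = "'n spacetime"] by (metis Compl_UNIV_eq double_complement)
 have cl: "closed (- A)" using A(1) by (simp add: closed_def)
 define \<phi> where "\<phi> z = min 1 (infdist z (- A))" for z
 have \<phi>0: "\<phi> z = 0" if "z \<notin> A" for z using that by (simp add: \<phi>_def)
 have \<phi>p: "\<phi> z \<noteq> 0" if "z \<in> A" for z using infdist_pos_not_in_closed[OF cl ne, of z] that by (simp add: \<phi>_def)
 have \<phi>n: "0 \<le> \<phi> z" "\<phi> z \<le> 1" for z by (auto simp: \<phi>_def infdist_nonneg)
 have \<phi>l: "\<bar>\<phi> z - \<phi> w\<bar> \<le> norm (z - w)" for z w
  using infdist_triangle_abs[of z "- A" w] by (auto simp: \<phi>_def min_def dist_norm abs_if split: if_splits)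
 obtain R0 where R0: "\<And>z. z \<in> A ==> norm z \<le> R0" using A(2) by (auto simp: bounded_iff)
 define R where "R = max 0 R0"
 have R: "0 \<le> R" "\<And>z. R < norm z ==> z \<notin> A" using R0 by (force simp: R_def)+
 have \<phi>m [measurable]: "\<phi> \<in> borel_measurable borel" unfolding \<phi>_def[abs_def]
  by (intro borel_measurable_continuous_onI continuous_intros)
 have [measurable]: "F \<in> borel_measurable borel" using sqint_measurable[OF F(1)] by simp
 define g where "g z = of_real (\<phi> z) * cnj (F z)" for z
 have gs: "sqint lborel g"
 proof (rule sqint_bound[OF F(1), of g 1])
  show "AE z in lborel. cmod (g z) \<le> 1 * cmod (F z)"
   using \<phi>n by (intro AE_I2) (auto simp: g_def norm_mult abs_of_nonneg intro: mult_left_le_one_le)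
 qed (simp add: g_def[abs_def])
 have "(\<lambda>z. indicator (cball 0 R) z * g z) = g"
  using R(2) F(2) by (fastforce simp: g_def split: split_indicator)
 then have gL: "L12 g" using L12_truncate[OF gs, of R] by simp
 have "FI g \<zeta> = 0" for \<zeta>
 proof -
  define w where "w z = of_real (\<phi> z) * exp (\<i> * of_real (- (z \<bullet> \<zeta>)))" for z
  have "w \<in> hs s"
  proof (rule lipschitz_hs[OF s, of w "1 + norm \<zeta>" R])
   show "R < norm z ==> w z = 0" for z using R(2)[of z] \<phi>0[of z] by (simp add: w_def)
   show "cmod (w z - w z') \<le> (1 + norm \<zeta>) * norm (z - z')" for z z'
   proof -
    have "w z - w z' = of_real (\<phi> z - \<phi> z') * exp (\<i> * of_real (- (z \<bullet> \<zeta>))) +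
      of_real (\<phi> z') * (exp (\<i> * of_real (- (z \<bullet> \<zeta>))) - exp (\<i> * of_real (- (z' \<bullet> \<zeta>))))"
     unfolding w_def of_real_diff by (simp only: left_diff_distrib right_diff_distrib) simp
    also have "cmod \<dots> \<le> \<bar>\<phi> z - \<phi> z'\<bar> * 1 + 1 * \<bar>- (z \<bullet> \<zeta>) - - (z' \<bullet> \<zeta>)\<bar>"
    proof (rule order_trans[OF norm_triangle_ineq add_mono])
     show "cmod (of_real (\<phi> z - \<phi> z') * exp (\<i> * of_real (- (z \<bullet> \<zeta>)))) \<le> \<bar>\<phi> z - \<phi> z'\<bar> * 1"
      unfolding norm_mult norm_of_real by (simp only: norm_exp_i_times)
     show "cmod (of_real (\<phi> z') * (exp (\<i> * of_real (- (z \<bullet> \<zeta>))) - exp (\<i> * of_real (- (z' \<bullet> \<zeta>))))) \<le> 1 * \<bar>- (z \<bullet> \<zeta>) - - (z' \<bullet> \<zeta>)\<bar>"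
      unfolding norm_mult norm_of_real using \<phi>n[of z'] by (intro mult_mono norm_iexp_diff) auto
    qed
    also have "\<bar>- (z \<bullet> \<zeta>) - - (z' \<bullet> \<zeta>)\<bar> = \<bar>(z - z') \<bullet> \<zeta>\<bar>" by (simp add: inner_diff_left)
    also have "\<bar>\<phi> z - \<phi> z'\<bar> * 1 + 1 * \<bar>(z - z') \<bullet> \<zeta>\<bar> \<le> norm (z - z') * 1 + 1 * (norm (z - z') * norm \<zeta>)"
     by (intro add_mono mult_mono \<phi>l Cauchy_Schwarz_ineq2) auto
    finally show ?thesis by (simp add: algebra_simps)
   qed
  qed (rule R)
  moreover have "w z = 0" if "z \<notin> E" for z
  proof -
   have "z \<notin> A" using that A(3) by blast
   then show ?thesis by (simp add: w_def \<phi>0)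
  qed
  ultimately have "w \<in> hsv s E" by (simp add: hsv_def)
  from I[OF this] show ?thesis by (simp add: inprod_def FI_def w_def g_def mult_ac)
 qed
 then have "sqnorm lborel (FI g) = 0" by (simp add: sqnorm_def)
 then have "sqnorm lborel g = 0" using plancherel_L12(2)[OF gL] by simp
 then have "AE z in lborel. g z = 0" by (rule sqnorm_0_AE[OF gs])
 then show ?thesis
 proof (rule eventually_mono)
  fix z assume "g z = 0"
  then show "F z = 0" using \<phi>p[of z] F(2)[of z] by (cases "z \<in> A") (auto simp: g_def)
 qed
qed

locale cylinder_potential = bounded_potential s T M q "{-T..T} \<times> closure \<Omega>"
 for s T M :: real and q :: "'n::finite spacetime => real" and \<Omega> :: "(real ^ 'n) set" +
 assumes \<Omega>: "open \<Omega>" "bounded \<Omega>" and q0: "\<And>z. z \<notin> cyl T \<Omega> ==> q z = 0"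
begin

abbreviation E :: "'n spacetime set" where "E \<equiv> {-T..T} \<times> closure \<Omega>"

lemma hs_of_hsv: "u \<in> hsv s E ==> u \<in> hs s" by (simp add: hsv_def)

lemma cyl_subset: "cyl T \<Omega> \<subseteq> E" using closure_subset[of \<Omega>] by (auto simp: cyl_def)

lemma open_cyl: "open (cyl T \<Omega>)" unfolding cyl_def by (intro open_Times \<Omega>) simp

lemma bounded_cyl: "bounded (cyl T \<Omega>)" unfolding cyl_def by (intro bounded_Times \<Omega>) simp

lemma qf_exterior:
 assumes "\<And>z. z \<in> cyl T \<Omega> ==> u z = 0" shows "qf q u w = 0" "qf q w u = 0"
proof -
 have "of_real (q z) * (u z * cnj (w z)) = 0" "of_real (q z) * (w z * cnj (u z)) = 0" for z
  using assms[of z] q0[of z] by (cases "z \<in> cyl T \<Omega>"; simp)+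
 then show "qf q u w = 0" "qf q w u = 0" by (simp_all only: qf_def Bochner_Integration.integral_zero)
qed

lemma Bf_zero_AE:
 assumes u: "u \<in> hs s" and v: "v \<in> hs s" "AE z in lborel. v z = 0"
 shows "Bf s q u v = 0" "Bf s q v u = 0"
proof -
 have "Ef s u v = 0" using Ef_cong_AE[OF u v(1) _ v(2), of u] hsD(4)[OF u] by (simp add: Ef_0(1)[OF u])
 moreover have "qf q u v = qf q u (\<lambda>_. 0)"
  by (rule qf_cong_AE) (use hsD(4)[OF u] hsD(4)[OF v(1)] v(2) qm in \<open>auto elim: eventually_mono\<close>)
 ultimately show "Bf s q u v = 0" by (simp add: Bf_def qf_def)
 have "Ef s v u = 0" using Ef_cong_AE[OF v(1) u v(2), of u] hsD(4)[OF u] by (simp add: Ef_0(2)[OF u])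
 moreover have "qf q v u = qf q (\<lambda>_. 0) u"
  by (rule qf_cong_AE) (use hsD(4)[OF u] hsD(4)[OF v(1)] v(2) qm in \<open>auto elim: eventually_mono\<close>)
 ultimately show "Bf s q v u = 0" by (simp add: Bf_def qf_def)
qed

text \<open>The datum \<open>f\<close> is moved to the right hand side: the remainder
  \<open>r\<close> solves the problem on the cylinder with the functional given by
  \<open>- Bf s q f\<close>, and likewise for the adjoint problem.\<close>

lemma solution_exists:
 assumes f: "f \<in> hs s"
 shows "\<exists>r\<in>hsv s E. \<forall>w\<in>hsv s E. Bf s q (\<lambda>z. f z + r z) w = 0"
  and "\<exists>r\<in>hsv s E. \<forall>w\<in>hsv s E. Bf s q w (\<lambda>z. f z + r z) = 0"
proof -
 have n: "0 \<le> (2 + 2 * M\<^sup>2) * nrm s f" by (simp add: sqnorm_nonneg)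
 have "\<exists>r\<in>hsv s E. \<forall>w\<in>hsv s E. Bf s q r w = (\<lambda>w. - Bf s q f w) w"
  by (rule solvable(1)[where K = "(2 + 2 * M\<^sup>2) * nrm s f"])
   (use Bf_add_right[OF f] Bf_cmult_right[OF f] Bf_bound[OF f] hs_of_hsv n in auto)
 then obtain r where "r \<in> hsv s E" "\<And>w. w \<in> hsv s E ==> Bf s q r w = - Bf s q f w" by auto
 then show "\<exists>r\<in>hsv s E. \<forall>w\<in>hsv s E. Bf s q (\<lambda>z. f z + r z) w = 0"
  by (intro bexI[of _ r]) (auto simp: Bf_add_left[OF f] hs_of_hsv)
 have "\<exists>r\<in>hsv s E. \<forall>w\<in>hsv s E. Bf s q w r = cnj ((\<lambda>w. - cnj (Bf s q w f)) w)"
 proof (rule solvable(2)[where K = "(2 + 2 * M\<^sup>2) * nrm s f"])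
  show "(cmod (- cnj (Bf s q u f)))\<^sup>2 \<le> (2 + 2 * M\<^sup>2) * nrm s f * nrm s u" if "u \<in> hsv s E" for u
   using Bf_bound[OF hs_of_hsv[OF that] f] by (simp add: mult_ac)
 qed (use Bf_add_left[OF _ _ f] Bf_cmult_left[OF _ f] hs_of_hsv n in auto)
 then obtain r where "r \<in> hsv s E" "\<And>w. w \<in> hsv s E ==> Bf s q w r = - Bf s q w f" by auto
 then show "\<exists>r\<in>hsv s E. \<forall>w\<in>hsv s E. Bf s q w (\<lambda>z. f z + r z) = 0"
  by (intro bexI[of _ r]) (auto simp: Bf_add_right[OF _ f] hs_of_hsv)
qed

text \<open>The dual problems of the Runge argument, with an L2 source \<open>F\<close>.\<close>

lemma source_solution_exists:
 assumes F: "sqint lborel F"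
 shows "\<exists>v\<in>hsv s E. \<forall>w\<in>hsv s E. Bf s q v w = inprod lborel F w"
  and "\<exists>v\<in>hsv s E. \<forall>w\<in>hsv s E. Bf s q w v = inprod lborel w F"
proof -
 have a: "inprod lborel F (\<lambda>z. u z + w z) = inprod lborel F u + inprod lborel F w" if "u \<in> hsv s E" "w \<in> hsv s E" for u w
  using inprod_add_left[OF hsD(1)[OF hs_of_hsv[OF that(1)]] hsD(1)[OF hs_of_hsv[OF that(2)]] F]
  by (metis complex_cnj_add inprod_cnj)
 have c: "inprod lborel F (\<lambda>z. c * u z) = cnj c * inprod lborel F u" for c u
  using inprod_cmult_left[of lborel c u F] by (metis complex_cnj_mult inprod_cnj)
 have b: "(cmod (inprod lborel F u))\<^sup>2 \<le> sqnorm lborel F * nrm s u" if "u \<in> hsv s E" for u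
 proof -
  have u: "u \<in> hs s" using that by (rule hs_of_hsv)
  have "(2 * pi) ^ DIM('n spacetime) \<ge> 1" using pi_gt3 by (intro one_le_power) linarith
  then have "sqnorm lborel u \<le> (2 * pi) ^ DIM('n spacetime) * sqnorm lborel u" using sqnorm_nonneg[of lborel u] mult_right_mono[of 1 "(2 * pi) ^ DIM('n spacetime)" "sqnorm lborel u"] by simp
  then have "sqnorm lborel u \<le> nrm s u" using sqnorm_le_nrm[OF s0 u] by linarith
  then show ?thesis using norm_inprod_le(2)[OF F hsD(1)[OF u]] mult_left_mono[OF _ sqnorm_nonneg[of lborel F]] order_trans by blast
 qed
 show "\<exists>v\<in>hsv s E. \<forall>w\<in>hsv s E. Bf s q v w = inprod lborel F w"
  by (rule solvable(1)[where K = "sqnorm lborel F"]) (use a c b sqnorm_nonneg in auto)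
 have "\<exists>v\<in>hsv s E. \<forall>w\<in>hsv s E. Bf s q w v = cnj (inprod lborel F w)"
  by (rule solvable(2)[where K = "sqnorm lborel F"]) (use a c b sqnorm_nonneg in auto)
 then show "\<exists>v\<in>hsv s E. \<forall>w\<in>hsv s E. Bf s q w v = inprod lborel w F" by (simp add: inprod_cnj)
qed

lemma unique_continuation:
 assumes v: "v \<in> hsv s E" and U: "open U" "U \<noteq> {}" "U \<inter> closure \<Omega> = {}" and e: "e = 1 \<or> e = -1"
  and Z: "\<And>p \<delta>. 0 < \<delta> ==> cball p \<delta> \<subseteq> cyl T U ==>
   (if e = (1::real) then Ef s (\<lambda>z. of_real (bump p \<delta> z)) v else Ef s v (\<lambda>z. of_real (bump p \<delta> z))) = 0"
 shows "AE z in lborel. v z = 0"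
proof -
 have vh: "v \<in> hs s" by (rule hs_of_hsv[OF v])
 obtain x where x: "x \<in> U" using U(2) by blast
 obtain r where r: "0 < r" "cball x r \<subseteq> U" using U(1) x unfolding open_contains_cball by blast
 \<comment> \<open>Half the radius leaves a distance of at least \<open>r / 2\<close> from
   \<open>B\<close> to the closure of \<open>\<Omega>\<close>; the separation constant is the square
   of this divided by 4, as in the exponent of the kernel.\<close>
 define B where "B = ball x (r / 2)"
 interpret cylinder_supported v T "closure \<Omega>" B e "(r / 2)\<^sup>2 / 4"
 proof unfold_locales
  show "sqint lborel v" by (rule hsD(1)[OF vh])
  show "v z = 0" if "z \<notin> {-T..T} \<times> closure \<Omega>" for z using v that unfolding hsv_def by blast
  show "compact (closure \<Omega>)" using \<Omega>(2) by (simp add: compact_closure)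
  show "open B" "B \<noteq> {}" "bounded B" using r(1) by (auto simp: B_def)
  show "(r / 2)\<^sup>2 / 4 \<le> (norm (b - a))\<^sup>2 / 4" if "a \<in> B" "b \<in> closure \<Omega>" for a b
  proof -
   have "b \<notin> cball x r" using that(2) r(2) U(3) by blast
   then have "r < dist x b" by simp
   moreover have "dist x b \<le> dist x a + dist a b" by (rule dist_triangle)
   moreover have "dist x a < r / 2" using that(1) by (simp add: B_def)
   ultimately have "r / 2 \<le> norm (b - a)" by (simp add: dist_norm norm_minus_commute)
   then have "(r / 2)\<^sup>2 \<le> (norm (b - a))\<^sup>2" using r(1) by (intro power_mono) auto
   then show ?thesis by simp
  qed
 qed (use T r(1) e in auto)
 have BU: "B \<subseteq> U" using r unfolding B_def by (rule_tac order_trans[OF _ r(2)]) auto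
 show ?thesis
 proof (rule vanishing_of_bumps[OF s vh])
  fix p \<delta> assume "0 < \<delta>" "cball p \<delta> \<subseteq> {-T<..<T} \<times> B"
  moreover from this(2) have "cball p \<delta> \<subseteq> cyl T U" using BU unfolding cyl_def by blast
  ultimately show "(if e = 1 then Ef s (\<lambda>z. of_real (bump p \<delta> z)) v else Ef s v (\<lambda>z. of_real (bump p \<delta> z))) = 0"
   by (intro Z)
 qed
qed

lemma bump_exterior:
 assumes U: "U \<inter> closure \<Omega> = {}" and d: "0 < \<delta>" "cball p \<delta> \<subseteq> cyl T U" and z: "z \<in> cyl T \<Omega>"
 shows "bump p \<delta> z = 0"
proof (rule bump_eq_0[OF d(1)], rule ccontr)
 assume "\<not> \<delta> \<le> norm (z - p)"
 then have "z \<in> cball p \<delta>" by (simp add: dist_norm norm_minus_commute)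
 then have "snd z \<in> U" using d(2) by (cases z) (auto simp: cyl_def)
 moreover have "snd z \<in> closure \<Omega>" using z closure_subset[of \<Omega>] by (cases z) (auto simp: cyl_def)
 ultimately show False using U by blast
qed

text \<open>Density by duality: a source \<open>F\<close> orthogonal to all remainders of adjoint
  solutions is shown to vanish. Let \<open>v\<close> solve the direct problem with source
  \<open>F\<close>. For an adjoint solution \<open>f + r\<close> with bump datum,
  \<open>0 = Bf v (f + r) = Ef v f + (F, r)\<close>, because the potential term does not see
  \<open>f\<close>. Hence \<open>Ef v f = 0\<close> for all bumps in the exterior cylinder, unique
  continuation gives \<open>v = 0\<close>, and then \<open>F\<close> is orthogonal to all test
  functions.\<close>

theorem runge_direct:
 assumes U: "open U" "U \<noteq> {}" "U \<inter> closure \<Omega> = {}" and F: "sqint lborel F" "\<And>z. z \<notin> cyl T \<Omega> ==> F z = 0"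
  and H: "\<And>p \<delta> r. 0 < \<delta> ==> cball p \<delta> \<subseteq> cyl T U ==> r \<in> hsv s E ==>
   (\<And>w. w \<in> hsv s E ==> Bf s q w (\<lambda>z. of_real (bump p \<delta> z) + r z) = 0) ==> inprod lborel F r = 0"
 shows "AE z in lborel. F z = 0"
proof -
 obtain v where v: "v \<in> hsv s E" "\<And>w. w \<in> hsv s E ==> Bf s q v w = inprod lborel F w"
  using source_solution_exists(1)[OF F(1)] by blast
 note vh = hs_of_hsv[OF v(1)]
 have "AE z in lborel. v z = 0"
 \<comment> \<open>\<open>v\<close> is the first argument of the form, so its potential at the bump
   collects earlier times.\<close>
 proof (rule unique_continuation[OF v(1) U, of "-1"])
  fix p \<delta> assume d: "0 < \<delta>" "cball p \<delta> \<subseteq> cyl T U"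
  define f where "f z = complex_of_real (bump p \<delta> z)" for z
  have fh: "f \<in> hs s" unfolding f_def by (rule bump_hs[OF s d(1)])
  obtain r where r: "r \<in> hsv s E" "\<And>w. w \<in> hsv s E ==> Bf s q w (\<lambda>z. f z + r z) = 0"
   using solution_exists(2)[OF fh] by blast
  have "inprod lborel F r = 0" using H[OF d r(1)] r(2) by (simp add: f_def)
  then have "Bf s q v r = 0" using v(2)[OF r(1)] by simp
  moreover have "Bf s q v f + Bf s q v r = 0" using Bf_add_right[OF vh fh hs_of_hsv[OF r(1)]] r(2)[OF v(1)] by simp
  moreover have "qf q v f = 0" by (rule qf_exterior(2)) (simp add: f_def bump_exterior[OF U(3) d])
  ultimately have "Ef s v f = 0" by (simp add: Bf_def)
  then show "(if - 1 = (1::real) then Ef s (\<lambda>z. of_real (bump p \<delta> z)) v else Ef s v (\<lambda>z. of_real (bump p \<delta> z))) = 0"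
   by (simp add: f_def[abs_def])
 qed simp
 then have "inprod lborel F w = 0" if "w \<in> hsv s E" for w
  using v(2)[OF that] Bf_zero_AE(2)[OF hs_of_hsv[OF that] vh] by simp
 then have ip: "inprod lborel w F = 0" if "w \<in> hsv s E" for w using that inprod_cnj[of lborel F w] by simp
 show ?thesis by (rule L2_zero_of_tests[OF s open_cyl bounded_cyl cyl_subset F ip])
qed

text \<open>The mirror image of \<open>runge_direct\<close>: the dual problem is now the adjoint
  one, and the approximating functions are remainders of direct solutions.\<close>

theorem runge_adjoint:
 assumes U: "open U" "U \<noteq> {}" "U \<inter> closure \<Omega> = {}" and F: "sqint lborel F" "\<And>z. z \<notin> cyl T \<Omega> ==> F z = 0"
  and H: "\<And>p \<delta> r. 0 < \<delta> ==> cball p \<delta> \<subseteq> cyl T U ==> r \<in> hsv s E ==>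
   (\<And>w. w \<in> hsv s E ==> Bf s q (\<lambda>z. of_real (bump p \<delta> z) + r z) w = 0) ==> inprod lborel r F = 0"
 shows "AE z in lborel. F z = 0"
proof -
 obtain v where v: "v \<in> hsv s E" "\<And>w. w \<in> hsv s E ==> Bf s q w v = inprod lborel w F"
  using source_solution_exists(2)[OF F(1)] by blast
 note vh = hs_of_hsv[OF v(1)]
 have "AE z in lborel. v z = 0"
 proof (rule unique_continuation[OF v(1) U, of 1])
  fix p \<delta> assume d: "0 < \<delta>" "cball p \<delta> \<subseteq> cyl T U"
  define f where "f z = complex_of_real (bump p \<delta> z)" for z
  have fh: "f \<in> hs s" unfolding f_def by (rule bump_hs[OF s d(1)])
  obtain r where r: "r \<in> hsv s E" "\<And>w. w \<in> hsv s E ==> Bf s q (\<lambda>z. f z + r z) w = 0"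
   using solution_exists(1)[OF fh] by blast
  have "inprod lborel r F = 0" using H[OF d r(1)] r(2) by (simp add: f_def)
  then have "Bf s q r v = 0" using v(2)[OF r(1)] by simp
  moreover have "Bf s q f v + Bf s q r v = 0" using Bf_add_left[OF fh hs_of_hsv[OF r(1)] vh] r(2)[OF v(1)] by simp
  moreover have "qf q f v = 0" by (rule qf_exterior(1)) (simp add: f_def bump_exterior[OF U(3) d])
  ultimately have "Ef s f v = 0" by (simp add: Bf_def)
  then show "(if 1 = (1::real) then Ef s (\<lambda>z. of_real (bump p \<delta> z)) v else Ef s v (\<lambda>z. of_real (bump p \<delta> z))) = 0"
   by (simp add: f_def[abs_def])
 qed simp
 then have ip: "inprod lborel w F = 0" if "w \<in> hsv s E" for w
  using v(2)[OF that] Bf_zero_AE(1)[OF hs_of_hsv[OF that] vh] by simp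
 show ?thesis by (rule L2_zero_of_tests[OF s open_cyl bounded_cyl cyl_subset F ip])
qed

end

section \<open>Classes modulo null sets\<close>

lemma borel_imp_lebesgue: "f \<in> borel_measurable borel ==> f \<in> borel_measurable lebesgue"
 by (rule measurable_completion) simp

lemma lebesgue_integral_cong_borel:
 fixes g g' :: "'a::euclidean_space => complex"
 assumes "g \<in> borel_measurable lebesgue" "g' \<in> borel_measurable borel" "AE z in lborel. g z = g' z"
 shows "integral\<^sup>L lebesgue g = integral\<^sup>L lborel g'"
proof -
 have "integral\<^sup>L lebesgue g = integral\<^sup>L lebesgue g'"
  using assms(3) by (intro integral_cong_AE[OF assms(1) borel_imp_lebesgue[OF assms(2)]]) (simp add: AE_completion_iff)
 also have "\<dots> = integral\<^sup>L lborel g'" by (rule integral_completion) (simp add: assms)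
 finally show ?thesis .
qed

lemma nn_integral_lebesgue_cong:
 assumes "AE z in lborel. f z = g z" shows "nn_integral lebesgue f = nn_integral lborel g"
 unfolding nn_integral_completion by (rule nn_integral_cong_AE[OF assms])

text \<open>
 The notions of the statement live on Lebesgue measurable functions, the analysis above on Borel functions and \<open>lborel\<close>.
\<close>

definition rep :: "('n::finite spacetime => complex) => ('n spacetime => complex) => bool" where
 "rep u u' \<longleftrightarrow> u \<in> borel_measurable lebesgue \<and> sqint lborel u' \<and> (AE z in lborel. u z = u' z)"

lemma repD: assumes "rep u u'"
 shows "u \<in> borel_measurable lebesgue" "sqint lborel u'" "AE z in lborel. u z = u' z" "u' \<in> borel_measurable borel"
 using assms sqint_measurable[of lborel u'] by (auto simp: rep_def)

lemma rep_self: "sqint lborel u ==> rep u u"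
proof -
 assume u: "sqint lborel u"
 then have "u \<in> borel_measurable borel" using sqint_measurable by fastforce
 with u show "rep u u" unfolding rep_def by (intro conjI borel_imp_lebesgue) simp_all
qed

lemma rep_L2_norm: assumes "rep u u'" shows "L2_norm_sq u = ennreal (sqnorm lborel u')"
proof -
 have "L2_norm_sq u = (\<integral>\<^sup>+ z. ennreal ((cmod (u' z))\<^sup>2) \<partial>lborel)"
  unfolding L2_norm_sq_def using repD(3)[OF assms] by (intro nn_integral_lebesgue_cong) (auto elim: eventually_mono)
 then show ?thesis using nn_integral_sqint[OF repD(2)[OF assms]] by simp
qed

lemma rep_L2: assumes "rep u u'" shows "u \<in> L2"
 using repD(1)[OF assms] rep_L2_norm[OF assms] by (simp add: L2_def)

lemma ex_rep: assumes "u \<in> L2" shows "\<exists>u'. rep u u'"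
proof -
 have m: "u \<in> borel_measurable lebesgue" using assms by (simp add: L2_def)
 have "(\<lambda>z. Re (u z)) \<in> borel_measurable lebesgue" "(\<lambda>z. Im (u z)) \<in> borel_measurable lebesgue" using m by measurable
 from this[THEN completion_ex_borel_measurable_real] obtain a b
  where a: "a \<in> borel_measurable lborel" "AE z in lborel. Re (u z) = a z" and b: "b \<in> borel_measurable lborel" "AE z in lborel. Im (u z) = b z"
  by (elim bexE) (rule that; assumption)
 define v where "v z = Complex (a z) (b z)" for z
 have vE: "v z = of_real (a z) + \<i> * of_real (b z)" for z by (simp add: v_def complex_eq_iff)
 have vm: "v \<in> borel_measurable lborel" unfolding vE[abs_def] using a(1) b(1) by measurable
 have ae: "AE z in lborel. u z = v z" using a(2) b(2) by eventually_elim (simp add: v_def complex_eq_iff)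
 have "L2_norm_sq u = (\<integral>\<^sup>+ z. ennreal ((cmod (v z))\<^sup>2) \<partial>lborel)"
  unfolding L2_norm_sq_def using ae by (intro nn_integral_lebesgue_cong) (auto elim: eventually_mono)
 then have "(\<integral>\<^sup>+ z. ennreal ((cmod (v z))\<^sup>2) \<partial>lborel) < \<infinity>" using assms by (simp add: L2_def)
 then have "sqint lborel v" using vm by (simp add: sqint_iff_nn_integral)
 with m ae show ?thesis by (auto simp: rep_def)
qed

lemma rep_diff: assumes "rep u u'" "rep w w'" shows "rep (\<lambda>z. u z - w z) (\<lambda>z. u' z - w' z)"
proof -
 have "AE z in lborel. u z - w z = u' z - w' z" using repD(3)[OF assms(1)] repD(3)[OF assms(2)] by eventually_elim simp
 then show ?thesis using repD(1)[OF assms(1)] repD(1)[OF assms(2)] sqint_diff[OF repD(2)[OF assms(1)] repD(2)[OF assms(2)]]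
  by (simp add: rep_def)
qed

lemma rep_add: assumes "rep u u'" "rep w w'" shows "rep (\<lambda>z. u z + w z) (\<lambda>z. u' z + w' z)"
proof -
 have "AE z in lborel. u z + w z = u' z + w' z" using repD(3)[OF assms(1)] repD(3)[OF assms(2)] by eventually_elim simp
 then show ?thesis using repD(1)[OF assms(1)] repD(1)[OF assms(2)] sqint_add[OF repD(2)[OF assms(1)] repD(2)[OF assms(2)]]
  by (simp add: rep_def)
qed

lemma fourier_integral_rep:
 fixes u :: "'n::finite spacetime => complex"
 assumes "rep u u'"
 shows "fourier_integral (\<lambda>z. indicator (cball 0 R) z * u z) = FI (\<lambda>z. indicator (cball 0 R) z * u' z)"
proof
 fix \<zeta> :: "'n spacetime"
 have [measurable]: "u \<in> borel_measurable lebesgue" "u' \<in> borel_measurable borel" using repD[OF assms] by auto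
 have e: "(\<lambda>z. exp (- (\<i> * complex_of_real (z \<bullet> \<zeta>)))) \<in> borel_measurable borel"
  by (intro borel_measurable_continuous_onI continuous_intros)
 have i: "(\<lambda>z :: 'n spacetime. indicator (cball 0 R) z :: complex) \<in> borel_measurable borel" by (intro borel_measurable_indicator) simp
 have im [measurable]: "cball 0 R \<in> sets (borel :: 'n spacetime measure)" by (intro borel_closed closed_cball)
 have "fourier_integral (\<lambda>z. indicator (cball 0 R) z * u z) \<zeta> = (LINT z|lebesgue. exp (- (\<i> * of_real (z \<bullet> \<zeta>))) * (indicator (cball 0 R) z * u z))"
  unfolding fourier_integral_def by (cases \<zeta>) (auto intro!: Bochner_Integration.integral_cong simp: inner_prod_def)
 also have "\<dots> = FI (\<lambda>z. indicator (cball 0 R) z * u' z) \<zeta>"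
  unfolding FI_def
 proof (rule lebesgue_integral_cong_borel)
  show "(\<lambda>z. exp (- (\<i> * of_real (z \<bullet> \<zeta>))) * (indicator (cball 0 R) z * u z)) \<in> borel_measurable lebesgue"
   by (intro borel_measurable_times borel_imp_lebesgue[OF e] borel_imp_lebesgue[OF i]) measurable
  show "AE z in lborel. exp (- (\<i> * of_real (z \<bullet> \<zeta>))) * (indicator (cball 0 R) z * u z) = exp (- (\<i> * of_real (z \<bullet> \<zeta>))) * (indicator (cball 0 R) z * u' z)"
   using repD(3)[OF assms] by (auto elim: eventually_mono)
 qed measurable
 finally show "fourier_integral (\<lambda>z. indicator (cball 0 R) z * u z) \<zeta> = FI (\<lambda>z. indicator (cball 0 R) z * u' z) \<zeta>" .
qed

lemma rep_truncated:
 assumes u: "rep u u'" and v: "rep v v'"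
 shows "L2_norm_sq (\<lambda>\<zeta>. fourier_integral (\<lambda>z. indicator (cball 0 R) z * u z) \<zeta> - v \<zeta>) =
  ennreal (sqnorm lborel (\<lambda>\<zeta>. FI (\<lambda>z. indicator (cball 0 R) z * u' z) \<zeta> - v' \<zeta>))"
 unfolding fourier_integral_rep[OF u]
 by (rule rep_L2_norm[OF rep_diff[OF rep_self[OF plancherel_L12(1)[OF L12_truncate[OF repD(2)[OF u]]]] v]])

lemma is_fourier_FT: assumes u: "rep u u'" shows "is_fourier u (FT u')"
proof -
 have f: "ft u' (FT u')" by (rule ft_FT[OF repD(2)[OF u]])
 note r = rep_self[OF ftD(2)[OF f]]
 show ?thesis unfolding is_fourier_def rep_truncated[OF u r]
  using rep_L2[OF u] rep_L2[OF r] tendsto_ennrealI[OF ft_truncate[OF f]] by simp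
qed

text \<open>Whatever value the choice in \<open>fourier\<close> takes, it is an L2 limit of the same
  truncated integrals as \<open>FT u'\<close>, and such limits agree almost everywhere.
  \<open>is_fourier_FT\<close> ensures that the choice is not vacuous.\<close>

lemma rep_fourier: assumes u: "rep u u'" shows "rep (fourier u) (FT u')"
proof -
 have f: "ft u' (FT u')" by (rule ft_FT[OF repD(2)[OF u]])
 have "is_fourier u (fourier u)" unfolding fourier_def by (rule someI[where P = "is_fourier u", OF is_fourier_FT[OF u]])
 then have F: "fourier u \<in> L2" and L: "((\<lambda>R::real. L2_norm_sq (\<lambda>\<zeta>. fourier_integral (\<lambda>z. indicator (cball 0 R) z * u z) \<zeta> - fourier u \<zeta>)) \<longlongrightarrow> 0) at_top"
  by (auto simp: is_fourier_def)
 obtain v where v: "rep (fourier u) v" using ex_rep[OF F] by blast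
 define a where "a R = sqnorm lborel (\<lambda>\<zeta>. FI (\<lambda>z. indicator (cball 0 R) z * u' z) \<zeta> - v \<zeta>)" for R
 define b where "b R = sqnorm lborel (\<lambda>\<zeta>. FI (\<lambda>z. indicator (cball 0 R) z * u' z) \<zeta> - FT u' \<zeta>)" for R
 have "((\<lambda>R. ennreal (a R)) \<longlongrightarrow> ennreal 0) at_top" using L unfolding rep_truncated[OF u v] a_def by simp
 then have "(a \<longlongrightarrow> 0) at_top" by (subst (asm) tendsto_ennreal_iff) (auto simp: a_def sqnorm_nonneg)
 moreover have "(b \<longlongrightarrow> 0) at_top" unfolding b_def by (rule ft_truncate[OF f])
 ultimately have "((\<lambda>R. 2 * a R + 2 * b R) \<longlongrightarrow> 2 * 0 + 2 * 0) at_top" by (intro tendsto_intros)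
 moreover have "sqnorm lborel (\<lambda>\<zeta>. v \<zeta> - FT u' \<zeta>) \<le> 2 * a R + 2 * b R" for R
  using sqnorm_triangle[OF repD(2)[OF v] plancherel_L12(1)[OF L12_truncate[OF repD(2)[OF u], of R]] ftD(2)[OF f]]
  by (simp add: a_def b_def sqnorm_commute[of _ v])
 ultimately have "sqnorm lborel (\<lambda>\<zeta>. v \<zeta> - FT u' \<zeta>) \<le> 2 * 0 + 2 * 0"
  by (intro tendsto_lowerbound[of _ _ at_top]) auto
 then have "sqnorm lborel (\<lambda>\<zeta>. v \<zeta> - FT u' \<zeta>) = 0" using sqnorm_nonneg[of lborel "\<lambda>\<zeta>. v \<zeta> - FT u' \<zeta>"] by simp
 from sqnorm_0_AE[OF sqint_diff[OF repD(2)[OF v] ftD(2)[OF f]] this] repD(3)[OF v]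
 have "AE \<zeta> in lborel. fourier u \<zeta> = FT u' \<zeta>" by eventually_elim simp
 then show ?thesis using repD(1)[OF v] ftD(2)[OF f] by (simp add: rep_def)
qed

lemma Hs_iff: assumes u: "rep u u'" shows "u \<in> Hs s \<longleftrightarrow> u' \<in> hs s"
proof -
 note F = rep_fourier[OF u]
 have "(\<integral>\<^sup>+ \<zeta>. ennreal ((1 + cmod (heat_symbol \<zeta>)) powr s * (cmod (fourier u \<zeta>))\<^sup>2) \<partial>lebesgue) = (\<integral>\<^sup>+ \<zeta>. ennreal ((cmod (rw s \<zeta> * FT u' \<zeta>))\<^sup>2) \<partial>lborel)"
  unfolding cmod_rw_sq wt_def using repD(3)[OF F] by (intro nn_integral_lebesgue_cong) (auto elim: eventually_mono)
 moreover have "(\<lambda>\<zeta>. rw s \<zeta> * FT u' \<zeta>) \<in> borel_measurable lborel" using repD(4)[OF F] by measurable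
 ultimately show ?thesis
  using repD(2)[OF u] rep_L2[OF u] by (simp add: Hs_def hs_def sqint_iff_nn_integral[of _ "\<lambda>\<zeta>. rw s \<zeta> * FT u' \<zeta>"])
qed

text \<open>Covers \<open>heat_pow\<close> and \<open>heat_pow_adj\<close> together.
  \<open>\<mu>\<close> is the multiplier as written in the definition, \<open>m\<close> a Borel
  function that agrees with it almost everywhere; the adjoint power is identified with a conjugate
  only off the branch cut. Surjectivity of the transform shows that the choice is not
  vacuous.\<close>

lemma multiplier_rep:
 assumes u: "rep u u'" "u' \<in> hs s" and s: "0 \<le> s" and m: "m \<in> borel_measurable borel" "\<And>\<zeta>. cmod (m \<zeta>) = cmod (heat_symbol \<zeta>) powr (s / 2)"
  and \<mu>: "AE \<zeta> in lborel. \<mu> \<zeta> = m \<zeta>"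
 shows "\<exists>h'. rep (SOME v. v \<in> L2 \<and> (AE \<zeta> in lebesgue. fourier v \<zeta> = \<mu> \<zeta> * fourier u \<zeta>)) h' \<and> ft h' (\<lambda>\<zeta>. m \<zeta> * FT u' \<zeta>)"
proof -
 define V where "V \<zeta> = m \<zeta> * FT u' \<zeta>" for \<zeta>
 note F = rep_fourier[OF u(1)]
 have [measurable]: "V \<in> borel_measurable borel" unfolding V_def[abs_def] using m(1) repD(4)[OF F] by measurable
 have "sqint lborel V"
 proof (rule sqint_bound[OF hsD(2)[OF u(2)], of V 1])
  have "cmod (V \<zeta>) \<le> cmod (rw s \<zeta> * FT u' \<zeta>)" for \<zeta>
  proof (rule power2_le_imp_le)
   have "(cmod (V \<zeta>))\<^sup>2 = cmod (heat_symbol \<zeta>) powr s * (cmod (FT u' \<zeta>))\<^sup>2"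
    using powr_power[of "cmod (heat_symbol \<zeta>)" "s / 2" 2] by (cases "heat_symbol \<zeta> = 0") (simp_all add: V_def norm_mult power_mult_distrib m(2))
   also have "\<dots> \<le> (cmod (rw s \<zeta> * FT u' \<zeta>))\<^sup>2" unfolding cmod_rw_sq by (intro mult_right_mono norm_heat_powr_le s) simp
   finally show "(cmod (V \<zeta>))\<^sup>2 \<le> (cmod (rw s \<zeta> * FT u' \<zeta>))\<^sup>2" .
  qed simp
  then show "AE \<zeta> in lborel. cmod (V \<zeta>) \<le> 1 * cmod (rw s \<zeta> * FT u' \<zeta>)" by simp
 qed measurable
 then obtain v where v: "ft v V" using ft_surj by blast
 note rv = rep_self[OF ftD(1)[OF v]]
 have "AE \<zeta> in lborel. fourier v \<zeta> = \<mu> \<zeta> * fourier u \<zeta>"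
  using repD(3)[OF rep_fourier[OF rv]] AE_FT[OF v] \<mu> repD(3)[OF F] by eventually_elim (simp add: V_def)
 then have ex: "v \<in> L2 \<and> (AE \<zeta> in lebesgue. fourier v \<zeta> = \<mu> \<zeta> * fourier u \<zeta>)" using rep_L2[OF rv] by (simp add: AE_completion_iff)
 define h where "h = (SOME v. v \<in> L2 \<and> (AE \<zeta> in lebesgue. fourier v \<zeta> = \<mu> \<zeta> * fourier u \<zeta>))"
 have h: "h \<in> L2" "AE \<zeta> in lborel. fourier h \<zeta> = \<mu> \<zeta> * fourier u \<zeta>"
  using someI[of "\<lambda>v. v \<in> L2 \<and> (AE \<zeta> in lebesgue. fourier v \<zeta> = \<mu> \<zeta> * fourier u \<zeta>)", OF ex] unfolding h_def by (auto simp: AE_completion_iff)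
 obtain h' where h': "rep h h'" using ex_rep[OF h(1)] by blast
 have "AE \<zeta> in lborel. FT h' \<zeta> = V \<zeta>"
  using repD(3)[OF rep_fourier[OF h']] h(2) \<mu> repD(3)[OF F] by eventually_elim (simp add: V_def)
 then have "ft h' V" by (rule ft_cong_right[OF ft_FT[OF repD(2)[OF h']]]) measurable
 then show ?thesis using h' unfolding h_def V_def by blast
qed

lemma L2_inner_rep: assumes "rep u u'" "rep w w'" shows "L2_inner UNIV u w = inprod lborel u' w'"
proof -
 note [measurable] = repD(1)[OF assms(1)] repD(1)[OF assms(2)] repD(4)[OF assms(1)] repD(4)[OF assms(2)]
 have "(LINT z|lebesgue. u z * cnj (w z)) = (LINT z|lborel. u' z * cnj (w' z))"
 proof (rule lebesgue_integral_cong_borel)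
  show "AE z in lborel. u z * cnj (w z) = u' z * cnj (w' z)"
   using repD(3)[OF assms(1)] repD(3)[OF assms(2)] by eventually_elim simp
 qed measurable
 then show ?thesis by (simp add: L2_inner_def set_lebesgue_integral_def inprod_def)
qed

text \<open>Off the branch cut the adjoint half power is the conjugate of the forward one. The
  conjugation in the inner product undoes this, so the two half powers multiply to the full power of
  the symbol.\<close>

lemma energy_rep:
 assumes s: "0 \<le> s" and u: "rep u u'" "u' \<in> hs s" and w: "rep w w'" "w' \<in> hs s"
 shows "L2_inner UNIV (heat_pow (s / 2) u) (heat_pow_adj (s / 2) w) = Ef s u' w'"
proof -
 define m where "m \<zeta> = heat_symbol \<zeta> powr of_real (s / 2)" for \<zeta> :: "'a spacetime"
 have mm: "m \<in> borel_measurable borel" unfolding m_def by measurable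
 have mc: "cmod (m \<zeta>) = cmod (heat_symbol \<zeta>) powr (s / 2)" for \<zeta> unfolding m_def by (rule norm_heat_powr)
 obtain a where a: "rep (heat_pow (s / 2) u) a" "ft a (\<lambda>\<zeta>. m \<zeta> * FT u' \<zeta>)"
  using multiplier_rep[OF u s mm mc, of "\<lambda>\<zeta>. heat_symbol \<zeta> powr of_real (s / 2)"] unfolding heat_pow_def m_def by auto
 have ae: "AE \<zeta> in lborel. heat_symbol_adj \<zeta> powr of_real (s / 2) = cnj (m \<zeta>)"
  using AE_heat_symbol_pos
 proof eventually_elim
  case (elim \<zeta>)
  have "heat_symbol_adj \<zeta> = cnj (heat_symbol \<zeta>)" by (cases \<zeta>) (simp add: heat_symbol_def heat_symbol_adj_def)
  moreover have "heat_symbol \<zeta> \<notin> \<real>\<^sub>\<le>\<^sub>0" using elim by (auto elim!: nonpos_Reals_cases)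
  ultimately show ?case using cnj_powr[of "heat_symbol \<zeta>" "of_real (s / 2)"] elim by (auto simp: m_def)
 qed
 have mm': "(\<lambda>\<zeta>. cnj (m \<zeta>)) \<in> borel_measurable borel" using mm by measurable
 have mc': "cmod (cnj (m \<zeta>)) = cmod (heat_symbol \<zeta>) powr (s / 2)" for \<zeta> by (simp add: mc)
 obtain b where b: "rep (heat_pow_adj (s / 2) w) b" "ft b (\<lambda>\<zeta>. cnj (m \<zeta>) * FT w' \<zeta>)"
  using multiplier_rep[where \<mu> = "\<lambda>\<zeta>. heat_symbol_adj \<zeta> powr of_real (s / 2)", OF w s mm' mc' ae] unfolding heat_pow_adj_def by blast
 have "m \<zeta> * m \<zeta> = heat_symbol \<zeta> powr of_real s" for \<zeta>
  unfolding m_def powr_add[symmetric] of_real_add[symmetric] by simp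
 then have "m \<zeta> * FT u' \<zeta> * cnj (cnj (m \<zeta>) * FT w' \<zeta>) = heat_symbol \<zeta> powr of_real s * (FT u' \<zeta> * cnj (FT w' \<zeta>))" for \<zeta>
  by (simp only: complex_cnj_mult complex_cnj_cnj mult_ac) (metis mult.assoc mult.commute)
 then have "(2 * pi) ^ DIM('a spacetime) * inprod lborel a b = (LINT \<zeta>|lborel. heat_symbol \<zeta> powr of_real s * (FT u' \<zeta> * cnj (FT w' \<zeta>)))"
  using parseval[OF a(2) b(2), symmetric] unfolding inprod_def[of _ "\<lambda>\<zeta>. m \<zeta> * FT u' \<zeta>"] by (simp only:)
 moreover have "complex_of_real (2 * pi) ^ DIM('a spacetime) \<noteq> 0" by simp
 ultimately have "inprod lborel a b = Ef s u' w'" unfolding Ef_def by (simp add: nonzero_eq_divide_eq mult.commute)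
 then show ?thesis using L2_inner_rep[OF a(1) b(1)] by simp
qed

text \<open>Replaces the potential by a Borel function that is bounded everywhere, so that later
  estimates hold pointwise.\<close>

lemma potential_rep:
 fixes \<Omega> :: "(real ^ 'n::finite) set"
 assumes Q: "Q \<in> Linfty_real (cyl T \<Omega>)" and \<Omega>: "open \<Omega>"
 obtains q M where "0 \<le> M" "q \<in> borel_measurable borel" "\<And>z. \<bar>q z\<bar> \<le> M" "\<And>z. z \<notin> cyl T \<Omega> ==> q z = 0"
  "AE z in lborel. z \<in> cyl T \<Omega> \<longrightarrow> q z = Q z" "(\<lambda>z. if z \<in> cyl T \<Omega> then Q z else 0) \<in> borel_measurable lebesgue"
proof -
 have o: "open (cyl T \<Omega>)" unfolding cyl_def by (intro open_Times \<Omega>) simp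
 then have A [measurable]: "cyl T \<Omega> \<in> sets borel" and A': "cyl T \<Omega> \<in> sets lebesgue" by auto
 define P where "P z = (if z \<in> cyl T \<Omega> then Q z else 0)" for z
 have Pm: "P \<in> borel_measurable lebesgue" unfolding P_def[abs_def]
  using Q A' by (intro borel_measurable_if_I) (auto simp: Linfty_real_def)
 obtain C where "AE z in lebesgue_on (cyl T \<Omega>). \<bar>Q z\<bar> \<le> C" using Q by (auto simp: Linfty_real_def)
 then have C: "AE z in lborel. z \<in> cyl T \<Omega> \<longrightarrow> \<bar>Q z\<bar> \<le> C"
  using A' by (subst (asm) AE_restrict_space_iff) (auto simp: AE_completion_iff)
 obtain p where p: "p \<in> borel_measurable lborel" "AE z in lborel. P z = p z"
  using completion_ex_borel_measurable_real[OF Pm] by blast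
 have [measurable]: "p \<in> borel_measurable borel" using p(1) by simp
 \<comment> \<open>On an empty cylinder \<open>C\<close> may be negative; clipping at
   \<open>M\<close> turns the bound almost everywhere into one at every point.\<close>
 define M where "M = max 0 C"
 define q where "q z = (if z \<in> cyl T \<Omega> then max (- M) (min M (p z)) else 0)" for z
 show ?thesis
 proof (rule that[of M q])
  show "q \<in> borel_measurable borel" unfolding q_def[abs_def] by measurable
  show "AE z in lborel. z \<in> cyl T \<Omega> \<longrightarrow> q z = Q z" using C p(2) by eventually_elim (auto simp: q_def P_def M_def)
  show "(\<lambda>z. if z \<in> cyl T \<Omega> then Q z else 0) \<in> borel_measurable lebesgue" using Pm by (simp add: P_def[abs_def])
 qed (auto simp: q_def M_def)
qed

text \<open>The complement of the support is a union of possibly uncountably many open sets on which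
  \<open>w\<close> vanishes almost everywhere; Lindelof reduces it to countably many.\<close>

lemma AE_zero_off_ess_supp:
 fixes w :: "'n::finite spacetime => complex"
 assumes "ess_supp w \<subseteq> E" shows "AE z in lborel. z \<notin> E \<longrightarrow> w z = 0"
proof -
 define \<V> where "\<V> = {V. open V \<and> (AE z in lebesgue. z \<in> V \<longrightarrow> w z = 0)}"
 obtain \<V>' where V: "\<V>' \<subseteq> \<V>" "countable \<V>'" "\<Union>\<V>' = \<Union>\<V>"
  by (rule Lindelof[of \<V>]) (auto simp: \<V>_def)
 have "AE z in lborel. \<forall>V\<in>\<V>'. z \<in> V \<longrightarrow> w z = 0"
  using V(1) by (subst AE_ball_countable[OF V(2)]) (auto simp: \<V>_def AE_completion_iff)
 then show ?thesis
 proof (rule eventually_mono)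
  fix z assume z: "\<forall>V\<in>\<V>'. z \<in> V \<longrightarrow> w z = 0"
  show "z \<notin> E \<longrightarrow> w z = 0"
  proof
   assume "z \<notin> E"
   then have "z \<in> \<Union>\<V>'" unfolding V(3) using assms by (auto simp: ess_supp_def \<V>_def)
   then show "w z = 0" using z by blast
  qed
 qed
qed

lemma Hs_supp_rep:
 assumes E: "E \<in> sets borel" and w: "w \<in> Hs_supp s E"
 shows "\<exists>w'\<in>hsv s E. rep w w'"
proof -
 have wH: "w \<in> Hs s" and ae: "AE z in lborel. z \<notin> E \<longrightarrow> w z = 0" using w AE_zero_off_ess_supp[of w E] by (auto simp: Hs_supp_def)
 then have "w \<in> L2" by (simp add: Hs_def)
 then obtain v where v: "rep w v" using ex_rep by blast
 define w' where "w' z = indicator E z * v z" for z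
 have "AE z in lborel. w z = w' z" using ae repD(3)[OF v] by eventually_elim (auto simp: w'_def split: split_indicator)
 then have r: "rep w w'" using repD(1)[OF v] sqnorm_indicator_le(1)[OF repD(2)[OF v] E] by (simp add: rep_def w'_def[abs_def])
 then have "w' \<in> hs s" using Hs_iff[OF r] wH by blast
 then have "w' \<in> hsv s E" by (simp add: hsv_def w'_def)
 with r show ?thesis by blast
qed

lemma hs_imp_Hs: "u \<in> hs s ==> u \<in> Hs s"
 using Hs_iff[OF rep_self[OF hsD(1)], of u s] by blast

lemma hsv_imp_Hs_supp: assumes "closed E" "w \<in> hsv s E" shows "w \<in> Hs_supp s E"
proof -
 have "w z = 0" if "z \<in> - E" for z using assms(2) that unfolding hsv_def by blast
 then have "- E \<in> {V. open V \<and> (AE z in lebesgue. z \<in> V \<longrightarrow> w z = 0)}"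
  using assms(1) by (intro CollectI conjI AE_I2) (blast intro: open_Compl)+
 then have "ess_supp w \<subseteq> E" unfolding ess_supp_def by blast
 then show ?thesis using assms(2) hs_imp_Hs[of w s] by (simp add: Hs_supp_def hsv_def)
qed

text \<open>Ties the Borel potential \<open>q\<close> of the analysis to the potential
  \<open>Q\<close> of the statement, whose values off the cylinder are arbitrary.\<close>

locale cylinder_equation = cylinder_potential s T M q \<Omega>
 for s T M :: real and q :: "'n::finite spacetime => real" and \<Omega> :: "(real ^ 'n) set" +
 fixes Q :: "'n spacetime => real"
 assumes qQ: "AE z in lborel. z \<in> cyl T \<Omega> \<longrightarrow> q z = Q z"
  and Qm: "(\<lambda>z. if z \<in> cyl T \<Omega> then Q z else 0) \<in> borel_measurable lebesgue"
begin

lemma closure_cyl: "closure (cyl T \<Omega>) = E" using T by (simp add: cyl_def closure_Times)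

lemma closed_E: "closed E" by (intro closed_Times) auto

lemma form_B_rep:
 assumes u: "rep u u'" "u' \<in> hs s" and w: "rep w w'" "w' \<in> hs s"
 shows "form_B s T \<Omega> Q u w = Bf s q u' w'"
proof -
 note [measurable] = repD(1)[OF u(1)] repD(1)[OF w(1)] repD(4)[OF u(1)] repD(4)[OF w(1)] Qm
 have "L2_inner (cyl T \<Omega>) (\<lambda>z. of_real (Q z) * u z) w = (LINT z|lebesgue. of_real (if z \<in> cyl T \<Omega> then Q z else 0) * (u z * cnj (w z)))"
  unfolding L2_inner_def set_lebesgue_integral_def by (rule Bochner_Integration.integral_cong) (auto split: split_indicator)
 also have "\<dots> = (LINT z|lborel. of_real (q z) * (u' z * cnj (w' z)))"
 proof (rule lebesgue_integral_cong_borel)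
  show "AE z in lborel. of_real (if z \<in> cyl T \<Omega> then Q z else 0) * (u z * cnj (w z)) = of_real (q z) * (u' z * cnj (w' z))"
   using repD(3)[OF u(1)] repD(3)[OF w(1)] qQ by eventually_elim (auto simp: q0)
 qed measurable
 finally have "L2_inner (cyl T \<Omega>) (\<lambda>z. of_real (Q z) * u z) w = qf q u' w'" by (simp add: qf_def)
 then show ?thesis unfolding form_B_def Bf_def energy_rep[OF s0 u w] by simp
qed

lemma solves_iff:
 assumes u: "rep u u'" "u' \<in> hs s" shows "solves s T \<Omega> Q u \<longleftrightarrow> (\<forall>w\<in>hsv s E. Bf s q u' w = 0)"
proof
 assume S: "solves s T \<Omega> Q u"
 show "\<forall>w\<in>hsv s E. Bf s q u' w = 0"
 proof
  fix w assume w: "w \<in> hsv s E"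
  have "form_B s T \<Omega> Q u w = 0" using S hsv_imp_Hs_supp[OF closed_E w] by (simp add: solves_def closure_cyl)
  then show "Bf s q u' w = 0" using form_B_rep[OF u rep_self[OF hsD(1)[OF hs_of_hsv[OF w]]] hs_of_hsv[OF w]] by simp
 qed
next
 assume Z: "\<forall>w\<in>hsv s E. Bf s q u' w = 0"
 have "form_B s T \<Omega> Q u w = 0" if w: "w \<in> Hs_supp s E" for w
 proof -
  obtain w' where w': "w' \<in> hsv s E" "rep w w'" using Hs_supp_rep[OF Em w] by blast
  show ?thesis using form_B_rep[OF u w'(2) hs_of_hsv[OF w'(1)]] Z w'(1) by simp
 qed
 then show "solves s T \<Omega> Q u" using Hs_iff[OF u(1), of s] u(2) by (simp add: solves_def closure_cyl)
qed

text \<open>\<open>exterior_solution\<close> is a choice, but the right hand side does not depend on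
  it. Adding \<open>r'\<close> to \<open>g\<close> changes nothing because the chosen function is a
  solution, and its remainder \<open>p\<close> then drops out because \<open>g + r'\<close> solves
  the adjoint equation.\<close>

lemma DN_map_eq:
 assumes f: "f \<in> hs s" and g: "g \<in> hs s" and r': "r' \<in> hsv s E" "\<And>w. w \<in> hsv s E ==> Bf s q w (\<lambda>z. g z + r' z) = 0"
 shows "DN_map s T \<Omega> Q f g = Bf s q f (\<lambda>z. g z + r' z)"
proof -
 define u where "u = exterior_solution s T \<Omega> Q f"
 have rf: "rep f f" by (rule rep_self[OF hsD(1)[OF f]])
 obtain r where r: "r \<in> hsv s E" "\<forall>w\<in>hsv s E. Bf s q (\<lambda>z. f z + r z) w = 0" using solution_exists(1)[OF f] by blast
 have h: "(\<lambda>z. f z + r z) \<in> hs s" by (rule hs_add[OF f hs_of_hsv[OF r(1)]])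
 have "solves s T \<Omega> Q (\<lambda>z. f z + r z) \<and> (\<lambda>z. f z + r z - f z) \<in> Hs_supp s (closure (cyl T \<Omega>))"
  using solves_iff[OF rep_self[OF hsD(1)[OF h]] h] r hsv_imp_Hs_supp[OF closed_E r(1)] by (simp add: closure_cyl)
 then have "solves s T \<Omega> Q u \<and> (\<lambda>z. u z - f z) \<in> Hs_supp s (closure (cyl T \<Omega>))"
  unfolding u_def exterior_solution_def
  by (rule someI[where P = "\<lambda>u. solves s T \<Omega> Q u \<and> (\<lambda>z. u z - f z) \<in> Hs_supp s (closure (cyl T \<Omega>))"])
 then have S: "solves s T \<Omega> Q u" and D: "(\<lambda>z. u z - f z) \<in> Hs_supp s E" by (auto simp: closure_cyl)
 obtain p where p: "p \<in> hsv s E" "rep (\<lambda>z. u z - f z) p" using Hs_supp_rep[OF Em D] by blast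
 have ph: "p \<in> hs s" by (rule hs_of_hsv[OF p(1)])
 have ru: "rep u (\<lambda>z. f z + p z)" using rep_add[OF rf p(2)] by simp
 have uh: "(\<lambda>z. f z + p z) \<in> hs s" by (rule hs_add[OF f ph])
 have rh: "r' \<in> hs s" by (rule hs_of_hsv[OF r'(1)])
 have gh: "(\<lambda>z. g z + r' z) \<in> hs s" by (rule hs_add[OF g rh])
 have "DN_map s T \<Omega> Q f g = Bf s q (\<lambda>z. f z + p z) g"
  unfolding DN_map_def u_def[symmetric] by (rule form_B_rep[OF ru uh rep_self[OF hsD(1)[OF g]] g])
 also have "\<dots> = Bf s q (\<lambda>z. f z + p z) (\<lambda>z. g z + r' z)"
  using Bf_add_right[OF uh g rh] S solves_iff[OF ru uh] r'(1) by simp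
 also have "\<dots> = Bf s q f (\<lambda>z. g z + r' z)" using Bf_add_left[OF f ph gh] r'(2)[OF p(1)] by simp
 finally show ?thesis .
qed

text \<open>As the value in \<open>DN_map_eq\<close> involves only the adjoint solution, the map may
  be evaluated with any solution that has datum \<open>f\<close>.\<close>

lemma DN_map_eq':
 assumes f: "f \<in> hs s" and g: "g \<in> hs s" and r: "r \<in> hsv s E" "\<And>w. w \<in> hsv s E ==> Bf s q (\<lambda>z. f z + r z) w = 0"
 shows "DN_map s T \<Omega> Q f g = Bf s q (\<lambda>z. f z + r z) g"
proof -
 obtain r' where r': "r' \<in> hsv s E" "\<And>w. w \<in> hsv s E ==> Bf s q w (\<lambda>z. g z + r' z) = 0" using solution_exists(2)[OF g] by blast
 have h: "r \<in> hs s" "r' \<in> hs s" using r(1) r'(1) by (auto intro: hs_of_hsv)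
 have fh: "(\<lambda>z. f z + r z) \<in> hs s" and gh: "(\<lambda>z. g z + r' z) \<in> hs s" by (intro hs_add f g h)+
 have "DN_map s T \<Omega> Q f g = Bf s q (\<lambda>z. f z + r z) (\<lambda>z. g z + r' z)"
  using DN_map_eq[OF f g r'] Bf_add_left[OF f h(1) gh] r'(2)[OF r(1)] by simp
 also have "\<dots> = Bf s q (\<lambda>z. f z + r z) g" using Bf_add_right[OF fh g h(2)] r(2)[OF r'(1)] by simp
 finally show ?thesis .
qed

end

theorem theorem1p1:
  fixes s T :: real
    and \<Omega> U1 U2 :: "(real ^ 'n::finite) set"
    and Q1 Q2 :: "real \<times> (real ^ 'n) \<Rightarrow> real"
  assumes "0 < s" and "s < 1"
    and "0 < T"
    and "open \<Omega>" and "bounded \<Omega>"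
    and "Q1 \<in> Linfty_real (cyl T \<Omega>)" and "Q2 \<in> Linfty_real (cyl T \<Omega>)"
    and "eigenvalue_condition s T \<Omega> Q1" and "eigenvalue_condition s T \<Omega> Q2"
    and "open U1" and "U1 \<noteq> {}" and "U1 \<subseteq> exterior \<Omega>"
    and "open U2" and "U2 \<noteq> {}" and "U2 \<subseteq> exterior \<Omega>"
    and "\<forall>f \<in> Cc_infty (cyl T U1). \<forall>g \<in> Cc_infty (cyl T U2).
           DN_map s T \<Omega> Q1 f g = DN_map s T \<Omega> Q2 f g"
  shows "AE z in lebesgue_on (cyl T \<Omega>). Q1 z = Q2 z"
proof -
 obtain q1 M1 where q1: "0 \<le> M1" "q1 \<in> borel_measurable borel" "\<And>z. \<bar>q1 z\<bar> \<le> M1" "\<And>z. z \<notin> cyl T \<Omega> ==> q1 z = 0"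
  "AE z in lborel. z \<in> cyl T \<Omega> \<longrightarrow> q1 z = Q1 z" "(\<lambda>z. if z \<in> cyl T \<Omega> then Q1 z else 0) \<in> borel_measurable lebesgue"
  by (rule potential_rep[OF assms(6,4)]) (rule that; assumption)
 obtain q2 M2 where q2: "0 \<le> M2" "q2 \<in> borel_measurable borel" "\<And>z. \<bar>q2 z\<bar> \<le> M2" "\<And>z. z \<notin> cyl T \<Omega> ==> q2 z = 0"
  "AE z in lborel. z \<in> cyl T \<Omega> \<longrightarrow> q2 z = Q2 z" "(\<lambda>z. if z \<in> cyl T \<Omega> then Q2 z else 0) \<in> borel_measurable lebesgue"
  by (rule potential_rep[OF assms(7,4)]) (rule that; assumption)
 have E: "{-T..T} \<times> closure \<Omega> \<in> sets borel" by (intro borel_closed closed_Times) auto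
 interpret A: cylinder_equation s T M1 q1 \<Omega> Q1
  by unfold_locales (use assms(1-5) q1 E in auto)
 interpret B: cylinder_equation s T M2 q2 \<Omega> Q2
  by unfold_locales (use assms(1-5) q2 E in auto)
 have U1: "open U1" "U1 \<noteq> {}" "U1 \<inter> closure \<Omega> = {}" and U2: "open U2" "U2 \<noteq> {}" "U2 \<inter> closure \<Omega> = {}"
  using assms(10-15) by (auto simp: exterior_def)
 note s = assms(1,2)
 define d where "d z = q1 z - q2 z" for z
 have d0: "d z = 0" if "z \<notin> cyl T \<Omega>" for z using q1(4)[OF that] q2(4)[OF that] by (simp add: d_def)
 have db: "\<bar>d z\<bar> \<le> M1 + M2" for z using q1(3)[of z] q2(3)[of z] by (simp add: d_def)
 have [measurable]: "d \<in> borel_measurable borel" unfolding d_def[abs_def] using q1(2) q2(2) by measurable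
 have sq: "sqint lborel (\<lambda>z. of_real (d z) * r z)" if r: "sqint lborel r" for r :: "'n spacetime => complex"
 proof (rule sqint_bound[OF r, where C = "M1 + M2"])
  show "(\<lambda>z. of_real (d z) * r z) \<in> borel_measurable lborel" using sqint_measurable[OF r] by measurable
  show "AE z in lborel. cmod (of_real (d z) * r z) \<le> (M1 + M2) * cmod (r z)"
   using db by (intro AE_I2) (auto simp: norm_mult intro: mult_right_mono)
 qed
 \<comment> \<open>The adjoint solution for the second potential stays fixed while the direct
   solution for the first one varies: Runge approximation in \<open>U1\<close> is applied to the
   source \<open>d * r2\<close>.\<close>
 have key: "AE z in lborel. of_real (d z) * r2 z = 0"
  if \<delta>': "0 < \<delta>'" "cball p' \<delta>' \<subseteq> cyl T U2" and r2: "r2 \<in> hsv s A.E"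
   and Z2: "\<And>w. w \<in> hsv s A.E ==> Bf s q2 w (\<lambda>z. of_real (bump p' \<delta>' z) + r2 z) = 0" for p' \<delta>' r2
 proof (rule A.runge_adjoint[OF U1])
  show "sqint lborel (\<lambda>z. of_real (d z) * r2 z)" by (rule sq[OF hsD(1)[OF A.hs_of_hsv[OF r2]]])
  show "of_real (d z) * r2 z = 0" if "z \<notin> cyl T \<Omega>" for z using d0[OF that] by simp
  fix p \<delta> r assume \<delta>: "0 < \<delta>" "cball p \<delta> \<subseteq> cyl T U1" and r: "r \<in> hsv s A.E"
   and Z1: "\<And>w. w \<in> hsv s A.E ==> Bf s q1 (\<lambda>z. of_real (bump p \<delta> z) + r z) w = 0"
  define f where "f z = complex_of_real (bump p \<delta> z)" for z
  define g where "g z = complex_of_real (bump p' \<delta>' z)" for z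
  define X where "X z = f z + r z" for z
  define Y where "Y z = g z + r2 z" for z
  have fh: "f \<in> hs s" and gh: "g \<in> hs s" unfolding f_def g_def by (intro bump_hs s \<delta> \<delta>')+
  have h: "r \<in> hs s" "r2 \<in> hs s" by (intro A.hs_of_hsv r r2)+
  have Xh: "X \<in> hs s" and Yh: "Y \<in> hs s" unfolding X_def Y_def by (intro hs_add fh gh h)+
  have "f \<in> Cc_infty (cyl T U1)" "g \<in> Cc_infty (cyl T U2)"
   unfolding f_def g_def by (intro bump_Cc_infty \<delta> \<delta>')+
  then have DN: "DN_map s T \<Omega> Q1 f g = DN_map s T \<Omega> Q2 f g" using assms(16) by blast
  \<comment> \<open>One pairing is completed by an adjoint solution for the second potential, the
    other by a direct solution for the first. Both become forms at the same pair \<open>X\<close>,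
    \<open>Y\<close>, so the energy part cancels and only the potentials differ.\<close>
  have "DN_map s T \<Omega> Q1 f g = Bf s q1 X g"
   unfolding X_def by (rule A.DN_map_eq'[OF fh gh r]) (use Z1 in \<open>simp add: f_def\<close>)
  also have "\<dots> = Bf s q1 X Y"
   using A.Bf_add_right[OF Xh gh h(2)] Z1[OF r2] by (simp add: X_def[abs_def] Y_def[abs_def] f_def[abs_def])
  finally have 1: "DN_map s T \<Omega> Q1 f g = Bf s q1 X Y" .
  have "DN_map s T \<Omega> Q2 f g = Bf s q2 f Y"
   unfolding Y_def by (rule B.DN_map_eq[OF fh gh r2]) (use Z2 in \<open>simp add: g_def\<close>)
  also have "\<dots> = Bf s q2 X Y"
   using B.Bf_add_left[OF fh h(1) Yh] Z2[OF r] by (simp add: X_def[abs_def] Y_def[abs_def] g_def[abs_def])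
  finally have "Bf s q1 X Y = Bf s q2 X Y" using 1 DN by simp
  then have "qf q1 X Y - qf q2 X Y = 0" by (simp add: Bf_def)
  also have "qf q1 X Y - qf q2 X Y = (LINT z|lborel. of_real (q1 z) * (X z * cnj (Y z)) - of_real (q2 z) * (X z * cnj (Y z)))"
   unfolding qf_def by (rule Bochner_Integration.integral_diff[symmetric])
    (rule A.qf_integrable[OF hsD(1)[OF Xh] hsD(1)[OF Yh]], rule B.qf_integrable[OF hsD(1)[OF Xh] hsD(1)[OF Yh]])
  also have "\<dots> = inprod lborel r (\<lambda>z. of_real (d z) * r2 z)"
   unfolding inprod_def
  proof (rule Bochner_Integration.integral_cong[OF refl])
   fix z
   show "of_real (q1 z) * (X z * cnj (Y z)) - of_real (q2 z) * (X z * cnj (Y z)) = r z * cnj (of_real (d z) * r2 z)"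
   \<comment> \<open>On the cylinder the exterior bumps vanish, so \<open>X\<close> and
     \<open>Y\<close> are the remainders \<open>r\<close> and \<open>r2\<close>; off it both
     potentials vanish.\<close>
   proof (cases "z \<in> cyl T \<Omega>")
    case True
    then show ?thesis using A.bump_exterior[OF U1(3) \<delta>] A.bump_exterior[OF U2(3) \<delta>']
     by (simp add: X_def Y_def f_def g_def d_def algebra_simps)
   qed (simp add: q1(4) q2(4) d_def)
  qed
  finally show "inprod lborel r (\<lambda>z. of_real (d z) * r2 z) = 0" .
 qed
 have "AE z in lborel. complex_of_real (d z) = 0"
 \<comment> \<open>Second use of Runge approximation, now in \<open>U2\<close> with source
   \<open>d\<close> itself: \<open>key\<close> says that \<open>d\<close> times every adjoint
   remainder is 0 almost everywhere, hence \<open>d\<close> is orthogonal to all of them.\<close>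
 proof (rule B.runge_direct[OF U2])
  have c: "cyl T \<Omega> \<in> sets borel" using A.open_cyl by simp
  have "sqint lborel (indicator (cyl T \<Omega>) :: 'n spacetime => complex)"
  proof (rule sqintI)
   have "integrable lborel (indicat_real (cyl T \<Omega>))"
    using c emeasure_bounded_finite[OF A.bounded_cyl] by (intro integrable_real_indicator) auto
   moreover have "(\<lambda>z. (cmod (indicator (cyl T \<Omega>) z))\<^sup>2) = indicat_real (cyl T \<Omega>)" by (auto split: split_indicator)
   ultimately show "integrable lborel (\<lambda>z. (cmod (indicator (cyl T \<Omega>) z))\<^sup>2)" by simp
  qed (use c in simp)
  from sq[OF this] have "sqint lborel (\<lambda>z. of_real (d z) * indicator (cyl T \<Omega>) z)" .
  moreover have "(\<lambda>z. of_real (d z) * indicator (cyl T \<Omega>) z) = (\<lambda>z. complex_of_real (d z))"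
   using d0 by (auto split: split_indicator)
  ultimately show "sqint lborel (\<lambda>z. complex_of_real (d z))" by simp
  show "complex_of_real (d z) = 0" if "z \<notin> cyl T \<Omega>" for z using d0[OF that] by simp
  fix p \<delta> r assume a: "0 < \<delta>" "cball p \<delta> \<subseteq> cyl T U2" "r \<in> hsv s A.E"
   "\<And>w. w \<in> hsv s A.E ==> Bf s q2 w (\<lambda>z. of_real (bump p \<delta> z) + r z) = 0"
  have "AE z in lborel. of_real (d z) * r z = 0" by (rule key[of \<delta> p r]) (rule a; assumption?)+
  then have "AE z in lborel. of_real (d z) * cnj (r z) = 0" by eventually_elim auto
  then show "inprod lborel (\<lambda>z. complex_of_real (d z)) r = 0" unfolding inprod_def by (rule integral_eq_zero_AE)
 qed
 then have "AE z in lborel. z \<in> cyl T \<Omega> \<longrightarrow> Q1 z = Q2 z"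
  using q1(5) q2(5) by eventually_elim (auto simp: d_def)
 moreover have "cyl T \<Omega> \<inter> space lebesgue \<in> sets lebesgue" using A.open_cyl by simp
 ultimately show ?thesis by (subst AE_restrict_space_iff) (auto simp: AE_completion_iff)
qed

end
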